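(* There is an algorithm which, given a graph $G$ with $n$ vertices and $m>0$ edges, decides whether $G\in\mathcal{G}$ in time $O(n^2+nm)$.
   Context: Graphs are finite, simple, undirected. A graph is series-parallel if it has no $K_4$ minor. A graph is chordal if it has no induced cycle of length at least $4$. A clique sum of graphs $G$ and $H$ is a graph obtained as follows: given a complete graph $K$ (possibly empty) and injective graph homomorphisms $\phi:K\to G$, $\psi:K\to H$, take the disjoint union of $G$ and $H$ and identify $\phi(x)$ with $\psi(x)$ for each vertex $x$ of $K$ (no edges are deleted). The cone over $G$ is obtained from $G$ by adding one new vertex adjacent to all vertices of $G$. $\mathcal{G}$ is the smallest collection of graphs such that: (1) series-parallel and chordal graphs are in $\mathcal{G}$; (2) any clique sum of two graphs in $\mathcal{G}$ is in $\mathcal{G}$; (3) the cone over any graph in $\mathcal{G}$ is in $\mathcal{G}$. Running time is in the usual random-access-machine model with $G$ given by adjacency lists. *)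

theory Defs
  imports Main
begin

section \<open>Finite simple graphs\<close>

record 'a ugraph =
  verts :: "'a set"
  edges :: "'a set set"

definition simple_graph :: "'a ugraph \<Rightarrow> bool" where
  "simple_graph G \<longleftrightarrow> finite (verts G) \<and> (\<forall>e\<in>edges G. e \<subseteq> verts G \<and> card e = 2)"

definition induced_subgraph :: "'a ugraph \<Rightarrow> 'a set \<Rightarrow> 'a ugraph" where
  "induced_subgraph G S = \<lparr>verts = verts G \<inter> S, edges = {e \<in> edges G. e \<subseteq> S}\<rparr>"

definition graph_iso :: "'a ugraph \<Rightarrow> 'b ugraph \<Rightarrow> bool" where
  "graph_iso G H \<longleftrightarrow> (\<exists>f. bij_betw f (verts G) (verts H) \<and>
     (\<forall>u\<in>verts G. \<forall>v\<in>verts G. {u, v} \<in> edges G \<longleftrightarrow> {f u, f v} \<in> edges H))"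

definition injective_hom :: "('a \<Rightarrow> 'b) \<Rightarrow> 'a ugraph \<Rightarrow> 'b ugraph \<Rightarrow> bool" where
  "injective_hom f G H \<longleftrightarrow> inj_on f (verts G) \<and> f ` verts G \<subseteq> verts H \<and>
     (\<forall>e\<in>edges G. f ` e \<in> edges H)"

definition connected_graph :: "'a ugraph \<Rightarrow> bool" where
  "connected_graph G \<longleftrightarrow> verts G \<noteq> {} \<and>
     (\<forall>u\<in>verts G. \<forall>v\<in>verts G. (u, v) \<in> {(x, y). {x, y} \<in> edges G}\<^sup>*)"

definition complete_on :: "'a set \<Rightarrow> 'a ugraph" where
  "complete_on S = \<lparr>verts = S, edges = {e. e \<subseteq> S \<and> card e = 2}\<rparr>"

definition cycle_graph :: "nat \<Rightarrow> nat ugraph" where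
  "cycle_graph k = \<lparr>verts = {..<k}, edges = {{i, Suc i mod k} | i. i < k}\<rparr>"

text \<open>The branch set \<^term>\<open>B x\<close> is the set of vertices of \<^term>\<open>G\<close> contracted to
  the vertex \<^term>\<open>x\<close> of the minor; vertices outside all branch sets and surplus edges are
  deleted.\<close>

definition is_minor :: "'a ugraph \<Rightarrow> 'b ugraph \<Rightarrow> bool" where
  "is_minor H G \<longleftrightarrow> (\<exists>B.
     (\<forall>x\<in>verts H. B x \<subseteq> verts G \<and> connected_graph (induced_subgraph G (B x))) \<and>
     (\<forall>x\<in>verts H. \<forall>y\<in>verts H. x \<noteq> y \<longrightarrow> B x \<inter> B y = {}) \<and>
     (\<forall>x\<in>verts H. \<forall>y\<in>verts H. {x, y} \<in> edges H \<longrightarrow>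
        (\<exists>u\<in>B x. \<exists>v\<in>B y. {u, v} \<in> edges G)))"

definition series_parallel :: "'a ugraph \<Rightarrow> bool" where
  "series_parallel G \<longleftrightarrow> \<not> is_minor (complete_on {..<4::nat}) G"

definition chordal :: "'a ugraph \<Rightarrow> bool" where
  "chordal G \<longleftrightarrow> \<not> (\<exists>k\<ge>4. \<exists>S\<subseteq>verts G. graph_iso (induced_subgraph G S) (cycle_graph k))"

definition cone :: "'a \<Rightarrow> 'a ugraph \<Rightarrow> 'a ugraph" where
  "cone v G = \<lparr>verts = insert v (verts G), edges = edges G \<union> {{v, u} | u. u \<in> verts G}\<rparr>"


section \<open>Clique sums\<close>

definition disjoint_union :: "'a ugraph \<Rightarrow> 'b ugraph \<Rightarrow> ('a + 'b) ugraph" where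
  "disjoint_union G H = \<lparr>verts = verts G <+> verts H,
     edges = (\<lambda>e. Inl ` e) ` edges G \<union> (\<lambda>e. Inr ` e) ` edges H\<rparr>"

definition quotient_graph :: "('a \<times> 'a) set \<Rightarrow> 'a ugraph \<Rightarrow> 'a set ugraph" where
  "quotient_graph R G = \<lparr>verts = verts G // R, edges = (\<lambda>e. e // R) ` edges G\<rparr>"

text \<open>The equivalence relation generated by the identifications of \<^term>\<open>\<phi> x\<close> with
  \<^term>\<open>\<psi> x\<close>, for \<^term>\<open>x \<in> S\<close>.\<close>

definition identify :: "'c set \<Rightarrow> ('c \<Rightarrow> 'a) \<Rightarrow> ('c \<Rightarrow> 'b) \<Rightarrow> (('a + 'b) \<times> ('a + 'b)) set" where
  "identify S \<phi> \<psi> = (let r = {(Inl (\<phi> x), Inr (\<psi> x)) | x. x \<in> S} in (r \<union> r\<inverse>)\<^sup>*)"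

definition clique_sum :: "'a ugraph \<Rightarrow> 'b ugraph \<Rightarrow> 'c ugraph \<Rightarrow> bool" where
  "clique_sum G H F \<longleftrightarrow> (\<exists>(S :: nat set) \<phi> \<psi>. finite S \<and>
     injective_hom \<phi> (complete_on S) G \<and> injective_hom \<psi> (complete_on S) H \<and>
     graph_iso F (quotient_graph (identify S \<phi> \<psi>) (disjoint_union G H)))"


section \<open>The class of graphs\<close>

text \<open>Finite graphs are taken up to isomorphism with vertices in \<^typ>\<open>nat\<close>. The class is closed
  under isomorphism because clique sums are and because the new vertex of a cone is arbitrary.\<close>

inductive in_class_G :: "nat ugraph \<Rightarrow> bool" where
  series_parallel: "simple_graph G \<Longrightarrow> series_parallel G \<Longrightarrow> in_class_G G"
| chordal: "simple_graph G \<Longrightarrow> chordal G \<Longrightarrow> in_class_G G"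
| clique_sum: "in_class_G G \<Longrightarrow> in_class_G H \<Longrightarrow> simple_graph F \<Longrightarrow> clique_sum G H F \<Longrightarrow> in_class_G F"
| cone: "in_class_G G \<Longrightarrow> v \<notin> verts G \<Longrightarrow> in_class_G (cone v G)"


section \<open>Random-access machines\<close>

text \<open>A machine has registers, named by the instructions, and a memory addressed indirectly through
  registers. Every instruction costs one time step. Subtraction is truncated, and division by
  zero gives zero.\<close>

datatype instr =
    SET nat nat
  | MOVE nat nat
  | ADD nat nat nat
  | SUB nat nat nat
  | MUL nat nat nat
  | DIV nat nat nat
  | LOAD nat nat
  | STORE nat nat
  | JUMP nat
  | JUMPZ nat nat
  | HALT

type_synonym program = "instr list"

record config =
  pc :: nat
  regs :: "nat \<Rightarrow> nat"
  mem :: "nat \<Rightarrow> nat"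

definition set_reg :: "nat \<Rightarrow> nat \<Rightarrow> config \<Rightarrow> config" where
  "set_reg r x c = c\<lparr>regs := (regs c)(r := x), pc := Suc (pc c)\<rparr>"

fun exec_instr :: "instr \<Rightarrow> config \<Rightarrow> config" where
  "exec_instr (SET r x) c = set_reg r x c"
| "exec_instr (MOVE r s) c = set_reg r (regs c s) c"
| "exec_instr (ADD r s t) c = set_reg r (regs c s + regs c t) c"
| "exec_instr (SUB r s t) c = set_reg r (regs c s - regs c t) c"
| "exec_instr (MUL r s t) c = set_reg r (regs c s * regs c t) c"
| "exec_instr (DIV r s t) c = set_reg r (regs c s div regs c t) c"
| "exec_instr (LOAD r s) c = set_reg r (mem c (regs c s)) c"
| "exec_instr (STORE r s) c = c\<lparr>mem := (mem c)(regs c r := regs c s), pc := Suc (pc c)\<rparr>"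
| "exec_instr (JUMP l) c = c\<lparr>pc := l\<rparr>"
| "exec_instr (JUMPZ r l) c = c\<lparr>pc := (if regs c r = 0 then l else Suc (pc c))\<rparr>"
| "exec_instr HALT c = c"

definition halted :: "program \<Rightarrow> config \<Rightarrow> bool" where
  "halted P c \<longleftrightarrow> pc c \<ge> length P \<or> P ! pc c = HALT"

definition step :: "program \<Rightarrow> config \<Rightarrow> config" where
  "step P c = (if halted P c then c else exec_instr (P ! pc c) c)"

definition run :: "program \<Rightarrow> nat \<Rightarrow> config \<Rightarrow> config" where
  "run P t = step P ^^ t"

definition words_bounded :: "nat \<Rightarrow> config \<Rightarrow> bool" where
  "words_bounded W c \<longleftrightarrow> (\<forall>r. regs c r \<le> W) \<and> (\<forall>a. mem c a \<le> W)"


section \<open>Graphs as machine input\<close>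

text \<open>The neighbours of each vertex are listed once, in arbitrary order.\<close>

definition adjacency_lists :: "nat list list \<Rightarrow> nat ugraph \<Rightarrow> bool" where
  "adjacency_lists adj G \<longleftrightarrow> verts G = {..<length adj} \<and>
     (\<forall>v<length adj. distinct (adj ! v) \<and> set (adj ! v) = {u. {v, u} \<in> edges G})"

text \<open>Memory cell 0 holds the number \<open>n\<close> of vertices, cell \<open>1 + v\<close> the address of the first entry
  of the list of vertex \<open>v\<close>, cell \<open>1 + n\<close> the first address after all lists. The lists follow,
  one after the other, from address \<open>n + 2\<close> on.\<close>

definition input_words :: "nat list list \<Rightarrow> nat list" where
  "input_words adj = length adj #
     map (\<lambda>v. length adj + 2 + length (concat (take v adj))) [0..<Suc (length adj)] @ concat adj"

definition initial_config :: "nat list list \<Rightarrow> config" where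
  "initial_config adj = \<lparr>pc = 0, regs = (\<lambda>_. 0),
     mem = (\<lambda>a. if a < length (input_words adj) then input_words adj ! a else 0)\<rparr>"

text \<open>The program halts within \<open>T\<close> steps with the truth value of \<open>Q\<close> in register 0, and all
  words occurring in the computation are at most \<open>W\<close>.\<close>

definition decides_within :: "program \<Rightarrow> nat list list \<Rightarrow> bool \<Rightarrow> nat \<Rightarrow> nat \<Rightarrow> bool" where
  "decides_within P adj Q T W \<longleftrightarrow>
     halted P (run P T (initial_config adj)) \<and>
     regs (run P T (initial_config adj)) 0 = (if Q then 1 else 0) \<and>
     (\<forall>t. words_bounded W (run P t (initial_config adj)))"

end

theory Submission
  imports Defs "HOL-Library.Nat_Bijection"
begin

text \<open>A graph belongs to the class if and only if each of its atoms (the induced subgraphs that are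
  not the union of two proper parts overlapping in a clique without edges across) has no \<open>K\<^sub>4\<close> minor once its universal
  vertices are deleted: cones only add universal vertices, clique sums only glue atoms, and by Dirac's
  theorem chordal atoms are complete.

  Atoms are found by visiting the vertices in the order of a maximum cardinality search of a minimal
  triangulation, and going through this order backwards. The component of the current vertex among
  the remaining vertices that come no earlier is a piece; if its earlier neighbours form a clique,
  then the piece together with them is an atom, and the piece can be removed. Each of the \<open>n\<close> searches
  takes time \<open>O(n + m)\<close>. On an atom the test for a \<open>K\<^sub>4\<close> minor repeatedly removes a vertex of degree at
  most two and joins its neighbours, in time \<open>O(n)\<close> per vertex. Charging the vertices of an atom to the
  removed piece and to the edges leaving it, the atoms have at most \<open>n + 2 m\<close> vertices altogether.

  The program uses arrays of unbounded extent, whose cells a pairing function maps to addresses of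
  polynomial size.\<close>

section \<open>Machine model: compilation with exact step counts and bounded words\<close>

section \<open>A structured language for random-access machines\<close>

text \<open>The hard point is the correctness of the peeling, because the minimal triangulation is
  never built. Everything rests on one comparison. When \<open>y\<close> is visited, its weight is
  at least the number of neighbours of its component among the unvisited vertices; on the other
  hand, as long as a full component of a clique separator has not been entered, the weights inside
  it are at most the number of visited vertices of the separator. Hence, of two full components, the
  second is entered only after the separator has been visited completely, and this makes each
  removed piece with its border an atom. Only the necessity of the condition on atoms is stated for
  the whole class; sufficiency travels with the run, as an implication from the remaining graph to
  the whole one. The time bound leaves no room for work of order n^2 outside the elimination of an
  atom: buckets replace sorting, cliques and universal vertices are recognised by counting marked
  neighbours, and the reduction of an atom leaves its matrix zero for the next one. The hypothesis m
  > 0 gives n at least 2, which absorbs the terms of lower order.\<close>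

record st =
  rg :: "nat \<Rightarrow> nat"
  ar :: "nat \<Rightarrow> nat \<Rightarrow> nat \<Rightarrow> nat"

definition upd :: "nat \<Rightarrow> nat \<Rightarrow> st \<Rightarrow> st" where
  "upd r x s = s\<lparr>rg := (rg s)(r := x)\<rparr>"

definition put :: "nat \<Rightarrow> nat \<Rightarrow> nat \<Rightarrow> nat \<Rightarrow> st \<Rightarrow> st" where
  "put k i j x s = s\<lparr>ar := (\<lambda>k' i' j'. if k' = k \<and> i' = i \<and> j' = j then x else ar s k' i' j')\<rparr>"

lemma rg_upd [simp]: "rg (upd r x s) r' = (if r' = r then x else rg s r')"
  and ar_upd [simp]: "ar (upd r x s) = ar s"
  and rg_put [simp]: "rg (put k i j x s) = rg s"
  and ar_put [simp]: "ar (put k i j x s) k' i' j' = (if k' = k \<and> i' = i \<and> j' = j then x else ar s k' i' j')"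
  by (simp_all add: upd_def put_def)

text \<open>Apart from small constants, only \<open>Inc\<close> creates a larger value, and products
  occur only inside address computations. Branches test for zero, so comparisons are made by
  truncated subtraction.\<close>

datatype com =
    Skip
  | Set nat nat
  | Mov nat nat
  | Inc nat nat
  | Dec nat nat
  | Sub nat nat nat
  | Inp nat nat
  | Get nat nat nat nat
  | Put nat nat nat nat
  | Seq com com (infixr ";;" 60)
  | If nat com com
  | While nat com

text \<open>The count is exactly the number of machine steps of the compiled code: 12 is eleven
  instructions for the address plus the access, a taken branch pays its test and the jump over the
  other branch, a loop round its test and the jump back. Reading input is guarded because cells past
  the input belong to the arrays.\<close>

inductive big :: "nat list \<Rightarrow> com \<Rightarrow> st \<Rightarrow> nat \<Rightarrow> st \<Rightarrow> bool" for w where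
  big_Skip: "big w Skip s 0 s"
| big_Set: "big w (Set r x) s 1 (upd r x s)"
| big_Mov: "big w (Mov r a) s 1 (upd r (rg s a) s)"
| big_Inc: "big w (Inc r a) s 1 (upd r (Suc (rg s a)) s)"
| big_Dec: "big w (Dec r a) s 1 (upd r (rg s a - 1) s)"
| big_Sub: "big w (Sub r a b) s 1 (upd r (rg s a - rg s b) s)"
| big_Inp: "rg s a < length w \<Longrightarrow> big w (Inp r a) s 1 (upd r (w ! rg s a) s)"
| big_Get: "big w (Get r k i j) s 12 (upd r (ar s k (rg s i) (rg s j)) s)"
| big_Put: "big w (Put k i j a) s 12 (put k (rg s i) (rg s j) (rg s a) s)"
| big_Seq: "big w c s t s' \<Longrightarrow> big w d s' u s'' \<Longrightarrow> big w (c ;; d) s (t + u) s''"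
| big_IfT: "rg s r \<noteq> 0 \<Longrightarrow> big w c s t s' \<Longrightarrow> big w (If r c d) s (t + 2) s'"
| big_IfF: "rg s r = 0 \<Longrightarrow> big w d s t s' \<Longrightarrow> big w (If r c d) s (t + 1) s'"
| big_WhileF: "rg s r = 0 \<Longrightarrow> big w (While r c) s 1 s"
| big_WhileT: "rg s r \<noteq> 0 \<Longrightarrow> big w c s t s' \<Longrightarrow> big w (While r c) s' u s'' \<Longrightarrow>
    big w (While r c) s (t + 2 + u) s''"

text \<open>Array cell \<open>(k, i, j)\<close> lives at address \<open>B + 16 * prod_encode (i, j) + k\<close>, where the
  base \<open>B\<close> (register 2) is the length of the input and register 1 holds 1; registers 3 to 10 are scratch.\<close>

definition addr_code :: "nat \<Rightarrow> nat \<Rightarrow> nat \<Rightarrow> instr list" where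
  "addr_code k i j =
    [ADD 3 i j, ADD 4 3 1, MUL 5 3 4, SET 6 2, DIV 5 5 6, ADD 7 5 i,
     SET 6 16, MUL 8 7 6, SET 6 k, ADD 9 8 6, ADD 10 9 2]"

fun clen :: "com \<Rightarrow> nat" where
  "clen Skip = 0"
| "clen (Get r k i j) = 12"
| "clen (Put k i j a) = 12"
| "clen (c ;; d) = clen c + clen d"
| "clen (If r c d) = clen c + clen d + 2"
| "clen (While r c) = clen c + 2"
| "clen c = 1"

fun compile :: "nat \<Rightarrow> com \<Rightarrow> instr list" where
  "compile l Skip = []"
| "compile l (Set r x) = [SET r x]"
| "compile l (Mov r a) = [MOVE r a]"
| "compile l (Inc r a) = [ADD r a 1]"
| "compile l (Dec r a) = [SUB r a 1]"
| "compile l (Sub r a b) = [SUB r a b]"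
| "compile l (Inp r a) = [LOAD r a]"
| "compile l (Get r k i j) = addr_code k i j @ [LOAD r 10]"
| "compile l (Put k i j a) = addr_code k i j @ [STORE 10 a]"
| "compile l (c ;; d) = compile l c @ compile (l + clen c) d"
| "compile l (If r c d) = JUMPZ r (l + clen c + 2) # compile (Suc l) c @
     JUMP (l + clen c + clen d + 2) # compile (l + clen c + 2) d"
| "compile l (While r c) = JUMPZ r (l + clen c + 2) # compile (Suc l) c @ [JUMP l]"

lemma length_compile [simp]: "length (compile l c) = clen c"
  by (induction c arbitrary: l) (auto simp: addr_code_def)

definition user :: "nat \<Rightarrow> bool" where
  "user r \<longleftrightarrow> r = 0 \<or> r > 10"

text \<open>The bound 16 on constants is the one allowed by \<open>leveled\<close>;
  \<open>k < 16\<close> keeps the sixteen interleaved arrays apart.\<close>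

fun wfc :: "com \<Rightarrow> bool" where
  "wfc Skip = True"
| "wfc (Set r x) = (user r \<and> x \<le> 16)"
| "wfc (Mov r a) = (user r \<and> user a)"
| "wfc (Inc r a) = (user r \<and> user a)"
| "wfc (Dec r a) = (user r \<and> user a)"
| "wfc (Sub r a b) = (user r \<and> user a \<and> user b)"
| "wfc (Inp r a) = (user r \<and> user a)"
| "wfc (Get r k i j) = (user r \<and> k < 16 \<and> user i \<and> user j)"
| "wfc (Put k i j a) = (user a \<and> k < 16 \<and> user i \<and> user j)"
| "wfc (c ;; d) = (wfc c \<and> wfc d)"
| "wfc (If r c d) = (user r \<and> wfc c \<and> wfc d)"
| "wfc (While r c) = (user r \<and> wfc c)"

subsection \<open>Correctness of the compiler\<close>

definition has_code :: "program \<Rightarrow> nat \<Rightarrow> instr list \<Rightarrow> bool" where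
  "has_code P l xs \<longleftrightarrow> l + length xs \<le> length P \<and> (\<forall>i<length xs. P ! (l + i) = xs ! i)"

lemma has_code_Cons: "has_code P l (x # xs) \<longleftrightarrow> l < length P \<and> P ! l = x \<and> has_code P (Suc l) xs"
  by (auto simp: has_code_def All_less_Suc2)

lemma has_code_append: "has_code P l (xs @ ys) \<longleftrightarrow> has_code P l xs \<and> has_code P (l + length xs) ys"
proof (induction xs arbitrary: l)
  case Nil
  then show ?case by (auto simp: has_code_def)
next
  case (Cons x xs)
  then show ?case by (auto simp: has_code_Cons)
qed

text \<open>The input stays untouched below address \<open>length w\<close> and can be read during
  the whole run. The scratch registers 3 to 10 are left unconstrained.\<close>

definition sim :: "nat list \<Rightarrow> st \<Rightarrow> config \<Rightarrow> bool" where
  "sim w s c \<longleftrightarrow> (\<forall>r. user r \<longrightarrow> regs c r = rg s r) \<and> regs c 1 = 1 \<and> regs c 2 = length w \<and>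
     (\<forall>a<length w. mem c a = w ! a) \<and>
     (\<forall>k<16. \<forall>i j. mem c (length w + 16 * prod_encode (i, j) + k) = ar s k i j)"

lemma run_0 [simp]: "run P 0 c = c"
  by (simp add: run_def)

lemma run_Suc: "run P (Suc t) c = run P t (step P c)"
  by (simp add: run_def funpow_Suc_right del: funpow.simps)

lemma run_add: "run P (t + u) c = run P u (run P t c)"
  by (simp add: run_def add.commute[of t] funpow_add)

lemma step_code:
  "pc c < length P \<Longrightarrow> P ! pc c = i \<Longrightarrow> i \<noteq> HALT \<Longrightarrow> step P c = exec_instr i c"
  by (auto simp: step_def halted_def)

fun simple_instr :: "instr \<Rightarrow> bool" where
  "simple_instr (JUMP l) = False"
| "simple_instr (JUMPZ r l) = False"
| "simple_instr HALT = False"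
| "simple_instr _ = True"

lemma run_straight:
  assumes "has_code P (pc c) xs" "\<forall>x\<in>set xs. simple_instr x"
  shows "run P (length xs) c = fold exec_instr xs c"
  using assms
proof (induction xs arbitrary: c)
  case Nil
  then show ?case by simp
next
  case (Cons x xs)
  have x: "pc c < length P" "P ! pc c = x" "has_code P (Suc (pc c)) xs" "simple_instr x"
    using Cons.prems by (auto simp: has_code_Cons)
  moreover have "step P c = exec_instr x c"
    using x by (intro step_code) auto
  moreover have "pc (exec_instr x c) = Suc (pc c)"
    using x(4) by (cases x) (auto simp: set_reg_def)
  ultimately show ?case
    using Cons.IH[of "exec_instr x c"] Cons.prems by (simp add: run_Suc)
qed

text \<open>The pairing function sends \<open>(a, b)\<close> to
  \<open>(a + b) (a + b + 1) / 2 + a\<close>, which the code evaluates literally.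
  \<open>SET 6 2\<close> loads the divisor 2, whereas \<open>ADD 10 9 2\<close> adds the base kept
  in register 2.\<close>

lemma fold_addr_code:
  assumes "user i" "user j" "sim w s c"
    and c'_def: "c' = fold exec_instr (addr_code k i j) c"
  shows "regs c' 10 = length w + 16 * prod_encode (rg s i, rg s j) + k"
    and "pc c' = pc c + 11" and "sim w s c'"
proof -
  have "i \<notin> {1..10}" "j \<notin> {1..10}"
    using assms by (auto simp: user_def)
  then have "i \<noteq> 3" "i \<noteq> 4" "i \<noteq> 5" "i \<noteq> 6" "i \<noteq> 7"
    by auto
  moreover have "regs c i = rg s i" "regs c j = rg s j" "regs c 1 = 1" "regs c (Suc 0) = 1" "regs c 2 = length w"
    using assms by (auto simp: sim_def)
  ultimately show "regs c' 10 = length w + 16 * prod_encode (rg s i, rg s j) + k"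
    by (simp add: c'_def addr_code_def set_reg_def prod_encode_def triangle_def)
  show "pc c' = pc c + 11"
    by (simp add: c'_def addr_code_def set_reg_def)
  have "regs c' r = regs c r" if "r \<notin> {3..10}" for r
    using that by (auto simp: c'_def addr_code_def set_reg_def)
  moreover have "mem c' = mem c"
    by (simp add: c'_def addr_code_def set_reg_def)
  ultimately show "sim w s c'"
    using assms(3) by (auto simp: sim_def user_def)
qed

lemma length_addr_code [simp]: "length (addr_code k i j) = 11"
  by (simp add: addr_code_def)

lemma simple_addr_code: "\<forall>x\<in>set (addr_code k i j). simple_instr x"
  by (simp add: addr_code_def)

lemma sim_set_reg: "sim w s c \<Longrightarrow> user r \<Longrightarrow> sim w (upd r x s) (set_reg r x c)"
  by (auto simp: sim_def user_def set_reg_def)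

lemma pc_set_reg [simp]: "pc (set_reg r x c) = Suc (pc c)"
  by (simp add: set_reg_def)

lemma sim_pc [simp]: "sim w s (c\<lparr>pc := l\<rparr>) = sim w s c"
  by (simp add: sim_def)

text \<open>Distinct cells have distinct addresses: \<open>k < 16\<close> is recovered as a
  remainder modulo 16, and the pairing function is injective.\<close>

lemma sim_store:
  assumes "sim w s c" "k < 16"
  shows "sim w (put k i j x s) (c\<lparr>mem := (mem c)(length w + 16 * prod_encode (i, j) + k := x), pc := l\<rparr>)"
proof -
  have "16 * prod_encode (i', j') + k' = 16 * prod_encode (i, j) + k \<longleftrightarrow> k' = k \<and> i' = i \<and> j' = j"
    if "k' < 16" for i' j' k'
  proof
    assume eq: "16 * prod_encode (i', j') + k' = 16 * prod_encode (i, j) + k"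
    then have "k' = k"
      using that assms(2) by presburger
    with eq show "k' = k \<and> i' = i \<and> j' = j" by simp
  qed auto
  then show ?thesis
    using assms by (auto simp: sim_def)
qed

lemma step_simple1:
  assumes "has_code P (pc c) [i]" "simple_instr i"
  shows "run P (Suc 0) c = exec_instr i c"
  using run_straight[of P c "[i]"] assms by simp

text \<open>By induction on the big-step derivation, where each loop round is a subderivation. The
  configuration is arbitrary because the code of a subcommand sits at another position. The same
  \<open>t\<close> occurs on both sides, so the translation costs no overhead.\<close>

lemma compile_correct:
  assumes "big w c s t s'" "wfc c" "has_code P (pc cf) (compile (pc cf) c)" "sim w s cf"
  shows "sim w s' (run P t cf) \<and> pc (run P t cf) = pc cf + clen c"
  using assms
proof (induction arbitrary: cf rule: big.induct)
  case (big_Skip s)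
  then show ?case by simp
next
  case (big_Set r x s)
  then show ?case using step_simple1[of P cf] by (simp add: sim_set_reg)
next
  case (big_Mov r a s)
  moreover have "regs cf a = rg s a" using big_Mov by (simp add: sim_def)
  ultimately show ?case using step_simple1[of P cf] by (simp add: sim_set_reg)
next
  case (big_Inc r a s)
  moreover have "regs cf a = rg s a" "regs cf (Suc 0) = 1" using big_Inc by (simp_all add: sim_def)
  ultimately show ?case using step_simple1[of P cf] by (simp add: sim_set_reg)
next
  case (big_Dec r a s)
  moreover have "regs cf a = rg s a" "regs cf (Suc 0) = 1" using big_Dec by (simp_all add: sim_def)
  ultimately show ?case using step_simple1[of P cf] by (simp add: sim_set_reg)
next
  case (big_Sub r a b s)
  moreover have "regs cf a = rg s a" "regs cf b = rg s b" using big_Sub by (simp_all add: sim_def)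
  ultimately show ?case using step_simple1[of P cf] by (simp add: sim_set_reg)
next
  case (big_Inp s a r)
  moreover have "regs cf a = rg s a" "mem cf (rg s a) = w ! rg s a"
    using big_Inp by (simp_all add: sim_def)
  ultimately show ?case using step_simple1[of P cf] by (simp add: sim_set_reg)
next
  case (big_Get r k i j s)
  let ?c = "fold exec_instr (addr_code k i j) cf"
  have *: "run P 12 cf = exec_instr (LOAD r 10) ?c"
    using run_straight[of P cf "addr_code k i j @ [LOAD r 10]"] big_Get simple_addr_code
    by (simp add: ball_Un del: exec_instr.simps)
  note c = fold_addr_code[of i j w s cf _ k, OF _ _ _ refl]
  have "mem ?c (regs ?c 10) = ar s k (rg s i) (rg s j)"
    using c big_Get by (simp add: sim_def)
  then have "run P 12 cf = set_reg r (ar s k (rg s i) (rg s j)) ?c"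
    using * by simp
  then show ?case
    using c big_Get by (simp add: sim_set_reg)
next
  case (big_Put k i j a s)
  let ?c = "fold exec_instr (addr_code k i j) cf"
  have *: "run P 12 cf = exec_instr (STORE 10 a) ?c"
    using run_straight[of P cf "addr_code k i j @ [STORE 10 a]"] big_Put simple_addr_code
    by (simp add: ball_Un del: exec_instr.simps)
  note c = fold_addr_code[of i j w s cf _ k, OF _ _ _ refl]
  have "regs ?c a = rg s a"
    using c big_Put by (simp add: sim_def)
  then have "run P 12 cf = ?c\<lparr>mem := (mem ?c)(length w + 16 * prod_encode (rg s i, rg s j) + k := rg s a),
      pc := Suc (pc ?c)\<rparr>"
    using * c big_Put by simp
  then show ?case
    using c big_Put sim_store[of w s ?c k] by simp
next
  case (big_Seq c s t s' d u s'')
  then show ?case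
    by (simp add: has_code_append run_add add.assoc)
next
  case (big_IfT s r c t s' d)
  let ?c1 = "cf\<lparr>pc := Suc (pc cf)\<rparr>"
  let ?c2 = "run P t ?c1"
  have "regs cf r = rg s r" using big_IfT by (simp add: sim_def)
  then have 1: "step P cf = ?c1"
    using big_IfT by (subst step_code) (auto simp: has_code_Cons)
  have 2: "sim w s' ?c2" "pc ?c2 = Suc (pc cf) + clen c"
    using big_IfT.IH[of ?c1] big_IfT.prems by (auto simp: has_code_Cons has_code_append)
  have "step P ?c2 = ?c2\<lparr>pc := pc cf + clen c + clen d + 2\<rparr>"
    using 2 big_IfT.prems by (subst step_code) (auto simp: has_code_Cons has_code_append)
  moreover have "run P (t + 2) cf = step P ?c2"
    using 1 run_add[of P t 1 ?c1] by (simp add: run_Suc)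
  ultimately show ?case using 2 by simp
next
  case (big_IfF s r d t s' c)
  let ?c1 = "cf\<lparr>pc := pc cf + clen c + 2\<rparr>"
  have "regs cf r = rg s r" using big_IfF by (simp add: sim_def)
  then have 1: "step P cf = ?c1"
    using big_IfF by (subst step_code) (auto simp: has_code_Cons)
  show ?case
    using 1 big_IfF.IH[of ?c1] big_IfF.prems by (auto simp: has_code_Cons has_code_append run_Suc)
next
  case (big_WhileF s r c)
  have "regs cf r = rg s r" using big_WhileF by (simp add: sim_def)
  then have 1: "step P cf = cf\<lparr>pc := pc cf + clen c + 2\<rparr>"
    using big_WhileF by (subst step_code) (auto simp: has_code_Cons)
  then show ?case using big_WhileF by (simp add: run_Suc)
next
  case (big_WhileT s r c t s' u s'')
  let ?c1 = "cf\<lparr>pc := Suc (pc cf)\<rparr>"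
  let ?c2 = "run P t ?c1"
  let ?c3 = "?c2\<lparr>pc := pc cf\<rparr>"
  have "regs cf r = rg s r" using big_WhileT by (simp add: sim_def)
  then have 1: "step P cf = ?c1"
    using big_WhileT by (subst step_code) (auto simp: has_code_Cons)
  have 2: "sim w s' ?c2" "pc ?c2 = Suc (pc cf) + clen c"
    using big_WhileT.IH(1)[of ?c1] big_WhileT.prems by (auto simp: has_code_Cons has_code_append)
  have 3: "step P ?c2 = ?c3"
    using 2 big_WhileT.prems by (subst step_code) (auto simp: has_code_Cons has_code_append)
  have "run P (t + 2 + u) cf = run P u (run P (t + 2) cf)"
    by (rule run_add)
  also have "run P (t + 2) cf = step P ?c2"
    using 1 run_add[of P t 1 ?c1] by (simp add: run_Suc)
  finally have "run P (t + 2 + u) cf = run P u ?c3"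
    using 3 by simp
  then show ?case
    using big_WhileT.IH(2)[of ?c3] big_WhileT.prems 2 by simp
qed

subsection \<open>A static bound on the words\<close>

text \<open>After \<open>t\<close> steps a register of level \<open>l\<close> holds at most \<open>(M + t) ^ 2 ^ l\<close>; memory, the input
  and the registers of the structured language have level 0, because there only increments by one increase values.\<close>

definition level :: "nat \<Rightarrow> nat" where
  "level r = (if r = 3 \<or> r = 4 then 1 else if r = 5 then 2 else if r = 7 then 3
     else if r = 8 then 4 else if r = 9 then 5 else if r = 10 then 6 else 0)"

text \<open>A static discipline: the target of an instruction has a level high enough for the
  result. Squaring moves up one level, so sums and products take operands of strictly lower level.
  Adding register 1 is exempt because it never exceeds 1, and for this reason only
  \<open>SET\<close> may write it. Memory has level 0, hence \<open>STORE\<close> takes a value of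
  level 0.\<close>

fun leveled :: "instr \<Rightarrow> bool" where
  "leveled (SET r x) = (x \<le> 16 \<and> (r = 1 \<longrightarrow> x \<le> 1))"
| "leveled (MOVE r a) = (r \<noteq> 1 \<and> level a \<le> level r)"
| "leveled (ADD r a b) = (r \<noteq> 1 \<and> (b = 1 \<and> level a \<le> level r \<or> level a < level r \<and> level b < level r))"
| "leveled (SUB r a b) = (r \<noteq> 1 \<and> level a \<le> level r)"
| "leveled (MUL r a b) = (r \<noteq> 1 \<and> level a < level r \<and> level b < level r)"
| "leveled (DIV r a b) = (r \<noteq> 1 \<and> level a \<le> level r)"
| "leveled (LOAD r a) = (r \<noteq> 1)"
| "leveled (STORE a r) = (level r = 0)"
| "leveled _ = True"

lemma level_user: "user r \<Longrightarrow> level r = 0 \<and> r \<noteq> Suc 0"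
  by (auto simp: user_def level_def)

lemma leveled_addr_code: "user i \<Longrightarrow> user j \<Longrightarrow> k < 16 \<Longrightarrow> list_all leveled (addr_code k i j)"
  by (simp add: addr_code_def level_user) (simp add: level_def)

lemma leveled_compile: "wfc c \<Longrightarrow> list_all leveled (compile l c)"
  by (induction c arbitrary: l) (simp_all add: level_user leveled_addr_code)

definition level_bounded :: "nat \<Rightarrow> config \<Rightarrow> bool" where
  "level_bounded M c \<longleftrightarrow> (\<forall>r. regs c r \<le> M ^ 2 ^ level r) \<and> regs c 1 \<le> 1 \<and> (\<forall>a. mem c a \<le> M)"

text \<open>Raising the base from \<open>M\<close> to \<open>Suc M\<close> pays for one increment.
  For levels below \<open>l\<close> the two exponents add up to at most \<open>2 ^ l\<close>, which
  pays for products, and a sum of numbers that are at least 2 is bounded by their product.\<close>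

lemma level_bounded_exec:
  assumes "level_bounded M c" "leveled i" "16 \<le> M"
  shows "level_bounded (Suc M) (exec_instr i c)"
proof -
  have R: "regs c r \<le> M ^ 2 ^ level r" for r
    using assms by (simp add: level_bounded_def)
  have pw: "M ^ 2 ^ a \<le> M ^ 2 ^ b" if "a \<le> b" for a b
    using assms(3) that by (intro power_increasing) auto
  have pw1: "M ^ 2 ^ a < Suc M ^ 2 ^ a" for a
    by (rule power_strict_mono) auto
  have Mle: "M \<le> Suc M ^ 2 ^ a" for a
    using pw[of 0 a] pw1[of a] by simp
  have pw2: "M ^ 2 ^ a * M ^ 2 ^ b \<le> M ^ 2 ^ l" if "a < l" "b < l" for a b l
  proof -
    obtain l' where l: "l = Suc l'" using \<open>a < l\<close> by (cases l) auto
    have "M ^ 2 ^ a * M ^ 2 ^ b \<le> M ^ 2 ^ l' * M ^ 2 ^ l'"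
      using that l by (intro mult_mono pw) auto
    also have "\<dots> = M ^ 2 ^ l"
      unfolding l by (simp add: power_add[symmetric] mult_2)
    finally show ?thesis .
  qed
  have mul: "regs c a * regs c b \<le> M ^ 2 ^ l" if "level a < l" "level b < l" for a b l
    using mult_mono[OF R R, of a b] pw2[OF that] by (meson le_trans zero_le)
  have ge2: "2 \<le> M ^ 2 ^ a" for a
    using pw[of 0 a] assms(3) by simp
  have add: "regs c a + regs c b \<le> M ^ 2 ^ l" if "level a < l" "level b < l" for a b l
  proof -
    have "x + y \<le> x * y" if "2 \<le> x" "2 \<le> y" for x y :: nat
    proof -
      obtain p q where "x = 2 + p" "y = 2 + q"
        using \<open>2 \<le> x\<close> \<open>2 \<le> y\<close> le_Suc_ex by blast
      then show ?thesis by (simp add: algebra_simps)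
    qed
    from this[OF ge2 ge2, of "level a" "level b"]
    show ?thesis using R[of a] R[of b] pw2[OF that] by linarith
  qed
  have le: "regs c r \<le> Suc M ^ 2 ^ level r" for r
    using R[of r] pw1[of "level r"] by linarith
  have rl: "regs c a \<le> M ^ 2 ^ l" if "level a \<le> l" for a l
    using R[of a] pw[OF that] by linarith
  have set: "level_bounded (Suc M) (set_reg r x c)"
    if "x \<le> Suc M ^ 2 ^ level r" "r = 1 \<longrightarrow> x \<le> 1" for r x
    using that assms(1) le by (auto simp: level_bounded_def set_reg_def le_SucI)
  have lt: "x \<le> Suc M ^ 2 ^ l" if "x \<le> M ^ 2 ^ l" for x l
    using that pw1[of l] by linarith
  show ?thesis
  proof (cases i)
    case (SET r x)
    have "x \<le> Suc M ^ 2 ^ level r" using SET assms Mle[of "level r"] by auto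
    then show ?thesis using SET set assms(2) by auto
  next
    case (MOVE r s)
    then show ?thesis using assms(2) by (auto intro!: set lt rl)
  next
    case (ADD r a b)
    consider "b = 1" "level a \<le> level r" | "level a < level r" "level b < level r"
      using ADD assms(2) by auto
    then show ?thesis
    proof cases
      case 1
      have "regs c a + regs c b \<le> M ^ 2 ^ level r + 1"
        using rl[OF 1(2)] 1(1) assms(1) by (simp add: level_bounded_def)
      also have "\<dots> \<le> Suc M ^ 2 ^ level r" using pw1[of "level r"] by simp
      finally show ?thesis using ADD assms(2) by (auto intro!: set)
    next
      case 2
      then show ?thesis using ADD assms(2) by (auto intro!: set lt add)
    qed
  next
    case (SUB r a b)
    then show ?thesis using assms(2) rl[of a "level r"] by (auto intro!: set lt)
  next
    case (MUL r a b)
    then show ?thesis using assms(2) by (auto intro!: set lt mul)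
  next
    case (DIV r a b)
    have "regs c a div regs c b \<le> M ^ 2 ^ level r"
      using DIV assms(2) rl[of a "level r"] by (auto intro: le_trans[OF div_le_dividend])
    then show ?thesis using DIV assms(2) by (auto intro!: set lt)
  next
    case (LOAD r a)
    have "mem c (regs c a) \<le> M" using assms(1) by (simp add: level_bounded_def)
    then show ?thesis using LOAD assms(2) Mle[of "level r"] by (auto intro!: set)
  next
    case (STORE a r)
    then show ?thesis using assms(1,2) R[of r] le by (auto simp: level_bounded_def le_SucI)
  qed (use assms(1) le in \<open>auto simp: level_bounded_def le_SucI\<close>)
qed

lemma level_bounded_mono: "level_bounded M c \<Longrightarrow> M \<le> N \<Longrightarrow> level_bounded N c"
  unfolding level_bounded_def by (meson le_trans power_mono zero_le)

lemma level_bounded_run: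
  assumes "level_bounded M c" "16 \<le> M" "\<forall>x\<in>set P. leveled x"
  shows "level_bounded (M + t) (run P t c)"
proof (induction t)
  case 0
  then show ?case using assms by simp
next
  case (Suc t)
  have "run P (Suc t) c = step P (run P t c)"
    using run_add[of P t 1 c] by (simp add: run_Suc)
  moreover have "level_bounded (Suc (M + t)) (step P (run P t c))"
  proof (cases "halted P (run P t c)")
    case True
    then show ?thesis using Suc level_bounded_mono by (simp add: step_def)
  next
    case False
    then have "leveled (P ! pc (run P t c))"
      using assms(3) by (auto simp: halted_def)
    then show ?thesis
      using False Suc level_bounded_exec assms(2) by (simp add: step_def)
  qed
  ultimately show ?case by simp
qed

text \<open>The exponent is \<open>64 = 2 ^ 6\<close>, where 6 is the largest level, that of the
  address register 10.\<close>

lemma words_bounded_level: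
  assumes "level_bounded M c" "16 \<le> M"
  shows "words_bounded (M ^ 64) c"
proof -
  have "M ^ 2 ^ level r \<le> M ^ 64" for r
    using assms(2) by (intro power_increasing) (auto simp: level_def)
  moreover have "M \<le> M ^ 64"
    using assms(2) power_increasing[of 1 64 M] by simp
  ultimately show ?thesis
    using assms(1) by (auto simp: words_bounded_def level_bounded_def intro: le_trans)
qed

lemma run_halted: "halted P (run P t c) \<Longrightarrow> run P (t + u) c = run P t c"
  unfolding run_add
  by (induction u) (auto simp: run_Suc step_def)

subsection \<open>Weakest preconditions with time credits\<close>

text \<open>Total correctness with credit: \<open>T\<close> is the number of steps that may still be
  spent, and the postcondition receives what is left. Unspent credit can therefore serve as
  amortised savings inside an invariant.\<close>

definition wp :: "nat list \<Rightarrow> com \<Rightarrow> (st \<Rightarrow> nat \<Rightarrow> bool) \<Rightarrow> st \<Rightarrow> nat \<Rightarrow> bool" where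
  "wp w c Q s T \<longleftrightarrow> (\<exists>s' t. big w c s t s' \<and> t \<le> T \<and> Q s' (T - t))"

lemma wp_Seq: "wp w c (wp w d Q) s T \<Longrightarrow> wp w (c ;; d) Q s T"
  unfolding wp_def
proof (elim exE conjE)
  fix s' t s'' u
  assume "big w c s t s'" "t \<le> T" "big w d s' u s''" "u \<le> T - t" "Q s'' (T - t - u)"
  then show "\<exists>s' t. big w (c ;; d) s t s' \<and> t \<le> T \<and> Q s' (T - t)"
    by (intro exI[of _ s''] exI[of _ "t + u"]) (auto intro: big_Seq)
qed

text \<open>No variant is needed for termination: every iteration consumes credit.\<close>

lemma wp_While:
  assumes "I s T"
    and step: "\<And>s T. I s T \<Longrightarrow> rg s r \<noteq> 0 \<Longrightarrow> 2 \<le> T \<and> wp w c I s (T - 2)"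
    and exit: "\<And>s T. I s T \<Longrightarrow> rg s r = 0 \<Longrightarrow> 1 \<le> T \<and> Q s (T - 1)"
  shows "wp w (While r c) Q s T"
  using assms(1)
proof (induction T arbitrary: s rule: less_induct)
  case (less T)
  show ?case
  proof (cases "rg s r = 0")
    case True
    then show ?thesis using exit[OF less.prems] unfolding wp_def by (metis big_WhileF)
  next
    case False
    obtain s' t where b: "big w c s t s'" "t \<le> T - 2" "I s' (T - 2 - t)" and T: "2 \<le> T"
      using step[OF less.prems False] by (auto simp: wp_def)
    have "wp w (While r c) Q s' (T - 2 - t)"
      using b T by (intro less.IH) auto
    then obtain s'' u where "big w (While r c) s' u s''" "u \<le> T - 2 - t" "Q s'' (T - 2 - t - u)"
      by (auto simp: wp_def)
    moreover from this(1) have "big w (While r c) s (t + 2 + u) s''"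
      by (rule big_WhileT[OF False b(1)])
    ultimately show ?thesis
      unfolding wp_def using T b(2)
      by (intro exI[of _ s''] exI[of _ "t + 2 + u"]) auto
  qed
qed

section \<open>Structural graph theory: K4 minors, atoms and the closure properties of the
  class\<close>

section \<open>Minors, cliques and separations of a binary relation\<close>

text \<open>The closure is reflexive everywhere, so \<open>conn E X u u\<close> holds also for
  \<open>u\<close> outside \<open>X\<close>; membership of an endpoint is assumed separately where
  it matters.\<close>

definition conn :: "('a \<Rightarrow> 'a \<Rightarrow> bool) \<Rightarrow> 'a set \<Rightarrow> 'a \<Rightarrow> 'a \<Rightarrow> bool" where
  "conn E X = (\<lambda>a b. a \<in> X \<and> b \<in> X \<and> E a b)\<^sup>*\<^sup>*"

definition connected :: "('a \<Rightarrow> 'a \<Rightarrow> bool) \<Rightarrow> 'a set \<Rightarrow> bool" where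
  "connected E X \<longleftrightarrow> X \<noteq> {} \<and> (\<forall>u\<in>X. \<forall>v\<in>X. conn E X u v)"

definition clique :: "('a \<Rightarrow> 'a \<Rightarrow> bool) \<Rightarrow> 'a set \<Rightarrow> bool" where
  "clique E X \<longleftrightarrow> (\<forall>u\<in>X. \<forall>v\<in>X. u \<noteq> v \<longrightarrow> E u v)"

definition k4_minor :: "('a \<Rightarrow> 'a \<Rightarrow> bool) \<Rightarrow> 'a set \<Rightarrow> bool" where
  "k4_minor E V \<longleftrightarrow> (\<exists>B :: nat \<Rightarrow> 'a set. (\<forall>i<4. B i \<subseteq> V \<and> connected E (B i)) \<and>
     (\<forall>i<4. \<forall>j<4. i \<noteq> j \<longrightarrow> B i \<inter> B j = {} \<and> (\<exists>u\<in>B i. \<exists>v\<in>B j. E u v)))"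

definition separation :: "('a \<Rightarrow> 'a \<Rightarrow> bool) \<Rightarrow> 'a set \<Rightarrow> 'a set \<Rightarrow> 'a set \<Rightarrow> bool" where
  "separation E X A B \<longleftrightarrow> A \<union> B = X \<and> clique E (A \<inter> B) \<and> (\<forall>a\<in>A - B. \<forall>b\<in>B - A. \<not> E a b)"

definition atom :: "('a \<Rightarrow> 'a \<Rightarrow> bool) \<Rightarrow> 'a set \<Rightarrow> bool" where
  "atom E X \<longleftrightarrow> (\<forall>A B. separation E X A B \<longrightarrow> A \<subseteq> B \<or> B \<subseteq> A)"

definition universals :: "('a \<Rightarrow> 'a \<Rightarrow> bool) \<Rightarrow> 'a set \<Rightarrow> 'a set" where
  "universals E X = {u \<in> X. \<forall>v\<in>X. v \<noteq> u \<longrightarrow> E u v}"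

text \<open>All induced atoms are meant, not only the maximal ones. So the property passes to
  subsets of \<open>V\<close> directly, and no uniqueness of the decomposition enters.\<close>

definition good_atoms :: "('a \<Rightarrow> 'a \<Rightarrow> bool) \<Rightarrow> 'a set \<Rightarrow> bool" where
  "good_atoms E V \<longleftrightarrow> (\<forall>X\<subseteq>V. atom E X \<longrightarrow> \<not> k4_minor E (X - universals E X))"

lemma conn_refl [simp]: "conn E X u u"
  by (simp add: conn_def)

lemma conn_step: "conn E X u v \<Longrightarrow> v \<in> X \<Longrightarrow> w \<in> X \<Longrightarrow> E v w \<Longrightarrow> conn E X u w"
  unfolding conn_def by (rule rtranclp.rtrancl_into_rtrancl) auto

lemma conn_edge: "u \<in> X \<Longrightarrow> v \<in> X \<Longrightarrow> E u v \<Longrightarrow> conn E X u v"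
  by (rule conn_step[OF conn_refl])

lemma conn_trans: "conn E X u v \<Longrightarrow> conn E X v w \<Longrightarrow> conn E X u w"
  unfolding conn_def by (rule rtranclp_trans)

lemma conn_induct [consumes 1, case_names refl step]:
  assumes "conn E X u v" "P u"
    and "\<And>y z. conn E X u y \<Longrightarrow> y \<in> X \<Longrightarrow> z \<in> X \<Longrightarrow> E y z \<Longrightarrow> P y \<Longrightarrow> P z"
  shows "P v"
  using assms(1) unfolding conn_def
  by (induction rule: rtranclp_induct) (auto simp: assms(2) conn_def[symmetric] intro: assms(3))

lemma conn_sym: "conn E X u v \<Longrightarrow> symp E \<Longrightarrow> conn E X v u"
  by (induction rule: conn_induct) (auto intro: conn_trans conn_edge dest: sympD)

lemma conn_mono:
  assumes "conn E X u v" "X \<subseteq> Y" "\<And>a b. a \<in> X \<Longrightarrow> b \<in> X \<Longrightarrow> E a b \<Longrightarrow> E' a b"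
  shows "conn E' Y u v"
  using assms(1) by (induction rule: conn_induct) (use assms in \<open>auto intro: conn_step\<close>)

lemma conn_in: "conn E X u v \<Longrightarrow> u \<in> X \<Longrightarrow> v \<in> X"
  by (induction rule: conn_induct) auto

lemma conn_subset: "u \<in> X \<Longrightarrow> {v. conn E X u v} \<subseteq> X"
proof
  fix v assume u: "u \<in> X" and "v \<in> {v. conn E X u v}"
  then have "conn E X u v" by simp
  then show "v \<in> X" using u by (rule conn_in)
qed

lemma cliqueD: "clique E X \<Longrightarrow> u \<in> X \<Longrightarrow> v \<in> X \<Longrightarrow> u \<noteq> v \<Longrightarrow> E u v"
  by (simp add: clique_def)

lemma connected_mono:
  "connected E X \<Longrightarrow> (\<And>a b. a \<in> X \<Longrightarrow> b \<in> X \<Longrightarrow> E a b \<Longrightarrow> E' a b) \<Longrightarrow> connected E' X"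
  unfolding connected_def by (auto intro: conn_mono[of E X _ _ X E'])

lemma connectedI:
  assumes "symp E" "r \<in> X" "\<And>v. v \<in> X \<Longrightarrow> conn E X r v"
  shows "connected E X"
  unfolding connected_def using assms by (blast intro: conn_trans conn_sym)

lemma connected_singleton [simp]: "connected E {v}"
  by (simp add: connected_def)

lemma connected_component:
  assumes "symp E" "r \<in> X"
  shows "connected E {v. conn E X r v}"
proof (rule connectedI[OF assms(1)])
  show "r \<in> {v. conn E X r v}" by simp
  fix v assume "v \<in> {v. conn E X r v}"
  then have "conn E X r v" by simp
  then show "conn E {v. conn E X r v} r v"
    by (induction rule: conn_induct) (auto intro: conn_step)
qed

lemma k4_minorE:
  assumes "k4_minor E V"
  obtains B :: "nat \<Rightarrow> 'a set" where "\<And>i. i < 4 \<Longrightarrow> B i \<subseteq> V" "\<And>i. i < 4 \<Longrightarrow> connected E (B i)"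
    "\<And>i j. i < 4 \<Longrightarrow> j < 4 \<Longrightarrow> i \<noteq> j \<Longrightarrow> B i \<inter> B j = {} \<and> (\<exists>u\<in>B i. \<exists>v\<in>B j. E u v)"
proof -
  obtain B :: "nat \<Rightarrow> 'a set" where B: "(\<forall>i<4. B i \<subseteq> V \<and> connected E (B i)) \<and>
     (\<forall>i<4. \<forall>j<4. i \<noteq> j \<longrightarrow> B i \<inter> B j = {} \<and> (\<exists>u\<in>B i. \<exists>v\<in>B j. E u v))"
    using assms unfolding k4_minor_def by (rule exE)
  show thesis
    by (rule that[of B]) (use B in simp_all)
qed

lemma k4_minor_branchI:
  fixes B :: "nat \<Rightarrow> 'a set"
  assumes "\<And>i. i < 4 \<Longrightarrow> B i \<subseteq> V" "\<And>i. i < 4 \<Longrightarrow> connected E (B i)"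
    "\<And>i j. i < 4 \<Longrightarrow> j < 4 \<Longrightarrow> i \<noteq> j \<Longrightarrow> B i \<inter> B j = {}"
    "\<And>i j. i < 4 \<Longrightarrow> j < 4 \<Longrightarrow> i \<noteq> j \<Longrightarrow> \<exists>u\<in>B i. \<exists>v\<in>B j. E u v"
  shows "k4_minor E V"
  unfolding k4_minor_def using assms by (intro exI[of _ B] conjI allI impI)

lemma k4_minor_mono:
  assumes "k4_minor E V" "V \<subseteq> W" "\<And>a b. a \<in> V \<Longrightarrow> b \<in> V \<Longrightarrow> E a b \<Longrightarrow> E' a b"
  shows "k4_minor E' W"
proof -
  obtain B :: "nat \<Rightarrow> 'a set" where B: "\<And>i. i < 4 \<Longrightarrow> B i \<subseteq> V" "\<And>i. i < 4 \<Longrightarrow> connected E (B i)"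
    "\<And>i j. i < 4 \<Longrightarrow> j < 4 \<Longrightarrow> i \<noteq> j \<Longrightarrow> B i \<inter> B j = {} \<and> (\<exists>u\<in>B i. \<exists>v\<in>B j. E u v)"
    using assms(1) by (rule k4_minorE) (rule that)
  show ?thesis
  proof (rule k4_minor_branchI[of B])
    fix i j :: nat assume i: "i < 4"
    show "B i \<subseteq> W" using B(1)[OF i] assms(2) by blast
    show "connected E' (B i)"
      using B(1)[OF i] by (intro connected_mono[OF B(2)[OF i]] assms(3)) auto
    assume ij: "j < 4" "i \<noteq> j"
    show "B i \<inter> B j = {}" using B(3)[OF i ij] by blast
    show "\<exists>u\<in>B i. \<exists>v\<in>B j. E' u v"
      using B(3)[OF i ij] B(1)[OF i] B(1)[OF ij(1)] assms(3) by blast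
  qed
qed

lemma k4_minorI:
  assumes "symp E"
    and "A \<subseteq> V" "B \<subseteq> V" "C \<subseteq> V" "D \<subseteq> V"
    and "connected E A" "connected E B" "connected E C" "connected E D"
    and "A \<inter> B = {}" "A \<inter> C = {}" "A \<inter> D = {}" "B \<inter> C = {}" "B \<inter> D = {}" "C \<inter> D = {}"
    and "\<exists>u\<in>A. \<exists>v\<in>B. E u v" "\<exists>u\<in>A. \<exists>v\<in>C. E u v" "\<exists>u\<in>A. \<exists>v\<in>D. E u v"
      "\<exists>u\<in>B. \<exists>v\<in>C. E u v" "\<exists>u\<in>B. \<exists>v\<in>D. E u v" "\<exists>u\<in>C. \<exists>v\<in>D. E u v"
  shows "k4_minor E V"
proof -
  have sw: "\<exists>v\<in>Y. \<exists>u\<in>X. E v u" if "\<exists>u\<in>X. \<exists>v\<in>Y. E u v" for X Y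
    using that assms(1) by (meson sympD)
  have 4: "i = 0 \<or> i = 1 \<or> i = 2 \<or> i = 3" if "i < 4" for i :: nat
    using that by auto
  have sets: "[A, B, C, D] ! i \<subseteq> V \<and> connected E ([A, B, C, D] ! i)" if "i < 4" for i
    using 4[OF that] assms(2-9) by (elim disjE) simp_all
  have disj: "[A, B, C, D] ! i \<inter> [A, B, C, D] ! j = {}" if "i < 4" "j < 4" "i \<noteq> j" for i j
    using 4[OF that(1)] 4[OF that(2)] that(3) assms(10-15) by (elim disjE) (simp_all add: Int_commute)
  have adj: "\<exists>u\<in>[A, B, C, D] ! i. \<exists>v\<in>[A, B, C, D] ! j. E u v" if "i < 4" "j < 4" "i \<noteq> j" for i j
    using 4[OF that(1)] 4[OF that(2)] that(3) assms(16-21) assms(16-21)[THEN sw] by (elim disjE) simp_all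
  show ?thesis
    by (rule k4_minor_branchI[of "\<lambda>i. [A, B, C, D] ! i"]) (use sets disj adj in simp_all)
qed

lemma k4_minor_image:
  assumes "k4_minor E V" "inj_on f V" "\<And>a b. a \<in> V \<Longrightarrow> b \<in> V \<Longrightarrow> E a b \<Longrightarrow> E' (f a) (f b)"
  shows "k4_minor E' (f ` V)"
proof -
  obtain B :: "nat \<Rightarrow> 'a set" where B: "\<And>i. i < 4 \<Longrightarrow> B i \<subseteq> V" "\<And>i. i < 4 \<Longrightarrow> connected E (B i)"
    "\<And>i j. i < 4 \<Longrightarrow> j < 4 \<Longrightarrow> i \<noteq> j \<Longrightarrow> B i \<inter> B j = {} \<and> (\<exists>u\<in>B i. \<exists>v\<in>B j. E u v)"
    using assms(1) by (rule k4_minorE) (rule that)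
  have "connected E' (f ` B i)" if "i < 4" for i
  proof -
    have "conn E' (f ` B i) (f u) (f v)" if "conn E (B i) u v" "u \<in> B i" for u v
      using that(1)
    proof (induction rule: conn_induct)
      case (step y z)
      then show ?case using B(1)[OF \<open>i < 4\<close>] assms(3) by (blast intro: conn_step)
    qed simp
    then show ?thesis
      using B(2)[OF that] by (auto simp: connected_def)
  qed
  moreover have "f ` B i \<inter> f ` B j = {}" if "i < 4" "j < 4" "i \<noteq> j" for i j
    using B(1)[OF that(1)] B(1)[OF that(2)] B(3)[OF that] assms(2) by (simp add: inj_on_image_Int[symmetric])
  moreover have "\<exists>u\<in>f ` B i. \<exists>v\<in>f ` B j. E' u v" if ij: "i < 4" "j < 4" "i \<noteq> j" for i j
  proof -
    obtain u v where "u \<in> B i" "v \<in> B j" "E u v" using B(3)[OF ij] by auto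
    then show ?thesis using assms(3) B(1)[OF ij(1)] B(1)[OF ij(2)] by blast
  qed
  moreover have "f ` B i \<subseteq> f ` V" if "i < 4" for i
    using B(1)[OF that] by blast
  ultimately show ?thesis
    by (intro k4_minor_branchI[of "\<lambda>i. f ` B i"])
qed

section \<open>Eliminating a vertex of degree at most two\<close>

text \<open>Deleting \<open>v\<close> from its branch set keeps the set connected, because its at
  most two neighbours become adjacent. Conversely, \<open>v\<close> is added to a branch set that
  contains one of its neighbours; as there is at most one other neighbour, every new edge in use is
  incident with that set and can be replaced by a connection through \<open>v\<close>.\<close>

lemma k4_minor_eliminate:
  fixes E :: "'a \<Rightarrow> 'a \<Rightarrow> bool"
  assumes sym: "symp E" and fin: "finite V" and v: "v \<in> V" "\<not> E v v" and deg: "card {u \<in> V. E v u} \<le> 2"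
  defines "E' \<equiv> \<lambda>x y. E x y \<or> x \<noteq> y \<and> E v x \<and> E v y"
  shows "k4_minor E V \<longleftrightarrow> k4_minor E' (V - {v})"
proof -
  let ?N = "{u \<in> V. E v u}"
  have no3: "\<not> (x \<in> ?N \<and> y \<in> ?N \<and> z \<in> ?N \<and> x \<noteq> y \<and> x \<noteq> z \<and> y \<noteq> z)" for x y z
  proof
    assume *: "x \<in> ?N \<and> y \<in> ?N \<and> z \<in> ?N \<and> x \<noteq> y \<and> x \<noteq> z \<and> y \<noteq> z"
    then have "card {x, y, z} \<le> card ?N"
      using fin by (intro card_mono) auto
    moreover have "card {x, y, z} = 3" using * by auto
    ultimately show False using deg by simp
  qed
  have sym': "symp E'"
    using sym by (auto simp: E'_def symp_def)
  have E_E': "E x y \<Longrightarrow> E' x y" for x y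
    by (simp add: E'_def)
  show ?thesis
  proof
    assume "k4_minor E V"
    then obtain B :: "nat \<Rightarrow> 'a set" where B: "\<And>i. i < 4 \<Longrightarrow> B i \<subseteq> V" "\<And>i. i < 4 \<Longrightarrow> connected E (B i)"
      "\<And>i j. i < 4 \<Longrightarrow> j < 4 \<Longrightarrow> i \<noteq> j \<Longrightarrow> B i \<inter> B j = {} \<and> (\<exists>u\<in>B i. \<exists>v\<in>B j. E u v)"
      by (rule k4_minorE) (rule that)
    \<comment> \<open>A branch set \<open>{v}\<close> would need neighbours in three other, disjoint
      branch sets.\<close>
    have nonsing: "B i \<noteq> {v}" if "i < 4" for i
    proof
      assume Bi: "B i = {v}"
      have nb: "\<exists>x. x \<in> ?N \<and> x \<in> B j" if "j < 4" "j \<noteq> i" for j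
        using B(3)[of i j] B(1)[of j] that \<open>i < 4\<close> Bi by auto
      \<comment> \<open>Replacing \<open>i\<close> by 3 in the list 0, 1, 2 gives the three indices
        other than \<open>i\<close>.\<close>
      obtain j k l where jkl: "j < 4" "k < 4" "l < 4" "j \<noteq> i" "k \<noteq> i" "l \<noteq> i" "j \<noteq> k" "j \<noteq> l" "k \<noteq> l"
      proof -
        have "i = 0 \<or> i = 1 \<or> i = 2 \<or> i = 3" using \<open>i < 4\<close> by auto
        then show ?thesis
          by (elim disjE; intro that[of "if i = 0 then 3 else 0" "if i = 1 then 3 else 1" "if i = 2 then 3 else 2"]; simp)
      qed
      obtain x y z where "x \<in> ?N" "x \<in> B j" "y \<in> ?N" "y \<in> B k" "z \<in> ?N" "z \<in> B l"
        using nb[of j] nb[of k] nb[of l] jkl by blast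
      moreover have "B j \<inter> B k = {}" "B j \<inter> B l = {}" "B k \<inter> B l = {}"
        using B(3) jkl by auto
      ultimately show False using no3 by blast
    qed
    have nbr: "\<exists>p\<in>B i - {v}. E v p" if i: "i < 4" "v \<in> B i" for i
    proof -
      obtain q where "q \<in> B i" "q \<noteq> v" using nonsing[OF i(1)] i(2) by blast
      then have "conn E (B i) v q" using B(2)[OF i(1)] i(2) by (auto simp: connected_def)
      then have "q = v \<or> (\<exists>p\<in>B i - {v}. E v p)"
      proof (induction rule: conn_induct)
        case (step y z)
        then show ?case using v(2) by (cases "y = v") auto
      qed simp
      then show ?thesis using \<open>q \<noteq> v\<close> by simp
    qed
    have con: "connected E' (B i - {v})" if "i < 4" for i
    proof -
      have "conn E' (B i - {v}) u x" if "u \<in> B i - {v}" "x \<in> B i - {v}" for u x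
      proof -
        have "conn E (B i) u x"
          using B(2)[OF \<open>i < 4\<close>] that by (auto simp: connected_def)
        \<comment> \<open>A walk that stands at \<open>v\<close> is represented by some neighbour
          \<open>p\<close> of \<open>v\<close> that is already reached; the next vertex equals
          \<open>p\<close> or is joined to it by a new edge.\<close>
        then have "(x \<noteq> v \<longrightarrow> conn E' (B i - {v}) u x) \<and>
            (x = v \<longrightarrow> (\<exists>p\<in>B i - {v}. conn E' (B i - {v}) u p \<and> E v p))"
        proof (induction rule: conn_induct)
          case refl
          then show ?case using that by auto
        next
          case (step y z)
          show ?case
          proof (cases "y = v")
            case True
            then obtain p where p: "p \<in> B i - {v}" "conn E' (B i - {v}) u p" "E v p"
              using step by auto
            have "z \<noteq> v" using step True v(2) by auto
            moreover have "conn E' (B i - {v}) u z"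
            proof (cases "p = z")
              case False
              then have "E' p z" using p step True by (auto simp: E'_def)
              then show ?thesis using p step \<open>z \<noteq> v\<close> by (auto intro: conn_step)
            qed (use p in simp)
            ultimately show ?thesis by simp
          next
            case False
            then show ?thesis
              using step sym by (auto intro!: conn_step[where v = y] E_E' dest: sympD)
          qed
        qed
        then show ?thesis using that by auto
      qed
      moreover have "B i - {v} \<noteq> {}"
        using nonsing[OF that] B(2)[OF that] by (auto simp: connected_def)
      ultimately show ?thesis by (auto simp: connected_def)
    qed
    have adj: "\<exists>x\<in>B i - {v}. \<exists>y\<in>B j - {v}. E' x y" if ij: "i < 4" "j < 4" "i \<noteq> j" for i j
    proof -
      obtain x y where xy: "x \<in> B i" "y \<in> B j" "E x y" using B(3)[OF ij] by auto
      have disj: "B i \<inter> B j = {}" using B(3)[OF ij] by auto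
      consider "x = v" | "y = v" | "x \<noteq> v" "y \<noteq> v" by auto
      then show ?thesis
      proof cases
        case 1
        obtain p where "p \<in> B i - {v}" "E v p" using nbr[OF ij(1)] xy 1 by auto
        moreover have "p \<noteq> y" "y \<noteq> v" using calculation disj xy 1 by auto
        ultimately show ?thesis using xy 1 by (intro bexI[of _ p] bexI[of _ y]) (auto simp: E'_def)
      next
        case 2
        obtain p where "p \<in> B j - {v}" "E v p" using nbr[OF ij(2)] xy 2 by auto
        moreover have "p \<noteq> x" "x \<noteq> v" using calculation disj xy 2 by auto
        moreover have "E v x" using sym xy 2 by (auto dest: sympD)
        ultimately show ?thesis using xy 2 by (intro bexI[of _ x] bexI[of _ p]) (auto simp: E'_def)
      next
        case 3
        then show ?thesis using xy E_E' by auto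
      qed
    qed
    have "(B i - {v}) \<inter> (B j - {v}) = {}" if "i < 4" "j < 4" "i \<noteq> j" for i j
      using B(3)[OF that] by auto
    moreover have "B i - {v} \<subseteq> V - {v}" if "i < 4" for i
      using B(1)[OF that] by auto
    ultimately show "k4_minor E' (V - {v})"
      using con adj by (intro k4_minor_branchI[of "\<lambda>i. B i - {v}"])
  next
    assume "k4_minor E' (V - {v})"
    then obtain B :: "nat \<Rightarrow> 'a set" where B: "\<And>i. i < 4 \<Longrightarrow> B i \<subseteq> V - {v}" "\<And>i. i < 4 \<Longrightarrow> connected E' (B i)"
      "\<And>i j. i < 4 \<Longrightarrow> j < 4 \<Longrightarrow> i \<noteq> j \<Longrightarrow> B i \<inter> B j = {} \<and> (\<exists>u\<in>B i. \<exists>v\<in>B j. E' u v)"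
      by (rule k4_minorE) (rule that)
    show "k4_minor E V"
    proof (cases "\<exists>i<4. B i \<inter> ?N \<noteq> {}")
      case False
      have "connected E (B i)" if "i < 4" for i
        using B(1,2)[OF that] by (rule_tac connected_mono[of E']) (use False that in \<open>auto simp: E'_def\<close>)
      moreover have "\<exists>u\<in>B i. \<exists>w\<in>B j. E u w" if ij: "i < 4" "j < 4" "i \<noteq> j" for i j
      proof -
        obtain x y where "x \<in> B i" "y \<in> B j" "E' x y" using B(3)[OF ij] by auto
        moreover have "\<not> E v x" using False ij B(1)[OF ij(1)] \<open>x \<in> B i\<close> by auto
        ultimately show ?thesis by (auto simp: E'_def)
      qed
      ultimately show ?thesis
        using B by (intro k4_minor_branchI[of B]) blast+
    next
      case True
      then obtain i a where i: "i < 4" "a \<in> B i" "a \<in> ?N" by auto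
      let ?B = "B(i := insert v (B i))"
      \<comment> \<open>A new edge among the other branch sets would give \<open>v\<close> three
        distinct neighbours, one of them being \<open>a\<close>.\<close>
      have eq: "E x y" if "E' x y" "x \<in> B j" "y \<in> B k" "j < 4" "k < 4" "j \<noteq> i" "k \<noteq> i" for x y j k
      proof (rule ccontr)
        assume "\<not> E x y"
        then have "x \<noteq> y" "E v x" "E v y" using that(1) by (auto simp: E'_def)
        moreover have "a \<noteq> x" "a \<noteq> y" using B(3) i that by blast+
        moreover have "x \<in> V" "y \<in> V" using B(1) that by auto
        ultimately show False using no3[of a x y] i by auto
      qed
      have "connected E (?B j)" if "j < 4" for j
      proof (cases "j = i")
        case True
        have st: "conn E (insert v (B i)) x y" if "E' x y" "x \<in> B i" "y \<in> B i" for x y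
        proof (cases "E x y")
          case False
          then have "E v x" "E v y" using that by (auto simp: E'_def)
          then show ?thesis
            using that sym by (auto intro!: conn_trans[of _ _ x v y] conn_edge dest: sympD)
        qed (use that in \<open>auto intro: conn_edge\<close>)
        have "conn E (insert v (B i)) a x" if "x \<in> B i" for x
        proof -
          have "conn E' (B i) a x" using B(2)[OF i(1)] i that by (auto simp: connected_def)
          then show ?thesis
          proof (induction rule: conn_induct)
            case (step y z)
            then show ?case using st by (blast intro: conn_trans)
          qed simp
        qed
        moreover have "conn E (insert v (B i)) a v"
          using i sym by (auto intro!: conn_edge dest: sympD)
        ultimately have "connected E (insert v (B i))"
          using i sym by (intro connectedI[of _ a]) auto
        then show ?thesis using True by simp
      next
        case False
        then show ?thesis using B(2)[OF that] eq[of _ _ j j] that by (auto intro: connected_mono[of E'])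
      qed
      moreover have "?B j \<inter> ?B k = {} \<and> (\<exists>u\<in>?B j. \<exists>w\<in>?B k. E u w)" if jk: "j < 4" "k < 4" "j \<noteq> k" for j k
      proof -
        obtain x y where xy: "x \<in> B j" "y \<in> B k" "E' x y" using B(3)[OF jk] by auto
        have disj: "?B j \<inter> ?B k = {}" using B(1)[OF jk(1)] B(1)[OF jk(2)] B(3)[OF jk] jk(3) by auto
        have "\<exists>u\<in>?B j. \<exists>w\<in>?B k. E u w"
        proof (cases "E x y")
          case False
          then have *: "E v x" "E v y" using xy by (auto simp: E'_def)
          consider "j = i" | "k = i" | "j \<noteq> i" "k \<noteq> i" by auto
          then show ?thesis
          proof cases
            case 1
            then show ?thesis using xy * jk by auto
          next
            case 2
            then show ?thesis using xy * jk sym by (auto dest: sympD)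
          next
            case 3
            then show ?thesis using eq[OF xy(3,1,2) jk(1,2)] False by simp
          qed
        qed (use xy in auto)
        with disj show ?thesis by simp
      qed
      moreover have "?B j \<subseteq> V" if "j < 4" for j
        using B(1)[OF that] v by auto
      ultimately show ?thesis
        by (intro k4_minor_branchI[of ?B]) blast+
    qed
  qed
qed

section \<open>Minimum degree three\<close>

lemma connected_path:
  assumes "symp E" "successively E xs" "xs \<noteq> []"
  shows "connected E (set xs)"
proof -
  have "conn E (set xs) (hd xs) v" if "v \<in> set xs" for v
    using assms(2,3) that
  proof (induction xs arbitrary: v rule: rev_induct)
    case (snoc x xs)
    show ?case
    proof (cases "xs = []")
      case False
      have IH: "conn E (set (xs @ [x])) (hd xs) v" if "v \<in> set xs" for v
      proof (rule conn_mono)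
        show "conn E (set xs) (hd xs) v"
          using snoc.prems(1) False that by (intro snoc.IH) (auto simp: successively_append_iff)
      qed (use False in auto)
      have "E (last xs) x" using snoc.prems False by (auto simp: successively_append_iff)
      then have "conn E (set (xs @ [x])) (hd xs) x"
        using IH[of "last xs"] False by (rule_tac conn_step[of _ _ _ "last xs"]) auto
      then show ?thesis using IH snoc.prems False by auto
    qed (use snoc in simp)
  qed simp
  then show ?thesis
    using assms by (intro connectedI[of _ "hd xs"]) auto
qed

text \<open>Take a longest path \<open>x\<^sub>0 \<dots> x\<^sub>k\<close> with a chord \<open>x\<^sub>0 x\<^sub>i\<close>, \<open>i \<ge> 2\<close>, for which \<open>i\<close> is as small as
  possible. Rerouting along this chord makes \<open>x\<^sub>i\<^sub>-\<^sub>1\<close> the first vertex, so by minimality both \<open>x\<^sub>0\<close>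
  and \<open>x\<^sub>i\<^sub>-\<^sub>1\<close> have neighbours beyond \<open>x\<^sub>i\<close>. The branch sets are then
  \<open>{x\<^sub>0}\<close>, \<open>{x\<^sub>1, \<dots>, x\<^sub>i\<^sub>-\<^sub>1}\<close>, \<open>{x\<^sub>i}\<close> and \<open>{x\<^sub>i\<^sub>+\<^sub>1, \<dots>, x\<^sub>k}\<close>.\<close>

lemma k4_minor_min_degree:
  fixes E :: "'a \<Rightarrow> 'a \<Rightarrow> bool"
  assumes sym: "symp E" and irr: "\<And>v. \<not> E v v" and fin: "finite V" and "V \<noteq> {}"
    and deg: "\<And>v. v \<in> V \<Longrightarrow> 3 \<le> card {u \<in> V. E v u}"
  shows "k4_minor E V"
proof -
  define path where "path xs \<longleftrightarrow> distinct xs \<and> set xs \<subseteq> V \<and> successively E xs" for xs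
  have third: "\<exists>u\<in>V. E v u \<and> u \<noteq> a \<and> u \<noteq> b" if "v \<in> V" for v a b
  proof (rule ccontr)
    assume "\<not> ?thesis"
    then have "{u \<in> V. E v u} \<subseteq> {a, b}" by auto
    then have "card {u \<in> V. E v u} \<le> card {a, b}" by (intro card_mono) auto
    also have "\<dots> \<le> 2" by (simp add: card_insert_if)
    finally show False using deg[OF that] by simp
  qed
  have bound: "length xs \<le> card V" if "path xs" for xs
    using that fin by (metis card_mono distinct_card path_def)
  obtain v where "v \<in> V" using \<open>V \<noteq> {}\<close> by auto
  then have "path [v]" by (simp add: path_def)
  define L where "L = (GREATEST l. \<exists>xs. path xs \<and> length xs = l)"
  have Lex: "\<exists>xs. path xs \<and> length xs = L"
    unfolding L_def using \<open>path [v]\<close> bound by (rule_tac GreatestI_ex_nat[of "\<lambda>l. \<exists>xs. path xs \<and> length xs = l" "card V"]) auto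
  have Lmax: "length xs \<le> L" if "path xs" for xs
    unfolding L_def using that bound by (rule_tac Greatest_le_nat[of "\<lambda>l. \<exists>xs. path xs \<and> length xs = l" _ "card V"]) auto
  have "length [v] \<le> L" using Lmax \<open>path [v]\<close> by blast
  then have L1: "1 \<le> L" by simp
  \<comment> \<open>A longest path cannot be prolonged, so it contains every neighbour of its first
    vertex.\<close>
  have on_path: "\<exists>j<L. u = xs ! j \<and> j \<noteq> 0" if xs: "path xs" "length xs = L" and u: "u \<in> V" "E (xs ! 0) u" for xs u
  proof -
    have ne: "xs \<noteq> []" using xs L1 by auto
    have "u \<in> set xs"
    proof (rule ccontr)
      assume "u \<notin> set xs"
      then have "path (u # xs)"
        using xs u ne sym by (cases xs) (auto simp: path_def dest: sympD)
      then show False using Lmax xs(2) by fastforce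
    qed
    then show ?thesis using xs u irr by (metis in_set_conv_nth)
  qed
  define chord where "chord i xs \<longleftrightarrow> path xs \<and> length xs = L \<and> 2 \<le> i \<and> i < L \<and> E (xs ! 0) (xs ! i)" for i xs
  have in_V: "xs ! j \<in> V" if "path xs" "j < length xs" for xs j
    using that by (auto simp: path_def)
  have ex_chord: "\<exists>j xs'. chord j xs'"
  proof -
    obtain xs where xs: "path xs" "length xs = L" using Lex by auto
    obtain u where u: "u \<in> V" "E (xs ! 0) u" "u \<noteq> xs ! 1" using third[of "xs ! 0" "xs ! 1" "xs ! 1"] in_V xs L1 by auto
    obtain j where "j < L" "u = xs ! j" "j \<noteq> 0" using on_path[OF xs u(1,2)] by auto
    moreover have "j \<noteq> 1" using calculation u by auto
    ultimately have "chord j xs" using xs u unfolding chord_def by auto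
    then show ?thesis by blast
  qed
  define i where "i = (LEAST i. \<exists>xs. chord i xs)"
  have "\<exists>xs. chord i xs" unfolding i_def using ex_chord by (rule LeastI_ex)
  then obtain xs where "chord i xs" by auto
  then have xs: "path xs" "length xs = L" and i: "2 \<le> i" "i < L" "E (xs ! 0) (xs ! i)"
    by (auto simp: chord_def)
  have imin: "i \<le> j" if "chord j ys" for j ys
    unfolding i_def using that by (auto intro: Least_le)
  have dist: "xs ! a = xs ! b \<longleftrightarrow> a = b" if "a < L" "b < L" for a b
    using xs that by (simp add: path_def nth_eq_iff_index_eq)
  obtain j where j: "i < j" "j < L" "E (xs ! 0) (xs ! j)"
  proof -
    obtain u where u: "u \<in> V" "E (xs ! 0) u" "u \<noteq> xs ! 1" "u \<noteq> xs ! i"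
      using third[of "xs ! 0" "xs ! 1" "xs ! i"] in_V[OF xs(1), of 0] xs L1 by auto
    obtain j where j: "j < L" "u = xs ! j" "j \<noteq> 0" using on_path[OF xs u(1,2)] by auto
    have "j \<noteq> 1" "j \<noteq> i" using j u by auto
    then have "chord j xs" using xs u j unfolding chord_def by auto
    then have "i \<le> j" by (rule imin)
    then show thesis using that[of j] j u \<open>j \<noteq> i\<close> by simp
  qed
  define ys where "ys = rev (take i xs) @ drop i xs"
  have suc: "successively E (take i xs)" "successively E (drop i xs)" "successively E xs"
    using xs(1) successively_append_iff[of E "take i xs" "drop i xs"] by (auto simp: path_def)
  have Erev: "(\<lambda>x y. E y x) = E" using sym by (auto simp: fun_eq_iff dest: sympD)
  have "xs \<noteq> []" using i xs by auto
  then have "last (rev (take i xs)) = xs ! 0" "hd (drop i xs) = xs ! i"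
    using i xs hd_conv_nth[of xs] \<open>xs \<noteq> []\<close> by (auto simp: last_rev hd_drop_conv_nth)
  moreover have "successively E (rev (take i xs))"
    using suc(1) Erev by (simp only: successively_rev)
  ultimately have "successively E ys"
    using suc i xs by (auto simp: ys_def successively_append_iff)
  moreover have "distinct ys"
    using xs(1) by (auto simp: ys_def path_def set_take_disj_set_drop_if_distinct)
  moreover have set_ys: "set ys = set xs"
    unfolding ys_def set_append set_rev by (metis append_take_drop_id set_append)
  ultimately have ys: "path ys" "length ys = L"
    using xs i by (auto simp: path_def ys_def)
  have ys_nth: "ys ! a = xs ! (i - 1 - a)" if "a < i" for a
    using that i xs by (simp add: ys_def nth_append rev_nth)
  obtain l where l: "i < l" "l < L" "E (xs ! (i - 1)) (xs ! l)"
  proof -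
    obtain u where u: "u \<in> V" "E (xs ! (i - 1)) u" "u \<noteq> xs ! (i - 2)" "u \<noteq> xs ! i"
      using third[of "xs ! (i - 1)" "xs ! (i - 2)" "xs ! i"] in_V[OF xs(1), of "i - 1"] xs i by auto
    have y0: "ys ! 0 = xs ! (i - 1)" using ys_nth[of 0] i by simp
    have "u \<in> set ys" using on_path[OF ys u(1)] y0 u ys(2) by auto
    then have "u \<in> set xs" using set_ys by simp
    then obtain l where l: "l < L" "u = xs ! l" using xs(2) by (metis in_set_conv_nth)
    have "l \<noteq> i - 1" "l \<noteq> i - 2" "l \<noteq> i" using l u irr by auto
    \<comment> \<open>In the rerouted path this vertex has position \<open>i - 1 - l\<close>, which
      is at least 2 and below \<open>i\<close>, so the chord would beat the minimal one.\<close>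
    moreover have "\<not> l < i - 2"
    proof
      assume "l < i - 2"
      then have "ys ! (i - 1 - l) = xs ! l" using ys_nth[of "i - 1 - l"] i by simp
      then have "chord (i - 1 - l) ys"
        using y0 ys u l \<open>l < i - 2\<close> i unfolding chord_def by auto
      then show False using imin[of "i - 1 - l" ys] i by auto
    qed
    ultimately have "i < l" using i by linarith
    then show thesis using that[of l] l u by simp
  qed
  let ?B = "take (i - 1) (drop 1 xs)" and ?D = "drop (Suc i) xs"
  have nthB: "x \<in> set ?B \<longleftrightarrow> (\<exists>a. 1 \<le> a \<and> a < i \<and> x = xs ! a)" for x
  proof -
    have "x \<in> set ?B \<longleftrightarrow> (\<exists>a<i - 1. x = xs ! Suc a)"
      using i xs by (auto simp: in_set_conv_nth min_def)
    also have "\<dots> \<longleftrightarrow> (\<exists>a. 1 \<le> a \<and> a < i \<and> x = xs ! a)"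
    proof
      assume "\<exists>a<i - 1. x = xs ! Suc a"
      then obtain a where "a < i - 1" "x = xs ! Suc a" by auto
      then show "\<exists>a. 1 \<le> a \<and> a < i \<and> x = xs ! a" by (intro exI[of _ "Suc a"]) auto
    next
      assume "\<exists>a. 1 \<le> a \<and> a < i \<and> x = xs ! a"
      then obtain a where "1 \<le> a" "a < i" "x = xs ! a" by auto
      then show "\<exists>a<i - 1. x = xs ! Suc a" by (intro exI[of _ "a - 1"]) auto
    qed
    finally show ?thesis .
  qed
  have nthD: "x \<in> set ?D \<longleftrightarrow> (\<exists>a. i < a \<and> a < L \<and> x = xs ! a)" for x
  proof -
    have "x \<in> set ?D \<longleftrightarrow> (\<exists>a<L - Suc i. x = xs ! (Suc i + a))"
      using i xs by (auto simp: in_set_conv_nth)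
    also have "\<dots> \<longleftrightarrow> (\<exists>a. i < a \<and> a < L \<and> x = xs ! a)"
    proof
      assume "\<exists>a<L - Suc i. x = xs ! (Suc i + a)"
      then obtain a where "a < L - Suc i" "x = xs ! (Suc i + a)" by auto
      then show "\<exists>a. i < a \<and> a < L \<and> x = xs ! a" by (intro exI[of _ "Suc i + a"]) auto
    next
      assume "\<exists>a. i < a \<and> a < L \<and> x = xs ! a"
      then obtain a where "i < a" "a < L" "x = xs ! a" by auto
      then show "\<exists>a<L - Suc i. x = xs ! (Suc i + a)" by (intro exI[of _ "a - Suc i"]) auto
    qed
    finally show ?thesis .
  qed
  have sucB: "successively E ?B"
    using suc(3) append_take_drop_id[of 1 xs] append_take_drop_id[of "i - 1" "drop 1 xs"]
    by (metis successively_append_iff)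
  have sucD: "successively E ?D"
    using suc(3) append_take_drop_id[of "Suc i" xs] by (metis successively_append_iff)
  have edge: "E (xs ! a) (xs ! Suc a)" if "Suc a < L" for a
    using suc(3) that xs(2) by (simp add: successively_conv_nth)
  define BB DD where "BB = set ?B" and "DD = set ?D"
  note nthB = nthB[folded BB_def] and nthD = nthD[folded DD_def]
  show ?thesis
  proof (rule k4_minorI[OF sym, of "{xs ! 0}" V "BB" "{xs ! i}" "DD"])
    show "{xs ! 0} \<subseteq> V" "{xs ! i} \<subseteq> V" using in_V xs i by auto
    have "set xs \<subseteq> V" using xs(1) by (simp add: path_def)
    then show "BB \<subseteq> V" "DD \<subseteq> V"
      unfolding BB_def DD_def by (meson set_take_subset set_drop_subset subset_trans)+
    show "connected E BB" unfolding BB_def using i xs by (intro connected_path[OF sym sucB]) auto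
    show "connected E DD" unfolding DD_def using i xs j by (intro connected_path[OF sym sucD]) auto
    show "{xs ! 0} \<inter> BB = {}" "{xs ! 0} \<inter> {xs ! i} = {}" "{xs ! 0} \<inter> DD = {}"
      "BB \<inter> {xs ! i} = {}" "BB \<inter> DD = {}" "{xs ! i} \<inter> DD = {}"
      using i by (auto simp: nthB nthD dist)
    have "xs ! 1 \<in> BB" unfolding nthB using i by (intro exI[of _ 1]) auto
    moreover have "xs ! (i - 1) \<in> BB" unfolding nthB using i by (intro exI[of _ "i - 1"]) auto
    moreover have "xs ! j \<in> DD" "xs ! l \<in> DD" "xs ! Suc i \<in> DD"
      using j l by (auto simp: nthD)
    moreover have "E (xs ! 0) (xs ! 1)" "E (xs ! (i - 1)) (xs ! i)" "E (xs ! i) (xs ! Suc i)"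
      using edge[of 0] edge[of "i - 1"] edge[of i] i j by auto
    ultimately show "\<exists>u\<in>{xs ! 0}. \<exists>v\<in>BB. E u v" "\<exists>u\<in>{xs ! 0}. \<exists>v\<in>{xs ! i}. E u v"
      "\<exists>u\<in>{xs ! 0}. \<exists>v\<in>DD. E u v" "\<exists>u\<in>BB. \<exists>v\<in>{xs ! i}. E u v"
      "\<exists>u\<in>BB. \<exists>v\<in>DD. E u v" "\<exists>u\<in>{xs ! i}. \<exists>v\<in>DD. E u v"
      using i j l by blast+
  qed auto
qed

section \<open>Chordal graphs without clique separators\<close>

text \<open>Minimal length is taken over walks rather than paths: a chord and a repeated vertex both
  allow a segment to be cut out, so the walk is induced and simple by the same minimality.\<close>

lemma shortest_path:
  assumes sym: "symp E" and irr: "\<And>v. \<not> E v v" and conn: "conn E Y s t" "s \<in> Y"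
  obtains ys where "ys \<noteq> []" "hd ys = s" "last ys = t" "set ys \<subseteq> Y" "distinct ys"
    "\<And>i j. i < length ys \<Longrightarrow> j < length ys \<Longrightarrow> E (ys ! i) (ys ! j) \<longleftrightarrow> j = Suc i \<or> i = Suc j"
proof -
  define W where "W ys \<longleftrightarrow> ys \<noteq> [] \<and> hd ys = s \<and> last ys = t \<and> set ys \<subseteq> Y \<and> successively E ys" for ys
  have "\<exists>ys. W ys"
  proof -
    have "\<exists>ys. ys \<noteq> [] \<and> hd ys = s \<and> last ys = t \<and> set ys \<subseteq> Y \<and> successively E ys"
      using conn(1)
    proof (induction rule: conn_induct)
      case refl
      then show ?case using conn(2) by (intro exI[of _ "[s]"]) auto
    next
      case (step y z)
      then obtain ys where ys: "ys \<noteq> []" "hd ys = s" "last ys = y" "set ys \<subseteq> Y" "successively E ys" by auto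
      then show ?case using step(2-4) by (intro exI[of _ "ys @ [z]"]) (auto simp: successively_append_iff)
    qed
    then show ?thesis by (simp add: W_def)
  qed
  then obtain ys where ys: "W ys" and min: "\<And>zs. W zs \<Longrightarrow> length ys \<le> length zs"
    using ex_has_least_nat[of W _ length] by metis
  have suc: "successively E (take i ys)" "successively E (drop i ys)" for i
    using ys append_take_drop_id[of i ys] by (metis W_def successively_append_iff)+
  have short: "j \<le> Suc i" if "i < j" "j < length ys" "E (ys ! i) (ys ! j)" for i j
  proof -
    let ?zs = "take (Suc i) ys @ drop j ys"
    have "last (take (Suc i) ys) = ys ! i" using that by (simp add: take_Suc_conv_app_nth)
    moreover have "hd (drop j ys) = ys ! j" using that by (simp add: hd_drop_conv_nth)
    ultimately have "successively E ?zs"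
      using suc that by (auto simp: successively_append_iff)
    moreover have "hd ?zs = s" "last ?zs = t" "?zs \<noteq> []" "set ?zs \<subseteq> Y"
      using ys that set_take_subset[of "Suc i" ys] set_drop_subset[of j ys]
      by (auto simp: W_def hd_append last_append)
    ultimately have "W ?zs" by (simp add: W_def)
    then show ?thesis using min[of ?zs] that by auto
  qed
  have dist: "distinct ys"
  proof (rule ccontr)
    assume "\<not> distinct ys"
    then obtain i' j' where ij': "i' < length ys" "j' < length ys" "i' \<noteq> j'" "ys ! i' = ys ! j'"
      by (auto simp: distinct_conv_nth)
    then obtain i j where ij: "i < j" "j < length ys" "ys ! i = ys ! j"
      using linorder_neqE_nat[of i' j'] by metis
    \<comment> \<open>The segment between two occurrences is cut out. If the second one is the last
      entry, the remaining tail is empty and the walk ends at the first occurrence.\<close>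
    let ?zs = "take (Suc i) ys @ drop (Suc j) ys"
    have last: "last (take (Suc i) ys) = ys ! j" using ij by (simp add: take_Suc_conv_app_nth)
    have "E (ys ! j) (hd (drop (Suc j) ys))" if "drop (Suc j) ys \<noteq> []"
      using ys that by (simp add: W_def hd_drop_conv_nth successively_conv_nth)
    then have "successively E ?zs"
      using suc last by (auto simp: successively_append_iff)
    moreover have "hd ?zs = s" "?zs \<noteq> []" "set ?zs \<subseteq> Y"
      using ys ij set_take_subset[of "Suc i" ys] set_drop_subset[of "Suc j" ys]
      by (auto simp: W_def hd_append)
    moreover have "last ?zs = t"
    proof (cases "Suc j < length ys")
      case True
      then show ?thesis using ys by (simp add: W_def last_append)
    next
      case False
      then have "j = length ys - 1" using ij by simp
      then have "ys ! j = t" using ys last_conv_nth[of ys] by (simp add: W_def)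
      then show ?thesis using False last by simp
    qed
    ultimately have "W ?zs" by (simp add: W_def)
    then show False using min[of ?zs] ij by auto
  qed
  have step: "E (ys ! i) (ys ! Suc i)" if "Suc i < length ys" for i
    using ys that by (simp add: W_def successively_conv_nth)
  show thesis
  proof (rule that[of ys])
    fix i j assume ij: "i < length ys" "j < length ys"
    show "E (ys ! i) (ys ! j) \<longleftrightarrow> j = Suc i \<or> i = Suc j"
    proof
      assume *: "E (ys ! i) (ys ! j)"
      consider "i < j" | "j < i" | "i = j" by linarith
      then show "j = Suc i \<or> i = Suc j"
      proof cases
        case 1
        then show ?thesis using short[of i j] ij * by auto
      next
        case 2
        then show ?thesis using short[of j i] ij * sym by (auto dest: sympD)
      qed (use irr * in auto)
    next
      assume "j = Suc i \<or> i = Suc j"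
      then show "E (ys ! i) (ys ! j)" using step ij sym by (auto dest: sympD)
    qed
  qed (use ys dist in \<open>auto simp: W_def\<close>)
qed

definition induced_cycle :: "('a \<Rightarrow> 'a \<Rightarrow> bool) \<Rightarrow> 'a list \<Rightarrow> bool" where
  "induced_cycle E cs \<longleftrightarrow> distinct cs \<and> (\<forall>i<length cs. \<forall>j<length cs. i < j \<longrightarrow>
     (E (cs ! i) (cs ! j) \<longleftrightarrow> j = Suc i \<or> i = 0 \<and> Suc j = length cs))"

text \<open>Two shortest paths between \<open>s\<close> and \<open>t\<close>, one through each side,
  close up to a cycle. Each has at least two edges because \<open>s\<close> and \<open>t\<close> are
  not adjacent, which gives length at least 4, and there are no edges between the sides to form
  chords.\<close>

lemma induced_cycle_through:
  assumes sym: "symp E" and irr: "\<And>v. \<not> E v v"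
    and st: "s \<noteq> t" "\<not> E s t" "s \<notin> C \<union> D" "t \<notin> C \<union> D"
    and CD: "C \<inter> D = {}" "\<And>c d. c \<in> C \<Longrightarrow> d \<in> D \<Longrightarrow> \<not> E c d"
    and conn: "conn E (C \<union> {s, t}) s t" "conn E (D \<union> {s, t}) t s"
  obtains cs where "induced_cycle E cs" "4 \<le> length cs" "set cs \<subseteq> C \<union> D \<union> {s, t}"
proof -
  obtain ys where ys: "ys \<noteq> []" "hd ys = s" "last ys = t" "set ys \<subseteq> C \<union> {s, t}" "distinct ys"
    "\<And>i j. i < length ys \<Longrightarrow> j < length ys \<Longrightarrow> E (ys ! i) (ys ! j) \<longleftrightarrow> j = Suc i \<or> i = Suc j"
    using shortest_path[OF sym irr conn(1)] by blast
  obtain zs where zs: "zs \<noteq> []" "hd zs = t" "last zs = s" "set zs \<subseteq> D \<union> {s, t}" "distinct zs"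
    "\<And>i j. i < length zs \<Longrightarrow> j < length zs \<Longrightarrow> E (zs ! i) (zs ! j) \<longleftrightarrow> j = Suc i \<or> i = Suc j"
    using shortest_path[OF sym irr conn(2)] by blast
  define p q where "p = length ys - 1" and "q = length zs - 1"
  have len: "length ys = Suc p" "length zs = Suc q"
    using ys(1) zs(1) by (auto simp: p_def q_def)
  have ends: "ys ! 0 = s" "ys ! p = t" "zs ! 0 = t" "zs ! q = s"
    using ys zs by (simp_all add: p_def q_def hd_conv_nth last_conv_nth)
  have "p \<noteq> 0" "q \<noteq> 0" using ends st(1) by metis+
  moreover have "p \<noteq> 1" using ys(6)[of 0 1] len ends st(2) by auto
  moreover have "q \<noteq> 1" using zs(6)[of 1 0] len ends st(2) by auto
  ultimately have pq: "2 \<le> p" "2 \<le> q" by auto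
  have inC: "ys ! i \<in> C" if "0 < i" "i < p" for i
  proof -
    have "ys ! i \<in> set ys" using len that by simp
    then have "ys ! i \<in> C \<union> {s, t}" using ys(4) by blast
    moreover have "ys ! i \<noteq> s" "ys ! i \<noteq> t"
      using ys(5) len that ends by (metis less_SucI lessI nth_eq_iff_index_eq less_not_refl zero_less_Suc)+
    ultimately show ?thesis by simp
  qed
  have inD: "zs ! i \<in> D" if "0 < i" "i < q" for i
  proof -
    have "zs ! i \<in> set zs" using len that by simp
    then have "zs ! i \<in> D \<union> {s, t}" using zs(4) by blast
    moreover have "zs ! i \<noteq> s" "zs ! i \<noteq> t"
      using zs(5) len that ends by (metis less_SucI lessI nth_eq_iff_index_eq less_not_refl zero_less_Suc)+
    ultimately show ?thesis by simp
  qed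
  \<comment> \<open>Dropping the last vertices removes \<open>t\<close> from one path and
    \<open>s\<close> from the other, so each of them occurs exactly once.\<close>
  let ?cs = "butlast ys @ butlast zs"
  have lencs: "length ?cs = p + q" using len by simp
  have nth1: "?cs ! i = ys ! i" if "i < p" for i
    using that len by (simp add: nth_append nth_butlast)
  have nth2: "?cs ! i = zs ! (i - p)" if "p \<le> i" "i < p + q" for i
    using that len by (simp add: nth_append nth_butlast)
  have key: "?cs ! i \<noteq> ?cs ! j \<and> (E (?cs ! i) (?cs ! j) \<longleftrightarrow> j = Suc i \<or> i = 0 \<and> Suc j = p + q)"
    if ij: "i < j" "j < p + q" for i j
  proof -
    \<comment> \<open>The vertex at position \<open>p\<close> is also the end of the first path, and
      the one at position 0 the end of the second; cases three and four read it in the other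
      list.\<close>
    consider "j < p" | "p \<le> i" | "i < p" "j = p" | "i = 0" "p < j" | "0 < i" "i < p" "p < j"
      using ij by linarith
    then show ?thesis
    proof cases
      case 1
      then show ?thesis
        using ij nth1 ys(5) ys(6)[of i j] len pq by (auto simp: nth_eq_iff_index_eq)
    next
      case 2
      then show ?thesis
        using ij nth2 zs(5) zs(6)[of "i - p" "j - p"] len pq by (auto simp: nth_eq_iff_index_eq)
    next
      case 3
      then have "?cs ! j = ys ! p" using nth2[of p] pq ends by simp
      then show ?thesis
        using 3 nth1 ys(5) ys(6)[of i p] len pq by (auto simp: nth_eq_iff_index_eq)
    next
      case 4
      then have "?cs ! i = zs ! q" using nth1[of 0] pq ends by simp
      moreover have "?cs ! j = zs ! (j - p)" using nth2 4 ij by simp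
      ultimately show ?thesis
        using 4 ij zs(5) zs(6)[of q "j - p"] len pq by (auto simp: nth_eq_iff_index_eq)
    next
      case 5
      then have "?cs ! i \<in> C" "?cs ! j \<in> D"
        using nth1[of i] nth2[of j] inC[of i] inD[of "j - p"] ij by auto
      then show ?thesis using CD 5 by fastforce
    qed
  qed
  have "distinct ?cs"
    unfolding distinct_conv_nth lencs
  proof (intro allI impI)
    fix i j assume "i < p + q" "j < p + q" "i \<noteq> j"
    then show "?cs ! i \<noteq> ?cs ! j" using key[of i j] key[of j i] by (metis linorder_neqE_nat)
  qed
  then have "induced_cycle E ?cs"
    unfolding induced_cycle_def lencs using key by blast
  moreover have "4 \<le> length ?cs" using lencs pq by simp
  moreover have "set ?cs \<subseteq> C \<union> D \<union> {s, t}"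
    using ys(4) zs(4) by (auto dest!: in_set_butlastD)
  ultimately show thesis by (rule that)
qed

text \<open>Dirac: a minimal separator of two vertices in a graph without long induced cycles is a clique.\<close>

lemma chordal_atom_clique:
  assumes sym: "symp E" and irr: "\<And>v. \<not> E v v" and fin: "finite X"
    and chordal: "\<And>cs. induced_cycle E cs \<Longrightarrow> set cs \<subseteq> X \<Longrightarrow> length cs < 4"
    and atom: "atom E X"
  shows "clique E X"
proof (rule ccontr)
  assume "\<not> clique E X"
  then obtain a b where ab: "a \<in> X" "b \<in> X" "a \<noteq> b" "\<not> E a b" by (auto simp: clique_def)
  define sep where "sep S \<longleftrightarrow> S \<subseteq> X - {a, b} \<and> \<not> conn E (X - S) a b" for S
  have "\<not> conn E (X - (X - {a, b})) a b"
  proof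
    assume "conn E (X - (X - {a, b})) a b"
    then have "b = a" by (induction rule: conn_induct) (use irr ab in auto)
    then show False using ab by simp
  qed
  then have "sep (X - {a, b})" by (simp add: sep_def)
  then obtain S where S: "sep S" and min: "\<And>S'. sep S' \<Longrightarrow> card S \<le> card S'"
    using ex_has_least_nat[of sep _ card] by metis
  have SX: "S \<subseteq> X - {a, b}" and nc: "\<not> conn E (X - S) a b" using S by (auto simp: sep_def)
  define A where "A = {x. conn E (X - S) a x}"
  define B where "B = {x. conn E (X - S) b x}"
  have aX: "a \<in> X - S" "b \<in> X - S" using ab SX by auto
  have AX: "A \<subseteq> X - S" "B \<subseteq> X - S" using aX conn_in[of E "X - S"] by (auto simp: A_def B_def)
  have disj: "A \<inter> B = {}" using nc sym by (auto simp: A_def B_def intro: conn_trans conn_sym)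
  have noedge: "\<not> E x y" if "x \<in> A" "y \<in> X - S - A" for x y
    using that AX by (auto simp: A_def intro: conn_step)
  \<comment> \<open>Since \<open>S\<close> has least cardinality, giving back a single vertex
    reconnects \<open>a\<close> and \<open>b\<close>. So every vertex of \<open>S\<close> has a
    neighbour in both components.\<close>
  have smaller: "conn E (X - (S - {s})) a b" if "s \<in> S" for s
  proof (rule ccontr)
    assume "\<not> conn E (X - (S - {s})) a b"
    then have "sep (S - {s})" using SX by (auto simp: sep_def)
    then have "card S \<le> card (S - {s})" by (rule min)
    then show False using that fin SX by (metis card_Diff1_less finite_subset finite_Diff leD)
  qed
  have nbrA: "\<exists>c\<in>A. E s c" if "s \<in> S" for s
  proof (rule ccontr)
    assume *: "\<not> (\<exists>c\<in>A. E s c)"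
    have "b \<in> A"
      using smaller[OF that]
    proof (induction rule: conn_induct)
      case (step y z)
      then show ?case using * sym that AX by (cases "z = s") (auto simp: A_def intro: conn_step dest: sympD)
    qed (simp add: A_def)
    then show False using nc by (simp add: A_def)
  qed
  have nbrB: "\<exists>c\<in>B. E s c" if "s \<in> S" for s
  proof (rule ccontr)
    assume *: "\<not> (\<exists>c\<in>B. E s c)"
    have "a \<in> B"
      using conn_sym[OF smaller[OF that] sym]
    proof (induction rule: conn_induct)
      case (step y z)
      then show ?case using * sym that AX by (cases "z = s") (auto simp: B_def intro: conn_step dest: sympD)
    qed (simp add: B_def)
    moreover have "a \<in> A" by (simp add: A_def)
    ultimately show False using disj by blast
  qed
  have through: "conn E (C \<union> {s, t}) s t"
    if C: "connected E C" "\<exists>c\<in>C. E s c" "\<exists>c\<in>C. E t c" for C s t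
  proof -
    obtain c d where cd: "c \<in> C" "E s c" "d \<in> C" "E t d" using C(2,3) by auto
    have "conn E C c d" using C(1) cd by (auto simp: connected_def)
    then have "conn E (C \<union> {s, t}) c d" by (rule conn_mono) auto
    moreover have "conn E (C \<union> {s, t}) s c" "conn E (C \<union> {s, t}) d t"
      using cd sym by (auto intro!: conn_edge dest: sympD)
    ultimately show ?thesis by (blast intro: conn_trans)
  qed
  have cl: "clique E S"
    unfolding clique_def
  proof (intro ballI impI, rule ccontr)
    fix s t assume st: "s \<in> S" "t \<in> S" "s \<noteq> t" "\<not> E s t"
    have "connected E A" "connected E B"
      using connected_component[OF sym] aX unfolding A_def B_def by blast+
    then have "conn E (A \<union> {s, t}) s t" "conn E (B \<union> {t, s}) t s"
      using through nbrA nbrB st by auto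
    moreover have "{t, s} = {s, t}" by auto
    moreover have "s \<notin> A \<union> B" "t \<notin> A \<union> B" using AX st by auto
    moreover have "\<not> E c d" if "c \<in> A" "d \<in> B" for c d
      using noedge[OF that(1), of d] that(2) AX disj by blast
    ultimately obtain cs where cs: "induced_cycle E cs" "4 \<le> length cs" "set cs \<subseteq> A \<union> B \<union> {s, t}"
      using induced_cycle_through[OF sym irr st(3,4), of A B] disj by metis
    moreover have "set cs \<subseteq> X" using cs(3) AX SX st by auto
    ultimately show False using chordal[of cs] by simp
  qed
  \<comment> \<open>The separator is now known to be a clique, and it splits \<open>X\<close>
    properly, with \<open>a\<close> and \<open>b\<close> on different sides.\<close>
  have "separation E X (A \<union> S) (X - A)"
    unfolding separation_def
  proof (intro conjI)
    show "A \<union> S \<union> (X - A) = X" using AX SX by auto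
    have "(A \<union> S) \<inter> (X - A) = S" using AX SX by auto
    then show "clique E ((A \<union> S) \<inter> (X - A))" using cl by simp
    show "\<forall>x\<in>A \<union> S - (X - A). \<forall>y\<in>X - A - (A \<union> S). \<not> E x y"
      using noedge SX by auto
  qed
  then have "A \<union> S \<subseteq> X - A \<or> X - A \<subseteq> A \<union> S"
    using atom unfolding atom_def by blast
  moreover have "a \<in> A" "b \<in> X - A" "b \<notin> S"
    using ab nc SX by (auto simp: A_def)
  ultimately show False by auto
qed

section \<open>Members of the class have good atoms\<close>

definition adj :: "'a ugraph \<Rightarrow> 'a \<Rightarrow> 'a \<Rightarrow> bool" where
  "adj G u v \<longleftrightarrow> {u, v} \<in> edges G"

lemma symp_adj: "symp (adj G)"
  by (simp add: adj_def symp_def insert_commute)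

lemma adj_verts: "simple_graph G \<Longrightarrow> adj G u v \<Longrightarrow> u \<in> verts G \<and> v \<in> verts G \<and> u \<noteq> v"
  unfolding simple_graph_def adj_def by fastforce

lemma edge_adj:
  assumes "simple_graph G" "e \<in> edges G"
  obtains u v where "e = {u, v}" "adj G u v"
proof -
  have "card e = 2" using assms by (auto simp: simple_graph_def)
  then obtain u v where "e = {u, v}" by (auto simp: card_2_iff)
  then show thesis using that assms by (simp add: adj_def)
qed

lemma verts_induced [simp]: "verts (induced_subgraph G X) = verts G \<inter> X"
  by (simp add: induced_subgraph_def)

lemma adj_induced: "adj (induced_subgraph G X) u v \<longleftrightarrow> adj G u v \<and> u \<in> X \<and> v \<in> X"
  by (auto simp: induced_subgraph_def adj_def)

lemma simple_induced: "simple_graph G \<Longrightarrow> simple_graph (induced_subgraph G X)"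
  by (auto simp: simple_graph_def induced_subgraph_def)

lemma connected_induced:
  assumes "S \<subseteq> verts G"
  shows "connected_graph (induced_subgraph G S) \<longleftrightarrow> connected (adj G) S"
proof -
  have "{(x, y). {x, y} \<in> edges (induced_subgraph G S)} = {(x, y). x \<in> S \<and> y \<in> S \<and> adj G x y}"
    by (auto simp: induced_subgraph_def adj_def)
  moreover have "(x, y) \<in> {(x, y). x \<in> S \<and> y \<in> S \<and> adj G x y}\<^sup>* \<longleftrightarrow> conn (adj G) S x y" for x y
    unfolding conn_def using rtranclp_rtrancl_eq[of "\<lambda>x y. x \<in> S \<and> y \<in> S \<and> adj G x y" x y] by simp
  moreover have "verts G \<inter> S = S" using assms by auto
  ultimately show ?thesis
    unfolding connected_graph_def connected_def by simp
qed

lemma series_parallel_iff: "series_parallel G \<longleftrightarrow> \<not> k4_minor (adj G) (verts G)"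
proof -
  let ?K = "complete_on {..<4::nat}"
  have 1: "(\<forall>x\<in>{..<4::nat}. B x \<subseteq> verts G \<and> connected_graph (induced_subgraph G (B x))) \<longleftrightarrow>
      (\<forall>i<4. B i \<subseteq> verts G \<and> connected (adj G) (B i))" for B
    using connected_induced by (metis lessThan_iff)
  have K: "adj ?K x y \<longleftrightarrow> x < 4 \<and> y < 4 \<and> x \<noteq> y" for x y
    by (auto simp: adj_def complete_on_def card_insert_if)
  have 2: "(\<forall>x\<in>{..<4}. \<forall>y\<in>{..<4}. x \<noteq> y \<longrightarrow> P x y) \<and> (\<forall>x\<in>{..<4}. \<forall>y\<in>{..<4}. adj ?K x y \<longrightarrow> Q x y) \<longleftrightarrow>
      (\<forall>i<4. \<forall>j<4. i \<noteq> j \<longrightarrow> P i j \<and> Q i j)" for P Q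
    using K by auto
  have "verts ?K = {..<4}" by (simp add: complete_on_def)
  then show ?thesis
    unfolding series_parallel_def is_minor_def k4_minor_def adj_def[symmetric] by (simp only: 1 2)
qed

lemma series_parallel_induced:
  assumes "X \<subseteq> verts G"
  shows "series_parallel (induced_subgraph G X) \<longleftrightarrow> \<not> k4_minor (adj G) X"
proof -
  have "verts G \<inter> X = X" using assms by auto
  then show ?thesis
    unfolding series_parallel_iff verts_induced
    by (auto intro: k4_minor_mono simp: adj_induced)
qed

lemma edges_cycle_graph:
  assumes "i < j" "j < k" "4 \<le> k"
  shows "{i, j} \<in> edges (cycle_graph k) \<longleftrightarrow> j = Suc i \<or> i = 0 \<and> Suc j = k"
proof
  assume "{i, j} \<in> edges (cycle_graph k)"
  then obtain l where l: "l < k" "{i, j} = {l, Suc l mod k}" by (auto simp: cycle_graph_def)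
  then show "j = Suc i \<or> i = 0 \<and> Suc j = k"
    using assms by (cases "Suc l = k") (auto simp: doubleton_eq_iff)
next
  assume "j = Suc i \<or> i = 0 \<and> Suc j = k"
  then show "{i, j} \<in> edges (cycle_graph k)"
  proof
    assume "j = Suc i"
    then show ?thesis using assms by (auto simp: cycle_graph_def intro!: exI[of _ i])
  next
    assume "i = 0 \<and> Suc j = k"
    then show ?thesis using assms by (auto simp: cycle_graph_def intro!: exI[of _ j])
  qed
qed

lemma chordal_induced_cycle:
  assumes "simple_graph G" "chordal G" "induced_cycle (adj G) cs" "set cs \<subseteq> verts G"
  shows "length cs < 4"
proof (rule ccontr)
  let ?k = "length cs"
  assume "\<not> ?k < 4"
  then have k: "4 \<le> ?k" by simp
  define f where "f = inv_into {..<?k} ((!) cs)"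
  have dist: "distinct cs" using assms(3) by (simp add: induced_cycle_def)
  have bij: "bij_betw ((!) cs) {..<?k} (set cs)"
    using dist by (intro bij_betw_nth) auto
  have f: "f (cs ! i) = i" if "i < ?k" for i
    unfolding f_def using bij that by (intro inv_into_f_f) (auto simp: bij_betw_def)
  have V: "verts G \<inter> set cs = set cs" using assms(4) by auto
  have lt: "adj G (cs ! i) (cs ! j) \<longleftrightarrow> {i, j} \<in> edges (cycle_graph ?k)" if "i < j" "j < ?k" for i j
    using assms(3) that k by (simp add: induced_cycle_def edges_cycle_graph)
  have eq: "{i, i} \<notin> edges (cycle_graph ?k)" if "i < ?k" for i
  proof
    assume "{i, i} \<in> edges (cycle_graph ?k)"
    then obtain l where l: "l < ?k" "{i} = {l, Suc l mod ?k}" by (auto simp: cycle_graph_def)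
    then have "Suc l mod ?k = l" by (metis insertCI singletonD)
    then show False using k l(1) by (cases "Suc l = ?k") auto
  qed
  have "graph_iso (induced_subgraph G (set cs)) (cycle_graph ?k)"
    unfolding graph_iso_def verts_induced V
  proof (intro exI[of _ f] conjI ballI)
    show "bij_betw f (set cs) (verts (cycle_graph ?k))"
      unfolding f_def cycle_graph_def using bij_betw_inv_into[OF bij] by simp
    fix u v assume "u \<in> set cs" "v \<in> set cs"
    then obtain i j where ij: "i < ?k" "j < ?k" "u = cs ! i" "v = cs ! j" by (auto simp: in_set_conv_nth)
    have "{u, v} \<in> edges (induced_subgraph G (set cs)) \<longleftrightarrow> adj G u v"
      using ij by (auto simp: induced_subgraph_def adj_def)
    also have "\<dots> \<longleftrightarrow> {i, j} \<in> edges (cycle_graph ?k)"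
    proof -
      consider "i < j" | "j < i" | "i = j" by linarith
      then show ?thesis
      proof cases
        case 2
        then show ?thesis using lt[of j i] ij by (simp add: adj_def insert_commute)
      next
        case 3
        then show ?thesis using eq[OF ij(1)] ij adj_verts[OF assms(1)] by blast
      qed (use lt ij in simp)
    qed
    finally show "{u, v} \<in> edges (induced_subgraph G (set cs)) \<longleftrightarrow> {f u, f v} \<in> edges (cycle_graph ?k)"
      using f ij by simp
  qed
  then show False using assms(2,4) k by (auto simp: chordal_def)
qed

text \<open>Separations of the image pull back along \<open>g\<close>, so atoms are mapped to atoms,
  and universal vertices correspond. The lemma serves the two sides of a clique sum and the graph
  under a cone.\<close>

lemma good_atoms_embed:
  assumes good: "good_atoms E V" and g: "inj_on g W" "g ` W \<subseteq> V"
    and iff: "\<And>u v. u \<in> W \<Longrightarrow> v \<in> W \<Longrightarrow> E' u v \<longleftrightarrow> E (g u) (g v)"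
  shows "good_atoms E' W"
  unfolding good_atoms_def
proof (intro allI impI)
  fix X assume X: "X \<subseteq> W" "atom E' X"
  have inj: "inj_on g X" using g X by (auto intro: inj_on_subset)
  have "atom E (g ` X)"
    unfolding atom_def
  proof (intro allI impI)
    fix A B assume AB: "separation E (g ` X) A B"
    let ?A = "{x \<in> X. g x \<in> A}" and ?B = "{x \<in> X. g x \<in> B}"
    have "separation E' X ?A ?B"
      unfolding separation_def clique_def
    proof (intro conjI ballI impI)
      have "A \<union> B = g ` X" using AB by (auto simp: separation_def)
      then show "?A \<union> ?B = X" by blast
      fix u v assume "u \<in> ?A \<inter> ?B" "v \<in> ?A \<inter> ?B" "u \<noteq> v"
      then have "g u \<noteq> g v" "g u \<in> A \<inter> B" "g v \<in> A \<inter> B" "u \<in> W" "v \<in> W" using inj X by (auto dest: inj_onD)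
      then show "E' u v" using AB iff by (simp add: separation_def clique_def)
    next
      fix u v assume "u \<in> ?A - ?B" "v \<in> ?B - ?A"
      then have "g u \<in> A - B" "g v \<in> B - A" "u \<in> W" "v \<in> W" using X by auto
      then show "\<not> E' u v" using AB iff by (simp add: separation_def)
    qed
    then have "?A \<subseteq> ?B \<or> ?B \<subseteq> ?A" using X(2) by (simp add: atom_def)
    moreover have "A \<subseteq> g ` X" "B \<subseteq> g ` X" using AB by (auto simp: separation_def)
    ultimately show "A \<subseteq> B \<or> B \<subseteq> A" by blast
  qed
  then have nk: "\<not> k4_minor E (g ` X - universals E (g ` X))"
    using good g(2) X(1) unfolding good_atoms_def by (meson image_mono subset_trans)
  have "g u = g v \<longleftrightarrow> u = v" if "u \<in> X" "v \<in> X" for u v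
    using inj that by (auto dest: inj_onD)
  moreover have "E' u v \<longleftrightarrow> E (g u) (g v)" if "u \<in> X" "v \<in> X" for u v
    using iff that X(1) by blast
  ultimately have "g u \<in> universals E (g ` X) \<longleftrightarrow> u \<in> universals E' X" if "u \<in> X" for u
    using that unfolding universals_def by auto
  then have "g ` X - universals E (g ` X) = g ` (X - universals E' X)" by auto
  moreover have "inj_on g (X - universals E' X)" using inj by (auto intro: inj_on_subset)
  moreover have "E (g a) (g b)" if "a \<in> X - universals E' X" "b \<in> X - universals E' X" "E' a b" for a b
    using that iff X(1) by blast
  ultimately show "\<not> k4_minor E' (X - universals E' X)"
    using nk k4_minor_image[of E' "X - universals E' X" g E] by metis
qed

text \<open>Restricted to an atom, the separation is trivial, so every atom lies on one
  side.\<close>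

lemma good_atoms_separation:
  assumes "separation E V A B" "good_atoms E A" "good_atoms E B"
  shows "good_atoms E V"
  unfolding good_atoms_def
proof (intro allI impI)
  fix X assume X: "X \<subseteq> V" "atom E X"
  have "separation E X (A \<inter> X) (B \<inter> X)"
    using assms(1) X(1) by (auto simp: separation_def clique_def)
  then have "A \<inter> X \<subseteq> B \<inter> X \<or> B \<inter> X \<subseteq> A \<inter> X"
    using X(2) unfolding atom_def by blast
  moreover have "X \<subseteq> A \<union> B" using assms(1) X by (simp add: separation_def)
  ultimately have "X \<subseteq> A \<or> X \<subseteq> B" by auto
  then show "\<not> k4_minor E (X - universals E X)"
    using assms(2,3) X(2) by (auto simp: good_atoms_def)
qed

subsection \<open>Clique sums\<close>

text \<open>Serves both directions: arbitrary clique sums of members of the class, and the gluing of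
  two induced subgraphs along a clique separation.\<close>

locale amalgam =
  fixes G :: "'a ugraph" and H :: "'b ugraph" and S :: "'c set" and \<phi> \<psi>
  assumes simple: "simple_graph G" "simple_graph H"
    and hom: "injective_hom \<phi> (complete_on S) G" "injective_hom \<psi> (complete_on S) H"
begin

abbreviation "R \<equiv> identify S \<phi> \<psi>"
abbreviation "Q \<equiv> quotient_graph R (disjoint_union G H)"
abbreviation "left a \<equiv> R `` {Inl a}"
abbreviation "right b \<equiv> R `` {Inr b}"

lemma inj: "inj_on \<phi> S" "inj_on \<psi> S" "\<phi> ` S \<subseteq> verts G" "\<psi> ` S \<subseteq> verts H"
  using hom by (auto simp: injective_hom_def complete_on_def)

lemma hom_adj: "x \<in> S \<Longrightarrow> y \<in> S \<Longrightarrow> x \<noteq> y \<Longrightarrow> adj G (\<phi> x) (\<phi> y) \<and> adj H (\<psi> x) (\<psi> y)"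
proof -
  assume xy: "x \<in> S" "y \<in> S" "x \<noteq> y"
  then have "{x, y} \<in> edges (complete_on S)" by (simp add: complete_on_def)
  then have "\<phi> ` {x, y} \<in> edges G" "\<psi> ` {x, y} \<in> edges H"
    using hom unfolding injective_hom_def by blast+
  then show ?thesis by (simp add: adj_def)
qed

text \<open>Both maps are injective on \<open>S\<close>, so each vertex takes part in at most one
  identification, and composing identifications yields nothing beyond the identity.\<close>

lemma identify_eq:
  "R = Id \<union> {(Inl (\<phi> x), Inr (\<psi> x)) | x. x \<in> S} \<union> {(Inr (\<psi> x), Inl (\<phi> x)) | x. x \<in> S}"
  (is "_ = ?R")
proof -
  let ?r = "{(Inl (\<phi> x), Inr (\<psi> x)) | x. x \<in> S}"
  have conv: "?r\<inverse> = {(Inr (\<psi> x), Inl (\<phi> x)) | x. x \<in> S}" by auto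
  have "(p, q) \<in> ?R" if "(p, q) \<in> (?r \<union> ?r\<inverse>)\<^sup>*" for p q
    using that
  proof (induction rule: rtrancl_induct)
    case (step y z)
    then show ?case using inj(1,2) by (auto dest: inj_onD)
  qed simp
  then have "R \<subseteq> ?R" unfolding identify_def Let_def by (auto simp del: Un_iff)
  moreover have "?R \<subseteq> R" unfolding identify_def Let_def conv by auto
  ultimately show ?thesis by (rule equalityI)
qed

lemma mem_left: "(Inl a, p) \<in> R \<longleftrightarrow> p = Inl a \<or> (\<exists>x\<in>S. \<phi> x = a \<and> p = Inr (\<psi> x))"
  unfolding identify_eq by auto

lemma mem_right: "(Inr b, p) \<in> R \<longleftrightarrow> p = Inr b \<or> (\<exists>x\<in>S. \<psi> x = b \<and> p = Inl (\<phi> x))"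
  unfolding identify_eq by auto

lemma left_inj: "left a = left a' \<longleftrightarrow> a = a'"
proof
  assume "left a = left a'"
  then have "Inl a \<in> left a'" using mem_left[of a "Inl a"] by blast
  then show "a = a'" by (simp add: mem_left)
qed simp

lemma right_inj: "right b = right b' \<longleftrightarrow> b = b'"
proof
  assume "right b = right b'"
  then have "Inr b \<in> right b'" using mem_right[of b "Inr b"] by blast
  then show "b = b'" by (simp add: mem_right)
qed simp

lemma left_right: "left a = right b \<longleftrightarrow> (\<exists>x\<in>S. \<phi> x = a \<and> \<psi> x = b)"
proof
  assume "left a = right b"
  then have "Inl a \<in> right b" using mem_left[of a "Inl a"] by blast
  then show "\<exists>x\<in>S. \<phi> x = a \<and> \<psi> x = b" by (auto simp: mem_right)
next
  assume "\<exists>x\<in>S. \<phi> x = a \<and> \<psi> x = b"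
  then obtain x where x: "x \<in> S" "\<phi> x = a" "\<psi> x = b" by auto
  show "left a = right b"
  proof (rule set_eqI)
    fix p
    show "p \<in> left a \<longleftrightarrow> p \<in> right b"
      unfolding Image_singleton_iff mem_left mem_right using x inj(1,2) by (auto dest: inj_onD)
  qed
qed

lemma verts_Q: "verts Q = left ` verts G \<union> right ` verts H"
  unfolding quotient_graph_def disjoint_union_def quotient_def by auto

lemma edges_Q:
  "{p, q} \<in> edges Q \<longleftrightarrow> (\<exists>a a'. adj G a a' \<and> p = left a \<and> q = left a') \<or>
     (\<exists>b b'. adj H b b' \<and> p = right b \<and> q = right b')" (is "?L \<longleftrightarrow> ?R")
proof
  assume ?L
  then have "(\<exists>e\<in>edges G. {p, q} = (Inl ` e) // R) \<or> (\<exists>e\<in>edges H. {p, q} = (Inr ` e) // R)"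
    by (auto simp: quotient_graph_def disjoint_union_def)
  then consider e where "e \<in> edges G" "{p, q} = (Inl ` e) // R" | e where "e \<in> edges H" "{p, q} = (Inr ` e) // R"
    by blast
  then show ?R
  proof cases
    case 1
    obtain u v where "e = {u, v}" "adj G u v" using edge_adj[OF simple(1) 1(1)] .
    moreover have "adj G v u" using symp_adj calculation by (metis sympD)
    moreover have "(Inl ` {u, v}) // R = {left u, left v}" by (auto simp: quotient_def)
    then have "{p, q} = {left u, left v}" using 1 calculation by simp
    ultimately show ?thesis unfolding doubleton_eq_iff by blast
  next
    case 2
    obtain u v where "e = {u, v}" "adj H u v" using edge_adj[OF simple(2) 2(1)] .
    moreover have "adj H v u" using symp_adj calculation by (metis sympD)
    moreover have "(Inr ` {u, v}) // R = {right u, right v}" by (auto simp: quotient_def)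
    then have "{p, q} = {right u, right v}" using 2 calculation by simp
    ultimately show ?thesis unfolding doubleton_eq_iff by blast
  qed
next
  assume ?R
  then show ?L
  proof (elim disjE exE conjE)
    fix a a' assume *: "adj G a a'" "p = left a" "q = left a'"
    then have "{p, q} = (Inl ` {a, a'}) // R" by (auto simp: quotient_def)
    moreover have "Inl ` {a, a'} \<in> edges (disjoint_union G H)"
      using *(1) unfolding disjoint_union_def adj_def by (auto simp del: image_insert image_empty)
    ultimately show ?L unfolding quotient_graph_def by simp
  next
    fix a a' assume *: "adj H a a'" "p = right a" "q = right a'"
    then have "{p, q} = (Inr ` {a, a'}) // R" by (auto simp: quotient_def)
    moreover have "Inr ` {a, a'} \<in> edges (disjoint_union G H)"
      using *(1) unfolding disjoint_union_def adj_def by (auto simp del: image_insert image_empty)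
    ultimately show ?L unfolding quotient_graph_def by simp
  qed
qed

text \<open>Glued vertices that are adjacent through \<open>H\<close> are adjacent in
  \<open>G\<close> as well, because the identified set is a clique on both sides. So gluing creates
  no new edge within \<open>G\<close>.\<close>

lemma edges_left: "{left a, left a'} \<in> edges Q \<longleftrightarrow> adj G a a'"
proof -
  have "adj G a a'" if b: "adj H b b'" "left a = right b" "left a' = right b'" for b b'
  proof -
    obtain x y where "x \<in> S" "\<phi> x = a" "\<psi> x = b" "y \<in> S" "\<phi> y = a'" "\<psi> y = b'"
      using b(2,3) unfolding left_right by blast
    then show ?thesis using hom_adj[of x y] adj_verts[OF simple(2) b(1)] by blast
  qed
  then show ?thesis unfolding edges_Q left_inj by blast
qed

lemma edges_right: "{right b, right b'} \<in> edges Q \<longleftrightarrow> adj H b b'"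
proof -
  have "adj H b b'" if a: "adj G a a'" "right b = left a" "right b' = left a'" for a a'
  proof -
    obtain x y where "x \<in> S" "\<phi> x = a" "\<psi> x = b" "y \<in> S" "\<phi> y = a'" "\<psi> y = b'"
      using a(2,3)[symmetric] unfolding left_right by blast
    then show ?thesis using hom_adj[of x y] adj_verts[OF simple(1) a(1)] by blast
  qed
  then show ?thesis unfolding edges_Q right_inj by blast
qed

lemma edges_cross:
  assumes "{p, q} \<in> edges Q" "p \<notin> right ` verts H" "q \<notin> left ` verts G"
  shows False
  using assms adj_verts[OF simple(1)] adj_verts[OF simple(2)] unfolding edges_Q by blast

text \<open>Pulled back to \<open>F\<close>, the two sides form a separation whose overlap is the
  glued clique, and each side embeds into its summand.\<close>

lemma good_atoms_sum:
  assumes "good_atoms (adj G) (verts G)" "good_atoms (adj H) (verts H)" "graph_iso F Q"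
  shows "good_atoms (adj F) (verts F)"
proof -
  obtain f where f: "bij_betw f (verts F) (verts Q)"
    and iff: "\<And>u v. u \<in> verts F \<Longrightarrow> v \<in> verts F \<Longrightarrow> adj F u v \<longleftrightarrow> {f u, f v} \<in> edges Q"
    using assms(3) by (auto simp: graph_iso_def adj_def)
  have f_inj: "f u = f v \<longleftrightarrow> u = v" if "u \<in> verts F" "v \<in> verts F" for u v
    using f that by (auto simp: bij_betw_def dest: inj_onD)
  have f_im: "f u \<in> left ` verts G \<union> right ` verts H" if "u \<in> verts F" for u
  proof -
    have "f u \<in> verts Q" using f that by (auto simp: bij_betw_def)
    then show ?thesis unfolding verts_Q .
  qed
  define A where "A = {u \<in> verts F. f u \<in> left ` verts G}"
  define B where "B = {u \<in> verts F. f u \<in> right ` verts H}"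
  define g where "g u = (SOME a. a \<in> verts G \<and> f u = left a)" for u
  define h where "h u = (SOME b. b \<in> verts H \<and> f u = right b)" for u
  have g: "g u \<in> verts G \<and> f u = left (g u)" if "u \<in> A" for u
    unfolding g_def by (rule someI_ex) (use that in \<open>auto simp: A_def\<close>)
  have h: "h u \<in> verts H \<and> f u = right (h u)" if "u \<in> B" for u
    unfolding h_def by (rule someI_ex) (use that in \<open>auto simp: B_def\<close>)
  have AF: "A \<subseteq> verts F" "B \<subseteq> verts F" by (auto simp: A_def B_def)
  have "good_atoms (adj F) A"
  proof (rule good_atoms_embed[OF assms(1), of g])
    show "inj_on g A"
    proof (rule inj_onI)
      fix u v assume "u \<in> A" "v \<in> A" "g u = g v"
      then show "u = v" using g f_inj AF by (metis subsetD)
    qed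
    show "g ` A \<subseteq> verts G" using g by auto
    show "adj F u v \<longleftrightarrow> adj G (g u) (g v)" if "u \<in> A" "v \<in> A" for u v
    proof -
      have "f u = left (g u)" "f v = left (g v)" "u \<in> verts F" "v \<in> verts F" using g that AF by auto
      then show ?thesis using iff[of u v] edges_left by simp
    qed
  qed
  moreover have "good_atoms (adj F) B"
  proof (rule good_atoms_embed[OF assms(2), of h])
    show "inj_on h B"
    proof (rule inj_onI)
      fix u v assume "u \<in> B" "v \<in> B" "h u = h v"
      then show "u = v" using h f_inj AF by (metis subsetD)
    qed
    show "h ` B \<subseteq> verts H" using h by auto
    show "adj F u v \<longleftrightarrow> adj H (h u) (h v)" if "u \<in> B" "v \<in> B" for u v
    proof -
      have "f u = right (h u)" "f v = right (h v)" "u \<in> verts F" "v \<in> verts F" using h that AF by auto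
      then show ?thesis using iff[of u v] edges_right by simp
    qed
  qed
  moreover have "separation (adj F) (verts F) A B"
    unfolding separation_def clique_def
  proof (intro conjI ballI impI)
    show "A \<union> B = verts F" using f_im by (auto simp: A_def B_def)
    fix u v assume uv: "u \<in> A \<inter> B" "v \<in> A \<inter> B" "u \<noteq> v"
    then have "f u = left (g u)" "f u = right (h u)" "f v = left (g v)" "f v = right (h v)"
      using g h by auto
    moreover have "f u \<noteq> f v" using f_inj uv AF by blast
    ultimately have "g u \<noteq> g v" "left (g u) = right (h u)" "left (g v) = right (h v)" by auto
    then obtain x y where "x \<in> S" "y \<in> S" "g u = \<phi> x" "g v = \<phi> y" "x \<noteq> y"
      using left_right by metis
    then have "{f u, f v} \<in> edges Q"
      using hom_adj edges_left \<open>f u = left (g u)\<close> \<open>f v = left (g v)\<close> by metis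
    then show "adj F u v" using iff uv AF by blast
  next
    fix u v assume uv: "u \<in> A - B" "v \<in> B - A"
    then have "{f u, f v} \<notin> edges Q"
      using edges_cross[of "f u" "f v"] by (auto simp: A_def B_def)
    then show "\<not> adj F u v" using iff uv AF by blast
  qed
  ultimately show ?thesis by (rule good_atoms_separation[rotated])
qed

end

text \<open>The converse of gluing, with the identity on \<open>A \<inter> B\<close> for both maps.
  Vertices are naturals because \<open>clique_sum\<close> takes its clique from
  \<open>nat\<close>.\<close>

lemma clique_sum_separation:
  fixes G :: "nat ugraph"
  assumes G: "simple_graph G" and L: "L \<subseteq> verts G" and sep: "separation (adj G) L A B"
  shows "clique_sum (induced_subgraph G A) (induced_subgraph G B) (induced_subgraph G L)"
proof -
  let ?S = "A \<inter> B" and ?GA = "induced_subgraph G A" and ?GB = "induced_subgraph G B"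
  have AB: "A \<union> B = L" "clique (adj G) ?S" "\<And>a b. a \<in> A - B \<Longrightarrow> b \<in> B - A \<Longrightarrow> \<not> adj G a b"
    using sep by (auto simp: separation_def)
  have V: "verts G \<inter> A = A" "verts G \<inter> B = B" "verts G \<inter> L = L" using L AB by auto
  have "e \<in> edges G" if e: "e \<subseteq> ?S" "card e = 2" for e
  proof -
    obtain u v where "e = {u, v}" "u \<noteq> v" using e(2) by (auto simp: card_2_iff)
    then show ?thesis using AB(2) e(1) by (auto simp: clique_def adj_def)
  qed
  then have hom: "injective_hom id (complete_on ?S) ?GA" "injective_hom id (complete_on ?S) ?GB"
    using V by (auto simp: injective_hom_def complete_on_def induced_subgraph_def)
  interpret amalgam ?GA ?GB ?S id id
    using simple_induced[OF G] hom by unfold_locales auto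
  have eq: "left v = right v" if "v \<in> ?S" for v
    using that left_right by auto
  have neq: "left u = right v \<Longrightarrow> u = v \<and> u \<in> ?S" for u v
    using left_right by auto
  define f where "f v = (if v \<in> A then left v else right v)" for v
  have fB: "f v = right v" if "v \<in> B" for v
    using that eq by (simp add: f_def)
  have fA: "f v = left v" if "v \<in> A" for v
    using that by (simp add: f_def)
  have "graph_iso (induced_subgraph G L) Q"
    unfolding graph_iso_def verts_induced V
  proof (intro exI[of _ f] conjI ballI)
    have "inj_on f L"
    proof (rule inj_onI)
      fix u v assume "u \<in> L" "v \<in> L" "f u = f v"
      then show "u = v" using neq left_inj right_inj unfolding f_def by (metis (full_types))
    qed
    moreover have "f ` L = left ` A \<union> right ` B"
      unfolding AB(1)[symmetric] using fA fB by (auto simp: image_Un)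
    ultimately show "bij_betw f L (verts Q)"
      unfolding verts_Q verts_induced V by (simp add: bij_betw_def)
    fix u v assume uv: "u \<in> L" "v \<in> L"
    have lhs: "{u, v} \<in> edges (induced_subgraph G L) \<longleftrightarrow> adj G u v"
      using uv by (auto simp: induced_subgraph_def adj_def)
    have cross: "{left a, right b} \<notin> edges Q" if "a \<in> A - B" "b \<in> B - A" for a b
    proof
      assume "{left a, right b} \<in> edges Q"
      then show False
        by (rule edges_cross) (use that neq in \<open>auto simp del: Int_iff dest!: sym[of "right _" "left _"]\<close>)
    qed
    have cross': "{right b, left a} \<notin> edges Q" if "a \<in> A - B" "b \<in> B - A" for a b
      using cross[OF that] by (simp add: insert_commute)
    consider "u \<in> A" "v \<in> A" | "u \<in> B" "v \<in> B" | "u \<in> A - B" "v \<in> B - A" | "v \<in> A - B" "u \<in> B - A"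
      using uv AB(1) by auto
    then show "{u, v} \<in> edges (induced_subgraph G L) \<longleftrightarrow> {f u, f v} \<in> edges Q"
    proof cases
      case 1
      then show ?thesis unfolding lhs using fA edges_left adj_induced by metis
    next
      case 2
      then show ?thesis unfolding lhs using fB edges_right adj_induced by metis
    next
      case 3
      then show ?thesis unfolding lhs using fA[of u] fB[of v] cross[OF 3] AB(3) by auto
    next
      case 4
      then have "\<not> adj G u v" using AB(3) symp_adj by (metis sympD)
      then show ?thesis unfolding lhs using 4 fA[of v] fB[of u] cross'[OF 4] by auto
    qed
  qed
  moreover have "finite ?S"
    using L AB(1) G by (auto simp: simple_graph_def intro: finite_subset)
  ultimately show ?thesis
    unfolding clique_sum_def using hom by blast
qed

subsection \<open>The class\<close>

lemma not_k4_minor_empty [simp]: "\<not> k4_minor E {}"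
proof
  assume "k4_minor E {}"
  then obtain B :: "nat \<Rightarrow> 'a set" where B: "\<And>i. i < 4 \<Longrightarrow> B i \<subseteq> {}" "\<And>i. i < 4 \<Longrightarrow> connected E (B i)"
    by (rule k4_minorE) (rule that)
  show False using B(1)[of 0] B(2)[of 0] by (simp add: connected_def)
qed

lemma simple_cone: "simple_graph G \<Longrightarrow> v \<notin> verts G \<Longrightarrow> simple_graph (cone v G)"
  by (auto simp: simple_graph_def cone_def card_insert_if)

lemma in_class_simple: "in_class_G G \<Longrightarrow> simple_graph G"
  by (induction rule: in_class_G.induct) (auto intro: simple_cone)

text \<open>An atom that contains the new vertex stays an atom without it, since the vertex can be
  added to both sides of any separation. Being universal, it is deleted before the test for a minor
  anyway.\<close>

lemma good_atoms_cone:
  assumes G: "simple_graph G" and v: "v \<notin> verts G" and good: "good_atoms (adj G) (verts G)"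
  shows "good_atoms (adj (cone v G)) (verts (cone v G))"
proof -
  let ?E = "adj (cone v G)"
  have E: "?E x y \<longleftrightarrow> adj G x y" if "x \<in> verts G" "y \<in> verts G" for x y
    using that v by (auto simp: adj_def cone_def doubleton_eq_iff)
  have univ: "?E v u" "?E u v" if "u \<in> verts G" for u
    using that by (auto simp: adj_def cone_def insert_commute)
  have good': "good_atoms ?E (verts G)"
    by (rule good_atoms_embed[OF good, of id]) (auto simp: E)
  show ?thesis
    unfolding good_atoms_def
  proof (intro allI impI)
    fix X assume X: "X \<subseteq> verts (cone v G)" "atom ?E X"
    show "\<not> k4_minor ?E (X - universals ?E X)"
    proof (cases "v \<in> X")
      case False
      then have "X \<subseteq> verts G" using X(1) by (auto simp: cone_def)
      then show ?thesis using good' X(2) by (simp add: good_atoms_def)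
    next
      case True
      define Y where "Y = X - {v}"
      have Y: "Y \<subseteq> verts G" "X = insert v Y" "v \<notin> Y" using X(1) True by (auto simp: cone_def Y_def)
      have "atom ?E Y"
        unfolding atom_def
      proof (intro allI impI)
        fix A B assume AB: "separation ?E Y A B"
        have "separation ?E X (insert v A) (insert v B)"
          using AB Y univ unfolding separation_def clique_def by auto
        then have "insert v A \<subseteq> insert v B \<or> insert v B \<subseteq> insert v A"
          using X(2) unfolding atom_def by blast
        moreover have "v \<notin> A" "v \<notin> B" using AB Y by (auto simp: separation_def)
        ultimately show "A \<subseteq> B \<or> B \<subseteq> A" by auto
      qed
      moreover have "X - universals ?E X = Y - universals ?E Y"
        using Y univ by (auto simp: universals_def)
      ultimately show ?thesis using good' Y by (simp add: good_atoms_def)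
    qed
  qed
qed

text \<open>The necessity half of the characterisation. The sufficiency half is carried along by the
  peeling invariant, one separation at a time.\<close>

theorem in_class_good_atoms: "in_class_G G \<Longrightarrow> good_atoms (adj G) (verts G)"
proof (induction rule: in_class_G.induct)
  case (series_parallel G)
  then show ?case
    unfolding good_atoms_def series_parallel_iff
    by (meson Diff_subset k4_minor_mono subset_trans)
next
  case (chordal G)
  show ?case
    unfolding good_atoms_def
  proof (intro allI impI)
    fix X assume X: "X \<subseteq> verts G" "atom (adj G) X"
    have "clique (adj G) X"
    proof (rule chordal_atom_clique[OF symp_adj])
      show "\<not> adj G v v" for v using adj_verts[OF chordal(1)] by blast
      show "finite X" using X chordal(1) by (auto simp: simple_graph_def intro: finite_subset)
      show "length cs < 4" if "induced_cycle (adj G) cs" "set cs \<subseteq> X" for cs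
        using chordal_induced_cycle[OF chordal] that X by auto
    qed (rule X)
    then have "X - universals (adj G) X = {}" by (auto simp: clique_def universals_def)
    then show "\<not> k4_minor (adj G) (X - universals (adj G) X)" by (metis not_k4_minor_empty)
  qed
next
  case (clique_sum G H F)
  then obtain S :: "nat set" and \<phi> \<psi> where S: "injective_hom \<phi> (complete_on S) G"
    "injective_hom \<psi> (complete_on S) H" "graph_iso F (quotient_graph (identify S \<phi> \<psi>) (disjoint_union G H))"
    by (auto simp: clique_sum_def)
  interpret amalgam G H S \<phi> \<psi>
    using S clique_sum in_class_simple by unfold_locales auto
  show ?case using good_atoms_sum clique_sum S by simp
next
  case (cone G v)
  show ?case by (rule good_atoms_cone[OF in_class_simple[OF cone(1)] cone(2,3)])
qed

lemma in_class_separation: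
  assumes "simple_graph G" "L \<subseteq> verts G" "separation (adj G) L A B"
    and "in_class_G (induced_subgraph G A)" "in_class_G (induced_subgraph G B)"
  shows "in_class_G (induced_subgraph G L)"
  using in_class_G.clique_sum[OF assms(4,5) simple_induced[OF assms(1)] clique_sum_separation[OF assms(1-3)]] .

text \<open>A universal vertex makes a graph the cone over the rest. The vertices are put back one
  at a time, each being still universal in \<open>X - U\<close>.\<close>

lemma in_class_universals:
  assumes G: "simple_graph G" and X: "X \<subseteq> verts G"
    and "in_class_G (induced_subgraph G (X - universals (adj G) X))"
  shows "in_class_G (induced_subgraph G X)"
proof -
  have "finite U \<Longrightarrow> U \<subseteq> universals (adj G) X \<Longrightarrow> in_class_G (induced_subgraph G (X - U)) \<Longrightarrow>
      in_class_G (induced_subgraph G X)" for U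
  proof (induction rule: finite_induct)
    case (insert u U)
    let ?H = "induced_subgraph G (X - insert u U)"
    have u: "u \<in> X - U" "\<And>w. w \<in> X \<Longrightarrow> w \<noteq> u \<Longrightarrow> {u, w} \<in> edges G"
      using insert by (auto simp: universals_def adj_def)
    have "edges (cone u ?H) = {e \<in> edges G. e \<subseteq> X - U}"
    proof (intro equalityI subsetI)
      fix e assume "e \<in> edges (cone u ?H)"
      then show "e \<in> {e \<in> edges G. e \<subseteq> X - U}"
        using u by (auto simp: cone_def induced_subgraph_def)
    next
      fix e assume e: "e \<in> {e \<in> edges G. e \<subseteq> X - U}"
      show "e \<in> edges (cone u ?H)"
      proof (cases "u \<in> e")
        case True
        obtain a b where ab: "e = {a, b}" "adj G a b" using edge_adj[OF G, of e] e by auto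
        then obtain w where w: "e = {u, w}" "w \<noteq> u"
          using True adj_verts[OF G ab(2)] by auto
        then show ?thesis using e X by (auto simp: cone_def induced_subgraph_def)
      next
        case False
        then show ?thesis using e by (auto simp: cone_def induced_subgraph_def)
      qed
    qed
    moreover have "verts (cone u ?H) = verts G \<inter> (X - U)"
      using u X by (auto simp: cone_def induced_subgraph_def)
    ultimately have "cone u ?H = induced_subgraph G (X - U)"
      by (simp add: induced_subgraph_def)
    moreover have "in_class_G (cone u ?H)"
      by (rule in_class_G.cone) (use insert in auto)
    ultimately show ?case using insert by simp
  qed simp
  moreover have "finite (universals (adj G) X)"
    using G X by (auto simp: simple_graph_def universals_def intro: finite_subset)
  ultimately show ?thesis using assms(3) by blast
qed

lemma in_class_not_k4_minor:
  assumes "simple_graph G" "X \<subseteq> verts G" "\<not> k4_minor (adj G) X"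
  shows "in_class_G (induced_subgraph G X)"
  using assms series_parallel_induced simple_induced by (blast intro: in_class_G.series_parallel)

section \<open>Clique decomposition along a maximum cardinality search order\<close>

section \<open>Maximum cardinality search of a minimal triangulation\<close>

text \<open>The path condition of the search MCS-M: a path leads from \<open>z\<close> to
  \<open>u\<close>, inside \<open>U\<close> after its start, and its inner vertices have weight
  below \<open>\<theta>\<close>. A visit to \<open>z\<close> raises the weight of \<open>u\<close>
  if this holds for \<open>\<theta> = w u\<close>; so fill edges are counted without being
  stored.\<close>

inductive_set below :: "('a \<Rightarrow> 'a \<Rightarrow> bool) \<Rightarrow> 'a set \<Rightarrow> ('a \<Rightarrow> nat) \<Rightarrow> 'a \<Rightarrow> nat \<Rightarrow> 'a set"
  for E U w z \<theta> where
  below_start: "u \<in> U \<Longrightarrow> E z u \<Longrightarrow> u \<in> below E U w z \<theta>"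
| below_step: "v \<in> below E U w z \<theta> \<Longrightarrow> w v < \<theta> \<Longrightarrow> u \<in> U \<Longrightarrow> E v u \<Longrightarrow> u \<in> below E U w z \<theta>"

lemma below_mono: "u \<in> below E U w z \<theta> \<Longrightarrow> \<theta> \<le> \<theta>' \<Longrightarrow> u \<in> below E U w z \<theta>'"
  by (induction rule: below.induct) (auto intro: below.intros)

definition nbrs :: "('a \<Rightarrow> 'a \<Rightarrow> bool) \<Rightarrow> 'a set \<Rightarrow> 'a set" where
  "nbrs E C = {v. v \<notin> C \<and> (\<exists>c\<in>C. E c v)}"

text \<open>A component of \<open>V - Q\<close> that sees every vertex of the clique
  \<open>Q\<close>; connectedness and \<open>nbrs E C = Q\<close> together make \<open>C\<close> a
  whole component.\<close>

definition full_component :: "('a \<Rightarrow> 'a \<Rightarrow> bool) \<Rightarrow> 'a set \<Rightarrow> 'a set \<Rightarrow> 'a set \<Rightarrow> bool" where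
  "full_component E V C Q \<longleftrightarrow> C \<subseteq> V \<and> connected E C \<and> clique E Q \<and> nbrs E C = Q"

locale fin_graph =
  fixes E :: "'a \<Rightarrow> 'a \<Rightarrow> bool" and V :: "'a set"
  assumes sym: "symp E" and irr: "\<not> E v v" and EV: "E u v \<Longrightarrow> u \<in> V \<and> v \<in> V" and fin: "finite V"
begin

lemma E_sym: "E u v \<Longrightarrow> E v u"
  using sym by (rule sympD)

lemma nbrs_component: "nbrs E {v. conn E (V - Q) r v} \<subseteq> Q" if "r \<in> V - Q"
proof
  fix x assume "x \<in> nbrs E {v. conn E (V - Q) r v}"
  then obtain c where c: "\<not> conn E (V - Q) r x" "conn E (V - Q) r c" "E c x" by (auto simp: nbrs_def)
  have "c \<in> V - Q" using conn_in[OF c(2) that] .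
  then show "x \<in> Q" using c EV[OF c(3)] conn_step[OF c(2)] by blast
qed

lemma conn_closed:
  assumes "conn E X r v" "r \<in> C" "nbrs E C \<inter> X = {}"
  shows "v \<in> C"
  using assms(1)
proof (induction rule: conn_induct)
  case (step y z)
  then show ?case using assms(3) by (auto simp: nbrs_def)
qed (rule assms)

lemma clique_subset: "clique E Q \<Longrightarrow> Q' \<subseteq> Q \<Longrightarrow> clique E Q'"
  by (auto simp: clique_def)

text \<open>The separator is shrunk twice: to the neighbourhood \<open>Q1\<close> of the component
  of \<open>r\<close>, and to the neighbourhood \<open>Q\<close> of the component of
  \<open>p\<close> off \<open>Q1\<close>. Meanwhile the component of \<open>r\<close> only grows, so
  it still sees every vertex of \<open>Q\<close>.\<close>

lemma separated_full_components:
  assumes Q0: "clique E Q0" and pr: "p \<in> V - Q0" "r \<in> V - Q0" "\<not> conn E (V - Q0) p r"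
  obtains Q C D where "full_component E V C Q" "full_component E V D Q" "C \<inter> D = {}" "p \<in> C" "r \<in> D"
proof -
  define D1 where "D1 = {v. conn E (V - Q0) r v}"
  define Q1 where "Q1 = nbrs E D1"
  have Q1: "Q1 \<subseteq> Q0" unfolding Q1_def D1_def by (rule nbrs_component[OF pr(2)])
  have D1V: "D1 \<subseteq> V - Q0" using conn_in[OF _ pr(2)] by (auto simp: D1_def)
  have pD1: "p \<notin> D1" using pr(3) conn_sym[OF _ sym] by (auto simp: D1_def)
  have p1: "p \<in> V - Q1" using pr Q1 by auto
  define C where "C = {v. conn E (V - Q1) p v}"
  define Q where "Q = nbrs E C"
  have Q: "Q \<subseteq> Q1" unfolding Q_def C_def by (rule nbrs_component[OF p1])
  have CV: "C \<subseteq> V - Q1" using conn_in[OF _ p1] by (auto simp: C_def)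
  have r2: "r \<in> V - Q" using pr Q Q1 by auto
  define D where "D = {v. conn E (V - Q) r v}"
  have DV: "D \<subseteq> V - Q" using conn_in[OF _ r2] by (auto simp: D_def)
  have "D1 \<subseteq> D"
  proof
    fix x assume "x \<in> D1"
    then have "conn E (V - Q0) r x" by (simp add: D1_def)
    then have "conn E (V - Q) r x" by (rule conn_mono) (use Q Q1 in auto)
    then show "x \<in> D" by (simp add: D_def)
  qed
  have "nbrs E D = Q"
  proof
    show "nbrs E D \<subseteq> Q" unfolding D_def by (rule nbrs_component[OF r2])
    show "Q \<subseteq> nbrs E D"
    proof
      fix q assume "q \<in> Q"
      then have "q \<in> nbrs E D1" using Q by (auto simp: Q1_def)
      then show "q \<in> nbrs E D" using \<open>q \<in> Q\<close> \<open>D1 \<subseteq> D\<close> DV by (auto simp: nbrs_def)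
    qed
  qed
  moreover have "r \<notin> C"
  proof
    assume "r \<in> C"
    then have "conn E (V - Q1) r p" using conn_sym[OF _ sym] by (simp add: C_def)
    then have "p \<in> D1"
      by (rule conn_closed) (auto simp: D1_def Q1_def)
    then show False using pD1 by simp
  qed
  moreover have "C \<inter> D = {}"
  proof (rule ccontr)
    assume "C \<inter> D \<noteq> {}"
    then obtain v where v: "v \<in> C" "conn E (V - Q) v r" using conn_sym[OF _ sym] by (auto simp: D_def)
    have "r \<in> C" using v(2,1) by (rule conn_closed) (auto simp: Q_def)
    then show False using \<open>r \<notin> C\<close> by simp
  qed
  moreover have "connected E C" "connected E D"
    unfolding C_def D_def using p1 r2 by (auto intro: connected_component[OF sym])
  moreover have "clique E Q" using Q0 Q Q1 by (auto intro: clique_subset)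
  ultimately have "full_component E V C Q" "full_component E V D Q"
    using CV DV by (auto simp: full_component_def Q_def)
  then show thesis
    using that \<open>C \<inter> D = {}\<close> by (auto simp: C_def D_def)
qed

text \<open>Detours through vertices outside \<open>L'\<close> enter and leave \<open>L'\<close> at vertices of a clique.\<close>

lemma conn_shortcut:
  assumes T: "clique E {v \<in> L'. \<exists>u\<in>L - L'. E u v}" and "L' \<subseteq> L"
    and xy: "conn E (L - Q) x y" "x \<in> L'" "y \<in> L'"
  shows "conn E (L' - Q) x y"
proof -
  let ?T = "{v \<in> L'. \<exists>u\<in>L - L'. E u v}"
  have "(y \<in> L' \<longrightarrow> conn E (L' - Q) x y) \<and> (y \<notin> L' \<longrightarrow> (\<exists>s\<in>?T - Q. conn E (L' - Q) x s))"
    using xy(1)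
  proof (induction rule: conn_induct)
    case refl
    then show ?case using xy by simp
  next
    case (step y z)
    show ?case
    proof (cases "y \<in> L'")
      case True
      then have xy': "conn E (L' - Q) x y" using step by simp
      show ?thesis
      proof (cases "z \<in> L'")
        case True
        then show ?thesis using step \<open>y \<in> L'\<close> conn_step[OF xy'] by auto
      next
        case False
        then have "y \<in> ?T - Q" using step \<open>y \<in> L'\<close> E_sym by auto
        then show ?thesis using False xy' by auto
      qed
    next
      case False
      then obtain s where s: "s \<in> ?T - Q" "conn E (L' - Q) x s" using step by auto
      show ?thesis
      proof (cases "z \<in> L'")
        case True
        then have "z \<in> ?T" using step False by auto
        moreover have "s \<in> ?T" using s(1) by (rule DiffD1)
        ultimately have "z = s \<or> E s z" using cliqueD[OF T, of s z] by blast
        then show ?thesis using s True step conn_step[OF s(2)] by auto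
      next
        case False
        then show ?thesis using s by auto
      qed
    qed
  qed
  then show ?thesis using xy(3) by simp
qed

end

text \<open>A run of MCS-M as pure data: \<open>w t v\<close> is the weight of \<open>v\<close>
  before visit \<open>t\<close>, relevant up to the visit of \<open>v\<close> itself, and
  \<open>ord\<close> and \<open>pos\<close> are inverse to each other.\<close>

locale mcs_order = fin_graph +
  fixes n :: nat and ord :: "nat \<Rightarrow> 'a" and pos :: "'a \<Rightarrow> nat" and w :: "nat \<Rightarrow> 'a \<Rightarrow> nat"
  assumes ord_V: "t < n \<Longrightarrow> ord t \<in> V" and pos_ord: "t < n \<Longrightarrow> pos (ord t) = t"
    and pos_n: "v \<in> V \<Longrightarrow> pos v < n" and ord_pos: "v \<in> V \<Longrightarrow> ord (pos v) = v"
    and w_0: "v \<in> V \<Longrightarrow> w 0 v = 0"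
    and w_max: "v \<in> V \<Longrightarrow> t \<le> pos v \<Longrightarrow> w t v \<le> w t (ord t)"
    and w_Suc: "v \<in> V \<Longrightarrow> t < pos v \<Longrightarrow>
      w (Suc t) v = (if v \<in> below E {u \<in> V. t < pos u} (w t) (ord t) (w t v) then Suc (w t v) else w t v)"
begin

abbreviation "unvisited t \<equiv> {v \<in> V. t \<le> pos v}"
abbreviation "lower t \<equiv> below E {u \<in> V. t < pos u} (w t) (ord t)"

lemma pos_inj: "u \<in> V \<Longrightarrow> v \<in> V \<Longrightarrow> pos u = pos v \<Longrightarrow> u = v"
  using ord_pos by metis

lemma w_le_Suc: "v \<in> V \<Longrightarrow> t < pos v \<Longrightarrow> w t v \<le> w (Suc t) v"
  by (simp add: w_Suc)

text \<open>If the visit of \<open>s\<close> did not raise \<open>y\<close>, a path in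
  \<open>K\<close> from a neighbour of \<open>s\<close> to \<open>y\<close> would be blocked by a
  vertex at least as heavy as \<open>y\<close>, and that vertex would be raised instead. From then
  on \<open>K\<close> always contains a vertex strictly heavier than \<open>y\<close>, which
  contradicts the choice of \<open>y\<close> at its visit.\<close>

lemma visit_reaches:
  assumes y: "y \<in> V" "K = {v. conn E (unvisited (pos y)) y v}"
    and s: "s \<in> V" "pos s < pos y" "c0 \<in> K" "E s c0"
  shows "y \<in> lower (pos s) (w (pos s) y)"
proof (rule ccontr)
  assume no: "y \<notin> lower (pos s) (w (pos s) y)"
  have y_U: "y \<in> unvisited (pos y)" using y by simp
  have KU: "K \<subseteq> unvisited (pos y)" unfolding y(2) by (rule conn_subset[OF y_U])
  have ordS: "ord (pos s) = s" using s ord_pos by simp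
  have grow: "w (Suc t) c = Suc (w t c)" if "c \<in> K" "t < pos y" "c \<in> lower t (w t c)" for c t
    using that KU w_Suc[of c t] by auto
  \<comment> \<open>Along a walk from \<open>c0\<close>, either the current vertex is still reached
    below the weight of \<open>y\<close>, or some vertex at least as heavy as \<open>y\<close> has
    been met that is reached below its own weight.\<close>
  have start: "v \<in> lower (pos s) (w (pos s) y) \<or> (\<exists>c\<in>K. w (pos s) y \<le> w (pos s) c \<and> c \<in> lower (pos s) (w (pos s) c))"
    if "conn E (unvisited (pos y)) c0 v" for v
    using that
  proof (induction rule: conn_induct)
    case refl
    have "c0 \<in> {u \<in> V. pos s < pos u}" using s KU by auto
    then show ?case using s(4) ordS by (auto intro!: below_start)
  next
    case (step v v')
    have cv: "conn E (unvisited (pos y)) y v" using conn_trans[of E _ y c0 v] s(3) y(2) step(1) by blast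
    then have v: "v \<in> K" by (simp add: y(2))
    show ?case
    proof (cases "v \<in> lower (pos s) (w (pos s) y)")
      case True
      show ?thesis
      proof (cases "w (pos s) v < w (pos s) y")
        case True
        have "v' \<in> {u \<in> V. pos s < pos u}" using step(3) s(2) by auto
        then show ?thesis using \<open>v \<in> lower (pos s) _\<close> True step(4) by (blast intro: below_step)
      next
        case False
        then show ?thesis using \<open>v \<in> lower (pos s) _\<close> v below_mono[of v] by (meson leI)
      qed
    qed (use step in auto)
  qed
  have conn_c0: "conn E (unvisited (pos y)) c0 y" using s(3) y(2) conn_sym[OF _ sym] by blast
  have base: "\<exists>c\<in>K. w (Suc (pos s)) y < w (Suc (pos s)) c"
  proof -
    obtain c where c: "c \<in> K" "w (pos s) y \<le> w (pos s) c" "c \<in> lower (pos s) (w (pos s) c)"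
      using start[OF conn_c0] no by auto
    moreover have "w (Suc (pos s)) y = w (pos s) y" using no y s w_Suc[of y "pos s"] by simp
    ultimately show ?thesis using grow[of c "pos s"] s(2) by (intro bexI[of _ c]) auto
  qed
  \<comment> \<open>If \<open>y\<close> is raised as well, its path continues inside
    \<open>K\<close>, either all the way to the heavier \<open>c\<close> or to another vertex
    heavier than \<open>y\<close>; the one where it arrives is raised too.\<close>
  have persist: "\<exists>c\<in>K. w (Suc t) y < w (Suc t) c" if t: "t < pos y" "\<exists>c\<in>K. w t y < w t c" for t
  proof -
    obtain c where c: "c \<in> K" "w t y < w t c" using t by auto
    show ?thesis
    proof (cases "y \<in> lower t (w t y)")
      case False
      then have "w (Suc t) y = w t y" using w_Suc[of y t] y t by simp
      moreover have "w t c \<le> w (Suc t) c" using w_le_Suc[of c t] c KU t by auto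
      ultimately show ?thesis using c by (intro bexI[of _ c]) auto
    next
      case True
      have "v \<in> lower t (Suc (w t y)) \<or> (\<exists>c\<in>K. w t y < w t c \<and> c \<in> lower t (w t c))"
        if "conn E (unvisited (pos y)) y v" for v
        using that
      proof (induction rule: conn_induct)
        case refl
        then show ?case using True below_mono by (metis le_SucI le_refl)
      next
        case (step v v')
        have v: "v \<in> K" using step(1) by (simp add: y(2))
        show ?case
        proof (cases "v \<in> lower t (Suc (w t y))")
          case low: True
          show ?thesis
          proof (cases "w t v \<le> w t y")
            case True
            have "v' \<in> {u \<in> V. t < pos u}" using step(3) t(1) by auto
            then show ?thesis using low True step(4) by (auto intro: below_step)
          next
            case False
            then have "v \<in> lower t (w t v)" using low below_mono[of v] by (metis Suc_leI not_le)
            then show ?thesis using False v by (meson leI)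
          qed
        qed (use step in auto)
      qed
      moreover have "conn E (unvisited (pos y)) y c" using c by (simp add: y(2))
      ultimately have "c \<in> lower t (Suc (w t y)) \<or> (\<exists>c\<in>K. w t y < w t c \<and> c \<in> lower t (w t c))" by blast
      then obtain c' where c': "c' \<in> K" "w t y < w t c'" "c' \<in> lower t (w t c')"
      proof
        assume *: "c \<in> lower t (Suc (w t y))"
        have "c \<in> lower t (w t c)" by (rule below_mono[OF *]) (use c in simp)
        then show thesis using that c by blast
      next
        assume "\<exists>c\<in>K. w t y < w t c \<and> c \<in> lower t (w t c)"
        then show thesis using that by blast
      qed
      moreover have "w (Suc t) y = Suc (w t y)" using True w_Suc[of y t] y t by simp
      ultimately show ?thesis using grow[of c' t] t(1) by (intro bexI[of _ c']) auto
    qed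
  qed
  have "Suc (pos s) \<le> t \<Longrightarrow> t \<le> pos y \<Longrightarrow> \<exists>c\<in>K. w t y < w t c" for t
  proof (induction t rule: dec_induct)
    case base
    then show ?case using \<open>\<exists>c\<in>K. w (Suc (pos s)) y < w (Suc (pos s)) c\<close> by simp
  next
    case (step t)
    then show ?case using persist[of t] by simp
  qed
  then obtain c where c: "c \<in> K" "w (pos y) y < w (pos y) c" using s(2) by (meson Suc_leI le_refl)
  then have "w (pos y) c \<le> w (pos y) (ord (pos y))" using KU by (intro w_max) auto
  then show False using c y ord_pos by simp
qed

text \<open>All neighbours of the component of \<open>y\<close> are visited before \<open>y\<close>,
  and each of these visits raises \<open>y\<close> by one.\<close>

lemma card_nbrs_le_weight:
  assumes y: "y \<in> V"
  shows "card (nbrs E {v. conn E (unvisited (pos y)) y v}) \<le> w (pos y) y"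
proof -
  define K where "K = {v. conn E (unvisited (pos y)) y v}"
  have y_U: "y \<in> unvisited (pos y)" using y by simp
  have "t \<le> pos y \<Longrightarrow> card {s \<in> nbrs E K. pos s < t} \<le> w t y" for t
  proof (induction t)
    case (Suc t)
    have finN: "finite (nbrs E K)"
      using EV fin by (auto simp: nbrs_def intro: finite_subset[of _ V])
    show ?case
    proof (cases "ord t \<in> nbrs E K")
      case True
      have t: "t < n" using Suc.prems pos_n[OF y] by simp
      have "{s \<in> nbrs E K. pos s < Suc t} \<subseteq> insert (ord t) {s \<in> nbrs E K. pos s < t}"
        using EV ord_pos by (auto simp: nbrs_def less_Suc_eq)
      then have "card {s \<in> nbrs E K. pos s < Suc t} \<le> card (insert (ord t) {s \<in> nbrs E K. pos s < t})"
        using finN by (intro card_mono) auto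
      also have "\<dots> \<le> Suc (w t y)"
        using Suc finN by (auto simp: card_insert_if)
      also have "Suc (w t y) = w (Suc t) y"
      proof -
        obtain c where c: "c \<in> K" "E (ord t) c" using True E_sym by (auto simp: nbrs_def)
        have "y \<in> lower (pos (ord t)) (w (pos (ord t)) y)"
          using visit_reaches[OF y K_def, of "ord t" c] ord_V[OF t] pos_ord[OF t] c Suc.prems by simp
        then show ?thesis using pos_ord[OF t] w_Suc[of y t] y Suc.prems by simp
      qed
      finally show ?thesis .
    next
      case False
      have "pos s < t" if "s \<in> nbrs E K" "pos s < Suc t" for s
        using that False EV ord_pos by (cases "pos s = t") (auto simp: nbrs_def)
      then have "{s \<in> nbrs E K. pos s < Suc t} \<subseteq> {s \<in> nbrs E K. pos s < t}"
        by auto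
      then have "card {s \<in> nbrs E K. pos s < Suc t} \<le> card {s \<in> nbrs E K. pos s < t}"
        using finN by (intro card_mono) auto
      also have "\<dots> \<le> w t y" using Suc by simp
      also have "\<dots> \<le> w (Suc t) y" using w_le_Suc y Suc.prems by simp
      finally show ?thesis .
    qed
  qed simp
  from this[of "pos y"] have "card {s \<in> nbrs E K. pos s < pos y} \<le> w (pos y) y" by simp
  moreover have "pos s < pos y" if sN: "s \<in> nbrs E K" for s
  proof (rule ccontr)
    assume "\<not> pos s < pos y"
    obtain c where c: "c \<in> K" "E c s" "s \<notin> K" using sN by (auto simp: nbrs_def)
    have "conn E (unvisited (pos y)) y c" using c by (simp add: K_def)
    then have "conn E (unvisited (pos y)) y s"
      by (rule conn_step[OF _ conn_in[OF _ y_U]]) (use \<open>conn E _ y c\<close> c EV[OF c(2)] \<open>\<not> pos s < pos y\<close> in simp_all)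
    then show False using c by (simp add: K_def)
  qed
  then have "{s \<in> nbrs E K. pos s < pos y} = nbrs E K" by auto
  ultimately show ?thesis by (simp add: K_def)
qed

text \<open>An invariant of the visits made before \<open>D\<close> is entered. A visit inside
  \<open>Q\<close> raises all unvisited vertices of \<open>Q\<close>, by adjacency, and a vertex of
  \<open>D\<close> by at most one. A visit elsewhere does not raise \<open>d\<close>, because a path
  into \<open>D\<close> passes through an unvisited vertex of \<open>Q\<close>, which is at least as
  heavy as \<open>d\<close>.\<close>

lemma weight_le_separator:
  assumes D: "D \<subseteq> V" "clique E Q" "nbrs E D = Q" "\<And>d. d \<in> D \<Longrightarrow> t \<le> pos d" and d: "d \<in> D"
  shows "(\<forall>s\<in>Q. t \<le> pos s \<longrightarrow> w t d \<le> w t s) \<and> w t d \<le> card {s \<in> Q. pos s < t}"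
  using D(4) d
proof (induction t arbitrary: d)
  case 0
  then show ?case using w_0 D(1) by auto
next
  case (Suc t)
  have QV: "Q \<subseteq> V" and QD: "Q \<inter> D = {}" using D(3) EV by (auto simp: nbrs_def)
  have finQ: "finite Q" using QV fin by (rule finite_subset)
  have IH: "s \<in> Q \<Longrightarrow> t \<le> pos s \<Longrightarrow> w t d \<le> w t s" "w t d \<le> card {s \<in> Q. pos s < t}" if "d \<in> D" for s d
    using Suc.IH[of d] Suc.prems(1) that by (auto dest: Suc_leD)
  have dV: "d \<in> V" "t < pos d" using Suc.prems(1)[OF Suc.prems(2)] Suc.prems(2) D(1) by auto
  have t: "t < n" using pos_n[OF dV(1)] dV(2) by simp
  have zD: "ord t \<notin> D" using Suc.prems(1)[of "ord t"] pos_ord[OF t] by auto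
  have mono: "w t s \<le> w (Suc t) s" if "s \<in> Q" "Suc t \<le> pos s" for s
    using w_le_Suc[of s t] that QV by auto
  show ?case
  proof (cases "ord t \<in> Q")
    case True
    have up: "w (Suc t) s = Suc (w t s)" if "s \<in> Q" "Suc t \<le> pos s" for s
    proof -
      have "s \<noteq> ord t" using that pos_ord[OF t] by auto
      then have "E (ord t) s" using D(2) True that(1) by (auto simp: clique_def)
      then have "s \<in> lower t (w t s)" using that QV by (auto intro!: below_start)
      then show ?thesis using w_Suc[of s t] that QV by auto
    qed
    have "insert (ord t) {s \<in> Q. pos s < t} \<subseteq> {s \<in> Q. pos s < Suc t}"
      using True pos_ord[OF t] by auto
    then have "card (insert (ord t) {s \<in> Q. pos s < t}) \<le> card {s \<in> Q. pos s < Suc t}"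
      using finQ by (intro card_mono) auto
    moreover have "ord t \<notin> {s \<in> Q. pos s < t}" using pos_ord[OF t] by auto
    ultimately have "Suc (card {s \<in> Q. pos s < t}) \<le> card {s \<in> Q. pos s < Suc t}"
      using finQ by simp
    moreover have "w (Suc t) d \<le> Suc (w t d)" using w_Suc[of d t] dV by simp
    ultimately show ?thesis using IH[OF Suc.prems(2)] up by fastforce
  next
    case False
    have "v \<notin> D" if "v \<in> lower t (w t d)" for v
      using that
    proof (induction rule: below.induct)
      case (below_start u)
      then show ?case using D(3) zD False E_sym by (auto simp: nbrs_def)
    next
      case (below_step v u)
      show ?case
      proof
        assume "u \<in> D"
        then have "v \<in> Q" using D(3) below_step E_sym by (auto simp: nbrs_def)
        moreover have "t < pos v" using below_step(1) by (cases rule: below.cases) auto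
        ultimately show False using IH(1)[OF Suc.prems(2), of v] below_step(2) by simp
      qed
    qed
    then have "w (Suc t) d = w t d" using w_Suc[of d t] dV Suc.prems(2) by auto
    moreover have "card {s \<in> Q. pos s < t} \<le> card {s \<in> Q. pos s < Suc t}"
      using finQ by (intro card_mono) auto
    moreover have "w t d \<le> w (Suc t) s" if "s \<in> Q" "Suc t \<le> pos s" for s
      using IH(1)[OF Suc.prems(2) that(1)] mono[OF that] that(2) by simp
    ultimately show ?thesis using IH(2)[OF Suc.prems(2)] by auto
  qed
qed

text \<open>Of two full components of a clique separator, the one entered later is entered only after
  the whole separator has been visited.\<close>

lemma separator_before_component:
  assumes C: "full_component E V C Q" and D: "full_component E V D Q" and disj: "C \<inter> D = {}"
    and y: "y \<in> D" "\<And>d. d \<in> D \<Longrightarrow> pos y \<le> pos d" and x: "x \<in> C" "pos x < pos y" and q: "q \<in> Q"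
  shows "pos q < pos y"
proof (rule ccontr)
  assume "\<not> pos q < pos y"
  define K where "K = {v. conn E (unvisited (pos y)) y v}"
  have DV: "D \<subseteq> V" "connected E D" "clique E Q" "nbrs E D = Q"
    and CV: "C \<subseteq> V" "connected E C" "nbrs E C = Q" using C D by (auto simp: full_component_def)
  have yV: "y \<in> V" using y DV by auto
  have y_U: "y \<in> unvisited (pos y)" using yV by simp
  have KU: "K \<subseteq> unvisited (pos y)" unfolding K_def by (rule conn_subset[OF y_U])
  have step: "v' \<in> K" if "v \<in> K" "E v v'" "pos y \<le> pos v'" for v v'
    unfolding K_def mem_Collect_eq
    by (rule conn_step[of _ _ _ v]) (use that KU EV[OF that(2)] in \<open>auto simp: K_def\<close>)
  have "D \<subseteq> K"
  proof
    fix d assume "d \<in> D"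
    then have "conn E D y d" using DV y by (auto simp: connected_def)
    then show "d \<in> K" unfolding K_def mem_Collect_eq
      by (rule conn_mono) (use DV y in auto)
  qed
  have finN: "finite (nbrs E K)" using EV fin by (auto simp: nbrs_def intro: finite_subset[of _ V])
  have sub: "{s \<in> Q. pos s < pos y} \<subseteq> nbrs E K"
    using DV(4) \<open>D \<subseteq> K\<close> KU by (fastforce simp: nbrs_def)
  have "card (nbrs E K) \<le> w (pos y) y" unfolding K_def by (rule card_nbrs_le_weight[OF yV])
  also have "\<dots> \<le> card {s \<in> Q. pos s < pos y}"
    using weight_le_separator[OF DV(1,3,4) y(2) y(1)] by simp
  \<comment> \<open>The component \<open>K\<close> has at most as many neighbours as
    \<open>Q\<close> has visited vertices; these are among its neighbours, so there are no
    others.\<close>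
  finally have N: "nbrs E K \<subseteq> Q" using sub finN card_seteq by blast
  have "q \<in> nbrs E D" using q DV by simp
  then have "q \<in> K" using \<open>D \<subseteq> K\<close> step \<open>\<not> pos q < pos y\<close> by (auto simp: nbrs_def)
  \<comment> \<open>So \<open>K\<close> cannot stop at a vertex of \<open>C\<close>: the unvisited
    \<open>q\<close> leads it through all of \<open>C\<close>, up to the visited vertex
    \<open>x\<close>.\<close>
  have into: "v' \<in> K" if "v \<in> K" "E v v'" "v' \<in> C" for v v'
  proof (rule ccontr)
    assume "v' \<notin> K"
    then have "v' \<in> nbrs E K" using that by (auto simp: nbrs_def)
    then show False using N CV(3) that(3) by (auto simp: nbrs_def)
  qed
  obtain c where c: "c \<in> C" "E c q" using q CV(3) by (auto simp: nbrs_def)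
  have "conn E C c x" using CV x c by (auto simp: connected_def)
  then have "x \<in> K"
    by (induction rule: conn_induct) (use into \<open>q \<in> K\<close> c E_sym in blast)+
  then show False using KU x by auto
qed

section \<open>Peeling off pieces in reverse order\<close>

definition piece :: "nat \<Rightarrow> 'a set \<Rightarrow> 'a set" where
  "piece i L = {v. conn E {v \<in> L. i \<le> pos v} (ord i) v}"

definition border :: "nat \<Rightarrow> 'a set \<Rightarrow> 'a set" where
  "border i L = {v \<in> L. pos v < i \<and> (\<exists>k\<in>piece i L. E k v)}"

text \<open>Only vertices from position \<open>i\<close> on are gone; removals never cut a
  connection that avoids a given set \<open>Q\<close>; and every full component that lies entirely
  from \<open>i\<close> on, with its separator before it, has disappeared. The last clause ensures
  that no later piece meets such a component.\<close>

definition peeled :: "nat \<Rightarrow> 'a set \<Rightarrow> bool" where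
  "peeled i L \<longleftrightarrow> L \<subseteq> V \<and> (\<forall>v\<in>V - L. i \<le> pos v) \<and>
     (\<forall>Q. \<forall>x\<in>L. \<forall>y\<in>L. conn E (V - Q) x y \<longrightarrow> conn E (L - Q) x y) \<and>
     (\<forall>C Q. full_component E V C Q \<and> (\<forall>c\<in>C. i \<le> pos c) \<and> (\<forall>q\<in>Q. \<forall>c\<in>C. pos q < pos c) \<longrightarrow> C \<inter> L = {})"

lemma peeled_start: "peeled n V"
  unfolding peeled_def full_component_def connected_def
  using pos_n by (auto simp: not_le[symmetric])

context
  fixes i L
  assumes inv: "peeled (Suc i) L" and i: "i < n"
begin

lemma L_V: "L \<subseteq> V" and alive: "v \<in> V \<Longrightarrow> pos v \<le> i \<Longrightarrow> v \<in> L"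
  and conn_L: "x \<in> L \<Longrightarrow> y \<in> L \<Longrightarrow> conn E (V - Q) x y \<Longrightarrow> conn E (L - Q) x y"
  and peeled_component: "full_component E V C Q \<Longrightarrow> (\<And>c. c \<in> C \<Longrightarrow> Suc i \<le> pos c) \<Longrightarrow>
      (\<And>q c. q \<in> Q \<Longrightarrow> c \<in> C \<Longrightarrow> pos q < pos c) \<Longrightarrow> C \<inter> L = {}"
proof -
  show "L \<subseteq> V" using inv by (simp add: peeled_def)
  show "v \<in> L" if "v \<in> V" "pos v \<le> i" using inv that unfolding peeled_def by (metis DiffI not_less_eq_eq)
  show "conn E (L - Q) x y" if "x \<in> L" "y \<in> L" "conn E (V - Q) x y"
    using inv that unfolding peeled_def by simp
  show "C \<inter> L = {}" if "full_component E V C Q" "\<And>c. c \<in> C \<Longrightarrow> Suc i \<le> pos c"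
    "\<And>q c. q \<in> Q \<Longrightarrow> c \<in> C \<Longrightarrow> pos q < pos c"
  proof -
    have "full_component E V C Q \<and> (\<forall>c\<in>C. Suc i \<le> pos c) \<and> (\<forall>q\<in>Q. \<forall>c\<in>C. pos q < pos c) \<longrightarrow> C \<inter> L = {}"
      using inv unfolding peeled_def by (elim conjE allE)
    then show ?thesis by (rule mp) (use that in auto)
  qed
qed

lemma ord_L: "ord i \<in> {v \<in> L. i \<le> pos v}"
  using alive ord_V[OF i] pos_ord[OF i] by simp

lemma piece_sub: "piece i L \<subseteq> {v \<in> L. i \<le> pos v}"
  unfolding piece_def by (rule conn_subset[OF ord_L])

lemma ord_piece: "ord i \<in> piece i L"
  by (simp add: piece_def)

lemma piece_nbr: "k \<in> piece i L \<Longrightarrow> v \<in> L \<Longrightarrow> E k v \<Longrightarrow> v \<in> piece i L \<union> border i L"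
  using piece_sub conn_step[of E "{v \<in> L. i \<le> pos v}" "ord i" k v]
  by (cases "i \<le> pos v") (auto simp: border_def piece_def)

text \<open>If \<open>ord i\<close> opens a full component and the separator comes earlier, the
  piece is exactly what is left of the component, because the second clause of \<open>peeled\<close>
  keeps this rest connected. Its border then lies in a clique.\<close>

lemma piece_component:
  assumes C: "full_component E V C Q" "ord i \<in> C" "\<And>c. c \<in> C \<Longrightarrow> i \<le> pos c"
    and Q: "\<And>q c. q \<in> Q \<Longrightarrow> c \<in> C \<Longrightarrow> pos q < pos c"
  shows "piece i L = C \<inter> L" and "border i L \<subseteq> Q"
proof -
  have Qi: "pos q < i" if "q \<in> Q" for q using Q[OF that C(2)] pos_ord[OF i] by simp
  have CC: "connected E C" "nbrs E C = Q" "C \<subseteq> V" using C(1) by (auto simp: full_component_def)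
  show *: "piece i L = C \<inter> L"
  proof (intro equalityI subsetI)
    fix v assume v: "v \<in> piece i L"
    then have "conn E {v \<in> L. i \<le> pos v} (ord i) v" by (simp add: piece_def)
    then have "v \<in> C"
      by (rule conn_closed) (use C(2) CC(2) Qi in \<open>auto simp: not_le[symmetric] dest: Qi\<close>)
    then show "v \<in> C \<inter> L" using v piece_sub by auto
  next
    fix v assume v: "v \<in> C \<inter> L"
    have "conn E C (ord i) v" using CC C(2) v by (auto simp: connected_def)
    then have "conn E (V - Q) (ord i) v"
      by (rule conn_mono) (use CC in \<open>auto simp: nbrs_def\<close>)
    then have "conn E (L - Q) (ord i) v" using conn_L ord_L v by blast
    then have "v \<in> C \<and> conn E {v \<in> L. i \<le> pos v} (ord i) v"
    proof (induction rule: conn_induct)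
      case refl
      then show ?case using C(2) by simp
    next
      case (step y z)
      then have "z \<in> C" using CC(2) by (auto simp: nbrs_def)
      then show ?case using step C(3) by (auto intro: conn_step)
    qed
    then show "v \<in> piece i L" by (simp add: piece_def)
  qed
  show "border i L \<subseteq> Q"
  proof
    fix v assume "v \<in> border i L"
    then obtain k where k: "k \<in> C" "E k v" "pos v < i" using * by (auto simp: border_def)
    then have "v \<notin> C" using C(3) by (metis leD)
    then show "v \<in> Q" using k CC(2) by (auto simp: nbrs_def)
  qed
qed

text \<open>Restores the third clause of \<open>peeled\<close>: a component without
  \<open>ord i\<close> was gone before, and one that contains \<open>ord i\<close> has a piece with
  clique border, which is removed.\<close>

lemma peeled_components:
  assumes "L' \<subseteq> L" "clique E (border i L) \<Longrightarrow> L' \<inter> piece i L = {}"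
    and C: "full_component E V C Q" "\<And>c. c \<in> C \<Longrightarrow> i \<le> pos c" and Q: "\<And>q c. q \<in> Q \<Longrightarrow> c \<in> C \<Longrightarrow> pos q < pos c"
  shows "C \<inter> L' = {}"
proof (cases "ord i \<in> C")
  case False
  have "Suc i \<le> pos c" if "c \<in> C" for c
  proof -
    have "c \<in> V" using C(1) that by (auto simp: full_component_def)
    then have "pos c \<noteq> i" using False that ord_pos by metis
    then show ?thesis using C(2)[OF that] by simp
  qed
  then show ?thesis using peeled_component[OF C(1)] Q assms(1) by blast
next
  case True
  have "clique E (border i L)"
    using piece_component(2)[OF C(1) True C(2) Q] C(1) clique_subset by (auto simp: full_component_def)
  then show ?thesis using assms(1,2) piece_component(1)[OF C(1) True C(2) Q] by blast
qed

lemma peeled_keep: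
  assumes "\<not> clique E (border i L)"
  shows "peeled i L"
  unfolding peeled_def
proof (intro conjI allI impI ballI)
  show "L \<subseteq> V" by (rule L_V)
  show "i \<le> pos v" if "v \<in> V - L" for v
    using that alive[of v] nat_le_linear by blast
  show "conn E (L - Q) x y" if "x \<in> L" "y \<in> L" "conn E (V - Q) x y" for Q x y
    using that by (rule conn_L)
  fix C Q assume "full_component E V C Q \<and> (\<forall>c\<in>C. i \<le> pos c) \<and> (\<forall>q\<in>Q. \<forall>c\<in>C. pos q < pos c)"
  then show "C \<inter> L = {}"
    using assms by (intro peeled_components[of L C Q]) auto
qed

text \<open>Remaining vertices that touch the piece lie in its clique border, so walks through the
  piece can be shortcut.\<close>

lemma peeled_remove:
  assumes S: "clique E (border i L)"
  shows "peeled i (L - piece i L)"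
  unfolding peeled_def
proof (intro conjI allI impI ballI)
  show "L - piece i L \<subseteq> V" using L_V by auto
  show "i \<le> pos v" if "v \<in> V - (L - piece i L)" for v
  proof (cases "v \<in> L")
    case True
    then show ?thesis using that piece_sub by blast
  next
    case False
    then show ?thesis using that alive[of v] nat_le_linear by blast
  qed
  fix Q x y assume xy: "x \<in> L - piece i L" "y \<in> L - piece i L" "conn E (V - Q) x y"
  have "{v \<in> L - piece i L. \<exists>u\<in>L - (L - piece i L). E u v} \<subseteq> border i L"
    using piece_nbr by auto
  then have "clique E {v \<in> L - piece i L. \<exists>u\<in>L - (L - piece i L). E u v}"
    using S clique_subset by blast
  moreover have "conn E (L - Q) x y" using conn_L xy by auto
  ultimately show "conn E (L - piece i L - Q) x y"
    using conn_shortcut[of "L - piece i L" L Q x y] xy by auto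
next
  fix C Q assume "full_component E V C Q \<and> (\<forall>c\<in>C. i \<le> pos c) \<and> (\<forall>q\<in>Q. \<forall>c\<in>C. pos q < pos c)"
  then show "C \<inter> (L - piece i L) = {}"
    using peeled_components[of "L - piece i L" C Q] by auto
qed

lemma separation_piece:
  assumes "clique E (border i L)"
  shows "separation E L (L - piece i L) (piece i L \<union> border i L)"
  unfolding separation_def
proof (intro conjI ballI)
  have BL: "border i L \<subseteq> L" "border i L \<inter> piece i L = {}"
    using piece_sub by (auto simp: border_def)
  show "L - piece i L \<union> (piece i L \<union> border i L) = L"
    using BL piece_sub by auto
  have "(L - piece i L) \<inter> (piece i L \<union> border i L) = border i L" using BL by auto
  then show "clique E ((L - piece i L) \<inter> (piece i L \<union> border i L))" using assms by simp
  fix a b assume "a \<in> L - piece i L - (piece i L \<union> border i L)" "b \<in> piece i L \<union> border i L - (L - piece i L)"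
  then show "\<not> E a b" using piece_nbr[of b a] E_sym BL by blast
qed

text \<open>By the order of visits, \<open>Q\<close> lies before all of \<open>D\<close>. If
  \<open>D\<close> starts after \<open>i\<close>, it has been peeled; if it starts at
  \<open>i\<close>, the piece and its border stay within \<open>D \<union> Q\<close> and miss
  \<open>C\<close>; if it starts before \<open>i\<close>, both \<open>C\<close> and \<open>D\<close>
  contain border vertices, which would be adjacent.\<close>

lemma not_separated_by_later_component:
  assumes S: "clique E (border i L)" and C: "full_component E V C Q" and D: "full_component E V D Q"
    and disj: "C \<inter> D = {}" and p: "p \<in> C \<inter> (piece i L \<union> border i L)" and r: "r \<in> D \<inter> (piece i L \<union> border i L)"
    and x: "x \<in> C" and y: "y \<in> D" "\<And>d. d \<in> D \<Longrightarrow> pos y \<le> pos d" and xy: "pos x < pos y"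
  shows False
proof -
  have BL: "border i L \<subseteq> L" by (auto simp: border_def)
  have CV: "C \<subseteq> V" "connected E C" "nbrs E C = Q" and DV: "D \<subseteq> V" "connected E D" "nbrs E D = Q"
    using C D by (auto simp: full_component_def)
  have Q: "pos q < pos d" if "q \<in> Q" "d \<in> D" for q d
    using separator_before_component[OF C D disj y x xy that(1)] y(2)[OF that(2)] by simp
  have r_L: "r \<in> L" "p \<in> L" using r p piece_sub BL by auto
  have "pos y \<le> i"
  proof (rule ccontr)
    assume "\<not> pos y \<le> i"
    then have "D \<inter> L = {}" by (intro peeled_component[OF D]) (use y(2) Q in \<open>auto intro: le_trans[of _ "pos y"]\<close>)
    then show False using r r_L by auto
  qed
  moreover have "pos y \<noteq> i"
  proof
    assume "pos y = i"
    then have yi: "ord i = y" using ord_pos y DV by auto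
    then have "ord i \<in> D" "\<And>d. d \<in> D \<Longrightarrow> i \<le> pos d" using y \<open>pos y = i\<close> by auto
    then have "piece i L \<union> border i L \<subseteq> D \<union> Q"
      using piece_component[OF D _ _ Q] by blast
    moreover have "p \<notin> Q" using p CV(3) by (auto simp: nbrs_def)
    ultimately show False using p disj by auto
  qed
  ultimately have yi: "pos y < i" by simp
  \<comment> \<open>Inside \<open>L\<close>, a walk from the piece to a vertex before position
    \<open>i\<close> has to pass through the border.\<close>
  have leave: "\<exists>s\<in>border i L. s \<in> C'"
    if C': "C' \<subseteq> V" "connected E C'" "nbrs E C' = Q" and p': "p' \<in> C' \<inter> (piece i L \<union> border i L)"
      and x': "x' \<in> C'" "pos x' < i" for C' p' x'
  proof -
    have x'L: "x' \<in> L" using alive x' C' by auto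
    have p'L: "p' \<in> L" using p' piece_sub BL by auto
    have "conn E C' p' x'" using C' p' x' by (auto simp: connected_def)
    then have "conn E (V - Q) p' x'"
      by (rule conn_mono) (use C' in \<open>auto simp: nbrs_def\<close>)
    then have "conn E (L - Q) p' x'" by (rule conn_L[OF p'L x'L])
    then have "x' \<in> C' \<and> (x' \<in> piece i L \<or> (\<exists>s\<in>border i L. s \<in> C'))"
    proof (induction rule: conn_induct)
      case (step u v)
      then have "v \<in> C'" using C'(3) by (auto simp: nbrs_def)
      then show ?case using step piece_nbr[of u v] by auto
    qed (use p' in auto)
    moreover have "x' \<notin> piece i L" using piece_sub x'(2) by auto
    ultimately show ?thesis by simp
  qed
  obtain c where c: "c \<in> border i L" "c \<in> C" using leave[OF CV p x] xy yi by auto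
  obtain d where d: "d \<in> border i L" "d \<in> D" using leave[OF DV r y(1) yi] by auto
  have "c \<noteq> d" using c d disj by auto
  then have "E c d" by (rule cliqueD[OF S c(1) d(1)])
  then have "d \<in> nbrs E C" using c d disj by (auto simp: nbrs_def)
  then show False using CV(3) DV(3) d by (auto simp: nbrs_def)
qed

text \<open>A proper separation would separate two vertices in the whole graph too, since detours
  can be shortcut through the clique border. This yields two full components of one clique, and the
  one entered later gives the contradiction.\<close>

lemma atom_piece:
  assumes S: "clique E (border i L)"
  shows "atom E (piece i L \<union> border i L)"
  unfolding atom_def
proof (intro allI impI, rule ccontr)
  let ?M = "piece i L \<union> border i L"
  fix A B assume sep: "separation E ?M A B" and "\<not> (A \<subseteq> B \<or> B \<subseteq> A)"
  then obtain p r where pr: "p \<in> A - B" "r \<in> B - A" by auto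
  have BL: "border i L \<subseteq> L" by (auto simp: border_def)
  have M_L: "?M \<subseteq> L" using BL piece_sub by auto
  have AB: "A \<union> B = ?M" "clique E (A \<inter> B)" "\<And>a b. a \<in> A - B \<Longrightarrow> b \<in> B - A \<Longrightarrow> \<not> E a b"
    using sep by (auto simp: separation_def)
  have prM: "p \<in> ?M" "r \<in> ?M" using pr AB(1) by auto
  have nc: "\<not> conn E (V - A \<inter> B) p r"
  proof
    assume "conn E (V - A \<inter> B) p r"
    then have "conn E (L - A \<inter> B) p r" using conn_L prM M_L by blast
    moreover have "clique E {v \<in> ?M. \<exists>u\<in>L - ?M. E u v}"
      by (rule clique_subset[OF S]) (use piece_nbr E_sym in blast)
    ultimately have "conn E (?M - A \<inter> B) p r"
      using conn_shortcut[of ?M L "A \<inter> B" p r] M_L prM by blast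
    then have "r \<in> A - B"
      by (induction rule: conn_induct) (use pr AB in blast)+
    then show False using pr by simp
  qed
  have V: "p \<in> V - A \<inter> B" "r \<in> V - A \<inter> B" using pr prM M_L L_V by auto
  obtain Q C D where CD: "full_component E V C Q" "full_component E V D Q" "C \<inter> D = {}" "p \<in> C" "r \<in> D"
    by (rule separated_full_components[OF AB(2) V nc])
  obtain x where x: "x \<in> C" "\<And>c. c \<in> C \<Longrightarrow> pos x \<le> pos c"
    using ex_has_least_nat[of "\<lambda>v. v \<in> C" p pos] CD(4) by auto
  obtain y where y: "y \<in> D" "\<And>c. c \<in> D \<Longrightarrow> pos y \<le> pos c"
    using ex_has_least_nat[of "\<lambda>v. v \<in> D" r pos] CD(5) by auto
  have "x \<noteq> y" using x y CD(3) by auto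
  moreover have "x \<in> V" "y \<in> V" using x y CD by (auto simp: full_component_def)
  ultimately have "pos x \<noteq> pos y" using pos_inj by blast
  then consider "pos x < pos y" | "pos y < pos x" by linarith
  then show False
  proof cases
    case 1
    show False
      by (rule not_separated_by_later_component[OF S CD(1,2,3) _ _ x(1) y 1]) (use CD prM in auto)
  next
    case 2
    have "D \<inter> C = {}" using CD(3) by auto
    show False
      by (rule not_separated_by_later_component[OF S CD(2,1) \<open>D \<inter> C = {}\<close> _ _ y(1) x 2]) (use CD prM in auto)
  qed
qed

end

text \<open>For \<open>i = 0\<close>, the component of any vertex, taken with the empty separator,
  falls under the third clause of \<open>peeled\<close>.\<close>

lemma peeled_end:
  assumes "peeled 0 L"
  shows "L = {}"
proof (rule ccontr)
  assume "L \<noteq> {}"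
  then obtain v where v: "v \<in> L" by auto
  have LV: "L \<subseteq> V" using assms by (simp add: peeled_def)
  have vV: "v \<in> V - {}" using v LV by auto
  let ?C = "{u. conn E (V - {}) v u}"
  have "nbrs E ?C = {}" using nbrs_component[OF vV] by auto
  moreover have "?C \<subseteq> V" using conn_subset[OF vV] by simp
  moreover have "connected E ?C" using connected_component[OF sym vV] .
  ultimately have "full_component E V ?C {}" by (simp add: full_component_def clique_def)
  then have "?C \<inter> L = {}" using assms unfolding peeled_def by blast
  moreover have "v \<in> ?C" by simp
  ultimately show False using v by blast
qed

end

section \<open>Calculation rules, frames and loops of the structured language\<close>

lemma wp_Skip_eq: "wp w Skip Q s T \<longleftrightarrow> Q s T"
  by (auto simp: wp_def elim: big.cases[of w Skip] intro!: exI[of _ s] exI[of _ 0] big_Skip)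

lemma wp_Set_eq: "wp w (Set r x) Q s T \<longleftrightarrow> 1 \<le> T \<and> Q (upd r x s) (T - 1)"
  and wp_Mov_eq: "wp w (Mov r a) Q s T \<longleftrightarrow> 1 \<le> T \<and> Q (upd r (rg s a) s) (T - 1)"
  and wp_Inc_eq: "wp w (Inc r a) Q s T \<longleftrightarrow> 1 \<le> T \<and> Q (upd r (Suc (rg s a)) s) (T - 1)"
  and wp_Dec_eq: "wp w (Dec r a) Q s T \<longleftrightarrow> 1 \<le> T \<and> Q (upd r (rg s a - 1) s) (T - 1)"
  and wp_Sub_eq: "wp w (Sub r a b) Q s T \<longleftrightarrow> 1 \<le> T \<and> Q (upd r (rg s a - rg s b) s) (T - 1)"
  and wp_Inp_eq: "wp w (Inp r a) Q s T \<longleftrightarrow> 1 \<le> T \<and> rg s a < length w \<and> Q (upd r (w ! rg s a) s) (T - 1)"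
  and wp_Get_eq: "wp w (Get r k i j) Q s T \<longleftrightarrow> 12 \<le> T \<and> Q (upd r (ar s k (rg s i) (rg s j)) s) (T - 12)"
  and wp_Put_eq: "wp w (Put k i j a) Q s T \<longleftrightarrow> 12 \<le> T \<and> Q (put k (rg s i) (rg s j) (rg s a) s) (T - 12)"
  unfolding wp_def
  by (auto elim!: big.cases[of w "Set _ _"] big.cases[of w "Mov _ _"] big.cases[of w "Inc _ _"]
      big.cases[of w "Dec _ _"] big.cases[of w "Sub _ _ _"] big.cases[of w "Inp _ _"] big.cases[of w "Get _ _ _ _"]
      big.cases[of w "Put _ _ _ _"]
      intro: big.intros(2-9)[simplified])

lemma wp_Seq_eq: "wp w (c ;; d) Q s T \<longleftrightarrow> wp w c (wp w d Q) s T"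
proof
  assume "wp w (c ;; d) Q s T"
  then obtain s' t where "big w (c ;; d) s t s'" "t \<le> T" "Q s' (T - t)" by (auto simp: wp_def)
  from this(1) obtain s1 t1 t2 where "big w c s t1 s1" "big w d s1 t2 s'" "t = t1 + t2"
    by (cases rule: big.cases) auto
  then show "wp w c (wp w d Q) s T"
    unfolding wp_def using \<open>t \<le> T\<close> \<open>Q s' (T - t)\<close>
    by (intro exI[of _ s1] exI[of _ t1] conjI exI[of _ s'] exI[of _ t2]) auto
qed (rule wp_Seq)

lemma wp_If_eq: "wp w (If r c d) Q s T \<longleftrightarrow>
  (if rg s r = 0 then 1 \<le> T \<and> wp w d Q s (T - 1) else 2 \<le> T \<and> wp w c Q s (T - 2))"
proof
  assume "wp w (If r c d) Q s T"
  then obtain s' t where "big w (If r c d) s t s'" "t \<le> T" "Q s' (T - t)" by (auto simp: wp_def)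
  then show "if rg s r = 0 then 1 \<le> T \<and> wp w d Q s (T - 1) else 2 \<le> T \<and> wp w c Q s (T - 2)"
  proof (cases rule: big.cases)
    case (big_IfT t1)
    then show ?thesis using \<open>t \<le> T\<close> \<open>Q s' (T - t)\<close>
      by (auto simp: wp_def intro!: exI[of _ s'] exI[of _ t1])
  next
    case (big_IfF t1)
    then show ?thesis using \<open>t \<le> T\<close> \<open>Q s' (T - t)\<close>
      by (auto simp: wp_def intro!: exI[of _ s'] exI[of _ t1])
  qed
next
  assume *: "if rg s r = 0 then 1 \<le> T \<and> wp w d Q s (T - 1) else 2 \<le> T \<and> wp w c Q s (T - 2)"
  show "wp w (If r c d) Q s T"
  proof (cases "rg s r = 0")
    case True
    then obtain s' t where "big w d s t s'" "t \<le> T - 1" "Q s' (T - 1 - t)" "1 \<le> T"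
      using * by (auto simp: wp_def)
    then show ?thesis
      unfolding wp_def using True big_IfF[of s r w d t s' c]
      by (intro exI[of _ s'] exI[of _ "t + 1"]) auto
  next
    case False
    then obtain s' t where "big w c s t s'" "t \<le> T - 2" "Q s' (T - 2 - t)" "2 \<le> T"
      using * by (auto simp: wp_def)
    then show ?thesis
      unfolding wp_def using False big_IfT[of s r w c t s' d]
      by (intro exI[of _ s'] exI[of _ "t + 2"]) (auto simp: add.commute)
  qed
qed

lemmas wp_eqs = wp_Skip_eq wp_Set_eq wp_Mov_eq wp_Inc_eq wp_Dec_eq wp_Sub_eq wp_Inp_eq wp_Get_eq wp_Put_eq
  wp_Seq_eq wp_If_eq

subsection \<open>Frame conditions\<close>

fun mods :: "com \<Rightarrow> nat set" where
  "mods Skip = {}"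
| "mods (Set r x) = {r}"
| "mods (Mov r a) = {r}"
| "mods (Inc r a) = {r}"
| "mods (Dec r a) = {r}"
| "mods (Sub r a b) = {r}"
| "mods (Inp r a) = {r}"
| "mods (Get r k i j) = {r}"
| "mods (Put k i j a) = {}"
| "mods (c ;; d) = mods c \<union> mods d"
| "mods (If r c d) = mods c \<union> mods d"
| "mods (While r c) = mods c"

fun arrs :: "com \<Rightarrow> nat set" where
  "arrs (Put k i j a) = {k}"
| "arrs (c ;; d) = arrs c \<union> arrs d"
| "arrs (If r c d) = arrs c \<union> arrs d"
| "arrs (While r c) = arrs c"
| "arrs _ = {}"

text \<open>Purely syntactic: a whole array counts as changed as soon as the program may write one
  of its cells.\<close>

definition frame :: "com \<Rightarrow> st \<Rightarrow> st \<Rightarrow> bool" where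
  "frame c s s' \<longleftrightarrow> (\<forall>r. r \<notin> mods c \<longrightarrow> rg s' r = rg s r) \<and> (\<forall>k. k \<notin> arrs c \<longrightarrow> ar s' k = ar s k)"

lemma ar_put_other: "k' \<noteq> k \<Longrightarrow> ar (put k i j x s) k' = ar s k'"
  by (auto simp: fun_eq_iff)

lemma big_frame: "big w c s t s' \<Longrightarrow> frame c s s'"
  by (induction rule: big.induct) (auto simp: frame_def ar_put_other)

lemma frame_refl [simp]: "frame c s s"
  by (simp add: frame_def)

lemma frame_rg: "frame c s s' \<Longrightarrow> r \<notin> mods c \<Longrightarrow> rg s' r = rg s r"
  and frame_ar: "frame c s s' \<Longrightarrow> k \<notin> arrs c \<Longrightarrow> ar s' k = ar s k"
  by (simp_all add: frame_def)

text \<open>The rule of consequence: a subprogram proved with budget \<open>t\<close> may run with a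
  larger one, the surplus is returned, and whatever it does not write is known to be
  preserved.\<close>

lemma wp_use:
  assumes "wp w c R s t" "t \<le> T" "\<And>s' t'. R s' t' \<Longrightarrow> frame c s s' \<Longrightarrow> Q s' (t' + (T - t))"
  shows "wp w c Q s T"
proof -
  obtain s' u where u: "big w c s u s'" "u \<le> t" "R s' (t - u)" using assms(1) by (auto simp: wp_def)
  have "Q s' ((t - u) + (T - t))" using assms(3) u big_frame by blast
  moreover have "(t - u) + (T - t) = T - u" using u assms(2) by simp
  ultimately show ?thesis unfolding wp_def using u assms(2) by (metis le_trans)
qed

text \<open>Loops test only for zero, so \<open>c\<close> holds the number of remaining rounds while
  \<open>v\<close> counts upwards.\<close>

definition for_loop :: "nat \<Rightarrow> nat \<Rightarrow> nat \<Rightarrow> com \<Rightarrow> com" where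
  "for_loop v c l body = Set v 0 ;; Sub c l v ;; While c (body ;; Inc v v ;; Sub c l v)"

lemma mods_for [simp]: "mods (for_loop v c l body) = {v, c} \<union> mods body"
  and arrs_for [simp]: "arrs (for_loop v c l body) = arrs body"
  by (auto simp: for_loop_def)

lemma wfc_for [simp]: "wfc (for_loop v c l body) \<longleftrightarrow> user v \<and> user c \<and> user l \<and> wfc body"
  by (auto simp: for_loop_def)

text \<open>\<open>J k s T\<close> is the invariant before iteration \<open>k\<close>, with \<open>T\<close> the credit saved for the remaining iterations.\<close>

lemma wp_for:
  assumes regs: "v \<noteq> c" "v \<noteq> l" "c \<noteq> l" "l \<notin> mods body" "v \<notin> mods body"
    and init: "J 0 s T0"
    and stable: "\<And>k s s' T. J k s T \<Longrightarrow> ar s' = ar s \<Longrightarrow> (\<And>r. r \<noteq> v \<Longrightarrow> r \<noteq> c \<Longrightarrow> rg s' r = rg s r) \<Longrightarrow> J k s' T"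
    and body: "\<And>k s' T'. k < rg s l \<Longrightarrow> J k s' T' \<Longrightarrow> rg s' v = k \<Longrightarrow> frame (for_loop v c l body) s s' \<Longrightarrow>
      wp w body (J (Suc k)) s' (b + T')"
    and post: "\<And>s' T'. J (rg s l) s' T' \<Longrightarrow> frame (for_loop v c l body) s s' \<Longrightarrow> Q s' T'"
    and T: "T = T0 + (rg s l * (b + 4) + 3)"
  shows "wp w (for_loop v c l body) Q s T"
proof -
  let ?n = "rg s l" and ?fr = "frame (for_loop v c l body) s"
  \<comment> \<open>A round costs the body plus 4: two steps of the loop, the increment and the
    subtraction. The final 1 pays for the failing test.\<close>
  define I where "I s' T' \<longleftrightarrow> (\<exists>k T''. k \<le> ?n \<and> J k s' T'' \<and> rg s' v = k \<and> rg s' c = ?n - k \<and> ?fr s' \<and>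
    T' = T'' + (?n - k) * (b + 4) + 1)" for s' T'
  have st: "J k (upd c x (upd v y s')) T" if "J k s' T" for k s' T x y
    using that by (rule stable) auto
  have fr: "?fr (upd c x (upd v y s'))" if "?fr s'" for x y s'
    using that by (auto simp: frame_def)
  have wh: "wp w (While c (body ;; Inc v v ;; Sub c l v)) Q s' T'" if "I s' T'" for s' T'
    using that
  proof (rule wp_While)
    fix s' T' assume "I s' T'" "rg s' c \<noteq> 0"
    then obtain k T'' where k: "k < ?n" "J k s' T''" "rg s' v = k" "?fr s'" "T' = T'' + (?n - k) * (b + 4) + 1"
      by (auto simp: I_def)
    obtain m where m: "?n - k = Suc m" using k(1) by (metis Suc_diff_Suc)
    have "wp w body (J (Suc k)) s' (b + T'')" by (rule body[OF k(1-4)])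
    then have "wp w body (wp w (Inc v v ;; Sub c l v) I) s' (T' - 2)"
    proof (rule wp_use)
      show "b + T'' \<le> T' - 2" using k(5) m by simp
      fix s1 t assume s1: "J (Suc k) s1 t" "frame body s' s1"
      have "?fr s1" using k(4) s1(2) by (auto simp: frame_def)
      moreover have "rg s1 v = k" "rg s1 l = ?n"
        using frame_rg[OF s1(2)] frame_rg[OF k(4)] regs k(3) by auto
      moreover have "I (upd c (?n - Suc k) (upd v (Suc k) s1)) (t + m * (b + 4) + 1)"
        unfolding I_def
        by (rule exI[of _ "Suc k"], rule exI[of _ t]) (use st[OF s1(1)] fr[OF \<open>?fr s1\<close>] k(1) m regs in auto)
      ultimately show "wp w (Inc v v ;; Sub c l v) I s1 (t + (T' - 2 - (b + T'')))"
        using k(5) m regs by (simp add: wp_eqs)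
    qed
    then show "2 \<le> T' \<and> wp w (body ;; Inc v v ;; Sub c l v) I s' (T' - 2)"
      using k(5) m by (simp add: wp_Seq_eq)
  next
    fix s' T' assume "I s' T'" "rg s' c = 0"
    then obtain T'' where "J ?n s' T''" "?fr s'" "T' = T'' + 1"
      by (auto simp: I_def)
    then show "1 \<le> T' \<and> Q s' (T' - 1)" using post by simp
  qed
  let ?s = "upd c ?n (upd v 0 s)"
  have "I ?s (T0 + ?n * (b + 4) + 1)"
    unfolding I_def
    by (rule exI[of _ 0], rule exI[of _ T0]) (use st[OF init] fr[of s] regs in auto)
  then have "wp w (While c (body ;; Inc v v ;; Sub c l v)) Q ?s (T0 + ?n * (b + 4) + 1)"
    by (rule wh)
  then show ?thesis
    unfolding for_loop_def wp_eqs using T regs by simp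
qed

section \<open>The input of the machine\<close>

text \<open>The address table supplies both ends: cell \<open>1 + x\<close> holds the start of the
  list of \<open>x\<close>, and the next cell its end. Register \<open>c\<close> counts the entries
  left.\<close>

definition for_adj :: "nat \<Rightarrow> nat \<Rightarrow> nat \<Rightarrow> nat \<Rightarrow> nat \<Rightarrow> com \<Rightarrow> com" where
  "for_adj x p e c u body = Inc p x ;; Inc e p ;; Inp p p ;; Inp e e ;; Sub c e p ;;
     While c (Inp u p ;; body ;; Inc p p ;; Sub c e p)"

lemma mods_adj [simp]: "mods (for_adj x p e c u body) = {p, e, c, u} \<union> mods body"
  and arrs_adj [simp]: "arrs (for_adj x p e c u body) = arrs body"
  by (auto simp: for_adj_def)

lemma wfc_adj [simp]: "wfc (for_adj x p e c u body) \<longleftrightarrow> user x \<and> user p \<and> user e \<and> user c \<and> user u \<and> wfc body"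
  by (auto simp: for_adj_def)

lemma input_words_start: "v \<le> length al \<Longrightarrow>
    input_words al ! Suc v = length al + 2 + length (concat (take v al))"
  by (simp add: input_words_def nth_append del: upt_Suc)

lemma length_input_words: "length (input_words al) = length al + 2 + length (concat al)"
  by (simp add: input_words_def)

lemma concat_split:
  assumes "v < length al"
  shows "concat al = concat (take v al) @ al ! v @ concat (drop (Suc v) al)"
  using id_take_nth_drop[OF assms] by (metis concat.simps(2) concat_append)

lemma input_words_entry:
  assumes "v < length al" "k < length (al ! v)"
  shows "length al + 2 + length (concat (take v al)) + k < length (input_words al)"
    and "input_words al ! (length al + 2 + length (concat (take v al)) + k) = al ! v ! k"
proof -
  show "length al + 2 + length (concat (take v al)) + k < length (input_words al)"
    unfolding length_input_words using concat_split[OF assms(1)] assms(2) by (metis add_less_mono1 length_append nat_add_left_cancel_less trans_less_add1 add.assoc)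
  have "input_words al ! (length al + 2 + length (concat (take v al)) + k) = concat al ! (length (concat (take v al)) + k)"
    by (simp add: input_words_def nth_append del: upt_Suc)
  also have "\<dots> = al ! v ! k"
    using assms by (subst concat_split[OF assms(1)]) (simp add: nth_append)
  finally show "input_words al ! (length al + 2 + length (concat (take v al)) + k) = al ! v ! k" .
qed

text \<open>A list entry costs the body plus 5: two steps of the loop, reading the entry, increment
  and subtraction. The credit \<open>T0\<close> is handed to the invariant, to be spent unevenly
  over the rounds.\<close>

lemma wp_adj:
  assumes regs: "distinct [p, e, c, u]" "p \<notin> mods body" "e \<notin> mods body" "x \<notin> {p, e, c, u}"
    and x: "rg s x < length al"
    and init: "J 0 s T0"
    and stable: "\<And>k s s' T. J k s T \<Longrightarrow> ar s' = ar s \<Longrightarrow> (\<And>r. r \<notin> {p, e, c, u} \<Longrightarrow> rg s' r = rg s r) \<Longrightarrow> J k s' T"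
    and body: "\<And>k s' T'. k < length (al ! rg s x) \<Longrightarrow> J k s' T' \<Longrightarrow> rg s' u = al ! rg s x ! k \<Longrightarrow>
      frame (for_adj x p e c u body) s s' \<Longrightarrow> wp (input_words al) body (J (Suc k)) s' (b + T')"
    and post: "\<And>s' T'. J (length (al ! rg s x)) s' T' \<Longrightarrow> frame (for_adj x p e c u body) s s' \<Longrightarrow> Q s' T'"
    and T: "T = T0 + (length (al ! rg s x) * (b + 5) + 6)"
  shows "wp (input_words al) (for_adj x p e c u body) Q s T"
proof -
  let ?w = "input_words al" and ?v = "rg s x"
  let ?n = "length (al ! ?v)" and ?fr = "frame (for_adj x p e c u body) s"
  let ?a = "length al + 2 + length (concat (take ?v al))"
  have neq: "e \<noteq> p" "c \<noteq> p" "c \<noteq> e" "u \<noteq> p" "u \<noteq> e" "u \<noteq> c" using regs(1) by auto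
  define I where "I s' T' \<longleftrightarrow> (\<exists>k T''. k \<le> ?n \<and> J k s' T'' \<and> rg s' p = ?a + k \<and> rg s' e = ?a + ?n \<and>
    rg s' c = ?n - k \<and> ?fr s' \<and> T' = T'' + (?n - k) * (b + 5) + 1)" for s' T'
  have wh: "wp ?w (While c (Inp u p ;; body ;; Inc p p ;; Sub c e p)) Q s' T'" if "I s' T'" for s' T'
    using that
  proof (rule wp_While)
    fix s' T' assume "I s' T'" "rg s' c \<noteq> 0"
    then obtain k T'' where k: "k < ?n" "J k s' T''" "rg s' p = ?a + k" "rg s' e = ?a + ?n" "?fr s'"
      "T' = T'' + (?n - k) * (b + 5) + 1"
      by (auto simp: I_def)
    obtain m where m: "?n - k = Suc m" using k(1) by (metis Suc_diff_Suc)
    let ?s1 = "upd u (al ! ?v ! k) s'"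
    have fr1: "?fr ?s1" using k(5) by (auto simp: frame_def)
    have J1: "J k ?s1 T''" by (rule stable[OF k(2)]) auto
    have "wp ?w body (J (Suc k)) ?s1 (b + T'')"
      by (rule body[OF k(1) J1 _ fr1]) simp
    then have "wp ?w body (wp ?w (Inc p p ;; Sub c e p) I) ?s1 (T' - 3)"
    proof (rule wp_use)
      show "b + T'' \<le> T' - 3" using k(6) m by simp
      fix s2 t assume s2: "J (Suc k) s2 t" "frame body ?s1 s2"
      have fr2: "?fr s2" using fr1 s2(2) by (auto simp: frame_def)
      have pe: "rg s2 p = ?a + k" "rg s2 e = ?a + ?n"
        using frame_rg[OF s2(2)] regs k(3,4) by auto
      let ?s3 = "upd c (?n - Suc k) (upd p (Suc (?a + k)) s2)"
      have m2: "?n - Suc k = m" using m by linarith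
      have J3: "J (Suc k) ?s3 t" by (rule stable[OF s2(1)]) auto
      have fr3: "?fr ?s3" using fr2 by (auto simp: frame_def)
      have "I ?s3 (t + m * (b + 5) + 1)"
        unfolding I_def
        by (rule exI[of _ "Suc k"], rule exI[of _ t]) (use J3 fr3 k(1) m2 pe regs in auto)
      then show "wp ?w (Inc p p ;; Sub c e p) I s2 (t + (T' - 3 - (b + T'')))"
        using k(6) m m2 pe regs neq by (simp add: wp_eqs add.assoc)
    qed
    then show "2 \<le> T' \<and> wp ?w (Inp u p ;; body ;; Inc p p ;; Sub c e p) I s' (T' - 2)"
      using k(3,6) m input_words_entry[OF x k(1)] by (simp add: wp_eqs)
  next
    fix s' T' assume "I s' T'" "rg s' c = 0"
    then obtain T'' where "J ?n s' T''" "?fr s'" "T' = T'' + 1"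
      by (auto simp: I_def)
    then show "1 \<le> T' \<and> Q s' (T' - 1)" using post by simp
  qed
  have ends: "?w ! Suc (Suc ?v) = ?a + ?n" "?w ! Suc ?v = ?a"
    using input_words_start[of "Suc ?v" al] input_words_start[of ?v al] x
    by (simp_all add: take_Suc_conv_app_nth)
  have len: "Suc (Suc ?v) < length ?w" "Suc ?v < length ?w"
    using x by (simp_all add: length_input_words)
  let ?s1 = "upd c ?n (upd e (?a + ?n) (upd p ?a (upd e (Suc (Suc ?v)) (upd p (Suc ?v) s))))"
  have J1: "J 0 ?s1 T0" by (rule stable[OF init]) auto
  have fr1: "?fr ?s1" by (auto simp: frame_def)
  have "I ?s1 (T0 + ?n * (b + 5) + 1)"
    unfolding I_def by (rule exI[of _ 0], rule exI[of _ T0]) (use J1 fr1 regs in auto)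
  then have "wp ?w (While c (Inp u p ;; body ;; Inc p p ;; Sub c e p)) Q ?s1 (T0 + ?n * (b + 5) + 1)"
    by (rule wh)
  then show ?thesis
    unfolding for_adj_def wp_eqs using T regs neq ends len by simp
qed

lemma wp_seq:
  assumes "wp w c (\<lambda>s' _. R s') s t" "t \<le> T"
    and "\<And>s'. R s' \<Longrightarrow> frame c s s' \<Longrightarrow> wp w d (\<lambda>s' _. Q s') s' (T - t)"
  shows "wp w (c ;; d) (\<lambda>s' _. Q s') s T"
  unfolding wp_Seq_eq
proof (rule wp_use[OF assms(1,2)])
  fix s' t' assume "R s'" "frame c s s'"
  then show "wp w d (\<lambda>s' _. Q s') s' (t' + (T - t))"
    by (intro wp_use[OF assms(3)]) auto
qed

lemma wp_weaken:
  assumes "wp w c (\<lambda>s' _. R s') s t" "t \<le> T" "\<And>s'. R s' \<Longrightarrow> frame c s s' \<Longrightarrow> Q s'"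
  shows "wp w c (\<lambda>s' _. Q s') s T"
  using assms(1,2) by (rule wp_use) (use assms(3) in auto)

text \<open>For bodies whose cost varies with the round, such as the degree of vertex
  \<open>k\<close>. The saved credit is the sum of the costs still to come.\<close>

lemma wp_for_sum:
  assumes regs: "v \<noteq> c" "v \<noteq> l" "c \<noteq> l" "l \<notin> mods body" "v \<notin> mods body"
    and init: "I 0 s"
    and stable: "\<And>k s s'. I k s \<Longrightarrow> ar s' = ar s \<Longrightarrow> (\<And>r. r \<noteq> v \<Longrightarrow> r \<noteq> c \<Longrightarrow> rg s' r = rg s r) \<Longrightarrow> I k s'"
    and body: "\<And>k s'. k < rg s l \<Longrightarrow> I k s' \<Longrightarrow> rg s' v = k \<Longrightarrow> frame (for_loop v c l body) s s' \<Longrightarrow>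
      wp w body (\<lambda>s' _. I (Suc k) s') s' (b + g k)"
    and post: "\<And>s'. I (rg s l) s' \<Longrightarrow> frame (for_loop v c l body) s s' \<Longrightarrow> Q s'"
    and T: "(\<Sum>k<rg s l. g k) + (rg s l * (b + 4) + 3) \<le> T"
  shows "wp w (for_loop v c l body) (\<lambda>s' _. Q s') s T"
proof -
  have "wp w (for_loop v c l body) (\<lambda>s' _. Q s') s (sum g {0..<rg s l} + (rg s l * (b + 4) + 3))"
  proof (rule wp_for[where J = "\<lambda>k s' T. I k s' \<and> sum g {k..<rg s l} \<le> T"])
    fix k s' T' assume *: "k < rg s l" "I k s' \<and> sum g {k..<rg s l} \<le> T'" "rg s' v = k" "frame (for_loop v c l body) s s'"
    have "sum g {k..<rg s l} = g k + sum g {Suc k..<rg s l}" using *(1) by (simp add: sum.atLeast_Suc_lessThan)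
    then show "wp w body (\<lambda>s' T. I (Suc k) s' \<and> sum g {Suc k..<rg s l} \<le> T) s' (b + T')"
      using *(2) by (intro wp_use[OF body[OF *(1) _ *(3,4)]]) auto
  qed (use regs init post in \<open>auto intro: stable\<close>)
  then show ?thesis by (rule wp_weaken) (use T in \<open>auto simp: lessThan_atLeast0\<close>)
qed

lemma wp_for_const:
  assumes regs: "v \<noteq> c" "v \<noteq> l" "c \<noteq> l" "l \<notin> mods body" "v \<notin> mods body"
    and init: "I 0 s"
    and stable: "\<And>k s s'. I k s \<Longrightarrow> ar s' = ar s \<Longrightarrow> (\<And>r. r \<noteq> v \<Longrightarrow> r \<noteq> c \<Longrightarrow> rg s' r = rg s r) \<Longrightarrow> I k s'"
    and body: "\<And>k s'. k < rg s l \<Longrightarrow> I k s' \<Longrightarrow> rg s' v = k \<Longrightarrow> frame (for_loop v c l body) s s' \<Longrightarrow>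
      wp w body (\<lambda>s' _. I (Suc k) s') s' b"
    and post: "\<And>s'. I (rg s l) s' \<Longrightarrow> frame (for_loop v c l body) s s' \<Longrightarrow> Q s'"
    and T: "rg s l * (b + 4) + 3 \<le> T"
  shows "wp w (for_loop v c l body) (\<lambda>s' _. Q s') s T"
  by (rule wp_for_sum[where I = I and g = "\<lambda>_. 0" and b = b]) (use assms in auto)

lemma wp_adj_const:
  assumes regs: "distinct [p, e, c, u]" "p \<notin> mods body" "e \<notin> mods body" "x \<notin> {p, e, c, u}"
    and x: "rg s x < length al"
    and init: "I 0 s"
    and stable: "\<And>k s s'. I k s \<Longrightarrow> ar s' = ar s \<Longrightarrow> (\<And>r. r \<notin> {p, e, c, u} \<Longrightarrow> rg s' r = rg s r) \<Longrightarrow> I k s'"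
    and body: "\<And>k s'. k < length (al ! rg s x) \<Longrightarrow> I k s' \<Longrightarrow> rg s' u = al ! rg s x ! k \<Longrightarrow>
      frame (for_adj x p e c u body) s s' \<Longrightarrow> wp (input_words al) body (\<lambda>s' _. I (Suc k) s') s' b"
    and post: "\<And>s'. I (length (al ! rg s x)) s' \<Longrightarrow> frame (for_adj x p e c u body) s s' \<Longrightarrow> Q s'"
    and T: "length (al ! rg s x) * (b + 5) + 6 \<le> T"
  shows "wp (input_words al) (for_adj x p e c u body) (\<lambda>s' _. Q s') s T"
proof -
  have "wp (input_words al) (for_adj x p e c u body) (\<lambda>s' _. Q s') s (0 + (length (al ! rg s x) * (b + 5) + 6))"
  proof (rule wp_adj[where J = "\<lambda>k s' _. I k s'"])
    fix k s' T' assume "k < length (al ! rg s x)" "I k s'" "rg s' u = al ! rg s x ! k"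
      "frame (for_adj x p e c u body) s s'"
    from body[OF this] show "wp (input_words al) body (\<lambda>s' _. I (Suc k) s') s' (b + T')"
      by (rule wp_weaken) auto
  qed (use regs x init post in \<open>auto intro: stable\<close>)
  then show ?thesis by (rule wp_weaken) (use T in auto)
qed

section \<open>Linear-time search by buckets, and the visiting order\<close>

section \<open>Bucket search\<close>

text \<open>Register 0 carries the answer; the other names avoid the reserved registers 1 to 10.
  \<open>rZero\<close> keeps the value 0 and is the second index of one-dimensional arrays.\<close>

abbreviation (input) "rRes \<equiv> 0 :: nat"
abbreviation (input) "rN \<equiv> 11 :: nat"
abbreviation (input) "rN1 \<equiv> 12 :: nat"
abbreviation (input) "rZero \<equiv> 13 :: nat"
abbreviation (input) "rI \<equiv> 14 :: nat"
abbreviation (input) "rZ \<equiv> 15 :: nat"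
abbreviation (input) "rBest \<equiv> 16 :: nat"
abbreviation (input) "rV \<equiv> 17 :: nat"
abbreviation (input) "rC \<equiv> 18 :: nat"
abbreviation (input) "rT \<equiv> 19 :: nat"
abbreviation (input) "rT2 \<equiv> 20 :: nat"
abbreviation (input) "rJ \<equiv> 21 :: nat"
abbreviation (input) "rCJ \<equiv> 22 :: nat"
abbreviation (input) "rL \<equiv> 23 :: nat"
abbreviation (input) "rCn \<equiv> 24 :: nat"
abbreviation (input) "rX \<equiv> 25 :: nat"
abbreviation (input) "rP \<equiv> 26 :: nat"
abbreviation (input) "rE \<equiv> 27 :: nat"
abbreviation (input) "rCA \<equiv> 28 :: nat"
abbreviation (input) "rU \<equiv> 29 :: nat"
abbreviation (input) "rKs \<equiv> 30 :: nat"
abbreviation (input) "rOk \<equiv> 31 :: nat"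
abbreviation (input) "rCc \<equiv> 32 :: nat"
abbreviation (input) "rA \<equiv> 33 :: nat"
abbreviation (input) "rH \<equiv> 34 :: nat"
abbreviation (input) "rK \<equiv> 35 :: nat"
abbreviation (input) "rCK \<equiv> 36 :: nat"
abbreviation (input) "rF \<equiv> 37 :: nat"
abbreviation (input) "rNa \<equiv> 38 :: nat"
abbreviation (input) "rNb \<equiv> 39 :: nat"
abbreviation (input) "rIC \<equiv> 40 :: nat"

text \<open>\<open>aPos\<close> stores the position plus one, so that 0 means unvisited.
  \<open>aR\<close> marks blocked and reached vertices, \<open>aBk\<close> at \<open>(t, k)\<close>
  is entry \<open>k\<close> of bucket \<open>t\<close>, \<open>aA\<close> and \<open>aH\<close> mark
  an atom and its non-universal part, \<open>aM\<close> and \<open>aD\<close> hold the matrix and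
  the degrees of the reduction, \<open>aDead\<close> the removed vertices.\<close>

abbreviation (input) "aPos \<equiv> 0 :: nat"
abbreviation (input) "aW \<equiv> 1 :: nat"
abbreviation (input) "aR \<equiv> 2 :: nat"
abbreviation (input) "aKey \<equiv> 3 :: nat"
abbreviation (input) "aF \<equiv> 4 :: nat"
abbreviation (input) "aBk \<equiv> 5 :: nat"
abbreviation (input) "aCnt \<equiv> 6 :: nat"
abbreviation (input) "aOrd \<equiv> 7 :: nat"
abbreviation (input) "aA \<equiv> 8 :: nat"
abbreviation (input) "aH \<equiv> 9 :: nat"
abbreviation (input) "aM \<equiv> 10 :: nat"
abbreviation (input) "aD \<equiv> 11 :: nat"
abbreviation (input) "aDead \<equiv> 12 :: nat"

abbreviation "GetV r k i \<equiv> Get r k i rZero"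
abbreviation "PutV k i r \<equiv> Put k i rZero r"

text \<open>A new vertex goes into the bucket given by the maximum of its key and the current level.
  If its key is larger, it has been reached through smaller keys and is flagged; as levels ascend,
  the first discovery decides this.\<close>

definition discover :: com where
  "discover = GetV rT aR rU ;;
     If rT Skip
      (Set rT 1 ;; PutV aR rU rT ;; GetV rT aKey rU ;; Sub rT2 rT rJ ;;
       If rT2 (Set rT2 1 ;; PutV aF rU rT2) (Mov rT rJ) ;;
       GetV rT2 aCnt rT ;; Put aBk rT rT2 rU ;; Inc rT2 rT2 ;; PutV aCnt rT rT2)"

text \<open>Buckets are stacks. The size is read again after the scan because new vertices may have
  entered the current bucket.\<close>

definition expand :: com where
  "expand = Dec rCn rCn ;; PutV aCnt rJ rCn ;; Get rX aBk rJ rCn ;;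
     for_adj rX rP rE rCA rU discover ;; GetV rCn aCnt rJ"

definition level_body :: com where
  "level_body = GetV rCn aCnt rJ ;; While rCn expand"

text \<open>Expands the vertices reached from \<open>z\<close> in the order of their keys, for keys below the
  content of \<open>rL\<close>; array \<open>aF\<close> marks the vertices first reached through vertices of smaller key.\<close>

definition search :: com where
  "search = for_loop rV rC rN1 (PutV aCnt rV rZero) ;;
     Put aBk rZero rZero rZ ;; Set rT 1 ;; PutV aCnt rZero rT ;;
     for_loop rJ rCJ rL level_body"

lemma mods_discover [simp]: "mods discover = {rT, rT2}" "arrs discover = {aR, aF, aBk, aCnt}"
  by (auto simp: discover_def)

lemma mods_level [simp]: "mods level_body = {rCn, rX, rP, rE, rCA, rU, rT, rT2}" "arrs level_body = {aR, aF, aBk, aCnt}"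
  by (auto simp: level_body_def expand_def)

lemma mods_search [simp]: "mods search = {rV, rC, rT, rJ, rCJ, rCn, rX, rP, rE, rCA, rU, rT2}"
  "arrs search = {aR, aF, aBk, aCnt}"
  by (auto simp: search_def)

text \<open>Vertices of key below \<open>j\<close> are passed through, others are only reached, and
  blocked ones are never entered. With weight plus one as key this is \<open>below\<close>; with
  keys 0 and 1 it gives a piece with its border.\<close>

inductive_set reach :: "('a \<Rightarrow> 'a \<Rightarrow> bool) \<Rightarrow> ('a \<Rightarrow> bool) \<Rightarrow> ('a \<Rightarrow> nat) \<Rightarrow> 'a \<Rightarrow> nat \<Rightarrow> 'a set"
  for E bl key z j where
  reach_start: "z \<in> reach E bl key z j"
| reach_step: "v \<in> reach E bl key z j \<Longrightarrow> key v < j \<Longrightarrow> E v u \<Longrightarrow> \<not> bl u \<Longrightarrow> u \<in> reach E bl key z j"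

lemma reach_mono: "u \<in> reach E bl key z j \<Longrightarrow> j \<le> j' \<Longrightarrow> u \<in> reach E bl key z j'"
  by (induction rule: reach.induct) (auto intro: reach.intros)

locale machine_input =
  fixes al :: "nat list list" and n :: nat and E :: "nat \<Rightarrow> nat \<Rightarrow> bool"
  assumes n: "n = length al" and al: "v < n \<Longrightarrow> distinct (al ! v) \<and> set (al ! v) = {u. E v u}"
    and E_n: "E u v \<Longrightarrow> u < n \<and> v < n"
    and E_sym: "E u v \<Longrightarrow> E v u" and E_irr: "\<not> E v v"
begin

abbreviation "deg v \<equiv> length (al ! v)"
abbreviation "wpi \<equiv> wp (input_words al)"

definition M :: nat where "M = (\<Sum>v<n. deg v)"

lemma deg_card: "v < n \<Longrightarrow> deg v = card {u. E v u}"
  using al by (metis distinct_card)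

lemma nth_al: "v < n \<Longrightarrow> k < deg v \<Longrightarrow> E v (al ! v ! k)"
  using al by (metis mem_Collect_eq nth_mem)

end

text \<open>The start is blocked, so it is never discovered a second time, and its key 0 puts it
  into the lowest level.\<close>

locale search_run = machine_input +
  fixes bl :: "nat \<Rightarrow> bool" and key :: "nat \<Rightarrow> nat" and z :: nat
  assumes z: "z < n" "bl z" "key z = 0" and key_n: "v < n \<Longrightarrow> key v \<le> n"
begin

abbreviation "X \<equiv> reach E bl key z"

definition seen :: "st \<Rightarrow> nat set" where
  "seen s = {v. v < n \<and> (v = z \<or> ar s aR v 0 \<noteq> 0 \<and> \<not> bl v)}"

definition pending :: "st \<Rightarrow> nat \<Rightarrow> bool" where
  "pending s v \<longleftrightarrow> (\<exists>t\<le>n. \<exists>k<ar s aCnt t 0. ar s aBk t k = v)"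

definition base :: "st \<Rightarrow> bool" where
  "base s \<longleftrightarrow> rg s rN = n \<and> rg s rZero = 0 \<and> (\<forall>v<n. ar s aKey v 0 = key v) \<and>
     (\<forall>v<n. bl v \<longrightarrow> ar s aR v 0 \<noteq> 0)"

text \<open>Bucket \<open>j\<close> may hold smaller keys, since vertices reached late are expanded
  at the current level. Injectivity over all buckets ensures that taking out an entry ends the
  pending state of its vertex.\<close>

definition buckets :: "nat \<Rightarrow> st \<Rightarrow> bool" where
  "buckets j s \<longleftrightarrow>
     (\<forall>t\<le>n. \<forall>k<ar s aCnt t 0. ar s aBk t k \<in> seen s \<and> j \<le> t \<and>
        (if t = j then key (ar s aBk t k) \<le> j else key (ar s aBk t k) = t)) \<and>
     (\<forall>t\<le>n. \<forall>t'\<le>n. \<forall>k<ar s aCnt t 0. \<forall>k'<ar s aCnt t' 0. ar s aBk t k = ar s aBk t' k' \<longrightarrow> t = t' \<and> k = k')"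

definition flags :: "nat \<Rightarrow> st \<Rightarrow> bool" where
  "flags j s \<longleftrightarrow> X j \<subseteq> seen s \<and> seen s \<subseteq> X (Suc j) \<and> z \<in> seen s \<and>
     (\<forall>v<n. ar s aF v 0 = (if v \<in> seen s \<and> v \<noteq> z \<and> v \<in> X (key v) then 1 else 0))"

text \<open>\<open>D v\<close> is the set of neighbours of an expanded vertex \<open>v\<close> that have been processed.\<close>

definition closed :: "nat \<Rightarrow> (nat \<Rightarrow> nat set) \<Rightarrow> st \<Rightarrow> bool" where
  "closed j D s \<longleftrightarrow> (\<forall>v\<in>seen s. \<not> pending s v \<longrightarrow> key v \<le> j \<and> (\<forall>u\<in>D v. \<not> bl u \<longrightarrow> u \<in> seen s))"

definition inv :: "nat \<Rightarrow> (nat \<Rightarrow> nat set) \<Rightarrow> st \<Rightarrow> bool" where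
  "inv j D s \<longleftrightarrow> base s \<and> buckets j s \<and> flags j s \<and> closed j D s"

text \<open>The savings of all vertices not yet expanded, seen or unseen. A neighbour costs 101 for
  \<open>discover\<close> and 5 for the list; 70 covers the fixed part of an expansion.\<close>

definition credit :: "st \<Rightarrow> nat" where
  "credit s = (\<Sum>v\<in>{v. v < n \<and> (v \<in> seen s \<longrightarrow> pending s v)}. 106 * deg v + 70)"

lemma inv_cong:
  assumes "inv j D s" "ar s' = ar s" "rg s' rN = rg s rN" "rg s' rZero = rg s rZero"
  shows "inv j D s'"
proof -
  have "seen s' = seen s" "pending s' = pending s"
    unfolding seen_def pending_def fun_eq_iff assms(2) by auto
  then show ?thesis
    using assms(1) unfolding inv_def base_def buckets_def flags_def closed_def assms(2-4) by simp
qed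

lemma credit_cong: "ar s' = ar s \<Longrightarrow> credit s' = credit s"
  unfolding credit_def seen_def pending_def by simp

lemma seen_n: "v \<in> seen s \<Longrightarrow> v < n"
  by (simp add: seen_def)

text \<open>The vertex changes from unseen to pending. Either way it is not expanded, so the credit
  stays the same.\<close>

lemma push:
  assumes I: "inv j D s" and u: "u < n" "ar s aR u 0 = 0" and t: "t = max j (key u)" "t \<le> n"
    and ux: "u \<in> X (Suc j)"
    and R: "\<And>v. ar s' aR v 0 = (if v = u then 1 else ar s aR v 0)"
    and F: "\<And>v. ar s' aF v 0 = (if v = u \<and> j < key u then 1 else ar s aF v 0)"
    and Bk: "\<And>t' k. ar s' aBk t' k = (if t' = t \<and> k = ar s aCnt t 0 then u else ar s aBk t' k)"
    and Cnt: "\<And>t'. ar s' aCnt t' 0 = (if t' = t then Suc (ar s aCnt t 0) else ar s aCnt t' 0)"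
    and rest: "ar s' aKey = ar s aKey" "rg s' rN = rg s rN" "rg s' rZero = rg s rZero"
  shows "inv j D s'" "seen s' = insert u (seen s)" "credit s' = credit s" "\<And>v. v \<noteq> u \<Longrightarrow> pending s' v = pending s v"
proof -
  have B: "base s" "buckets j s" "flags j s" "closed j D s" using I by (auto simp: inv_def)
  have nbl: "\<not> bl u" using B(1) u by (auto simp: base_def)
  have uz: "u \<noteq> z" using nbl z by auto
  have unseen: "u \<notin> seen s" using u uz by (simp add: seen_def)
  show seen: "seen s' = insert u (seen s)"
    using u nbl by (auto simp: seen_def R)
  show pend: "pending s' v = pending s v" if "v \<noteq> u" for v
  proof
    assume "pending s' v"
    then obtain t' k where tk: "t' \<le> n" "k < ar s' aCnt t' 0" "ar s' aBk t' k = v" by (auto simp: pending_def)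
    then have "\<not> (t' = t \<and> k = ar s aCnt t 0)" using that by (auto simp: Bk)
    then have "k < ar s aCnt t' 0" "ar s aBk t' k = v" using tk by (auto simp: Bk Cnt split: if_splits)
    then show "pending s v" using tk(1) by (auto simp: pending_def)
  next
    assume "pending s v"
    then obtain t' k where tk: "t' \<le> n" "k < ar s aCnt t' 0" "ar s aBk t' k = v" by (auto simp: pending_def)
    then have "k < ar s' aCnt t' 0" "ar s' aBk t' k = v" by (auto simp: Bk Cnt)
    then show "pending s' v" using tk(1) by (auto simp: pending_def)
  qed
  have pend_u: "pending s' u"
    unfolding pending_def Bk Cnt using t(2) by (intro exI[of _ t] conjI exI[of _ "ar s aCnt t 0"]) auto
  have "\<And>v. v < n \<and> (v \<in> seen s' \<longrightarrow> pending s' v) \<longleftrightarrow> v < n \<and> (v \<in> seen s \<longrightarrow> pending s v)"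
    using seen pend pend_u unseen by (metis insert_iff)
  then show "credit s' = credit s" by (simp add: credit_def)
  have "base s'" using B(1) rest by (auto simp: base_def R)
  moreover have "buckets j s'"
    unfolding buckets_def
  proof (intro conjI allI impI)
    fix t' k assume tk: "t' \<le> n" "k < ar s' aCnt t' 0"
    have old: "ar s aBk t' k \<in> seen s" "j \<le> t'"
        "if t' = j then key (ar s aBk t' k) \<le> j else key (ar s aBk t' k) = t'"
      if "k < ar s aCnt t' 0" using B(2) tk(1) that unfolding buckets_def by blast+
    have "t' = t \<and> k = ar s aCnt t 0 \<or> k < ar s aCnt t' 0 \<and> \<not> (t' = t \<and> k = ar s aCnt t 0)"
      using tk by (auto simp: Cnt split: if_splits)
    then show "ar s' aBk t' k \<in> seen s'" "j \<le> t'"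
        "if t' = j then key (ar s' aBk t' k) \<le> j else key (ar s' aBk t' k) = t'"
      using old t unfolding seen Bk by (auto simp: max_def split: if_splits)
  next
    fix t1 t2 k1 k2
    assume tk: "t1 \<le> n" "t2 \<le> n" "k1 < ar s' aCnt t1 0" "k2 < ar s' aCnt t2 0"
      and eq: "ar s' aBk t1 k1 = ar s' aBk t2 k2"
    have old: "t1 = t2 \<and> k1 = k2"
      if "k1 < ar s aCnt t1 0" "k2 < ar s aCnt t2 0" "ar s aBk t1 k1 = ar s aBk t2 k2"
      using B(2) tk(1,2) that unfolding buckets_def by blast
    have nu: "ar s aBk t' k \<noteq> u" if "t' \<le> n" "k < ar s aCnt t' 0" for t' k
      using B(2) that unseen unfolding buckets_def by blast
    have c: "t' = t \<and> k = ar s aCnt t 0 \<or> k < ar s aCnt t' 0 \<and> \<not> (t' = t \<and> k = ar s aCnt t 0)"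
      if "k < ar s' aCnt t' 0" for t' k
      using that by (auto simp: Cnt split: if_splits)
    have "t1 = t2 \<and> k1 = k2"
      using c[OF tk(3)] c[OF tk(4)] eq old nu[OF tk(1)] nu[OF tk(2)] unfolding Bk
      by (auto split: if_splits)
    then show "t1 = t2" "k1 = k2" by auto
  qed
  moreover have "flags j s'"
  proof -
    have f: "X j \<subseteq> seen s" "seen s \<subseteq> X (Suc j)" "z \<in> seen s"
      "\<And>v. v < n \<Longrightarrow> ar s aF v 0 = (if v \<in> seen s \<and> v \<noteq> z \<and> v \<in> X (key v) then 1 else 0)"
      using B(3) by (auto simp: flags_def)
    have "u \<notin> X j" using f(1) unseen by auto
    \<comment> \<open>\<open>u\<close> lies in \<open>X (Suc j)\<close> but not in
      \<open>X j\<close>, and \<open>X\<close> is monotone in the threshold.\<close>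
    then have "u \<in> X (key u) \<longleftrightarrow> j < key u"
      using ux reach_mono[of u E bl key z "Suc j" "key u"] reach_mono[of u E bl key z "key u" j]
      by (meson Suc_leI not_le)
    then have "ar s' aF v 0 = (if v \<in> seen s' \<and> v \<noteq> z \<and> v \<in> X (key v) then 1 else 0)" if "v < n" for v
      using f(4)[OF that] uz unseen unfolding F seen by auto
    then show ?thesis
      unfolding flags_def using f ux by (auto simp: seen)
  qed
  moreover have "closed j D s'"
    using B(4) pend pend_u unfolding closed_def seen by (metis insert_iff)
  ultimately show "inv j D s'" by (simp add: inv_def)
qed

lemma discover_correct:
  assumes I: "inv j D s" and j: "rg s rJ = j" "j \<le> n" and u: "rg s rU = u" "E x u"
    and x: "x \<in> seen s" "key x \<le> j" "\<not> pending s x"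
  shows "wpi discover (\<lambda>s' T. inv j (D(x := insert u (D x))) s' \<and> x \<in> seen s' \<and> \<not> pending s' x \<and>
     credit s' + T0 \<le> T) s (101 + (credit s + T0))"
proof -
  have un: "u < n" using E_n u(2) by simp
  have B: "base s" "buckets j s" "flags j s" "closed j D s" using I by (auto simp: inv_def)
  have zero: "rg s rZero = 0" and keyu: "ar s aKey u 0 = key u" using B(1) un by (auto simp: base_def)
  have add: "inv j (D(x := insert u (D x))) s'" if "inv j D s'" "bl u \<or> u \<in> seen s'" for s'
    using that unfolding inv_def closed_def by auto
  show ?thesis
  proof (cases "ar s aR u 0 = 0")
    case False
    let ?s = "upd rT (ar s aR u 0) s"
    have "inv j D ?s" using inv_cong[OF I] by simp
    moreover have "bl u \<or> u \<in> seen ?s" using False un by (auto simp: seen_def)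
    ultimately have "inv j (D(x := insert u (D x))) ?s" by (rule add)
    moreover have "x \<in> seen ?s" "\<not> pending ?s x" "credit ?s = credit s"
      using x credit_cong[of ?s s] by (auto simp: seen_def pending_def)
    ultimately show ?thesis
      using False u zero by (simp add: discover_def wp_eqs)
  next
    case True
    have nbl: "\<not> bl u" using B(1) un True by (auto simp: base_def)
    have "seen s \<subseteq> X (Suc j)" using B(3) by (simp add: flags_def)
    then have ux: "u \<in> X (Suc j)" using reach_step[of x E bl key z "Suc j" u] x u nbl by auto
    have "x \<noteq> u" using E_irr u(2) by auto
    have Q: "inv j (D(x := insert u (D x))) s' \<and> x \<in> seen s' \<and> \<not> pending s' x \<and> credit s' = credit s"
      if "inv j D s'" "seen s' = insert u (seen s)" "credit s' = credit s" "\<And>v. v \<noteq> u \<Longrightarrow> pending s' v = pending s v" for s'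
      using add[OF that(1)] that(2-4) x \<open>x \<noteq> u\<close> by auto
    let ?t = "max j (key u)"
    have tn: "?t \<le> n" using j key_n[OF un] by simp
    note push = push[OF I un True refl tn ux]
    show ?thesis
    proof (cases "j < key u")
      case jk: True
      let ?s1 = "put aF u 0 1 (upd rT2 1 (upd rT2 (key u - j) (upd rT (key u) (put aR u 0 1 (upd rT 1 (upd rT 0 s))))))"
      let ?s = "put aCnt (key u) 0 (Suc (ar s aCnt (key u) 0)) (upd rT2 (Suc (ar s aCnt (key u) 0))
        (put aBk (key u) (ar s aCnt (key u) 0) u (upd rT2 (ar s aCnt (key u) 0) ?s1)))"
      have max: "max j (key u) = key u" using jk by simp
      have "inv j (D(x := insert u (D x))) ?s \<and> x \<in> seen ?s \<and> \<not> pending ?s x \<and> credit ?s = credit s"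
        using jk by (intro Q push) (auto simp: max fun_eq_iff)
      then show ?thesis
        using True u zero j keyu jk by (simp add: discover_def wp_eqs)
    next
      case jk: False
      let ?s1 = "upd rT j (upd rT2 0 (upd rT (key u) (put aR u 0 1 (upd rT 1 (upd rT 0 s)))))"
      let ?s = "put aCnt j 0 (Suc (ar s aCnt j 0)) (upd rT2 (Suc (ar s aCnt j 0))
        (put aBk j (ar s aCnt j 0) u (upd rT2 (ar s aCnt j 0) ?s1)))"
      have max: "max j (key u) = j" using jk by simp
      have "inv j (D(x := insert u (D x))) ?s \<and> x \<in> seen ?s \<and> \<not> pending ?s x \<and> credit ?s = credit s"
        using jk by (intro Q push) (auto simp: max fun_eq_iff)
      then show ?thesis
        using True u zero j keyu jk by (simp add: discover_def wp_eqs)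
    qed
  qed
qed

abbreviation "nb \<equiv> \<lambda>v. {u. E v u}"

text \<open>The vertex taken out counts as expanded with no neighbour processed yet, hence the
  update \<open>nb(x := {})\<close>; its savings are released for the scan.\<close>

lemma pop:
  assumes I: "inv j nb s" and j: "j \<le> n" and c: "ar s aCnt j 0 = Suc m" and x: "x = ar s aBk j m"
    and Cnt: "\<And>t'. ar s' aCnt t' 0 = (if t' = j then m else ar s aCnt t' 0)"
    and rest: "\<And>k. k \<noteq> aCnt \<Longrightarrow> ar s' k = ar s k" "rg s' rN = rg s rN" "rg s' rZero = rg s rZero"
  shows "inv j (nb(x := {})) s'" "x \<in> seen s'" "\<not> pending s' x" "key x \<le> j" "x < n"
    "credit s = credit s' + (106 * deg x + 70)"
proof -
  have B: "base s" "buckets j s" "flags j s" "closed j nb s" using I by (auto simp: inv_def)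
  have seen: "seen s' = seen s" by (simp add: seen_def rest)
  have mc: "m < ar s aCnt j 0" using c by simp
  have b1: "ar s aBk t k \<in> seen s \<and> j \<le> t \<and> (if t = j then key (ar s aBk t k) \<le> j else key (ar s aBk t k) = t)"
    if "t \<le> n" "k < ar s aCnt t 0" for t k using B(2) that unfolding buckets_def by blast
  have b2: "t = t' \<and> k = k'" if "t \<le> n" "t' \<le> n" "k < ar s aCnt t 0" "k' < ar s aCnt t' 0" "ar s aBk t k = ar s aBk t' k'"
    for t t' k k' using B(2) that unfolding buckets_def by blast
  have le: "k < ar s aCnt t 0" if "k < ar s' aCnt t 0" for t k
    using that c by (auto simp: Cnt split: if_splits)
  have x1: "x \<in> seen s" "key x \<le> j" using b1[OF j mc] x by auto
  then show "x \<in> seen s'" "key x \<le> j" "x < n" using seen seen_n by auto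
  have pend: "pending s' v \<longleftrightarrow> pending s v \<and> v \<noteq> x" for v
  proof
    assume "pending s' v"
    then obtain t k where tk: "t \<le> n" "k < ar s' aCnt t 0" "ar s aBk t k = v" by (auto simp: pending_def rest)
    have "v \<noteq> x"
    proof
      assume "v = x"
      then have "t = j \<and> k = m" using b2[OF tk(1) j le[OF tk(2)] mc] tk(3) x by simp
      then show False using tk(2) by (simp add: Cnt)
    qed
    then show "pending s v \<and> v \<noteq> x" using tk le[OF tk(2)] by (auto simp: pending_def)
  next
    assume v: "pending s v \<and> v \<noteq> x"
    then obtain t k where tk: "t \<le> n" "k < ar s aCnt t 0" "ar s aBk t k = v" by (auto simp: pending_def)
    then have "\<not> (t = j \<and> k = m)" using v x by auto
    then have "k < ar s' aCnt t 0" using tk(2) c by (auto simp: Cnt)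
    then show "pending s' v" using tk by (auto simp: pending_def rest)
  qed
  then show np: "\<not> pending s' x" by simp
  have px: "pending s x" unfolding pending_def using j mc x by blast
  have "base s'" using B(1) rest by (simp add: base_def)
  moreover have "buckets j s'"
    unfolding buckets_def seen rest(1)[of aBk, simplified] using b1 b2 le by blast
  moreover have "flags j s'" using B(3) unfolding flags_def seen by (simp add: rest)
  moreover have "closed j (nb(x := {})) s'"
    using B(4) x1 unfolding closed_def seen pend by auto
  ultimately show "inv j (nb(x := {})) s'" by (simp add: inv_def)
  let ?A = "{v. v < n \<and> (v \<in> seen s \<longrightarrow> pending s v)}"
  have "{v. v < n \<and> (v \<in> seen s' \<longrightarrow> pending s' v)} = ?A - {x}"
    using seen pend x1 by auto
  moreover have "x \<in> ?A" "finite ?A" using px x1 seen_n by auto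
  ultimately show "credit s = credit s' + (106 * deg x + 70)"
    unfolding credit_def by (simp add: sum.remove[of ?A x])
qed

definition level_inv :: "nat \<Rightarrow> nat \<Rightarrow> st \<Rightarrow> nat \<Rightarrow> bool" where
  "level_inv j T0 s T \<longleftrightarrow> inv j nb s \<and> rg s rJ = j \<and> rg s rCn = ar s aCnt j 0 \<and> credit s + T0 + 1 \<le> T"

lemma expand_correct:
  assumes I: "level_inv j T0 s T" and j: "j \<le> n" and ne: "rg s rCn \<noteq> 0"
  shows "2 \<le> T \<and> wpi expand (level_inv j T0) s (T - 2)"
proof -
  obtain m where m: "ar s aCnt j 0 = Suc m" using I ne by (auto simp: level_inv_def gr0_conv_Suc)
  have Is: "inv j nb s" "rg s rJ = j" "rg s rCn = Suc m" "credit s + T0 + 1 \<le> T" using I m by (auto simp: level_inv_def)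
  have zero: "rg s rZero = 0" using Is(1) by (simp add: inv_def base_def)
  define x where "x = ar s aBk j m"
  let ?s = "upd rX x (put aCnt j 0 m (upd rCn m s))"
  have ars: "ar ?s k = ar s k" if "k \<noteq> aCnt" for k using that by (auto simp: fun_eq_iff)
  note pop = pop[OF Is(1) j m x_def, of ?s, OF _ ars, simplified]
  let ?adj = "for_adj rX rP rE rCA rU discover"
  let ?J = "\<lambda>k s' T. inv j (nb(x := set (take k (al ! x)))) s' \<and> x \<in> seen s' \<and> \<not> pending s' x \<and>
      rg s' rJ = j \<and> credit s' + T0 \<le> T"
  have "wpi ?adj (\<lambda>s' T. ?J (deg x) s' T) ?s (credit ?s + T0 + (deg x * (101 + 5) + 6))"
  proof (rule wp_adj[where J = ?J])
    fix k s' T'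
    assume k: "k < length (al ! rg ?s rX)" and J: "?J k s' T'" and u: "rg s' rU = al ! rg ?s rX ! k"
    have kx: "k < deg x" "rg s' rU = al ! x ! k" using k u by auto
    have "wpi discover (\<lambda>s'' T. inv j ((nb(x := set (take k (al ! x))))(x := insert (al ! x ! k) ((nb(x := set (take k (al ! x)))) x))) s'' \<and>
        x \<in> seen s'' \<and> \<not> pending s'' x \<and> credit s'' + T0 \<le> T) s' (101 + (credit s' + T0))"
      by (rule discover_correct) (use J j kx pop(4,5) nth_al in auto)
    then show "wpi discover (?J (Suc k)) s' (101 + T')"
    proof (rule wp_use)
      show "101 + (credit s' + T0) \<le> 101 + T'" using J by simp
      fix s'' t
      assume s'': "inv j ((nb(x := set (take k (al ! x))))(x := insert (al ! x ! k) ((nb(x := set (take k (al ! x)))) x))) s'' \<and>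
        x \<in> seen s'' \<and> \<not> pending s'' x \<and> credit s'' + T0 \<le> t" and "frame discover s' s''"
      then have "credit s'' + T0 \<le> t + (101 + T' - (101 + (credit s' + T0)))" by (simp add: trans_le_add1)
      then show "?J (Suc k) s'' (t + (101 + T' - (101 + (credit s' + T0))))"
        using s'' \<open>frame discover s' s''\<close> J kx frame_rg[of discover s' s'' rJ] by (simp add: take_Suc_conv_app_nth del: add_diff_cancel_left)
    qed
  next
    fix k s1 s2 T
    assume J: "?J k s1 T" and a: "ar (s2 :: st) = ar s1" and r: "\<And>r. r \<notin> {rP, rE, rCA, rU} \<Longrightarrow> rg s2 r = rg s1 r"
    then show "?J k s2 T"
      using inv_cong[of j _ s1 s2] credit_cong[OF a] by (auto simp: seen_def pending_def)
  qed (use pop Is n in auto)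
  then have "wpi ?adj (wpi (GetV rCn aCnt rJ) (level_inv j T0)) ?s (T - 27)"
  proof (rule wp_use)
    show "credit ?s + T0 + (deg x * (101 + 5) + 6) \<le> T - 27" using pop(6) Is(4) by simp
    fix s' t assume J: "?J (deg x) s' t"
    have d: "13 \<le> T - 27 - (credit ?s + T0 + (deg x * (101 + 5) + 6))"
      using pop(6) Is(4) by simp
    have "nb(x := set (take (deg x) (al ! x))) = nb" using al[of x] pop(5) by auto
    then have I': "inv j nb s'" using J by simp
    then have "rg s' rZero = 0" by (simp add: inv_def base_def)
    moreover have "inv j nb (upd rCn (ar s' aCnt j 0) s')" using inv_cong[OF I'] by simp
    moreover have "credit (upd rCn (ar s' aCnt j 0) s') = credit s'" by (rule credit_cong) simp
    ultimately have "wpi (GetV rCn aCnt rJ) (level_inv j T0) s' (t + d)" if "13 \<le> d" for d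
      using J that by (simp add: wp_eqs level_inv_def) linarith
    then show "wpi (GetV rCn aCnt rJ) (level_inv j T0) s' (t + (T - 27 - (credit ?s + T0 + (deg x * (101 + 5) + 6))))"
      using d .
  qed
  moreover have "27 \<le> T" using Is(4) pop(6) by simp
  ultimately show ?thesis
    using Is zero by (auto simp: expand_def wp_eqs x_def[symmetric])
qed

text \<open>When bucket \<open>j\<close> is empty, every pending vertex has key above
  \<open>j\<close>. So all seen vertices of key at most \<open>j\<close> are expanded, and
  \<open>X (Suc j)\<close> is exhausted.\<close>

lemma level_correct:
  assumes I: "inv j nb s" "rg s rJ = j" and j: "j \<le> n"
  shows "wpi level_body (\<lambda>s' T. inv (Suc j) nb s' \<and> seen s' \<subseteq> X (Suc j) \<and> credit s' + T0 \<le> T) s (13 + (credit s + T0))"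
proof -
  have zero: "rg s rZero = 0" using I(1) by (simp add: inv_def base_def)
  let ?s = "upd rCn (ar s aCnt j 0) s"
  have "wpi (While rCn expand) (\<lambda>s' T. inv (Suc j) nb s' \<and> seen s' \<subseteq> X (Suc j) \<and> credit s' + T0 \<le> T) ?s (1 + (credit s + T0))"
  proof (rule wp_While)
    show "level_inv j T0 ?s (1 + (credit s + T0))"
      unfolding level_inv_def using I inv_cong[OF I(1), of ?s] credit_cong[of ?s s] by simp
    show "2 \<le> T \<and> wpi expand (level_inv j T0) s (T - 2)" if "level_inv j T0 s T" "rg s rCn \<noteq> 0" for s T
      using expand_correct[OF that(1) j that(2)] .
    fix s T assume L: "level_inv j T0 s T" "rg s rCn = 0"
    then have "inv j nb s" and c: "ar s aCnt j 0 = 0" and T: "credit s + T0 + 1 \<le> T" by (auto simp: level_inv_def)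
    then have B: "base s" "buckets j s" "flags j s" "closed j nb s" by (auto simp: inv_def)
    have big_key: "j < key v" if pv: "pending s v" for v
    proof -
      obtain t k where tk: "t \<le> n" "k < ar s aCnt t 0" "ar s aBk t k = v" using pv by (auto simp: pending_def)
      then have "j \<le> t" "if t = j then key v \<le> j else key v = t" using B(2) unfolding buckets_def by blast+
      moreover have "t \<noteq> j" using tk c by auto
      ultimately show ?thesis by auto
    qed
    have sub: "X (Suc j) \<subseteq> seen s"
    proof
      fix v assume "v \<in> X (Suc j)"
      then show "v \<in> seen s"
      proof (induction rule: reach.induct)
        case reach_start
        then show ?case using B(3) by (simp add: flags_def)
      next
        case (reach_step v u)
        then have "\<not> pending s v" using big_key[of v] by auto
        then show ?case using B(4) reach_step unfolding closed_def by auto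
      qed
    qed
    have "buckets (Suc j) s"
    proof -
      have "Suc j \<le> t \<and> (if t = Suc j then key (ar s aBk t k) \<le> Suc j else key (ar s aBk t k) = t)"
        if tk: "t \<le> n" "k < ar s aCnt t 0" for t k
      proof -
        have "j \<le> t" "if t = j then key (ar s aBk t k) \<le> j else key (ar s aBk t k) = t"
          using B(2) tk unfolding buckets_def by blast+
        moreover have "t \<noteq> j" using tk c by auto
        ultimately show ?thesis by auto
      qed
      then show ?thesis using B(2) unfolding buckets_def by blast
    qed
    moreover have "X (Suc j) \<subseteq> X (Suc (Suc j))"
      using reach_mono[of _ E bl key z "Suc j" "Suc (Suc j)"] by auto
    then have "flags (Suc j) s" using B(3) sub unfolding flags_def by auto
    moreover have "closed (Suc j) nb s" using B(4) unfolding closed_def by (auto intro: le_SucI)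
    ultimately have "inv (Suc j) nb s" using B(1) by (simp add: inv_def)
    moreover have "seen s \<subseteq> X (Suc j)" using B(3) by (simp add: flags_def)
    ultimately show "1 \<le> T \<and> (inv (Suc j) nb s \<and> seen s \<subseteq> X (Suc j) \<and> credit s + T0 \<le> T - 1)"
      using T by simp
  qed
  then show ?thesis using I zero by (simp add: level_body_def wp_eqs)
qed

text \<open>The initial credit is \<open>106 * M + 70 * n\<close>. Clearing costs 16 per counter and
  the levels 17 each, at most \<open>n + 1\<close> of either, and 31 steps go into the
  set-up.\<close>

lemma search_correct:
  assumes regs: "rg s rN = n" "rg s rN1 = Suc n" "rg s rZero = 0" "rg s rZ = z" "rg s rL = J" "J \<le> Suc n"
    and key: "\<And>v. v < n \<Longrightarrow> ar s aKey v 0 = key v" and R: "\<And>v. v < n \<Longrightarrow> ar s aR v 0 \<noteq> 0 \<longleftrightarrow> bl v"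
    and F: "\<And>v. v < n \<Longrightarrow> ar s aF v 0 = 0"
  shows "wpi search (\<lambda>s' _. \<forall>v<n. (ar s' aR v 0 \<noteq> 0 \<longleftrightarrow> bl v \<or> v \<in> X J) \<and>
      ar s' aF v 0 = (if v \<noteq> z \<and> v \<in> X J \<and> v \<in> X (key v) then 1 else 0)) s (106 * M + 103 * n + 64)"
    (is "wpi search ?Q s ?T")
proof -
  let ?c0 = "106 * M + 70 * n"
  let ?rest = "Put aBk rZero rZero rZ ;; Set rT 1 ;; PutV aCnt rZero rT ;; for_loop rJ rCJ rL level_body"
  let ?clear = "for_loop rV rC rN1 (PutV aCnt rV rZero)"
  have levels: "wpi (for_loop rJ rCJ rL level_body) ?Q s1 (?c0 + (J * (13 + 4) + 3))"
    if I: "inv 0 nb s1" "seen s1 \<subseteq> X 0" "credit s1 = ?c0" and L: "rg s1 rL = J" for s1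
  proof (rule wp_for[where J = "\<lambda>k s' T. inv k nb s' \<and> seen s' \<subseteq> X k \<and> credit s' + 0 \<le> T"])
    fix k s' T' assume k: "k < rg s1 rL" and J: "inv k nb s' \<and> seen s' \<subseteq> X k \<and> credit s' + 0 \<le> T'" and "rg s' rJ = k"
    then have "wpi level_body (\<lambda>s' T. inv (Suc k) nb s' \<and> seen s' \<subseteq> X (Suc k) \<and> credit s' + 0 \<le> T) s' (13 + (credit s' + 0))"
      using L regs(6) by (intro level_correct) auto
    then show "wpi level_body (\<lambda>s' T. inv (Suc k) nb s' \<and> seen s' \<subseteq> X (Suc k) \<and> credit s' + 0 \<le> T) s' (13 + T')"
      by (rule wp_use) (use J in auto)
  next
    fix s' T' assume "inv (rg s1 rL) nb s' \<and> seen s' \<subseteq> X (rg s1 rL) \<and> credit s' + 0 \<le> T'"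
    then have B: "base s'" "flags J s'" "seen s' \<subseteq> X J" using L by (auto simp: inv_def)
    then have eq: "seen s' = X J" by (auto simp: flags_def)
    show "?Q s' T'"
    proof (intro allI impI conjI)
      fix v assume v: "v < n"
      have "v \<in> seen s' \<longleftrightarrow> v = z \<or> ar s' aR v 0 \<noteq> 0 \<and> \<not> bl v" using v by (simp add: seen_def)
      then show "ar s' aR v 0 \<noteq> 0 \<longleftrightarrow> bl v \<or> v \<in> X J"
        using B(1) v z unfolding eq base_def by blast
      show "ar s' aF v 0 = (if v \<noteq> z \<and> v \<in> X J \<and> v \<in> X (key v) then 1 else 0)"
        using B(2) v unfolding flags_def eq by auto
    qed
  next
    fix k s1 s2 T
    assume "inv k nb (s1 :: st) \<and> seen s1 \<subseteq> X k \<and> credit s1 + 0 \<le> T" and a: "ar (s2 :: st) = ar s1"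
      and "\<And>r. r \<noteq> rJ \<Longrightarrow> r \<noteq> rCJ \<Longrightarrow> rg s2 r = rg s1 r"
    then show "inv k nb s2 \<and> seen s2 \<subseteq> X k \<and> credit s2 + 0 \<le> T"
      using inv_cong[of k nb s1 s2] credit_cong[OF a] by (simp add: seen_def)
  qed (use I L in auto)
  have start: "inv 0 nb s1 \<and> seen s1 \<subseteq> X 0 \<and> credit s1 = ?c0"
    if "rg s1 rN = n" "rg s1 rZero = 0" "\<And>k. k \<noteq> aBk \<Longrightarrow> k \<noteq> aCnt \<Longrightarrow> ar s1 k = ar s k"
      "ar s1 aBk 0 0 = z" "\<And>t. t \<le> n \<Longrightarrow> ar s1 aCnt t 0 = (if t = 0 then 1 else 0)" for s1
  proof -
    have seen: "seen s1 = {z}" using R z that(3)[of aR] by (auto simp: seen_def)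
    have pend: "pending s1 v \<longleftrightarrow> v = z" for v
      using that(4,5) by (auto simp: pending_def split: if_splits intro!: exI[of _ 0])
    have X0: "X 0 = {z}"
    proof -
      have "v = z" if "v \<in> X 0" for v using that by (induction rule: reach.induct) auto
      then show ?thesis by (auto intro: reach_start)
    qed
    have "z \<in> X (Suc 0)" by (rule reach_start)
    then have "flags 0 s1" using F that(3)[of aF] by (auto simp: flags_def seen X0)
    moreover have "base s1" using that key R by (auto simp: base_def)
    moreover have "buckets 0 s1" using that(4,5) z by (auto simp: buckets_def seen split: if_splits)
    moreover have "closed 0 nb s1" by (auto simp: closed_def seen pend)
    moreover have "{v. v < n \<and> (v \<in> seen s1 \<longrightarrow> pending s1 v)} = {..<n}" by (auto simp: seen pend)
    then have "credit s1 = ?c0" by (simp add: credit_def sum.distrib M_def sum_distrib_left)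
    ultimately show ?thesis by (simp add: inv_def seen X0)
  qed
  have "wpi ?clear (wpi ?rest ?Q) s (0 + (?c0 + Suc n * 17 + 28) + (rg s rN1 * (12 + 4) + 3))"
  proof (rule wp_for[where J = "\<lambda>k s' T. (\<forall>t<k. ar s' aCnt t 0 = 0) \<and> 0 + (?c0 + Suc n * 17 + 28) \<le> T"])
    fix k s' T' assume "k < rg s rN1" "(\<forall>t<k. ar s' aCnt t 0 = 0) \<and> 0 + (?c0 + Suc n * 17 + 28) \<le> T'" "rg s' rV = k"
      "frame ?clear s s'"
    then show "wpi (PutV aCnt rV rZero) (\<lambda>s' T. (\<forall>t<Suc k. ar s' aCnt t 0 = 0) \<and> 0 + (?c0 + Suc n * 17 + 28) \<le> T) s' (12 + T')"
      using regs frame_rg[of ?clear s s' rZero] by (auto simp: wp_eqs less_Suc_eq)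
  next
    fix s' T' assume C: "(\<forall>t<rg s rN1. ar s' aCnt t 0 = 0) \<and> 0 + (?c0 + Suc n * 17 + 28) \<le> T'" and fr: "frame ?clear s s'"
    let ?s = "put aCnt 0 0 1 (upd rT 1 (put aBk 0 0 z s'))"
    have reg': "rg s' rN = n" "rg s' rZero = 0" "rg s' rZ = z" "rg s' rL = J"
      using regs frame_rg[OF fr] by auto
    have "inv 0 nb ?s \<and> seen ?s \<subseteq> X 0 \<and> credit ?s = ?c0"
      using reg' C regs frame_ar[OF fr] by (intro start) (auto simp: fun_eq_iff)
    then have "wpi (for_loop rJ rCJ rL level_body) ?Q ?s (?c0 + (J * (13 + 4) + 3))"
      using reg' by (intro levels) auto
    then have "wpi (for_loop rJ rCJ rL level_body) ?Q ?s (T' - 25)"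
      by (rule wp_use) (use C regs(6) in auto)
    moreover have "25 \<le> T'" using C by simp
    ultimately show "wpi ?rest ?Q s' T'"
      using reg' by (auto simp: wp_eqs)
  qed (use regs in auto)
  moreover have "0 + (?c0 + Suc n * 17 + 28) + (rg s rN1 * (12 + 4) + 3) = ?T"
    using regs by simp
  ultimately show ?thesis
    unfolding search_def wp_Seq_eq[of _ ?clear] by (simp only:)
qed

end

section \<open>Computing the order\<close>

text \<open>\<open>rBest\<close> holds the best weight plus one, with 0 for no candidate yet, so
  that an unvisited vertex of weight 0 can be chosen.\<close>

definition select :: com where
  "select = Set rBest 0 ;; Set rZ 0 ;;
     for_loop rV rC rN (GetV rT aPos rV ;;
       If rT Skip (GetV rT aW rV ;; Inc rT rT ;; Sub rT2 rT rBest ;; If rT2 (Mov rBest rT ;; Mov rZ rV) Skip))"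

text \<open>Visited vertices have nonzero \<open>aPos\<close> and become blocked. Keys are weights
  plus one, which reserves key 0 for the vertex being visited.\<close>

definition prepare_visit :: com where
  "prepare_visit = for_loop rV rC rN (GetV rT aPos rV ;; PutV aR rV rT ;;
     GetV rT aW rV ;; Inc rT rT ;; PutV aKey rV rT ;; PutV aF rV rZero)"

definition bump :: com where
  "bump = for_loop rV rC rN (GetV rT aF rV ;; If rT (GetV rT aW rV ;; Inc rT rT ;; PutV aW rV rT) Skip)"

definition visit :: com where
  "visit = select ;; PutV aOrd rI rZ ;; Inc rT rI ;; PutV aPos rZ rT ;; prepare_visit ;;
     PutV aKey rZ rZero ;; Inc rL rN ;; search ;; bump"

definition order_phase :: com where
  "order_phase = for_loop rI rIC rN visit"

lemma mods_phase1 [simp]: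
  "mods select = {rBest, rZ, rV, rC, rT, rT2}" "arrs select = {}"
  "mods prepare_visit = {rV, rC, rT}" "arrs prepare_visit = {aR, aKey, aF}"
  "mods bump = {rV, rC, rT}" "arrs bump = {aW}"
  by (auto simp: select_def prepare_visit_def bump_def)

lemma mods_visit [simp]:
  "mods visit = {rBest, rZ, rV, rC, rT, rT2, rL, rJ, rCJ, rCn, rX, rP, rE, rCA, rU}"
  "arrs visit = {aOrd, aPos, aR, aKey, aF, aW, aBk, aCnt}"
  by (auto simp: visit_def)

context machine_input
begin

definition regs_ok :: "st \<Rightarrow> bool" where
  "regs_ok s \<longleftrightarrow> rg s rN = n \<and> rg s rN1 = Suc n \<and> rg s rZero = 0"

lemma regs_ok_frame: "regs_ok s \<Longrightarrow> frame c s s' \<Longrightarrow> mods c \<inter> {rN, rN1, rZero} = {} \<Longrightarrow> regs_ok s'"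
  by (auto simp: regs_ok_def frame_def)

lemma select_correct:
  assumes r: "regs_ok s" and ex: "\<exists>v<n. ar s aPos v 0 = 0"
  shows "wpi select (\<lambda>s' _. rg s' rZ < n \<and> ar s aPos (rg s' rZ) 0 = 0 \<and>
     (\<forall>v<n. ar s aPos v 0 = 0 \<longrightarrow> ar s aW v 0 \<le> ar s aW (rg s' rZ) 0)) s (35 * n + 5)"
proof -
  let ?s = "upd rZ 0 (upd rBest 0 s)"
  define I where "I k s' \<longleftrightarrow> ar s' = ar s \<and> rg s' rZero = 0 \<and>
    (rg s' rBest = 0 \<longrightarrow> (\<forall>v<k. ar s aPos v 0 \<noteq> 0)) \<and>
    (rg s' rBest \<noteq> 0 \<longrightarrow> rg s' rZ < k \<and> ar s aPos (rg s' rZ) 0 = 0 \<and> rg s' rBest = Suc (ar s aW (rg s' rZ) 0)) \<and>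
    (\<forall>v<k. ar s aPos v 0 = 0 \<longrightarrow> Suc (ar s aW v 0) \<le> rg s' rBest)" for k and s' :: st
  have rN: "rg ?s rN = n" using r by (simp add: regs_ok_def)
  have "wpi (for_loop rV rC rN (GetV rT aPos rV ;;
       If rT Skip (GetV rT aW rV ;; Inc rT rT ;; Sub rT2 rT rBest ;; If rT2 (Mov rBest rT ;; Mov rZ rV) Skip)))
    (\<lambda>s' _. rg s' rZ < n \<and> ar s aPos (rg s' rZ) 0 = 0 \<and>
     (\<forall>v<n. ar s aPos v 0 = 0 \<longrightarrow> ar s aW v 0 \<le> ar s aW (rg s' rZ) 0)) ?s (35 * n + 3)"
  proof (rule wp_for_const[where I = I and b = 31])
    show "I 0 ?s" using r by (simp add: I_def regs_ok_def)
    show "I k s2" if "I k s1" "ar s2 = ar s1" "\<And>r. r \<noteq> rV \<Longrightarrow> r \<noteq> rC \<Longrightarrow> rg s2 r = rg s1 r" for k s1 s2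
      using that unfolding I_def by simp
    fix s' assume "I (rg ?s rN) s'"
    then have *: "I n s'" using rN by simp
    have "rg s' rBest \<noteq> 0" using * ex unfolding I_def by auto
    then show "rg s' rZ < n \<and> ar s aPos (rg s' rZ) 0 = 0 \<and>
     (\<forall>v<n. ar s aPos v 0 = 0 \<longrightarrow> ar s aW v 0 \<le> ar s aW (rg s' rZ) 0)"
      using * unfolding I_def by auto
  next
    fix k s' assume "I k s'" "rg s' rV = k"
    then show "wpi (GetV rT aPos rV ;; If rT Skip (GetV rT aW rV ;; Inc rT rT ;; Sub rT2 rT rBest ;;
        If rT2 (Mov rBest rT ;; Mov rZ rV) Skip)) (\<lambda>s' _. I (Suc k) s') s' 31"
      by (auto simp: wp_eqs I_def less_Suc_eq)
  qed (use rN in auto)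
  then show ?thesis by (simp add: select_def wp_eqs add_ac)
qed

lemma prepare_visit_correct:
  assumes r: "regs_ok s"
  shows "wpi prepare_visit (\<lambda>s' _. \<forall>v<n. ar s' aR v 0 = ar s aPos v 0 \<and>
     ar s' aKey v 0 = Suc (ar s aW v 0) \<and> ar s' aF v 0 = 0) s (65 * n + 3)"
  unfolding prepare_visit_def
proof (rule wp_for_const[where b = 61 and I = "\<lambda>k s'. ar s' aPos = ar s aPos \<and> ar s' aW = ar s aW \<and> rg s' rZero = 0 \<and>
    (\<forall>v<k. ar s' aR v 0 = ar s aPos v 0 \<and> ar s' aKey v 0 = Suc (ar s aW v 0) \<and> ar s' aF v 0 = 0)"])
qed (use r in \<open>auto simp: wp_eqs less_Suc_eq regs_ok_def ar_put_other\<close>)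

lemma bump_correct:
  assumes r: "regs_ok s"
  shows "wpi bump (\<lambda>s' _. \<forall>v<n. ar s' aW v 0 = (if ar s aF v 0 = 0 then ar s aW v 0 else Suc (ar s aW v 0))) s (43 * n + 3)"
  unfolding bump_def
proof (rule wp_for_const[where b = 39 and I = "\<lambda>k s'. ar s' aF = ar s aF \<and> rg s' rZero = 0 \<and>
    (\<forall>v. ar s' aW v 0 = (if v < k \<and> ar s aF v 0 \<noteq> 0 then Suc (ar s aW v 0) else ar s aW v 0))"])
qed (use r in \<open>auto simp: wp_eqs less_Suc_eq regs_ok_def ar_put_other\<close>)

text \<open>Unvisited vertices count as placed at \<open>n\<close>, after all visited ones.\<close>

definition pos_of :: "st \<Rightarrow> nat \<Rightarrow> nat" where
  "pos_of s v = (if ar s aPos v 0 = 0 then n else ar s aPos v 0 - 1)"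

text \<open>The function \<open>w\<close> is a ghost history of the weights, of which the array
  keeps only the last stage; the clauses for \<open>i < t\<close> become those of
  \<open>mcs_order\<close>. Weights at most \<open>t\<close> keep the keys within the
  \<open>n + 1\<close> buckets.\<close>

definition order_inv :: "nat \<Rightarrow> (nat \<Rightarrow> nat \<Rightarrow> nat) \<Rightarrow> st \<Rightarrow> bool" where
  "order_inv t w s \<longleftrightarrow> regs_ok s \<and>
     (\<forall>i<t. ar s aOrd i 0 < n \<and> ar s aPos (ar s aOrd i 0) 0 = Suc i) \<and>
     (\<forall>v<n. ar s aPos v 0 \<noteq> 0 \<longrightarrow> ar s aPos v 0 \<le> t \<and> ar s aOrd (ar s aPos v 0 - 1) 0 = v) \<and>
     (\<forall>v<n. w t v = ar s aW v 0 \<and> ar s aW v 0 \<le> t \<and> w 0 v = 0) \<and>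
     (\<forall>i<t. \<forall>v<n. i \<le> pos_of s v \<longrightarrow> w i v \<le> w i (ar s aOrd i 0)) \<and>
     (\<forall>i<t. \<forall>v<n. i < pos_of s v \<longrightarrow>
        w (Suc i) v = (if v \<in> below E {u \<in> {..<n}. i < pos_of s u} (w i) (ar s aOrd i 0) (w i v) then Suc (w i v) else w i v))"

lemma order_inv_cong: "order_inv t w s \<Longrightarrow> ar s' = ar s \<Longrightarrow> regs_ok s' \<Longrightarrow> order_inv t w s'"
  by (simp add: order_inv_def pos_of_def)

text \<open>The shift by one turns \<open>key v < Suc \<theta>\<close> into
  \<open>w v < \<theta>\<close>, while the start with key 0 is always expanded.\<close>

lemma reach_below:
  assumes U: "\<And>u. u < n \<Longrightarrow> u \<in> U \<longleftrightarrow> \<not> bl u" "U \<subseteq> {..<n}" and z: "bl z" "key z = 0"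
    and key: "\<And>v. v < n \<Longrightarrow> v \<noteq> z \<Longrightarrow> key v = Suc (w v)"
  shows "u \<in> reach E bl key z (Suc \<theta>) \<and> u \<noteq> z \<longleftrightarrow> u \<in> below E U w z \<theta>"
proof
  assume "u \<in> reach E bl key z (Suc \<theta>) \<and> u \<noteq> z"
  then have "u \<in> reach E bl key z (Suc \<theta>)" "u \<noteq> z" by auto
  then show "u \<in> below E U w z \<theta>"
  proof (induction rule: reach.induct)
    case (reach_step v u)
    have u: "u \<in> U" using U E_n reach_step by auto
    show ?case
    proof (cases "v = z")
      case True
      then show ?thesis using u reach_step by (auto intro: below_start)
    next
      case False
      then have "v \<in> below E U w z \<theta>" using reach_step by auto
      moreover have "w v < \<theta>" using key[of v] False reach_step E_n by auto
      ultimately show ?thesis using u reach_step by (auto intro: below_step)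
    qed
  qed simp
next
  assume "u \<in> below E U w z \<theta>"
  then show "u \<in> reach E bl key z (Suc \<theta>) \<and> u \<noteq> z"
  proof (induction rule: below.induct)
    case (below_start u)
    then have "\<not> bl u" using U by auto
    then show ?case using below_start z by (auto intro: reach_step reach_start)
  next
    case (below_step v u)
    then have "\<not> bl u" "v < n" using U E_n by auto
    then show ?case using below_step z key[of v] reach_step[of v E bl key z "Suc \<theta>" u] by auto
  qed
qed

lemma unvisited_exists:
  assumes "order_inv t w s" "t < n"
  shows "\<exists>v<n. ar s aPos v 0 = 0"
proof (rule ccontr)
  assume *: "\<not> (\<exists>v<n. ar s aPos v 0 = 0)"
  have "{..<n} \<subseteq> (\<lambda>i. ar s aOrd i 0) ` {..<t}"
  proof
    fix v assume "v \<in> {..<n}"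
    then have "ar s aPos v 0 \<noteq> 0" "ar s aPos v 0 \<le> t" "ar s aOrd (ar s aPos v 0 - 1) 0 = v"
      using * assms(1) by (auto simp: order_inv_def)
    then show "v \<in> (\<lambda>i. ar s aOrd i 0) ` {..<t}"
      by (intro image_eqI[of _ _ "ar s aPos v 0 - 1"]) auto
  qed
  then have "card {..<n} \<le> card ((\<lambda>i. ar s aOrd i 0) ` {..<t})" by (intro card_mono) auto
  also have "\<dots> \<le> card {..<t}" by (rule card_image_le) simp
  finally show False using assms(2) by simp
qed

text \<open>The new vertex moves from position \<open>n\<close> to \<open>t\<close>. Both are later
  than any \<open>i < t\<close>, so the recorded history is not disturbed.\<close>

lemma order_inv_step:
  assumes I: "order_inv t w s" and t: "t < n"
    and z: "z < n" "ar s aPos z 0 = 0" "\<And>v. v < n \<Longrightarrow> ar s aPos v 0 = 0 \<Longrightarrow> ar s aW v 0 \<le> ar s aW z 0"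
    and r: "regs_ok s'"
    and Pos: "\<And>v. ar s' aPos v 0 = (if v = z then Suc t else ar s aPos v 0)"
    and Ord: "\<And>i. ar s' aOrd i 0 = (if i = t then z else ar s aOrd i 0)"
    and W: "\<And>v. v < n \<Longrightarrow> ar s' aW v 0 = (if v \<in> below E {u \<in> {..<n}. t < pos_of s' u} (\<lambda>v. ar s aW v 0) z (ar s aW v 0)
      then Suc (ar s aW v 0) else ar s aW v 0)"
  shows "order_inv (Suc t) (w(Suc t := \<lambda>v. ar s' aW v 0)) s'"
proof -
  let ?w = "w(Suc t := \<lambda>v. ar s' aW v 0)"
  have I1: "ar s aOrd i 0 < n" "ar s aPos (ar s aOrd i 0) 0 = Suc i" if "i < t" for i
    using I that by (auto simp: order_inv_def)
  have I2: "ar s aPos v 0 \<le> t" "ar s aOrd (ar s aPos v 0 - 1) 0 = v" if "v < n" "ar s aPos v 0 \<noteq> 0" for v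
    using I that by (auto simp: order_inv_def)
  have I3: "w t v = ar s aW v 0" "ar s aW v 0 \<le> t" "w 0 v = 0" if "v < n" for v
    using I that by (auto simp: order_inv_def)
  have I4: "w i v \<le> w i (ar s aOrd i 0)" if "i < t" "v < n" "i \<le> pos_of s v" for i v
    using I that by (auto simp: order_inv_def)
  have I5: "w (Suc i) v = (if v \<in> below E {u \<in> {..<n}. i < pos_of s u} (w i) (ar s aOrd i 0) (w i v) then Suc (w i v) else w i v)"
    if "i < t" "v < n" "i < pos_of s v" for i v
    using I that unfolding order_inv_def by blast
  have pos: "pos_of s' v = (if v = z then t else pos_of s v)" for v
    by (simp add: pos_of_def Pos)
  have pz: "pos_of s z = n" using z by (simp add: pos_of_def)
  have same: "{u \<in> {..<n}. i < pos_of s' u} = {u \<in> {..<n}. i < pos_of s u}" if "i < t" for i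
    using that t pz by (auto simp: pos)
  have pt: "pos_of s v < t \<or> ar s aPos v 0 = 0" if "v < n" for v
    using I2[OF that] by (auto simp: pos_of_def)
  show ?thesis
    unfolding order_inv_def
  proof (intro conjI allI impI)
    show "regs_ok s'" by (rule r)
    fix i assume i: "i < Suc t"
    have ne: "ar s aOrd i 0 \<noteq> z" if "i < t" using I1[OF that] z by auto
    show "ar s' aOrd i 0 < n" using i z I1[of i] by (auto simp: Ord less_Suc_eq)
    show "ar s' aPos (ar s' aOrd i 0) 0 = Suc i" using i I1[of i] ne by (auto simp: Ord Pos less_Suc_eq)
    fix v assume v: "v < n"
    have wi: "?w i = w i" using i by auto
    show "?w i v \<le> ?w i (ar s' aOrd i 0)" if "i \<le> pos_of s' v"
    proof (cases "i = t")
      case True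
      have "v = z \<or> ar s aPos v 0 = 0" using that pt[OF v] True by (auto simp: pos split: if_splits)
      then show ?thesis using True z v I3 by (auto simp: Ord)
    next
      case False
      then have "i \<le> pos_of s v" using that i pz t by (auto simp: pos split: if_splits)
      then show ?thesis using I4[of i v] False i v by (simp add: Ord)
    qed
    show "?w (Suc i) v = (if v \<in> below E {u \<in> {..<n}. i < pos_of s' u} (?w i) (ar s' aOrd i 0) (?w i v) then Suc (?w i v) else ?w i v)"
      if "i < pos_of s' v"
    proof (cases "i = t")
      case True
      have eq: "below E U (w t) z \<theta> = below E U (\<lambda>v. ar s aW v 0) z \<theta>" if "U \<subseteq> {..<n}" for U \<theta>
      proof -
        have "u \<in> below E U (\<lambda>v. ar s aW v 0) z \<theta>" if "u \<in> below E U (w t) z \<theta>" for u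
          using that by (induction rule: below.induct) (use I3 E_n in \<open>auto intro: below.intros\<close>)
        moreover have "u \<in> below E U (w t) z \<theta>" if "u \<in> below E U (\<lambda>v. ar s aW v 0) z \<theta>" for u
          using that by (induction rule: below.induct) (use I3 E_n in \<open>auto intro: below.intros\<close>)
        ultimately show ?thesis by blast
      qed
      have "below E {u \<in> {..<n}. t < pos_of s' u} (w t) z \<theta> =
          below E {u \<in> {..<n}. t < pos_of s' u} (\<lambda>v. ar s aW v 0) z \<theta>" for \<theta> by (rule eq) auto
      then show ?thesis using True W[OF v] I3(1)[OF v] by (simp add: Ord)
    next
      case False
      then have "i < pos_of s v" using that i pz t by (auto simp: pos split: if_splits)
      then show ?thesis using I5[of i v] False i v same[of i] by (simp add: Ord)
    qed
  next
    fix v assume v: "v < n"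
    show "ar s' aPos v 0 \<le> Suc t" using I2[OF v] by (cases "ar s aPos v 0 = 0") (auto simp: Pos)
    show "ar s' aOrd (ar s' aPos v 0 - 1) 0 = v" if "ar s' aPos v 0 \<noteq> 0"
      using I2[OF v] that by (auto simp: Ord Pos split: if_splits)
    show "?w (Suc t) v = ar s' aW v 0" by simp
    show "ar s' aW v 0 \<le> Suc t" using W[OF v] I3[OF v] by auto
    show "?w 0 v = 0" using I3[OF v] by simp
  qed
qed

lemma visit_correct:
  assumes I: "order_inv t w s" and t: "t < n" "rg s rI = t"
  shows "wpi visit (\<lambda>s' _. \<exists>w. order_inv (Suc t) w s') s (106 * M + 246 * n + 113)"
  unfolding visit_def
proof (rule wp_seq[OF select_correct])
  show r: "regs_ok s" using I by (simp add: order_inv_def)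
  show "\<exists>v<n. ar s aPos v 0 = 0" using unvisited_exists[OF I t(1)] .
  fix s1
  assume zsel: "rg s1 rZ < n \<and> ar s aPos (rg s1 rZ) 0 = 0 \<and>
     (\<forall>v<n. ar s aPos v 0 = 0 \<longrightarrow> ar s aW v 0 \<le> ar s aW (rg s1 rZ) 0)" and fr1: "frame select s s1"
  define z where "z = rg s1 rZ"
  have a1: "ar s1 = ar s" using fr1 by (auto simp: frame_def fun_eq_iff)
  have r1: "regs_ok s1" "rg s1 rI = t" using regs_ok_frame[OF r fr1] frame_rg[OF fr1, of rI] t by auto
  let ?s2 = "put aPos z 0 (Suc t) (upd rT (Suc t) (put aOrd t 0 z s1))"
  have r2: "regs_ok ?s2" using r1 by (simp add: regs_ok_def)
  let ?T = "106 * M + 211 * n + 83"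
  have "wpi (prepare_visit ;; PutV aKey rZ rZero ;; Inc rL rN ;; search ;; bump) (\<lambda>s' _. \<exists>w. order_inv (Suc t) w s') ?s2 ?T"
  proof (rule wp_seq[OF prepare_visit_correct[OF r2]])
    fix s3 assume p: "\<forall>v<n. ar s3 aR v 0 = ar ?s2 aPos v 0 \<and> ar s3 aKey v 0 = Suc (ar ?s2 aW v 0) \<and> ar s3 aF v 0 = 0"
      and fr3: "frame prepare_visit ?s2 s3"
    have r3: "regs_ok s3" using regs_ok_frame[OF r2 fr3] by simp
    have z3: "rg s3 rZ = z" using frame_rg[OF fr3, of rZ] by (simp add: z_def)
    have a3: "ar s3 aPos = ar ?s2 aPos" "ar s3 aOrd = ar ?s2 aOrd" "ar s3 aW = ar ?s2 aW" using frame_ar[OF fr3] by auto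
    let ?s4 = "upd rL (Suc n) (put aKey z 0 0 s3)"
    define bl where "bl v \<longleftrightarrow> ar ?s2 aPos v 0 \<noteq> 0" for v
    define key where "key v = (if v = z then 0 else Suc (ar s aW v 0))" for v
    have Wt: "ar s aW v 0 \<le> t" if "v < n" for v using I that by (auto simp: order_inv_def)
    interpret search_run al n E bl key z
      using zsel t Wt by unfold_locales (auto simp: bl_def key_def z_def Suc_le_eq intro: le_less_trans)
    have r4: "regs_ok ?s4" using r3 by (simp add: regs_ok_def)
    have "wpi (search ;; bump) (\<lambda>s' _. \<exists>w. order_inv (Suc t) w s') ?s4 (106 * M + 146 * n + 67)"
    proof (rule wp_seq[OF search_correct[of ?s4 "Suc n"]])
      fix s5 assume q: "\<forall>v<n. (ar s5 aR v 0 \<noteq> 0 \<longleftrightarrow> bl v \<or> v \<in> X (Suc n)) \<and>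
          ar s5 aF v 0 = (if v \<noteq> z \<and> v \<in> X (Suc n) \<and> v \<in> X (key v) then 1 else 0)" and fr5: "frame search ?s4 s5"
      have r5: "regs_ok s5" using regs_ok_frame[OF r4 fr5] by simp
      have a5: "ar s5 aPos = ar ?s2 aPos" "ar s5 aOrd = ar ?s2 aOrd" "ar s5 aW = ar s aW"
        using frame_ar[OF fr5] a3 a1 by (auto simp: fun_eq_iff)
      have "wpi bump (\<lambda>s' _. \<exists>w. order_inv (Suc t) w s') s5 (43 * n + 3)"
      proof (rule wp_weaken[OF bump_correct[OF r5]])
        fix s6 assume b: "\<forall>v<n. ar s6 aW v 0 = (if ar s5 aF v 0 = 0 then ar s5 aW v 0 else Suc (ar s5 aW v 0))"
          and fr6: "frame bump s5 s6"
        have r6: "regs_ok s6" using regs_ok_frame[OF r5 fr6] by simp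
        have a6: "ar s6 aPos = ar ?s2 aPos" "ar s6 aOrd = ar ?s2 aOrd" using frame_ar[OF fr6] a5 by auto
        have pos6: "t < pos_of s6 v \<longleftrightarrow> \<not> bl v" if "v < n" for v
        proof -
          have "ar s aPos v 0 \<noteq> 0 \<longrightarrow> ar s aPos v 0 \<le> t" using I that by (auto simp: order_inv_def)
          then show ?thesis using t(1) by (auto simp: pos_of_def a6 bl_def a1)
        qed
        \<comment> \<open>A flag means that \<open>v\<close> was reached through keys below its own,
          hence through weights below its weight: exactly the condition for raising it.\<close>
        have F: "ar s5 aF v 0 \<noteq> 0 \<longleftrightarrow> v \<in> below E {u \<in> {..<n}. t < pos_of s6 u} (\<lambda>v. ar s aW v 0) z (ar s aW v 0)"
          if v: "v < n" for v
        proof -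
          have rb: "u \<in> X (Suc \<theta>) \<and> u \<noteq> z \<longleftrightarrow> u \<in> below E {u \<in> {..<n}. t < pos_of s6 u} (\<lambda>v. ar s aW v 0) z \<theta>" for u \<theta>
            by (rule reach_below) (use pos6 zsel in \<open>auto simp: key_def bl_def z_def\<close>)
          have "v \<in> X (Suc n)" if "v \<in> X (key v)" using reach_mono[OF that] key_n[OF v] by simp
          then have "ar s5 aF v 0 \<noteq> 0 \<longleftrightarrow> v \<noteq> z \<and> v \<in> X (key v)" using q v by auto
          also have "\<dots> \<longleftrightarrow> v \<in> X (Suc (ar s aW v 0)) \<and> v \<noteq> z" by (auto simp: key_def)
          finally show ?thesis using rb by simp
        qed
        have "order_inv (Suc t) (w(Suc t := \<lambda>v. ar s6 aW v 0)) s6"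
        proof (rule order_inv_step[OF I t(1), of z])
          show "z < n" "ar s aPos z 0 = 0" "\<And>v. v < n \<Longrightarrow> ar s aPos v 0 = 0 \<Longrightarrow> ar s aW v 0 \<le> ar s aW z 0"
            using zsel by (auto simp: z_def)
          show "ar s6 aW v 0 = (if v \<in> below E {u \<in> {..<n}. t < pos_of s6 u} (\<lambda>v. ar s aW v 0) z (ar s aW v 0)
              then Suc (ar s aW v 0) else ar s aW v 0)" if "v < n" for v
            using b F[OF that] that a5 by auto
        qed (use r6 a6 a1 in auto)
        then show "\<exists>w. order_inv (Suc t) w s6" by blast
      qed simp
      then show "wpi bump (\<lambda>s' _. \<exists>w. order_inv (Suc t) w s') s5 (106 * M + 146 * n + 67 - (106 * M + 103 * n + 64))"
        by (rule wp_weaken) auto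
    next
      fix v assume v: "v < n"
      show "ar ?s4 aKey v 0 = key v" using p v a1 by (auto simp: key_def)
      show "ar ?s4 aR v 0 \<noteq> 0 \<longleftrightarrow> bl v" using p v by (auto simp: bl_def)
      show "ar ?s4 aF v 0 = 0" using p v by auto
    qed (use r4 z3 in \<open>auto simp: regs_ok_def\<close>)
    then have "wpi (PutV aKey rZ rZero ;; Inc rL rN ;; search ;; bump) (\<lambda>s' _. \<exists>w. order_inv (Suc t) w s') s3 (106 * M + 146 * n + 80)"
      using r3 z3 by (simp add: wp_eqs regs_ok_def add_ac)
    then show "wpi (PutV aKey rZ rZero ;; Inc rL rN ;; search ;; bump) (\<lambda>s' _. \<exists>w. order_inv (Suc t) w s') s3 (?T - (65 * n + 3))"
      by (rule wp_weaken) auto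
  qed simp
  then have "wpi (PutV aOrd rI rZ ;; Inc rT rI ;; PutV aPos rZ rT ;; prepare_visit ;; PutV aKey rZ rZero ;; Inc rL rN ;; search ;; bump)
     (\<lambda>s' _. \<exists>w. order_inv (Suc t) w s') s1 (?T + 25)"
    using r1 by (simp add: wp_eqs regs_ok_def z_def add_ac)
  then show "wpi (PutV aOrd rI rZ ;; Inc rT rI ;; PutV aPos rZ rT ;; prepare_visit ;; PutV aKey rZ rZero ;; Inc rL rN ;; search ;; bump)
     (\<lambda>s' _. \<exists>w. order_inv (Suc t) w s') s1 (106 * M + 246 * n + 113 - (35 * n + 5))"
    by (rule wp_weaken) auto
qed simp

lemma order_phase_correct:
  assumes r: "regs_ok s" and zero: "\<And>v. ar s aPos v 0 = 0" "\<And>v. ar s aW v 0 = 0"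
  shows "wpi order_phase (\<lambda>s' _. \<exists>w. order_inv n w s') s (n * (106 * M + 246 * n + 117) + 3)"
  unfolding order_phase_def
proof (rule wp_for_const[where b = "106 * M + 246 * n + 113" and I = "\<lambda>t s'. \<exists>w. order_inv t w s'"])
  show "\<exists>w. order_inv 0 w s"
    using r zero by (intro exI[of _ "\<lambda>_ _. 0"]) (simp add: order_inv_def)
  show "\<exists>w. order_inv k w s2" if s12: "\<exists>w. order_inv k w s1" "ar s2 = ar s1" "\<And>r. r \<noteq> rI \<Longrightarrow> r \<noteq> rIC \<Longrightarrow> rg s2 r = rg s1 r"
    for k s1 s2
  proof -
    obtain w where w: "order_inv k w s1" using s12(1) by blast
    have "regs_ok s2" using w s12(3) by (simp add: order_inv_def regs_ok_def)
    then show ?thesis using order_inv_cong[OF w s12(2)] by blast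
  qed
  show "wpi visit (\<lambda>s' _. \<exists>w. order_inv (Suc k) w s') s' (106 * M + 246 * n + 113)"
    if "k < rg s rN" "\<exists>w. order_inv k w s'" "rg s' rI = k" for k s'
    using that visit_correct r by (auto simp: regs_ok_def)
  show "\<exists>w. order_inv n w s'" if "\<exists>w. order_inv (rg s rN) w s'" for s'
    using that r by (simp add: regs_ok_def)
qed (use r in \<open>auto simp: regs_ok_def\<close>)

text \<open>After \<open>n\<close> visits the order is an injective map of \<open>{..<n}\<close>
  into itself, hence onto, and no vertex keeps the default position.\<close>

lemma order_inv_mcs:
  assumes "order_inv n w s"
  shows "mcs_order E {..<n} n (\<lambda>i. ar s aOrd i 0) (\<lambda>v. ar s aPos v 0 - 1) w" and "v < n \<Longrightarrow> ar s aPos v 0 \<noteq> 0"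
proof -
  have I1: "ar s aOrd i 0 < n" "ar s aPos (ar s aOrd i 0) 0 = Suc i" if "i < n" for i
    using assms that by (auto simp: order_inv_def)
  have "inj_on (\<lambda>i. ar s aOrd i 0) {..<n}"
  proof (rule inj_onI)
    fix i j assume ij: "i \<in> {..<n}" "j \<in> {..<n}" "ar s aOrd i 0 = ar s aOrd j 0"
    have "Suc i = ar s aPos (ar s aOrd i 0) 0" using I1(2)[of i] ij(1) by simp
    also have "\<dots> = ar s aPos (ar s aOrd j 0) 0" by (simp only: ij(3))
    also have "\<dots> = Suc j" using I1(2)[of j] ij(2) by simp
    finally have "Suc i = Suc j" .
    then show "i = j" by simp
  qed
  then have surj: "(\<lambda>i. ar s aOrd i 0) ` {..<n} = {..<n}"
    using I1 by (intro endo_inj_surj) auto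
  have ne: "ar s aPos v 0 \<noteq> 0" if "v < n" for v
  proof -
    have "v \<in> (\<lambda>i. ar s aOrd i 0) ` {..<n}" unfolding surj using that by simp
    then obtain i where "i < n" "v = ar s aOrd i 0" by auto
    then show ?thesis using I1 by simp
  qed
  show "v < n \<Longrightarrow> ar s aPos v 0 \<noteq> 0" by (rule ne)
  have pos: "pos_of s v = ar s aPos v 0 - 1" if "v < n" for v using ne[OF that] by (simp add: pos_of_def)
  have I2: "ar s aPos v 0 \<le> n" "ar s aOrd (ar s aPos v 0 - 1) 0 = v" if "v < n" for v
    using assms that ne[OF that] by (auto simp: order_inv_def)
  have lt: "ar s aPos v 0 - 1 < n" if "v < n" for v using I2(1)[OF that] ne[OF that] by simp
  have U: "{u \<in> {..<n}. i < pos_of s u} = {u \<in> {..<n}. i < ar s aPos u 0 - 1}" for i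
    using pos by auto
  show "mcs_order E {..<n} n (\<lambda>i. ar s aOrd i 0) (\<lambda>v. ar s aPos v 0 - 1) w"
  proof unfold_locales
    show "symp E" using E_sym by (simp add: symp_def)
    show "\<not> E v v" for v by (rule E_irr)
    show "w t v \<le> w t (ar s aOrd t 0)" if "v \<in> {..<n}" "t \<le> ar s aPos v 0 - 1" for v t
    proof -
      have "t < n" using that lt[of v] by auto
      then show ?thesis using assms that pos[of v] by (auto simp: order_inv_def)
    qed
    show "w (Suc t) v = (if v \<in> below E {u \<in> {..<n}. t < ar s aPos u 0 - 1} (w t) (ar s aOrd t 0) (w t v) then Suc (w t v) else w t v)"
      if "v \<in> {..<n}" "t < ar s aPos v 0 - 1" for v t
    proof -
      have "t < n" "v < n" "t < pos_of s v" using that lt[of v] pos[of v] by auto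
      then have "w (Suc t) v = (if v \<in> below E {u \<in> {..<n}. t < pos_of s u} (w t) (ar s aOrd t 0) (w t v) then Suc (w t v) else w t v)"
        using assms unfolding order_inv_def by blast
      then show ?thesis unfolding U .
    qed
    show "w 0 v = 0" if "v \<in> {..<n}" for v using assms that by (auto simp: order_inv_def)
  qed (use I1 I2 lt E_n in auto)
qed

end

section \<open>Atoms on the machine: clique test, series-parallel reduction and removal\<close>

section \<open>Testing and removing a piece\<close>

definition count_adj :: "nat \<Rightarrow> com" where
  "count_adj a = for_adj rV rP rE rCA rU (GetV rT2 a rU ;; If rT2 (Inc rCc rCc) Skip)"

definition count_border :: com where
  "count_border = Set rKs 0 ;; for_loop rV rC rN (GetV rT aF rV ;; If rT (Inc rKs rKs) Skip)"

text \<open>A member is adjacent to all others when one plus the number of its marked neighbours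
  reaches the size of the set; the truncated difference is nonzero exactly if a neighbour is
  missing. Counting along the lists keeps the test linear.\<close>

definition check_border :: com where
  "check_border = Set rOk 1 ;; for_loop rV rC rN (GetV rT aF rV ;;
     If rT (Set rCc 1 ;; count_adj aF ;; Sub rT rKs rCc ;; If rT (Set rOk 0) Skip) Skip)"

text \<open>Removed vertices block the search and therefore carry marks in \<open>aR\<close> too;
  they are filtered out here.\<close>

definition mark_piece :: com where
  "mark_piece = Set rA 0 ;; for_loop rV rC rN (GetV rT aDead rV ;; If rT (Set rT2 0) (GetV rT2 aR rV) ;;
     PutV aA rV rT2 ;; If rT2 (Inc rA rA) Skip)"

text \<open>The same count as in the clique test: the stored difference is nonzero exactly for the
  vertices of the atom that are not universal in it, and outside the atom the stored value is
  0.\<close>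

definition mark_core :: com where
  "mark_core = for_loop rV rC rN (GetV rT aA rV ;;
     If rT (Set rCc 1 ;; count_adj aA ;; Sub rT rA rCc) Skip ;; PutV aH rV rT)"

definition copy_row :: com where
  "copy_row = for_adj rV rP rE rCA rU (GetV rT2 aH rU ;;
     If rT2 (Inc rCc rCc ;; Set rT2 1 ;; Put aM rV rU rT2) Skip)"

definition build :: com where
  "build = Set rH 0 ;; for_loop rV rC rN (GetV rT aH rV ;;
     If rT (Inc rH rH ;; Set rCc 0 ;; copy_row ;; PutV aD rV rCc) Skip)"

text \<open>Subtracting the degree from 3 leaves a nonzero value exactly for degree at most 2. The
  result is the vertex plus one, with 0 for none.\<close>

definition find_low :: com where
  "find_low = Set rF 0 ;; for_loop rV rC rN (GetV rT aH rV ;;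
     If rT (GetV rT aD rV ;; Set rT2 3 ;; Sub rT2 rT2 rT ;; If rT2 (Inc rF rV) Skip) Skip)"

text \<open>The last two neighbours met are kept, shifted by one so that 0 means absent; for degree
  at most 2 these are all of them.\<close>

definition detach :: com where
  "detach = Set rNa 0 ;; Set rNb 0 ;; for_loop rV rC rN (Get rT aM rX rV ;;
     If rT (Put aM rX rV rZero ;; Put aM rV rX rZero ;; GetV rT aD rV ;; Dec rT rT ;; PutV aD rV rT ;;
       Mov rNb rNa ;; Inc rNa rV) Skip) ;; PutV aH rX rZero"

definition join :: com where
  "join = If rNb (Dec rNb rNb ;; Dec rNa rNa ;; Get rT aM rNa rNb ;;
     If rT Skip (Set rT 1 ;; Put aM rNa rNb rT ;; Put aM rNb rNa rT ;;
       GetV rT aD rNa ;; Inc rT rT ;; PutV aD rNa rT ;; GetV rT aD rNb ;; Inc rT rT ;; PutV aD rNb rT)) Skip"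

text \<open>One round per vertex of the reduced atom; after a failure the remaining rounds do
  nothing.\<close>

definition eliminate :: com where
  "eliminate = for_loop rK rCK rH
     (If rRes (find_low ;; If rF (Dec rX rF ;; detach ;; join) (Set rRes 0)) Skip)"

text \<open>The border is still flagged in \<open>aF\<close> by the search, so only the piece is
  removed.\<close>

definition kill :: com where
  "kill = for_loop rV rC rN (GetV rT aA rV ;;
     If rT (GetV rT2 aF rV ;; If rT2 Skip (Set rT2 1 ;; PutV aDead rV rT2)) Skip)"

lemma mods_peel [simp]:
  "mods (count_adj a) = {rP, rE, rCA, rU, rT2, rCc}" "arrs (count_adj a) = {}"
  "mods count_border = {rKs, rV, rC, rT}" "arrs count_border = {}"
  "mods check_border = {rOk, rV, rC, rT, rCc, rP, rE, rCA, rU, rT2}" "arrs check_border = {}"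
  "mods mark_piece = {rA, rV, rC, rT, rT2}" "arrs mark_piece = {aA}"
  "mods mark_core = {rV, rC, rT, rCc, rP, rE, rCA, rU, rT2}" "arrs mark_core = {aH}"
  "mods copy_row = {rP, rE, rCA, rU, rT2, rCc}" "arrs copy_row = {aM}"
  "mods build = {rH, rV, rC, rT, rCc, rP, rE, rCA, rU, rT2}" "arrs build = {aM, aD}"
  "mods find_low = {rF, rV, rC, rT, rT2}" "arrs find_low = {}"
  "mods detach = {rNa, rNb, rV, rC, rT}" "arrs detach = {aM, aD, aH}"
  "mods join = {rNa, rNb, rT}" "arrs join = {aM, aD}"
  "mods eliminate = {rK, rCK, rF, rV, rC, rT, rT2, rX, rNa, rNb, rRes}" "arrs eliminate = {aM, aD, aH}"
  "mods kill = {rV, rC, rT, rT2}" "arrs kill = {aDead}"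
proof -
  show a: "mods (count_adj a) = {rP, rE, rCA, rU, rT2, rCc}" "arrs (count_adj a) = {}" for a
    by (auto simp: count_adj_def)
  show b: "mods copy_row = {rP, rE, rCA, rU, rT2, rCc}" "arrs copy_row = {aM}"
    by (auto simp: copy_row_def)
  show c: "mods find_low = {rF, rV, rC, rT, rT2}" "arrs find_low = {}"
    by (auto simp: find_low_def)
  show d: "mods detach = {rNa, rNb, rV, rC, rT}" "arrs detach = {aM, aD, aH}"
    by (auto simp: detach_def)
  show e: "mods join = {rNa, rNb, rT}" "arrs join = {aM, aD}"
    by (auto simp: join_def)
  show "mods eliminate = {rK, rCK, rF, rV, rC, rT, rT2, rX, rNa, rNb, rRes}" "arrs eliminate = {aM, aD, aH}"
    by (auto simp: eliminate_def c d e)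
  show "mods count_border = {rKs, rV, rC, rT}" "arrs count_border = {}"
    by (auto simp: count_border_def)
  show "mods check_border = {rOk, rV, rC, rT, rCc, rP, rE, rCA, rU, rT2}" "arrs check_border = {}"
    by (auto simp: check_border_def a)
  show "mods mark_piece = {rA, rV, rC, rT, rT2}" "arrs mark_piece = {aA}"
    by (auto simp: mark_piece_def)
  show "mods mark_core = {rV, rC, rT, rCc, rP, rE, rCA, rU, rT2}" "arrs mark_core = {aH}"
    by (auto simp: mark_core_def a)
  show "mods build = {rH, rV, rC, rT, rCc, rP, rE, rCA, rU, rT2}" "arrs build = {aM, aD}"
    by (auto simp: build_def b)
  show "mods kill = {rV, rC, rT, rT2}" "arrs kill = {aDead}"
    by (auto simp: kill_def)
qed

lemma wp_Seq_fun: "wp w (c ;; d) Q = wp w c (wp w d Q)"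
  by (intro ext) (rule wp_Seq_eq)

context machine_input
begin

definition marked :: "nat \<Rightarrow> st \<Rightarrow> nat set" where
  "marked a s = {v. v < n \<and> ar s a v 0 \<noteq> 0}"

lemma finite_marked [simp]: "finite (marked a s)"
  by (simp add: marked_def)

lemma take_al: "v < n \<Longrightarrow> k < deg v \<Longrightarrow>
    set (take (Suc k) (al ! v)) = insert (al ! v ! k) (set (take k (al ! v))) \<and> al ! v ! k \<notin> set (take k (al ! v))"
  using al[of v] by (auto simp: take_Suc_conv_app_nth in_set_conv_nth nth_eq_iff_index_eq)

lemma set_al: "v < n \<Longrightarrow> set (al ! v) = {u. E v u}"
  using al by simp

lemma card_filter_insert:
  "finite B \<Longrightarrow> x \<notin> B \<Longrightarrow> card {u \<in> insert x B. P u} = (if P x then Suc (card {u \<in> B. P u}) else card {u \<in> B. P u})"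
proof -
  assume B: "finite B" "x \<notin> B"
  have "{u \<in> insert x B. P u} = (if P x then insert x {u \<in> B. P u} else {u \<in> B. P u})" by auto
  then show ?thesis using B by simp
qed

lemma card_marked_less_Suc: "card {v. v < Suc k \<and> P v} = card {v. v < k \<and> P v} + (if P k then 1 else 0)"
proof -
  have "{v. v < Suc k \<and> P v} = {v \<in> insert k {..<k}. P v}" "{v. v < k \<and> P v} = {v \<in> {..<k}. P v}"
    by auto
  then show ?thesis using card_filter_insert[of "{..<k}" k P] by simp
qed

lemma count_adj_correct:
  assumes "regs_ok s" "rg s rV = v" "v < n"
  shows "wpi (count_adj a) (\<lambda>s' _. rg s' rCc = rg s rCc + card {u \<in> marked a s. E v u} \<and> ar s' = ar s) s (20 * deg v + 6)"
  unfolding count_adj_def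
proof (rule wp_adj_const[where b = 15 and I = "\<lambda>k s'. ar s' = ar s \<and> rg s' rZero = 0 \<and>
    rg s' rCc = rg s rCc + card {u \<in> set (take k (al ! v)). ar s a u 0 \<noteq> 0}"])
  fix s' :: st assume *: "ar s' = ar s \<and> rg s' rZero = 0 \<and>
    rg s' rCc = rg s rCc + card {u \<in> set (take (length (al ! rg s rV)) (al ! v)). ar s a u 0 \<noteq> 0}"
  have "{u \<in> set (al ! v). ar s a u 0 \<noteq> 0} = {u \<in> marked a s. E v u}"
    using set_al assms E_n by (auto simp: marked_def)
  then show "rg s' rCc = rg s rCc + card {u \<in> marked a s. E v u} \<and> ar s' = ar s" using * assms by simp
next
  fix k and s' :: st assume k: "k < length (al ! rg s rV)" and I: "ar s' = ar s \<and> rg s' rZero = 0 \<and>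
      rg s' rCc = rg s rCc + card {u \<in> set (take k (al ! v)). ar s a u 0 \<noteq> 0}"
    and u: "rg s' rU = al ! rg s rV ! k"
  have t: "set (take (Suc k) (al ! v)) = insert (al ! v ! k) (set (take k (al ! v)))" "al ! v ! k \<notin> set (take k (al ! v))"
    using take_al[of v k] assms k by auto
  show "wpi (GetV rT2 a rU ;; If rT2 (Inc rCc rCc) Skip) (\<lambda>s' _. ar s' = ar s \<and> rg s' rZero = 0 \<and>
      rg s' rCc = rg s rCc + card {u \<in> set (take (Suc k) (al ! v)). ar s a u 0 \<noteq> 0}) s' 15"
    unfolding t(1) card_filter_insert[OF finite_set t(2)] using I u assms by (auto simp: wp_eqs)
qed (use assms in \<open>simp_all add: regs_ok_def n[symmetric]\<close>)

lemma count_border_correct: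
  assumes r: "regs_ok s"
  shows "wpi count_border (\<lambda>s' _. rg s' rKs = card (marked aF s)) s (19 * n + 4)"
proof -
  have "wpi (for_loop rV rC rN (GetV rT aF rV ;; If rT (Inc rKs rKs) Skip))
      (\<lambda>s' _. rg s' rKs = card (marked aF s)) (upd rKs 0 s) (19 * n + 3)"
  proof (rule wp_for_const[where b = 15 and I = "\<lambda>k s'. ar s' = ar s \<and> rg s' rZero = 0 \<and>
      rg s' rKs = card {v. v < k \<and> ar s aF v 0 \<noteq> 0}"])
  qed (use r in \<open>auto simp: wp_eqs regs_ok_def marked_def card_marked_less_Suc\<close>)
  then show ?thesis by (simp add: count_border_def wp_eqs add_ac)
qed

text \<open>The relation is irreflexive, so \<open>v\<close> is missing among its own neighbours,
  which accounts for the \<open>Suc\<close>.\<close>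

lemma card_adjacent_all:
  assumes "finite A" "v \<in> A"
  shows "card A \<le> Suc (card {u \<in> A. E v u}) \<longleftrightarrow> (\<forall>u\<in>A. u \<noteq> v \<longrightarrow> E v u)"
proof
  assume le: "card A \<le> Suc (card {u \<in> A. E v u})"
  have sub: "{u \<in> A. E v u} \<subseteq> A - {v}" using E_irr by auto
  have "card (A - {v}) \<le> card {u \<in> A. E v u}" using le assms by simp
  then have "{u \<in> A. E v u} = A - {v}" using sub assms(1) by (intro card_seteq) auto
  then show "\<forall>u\<in>A. u \<noteq> v \<longrightarrow> E v u" by auto
next
  assume "\<forall>u\<in>A. u \<noteq> v \<longrightarrow> E v u"
  then have "A - {v} \<subseteq> {u \<in> A. E v u}" by auto
  then have "card (A - {v}) \<le> card {u \<in> A. E v u}" using assms(1) by (intro card_mono) auto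
  then show "card A \<le> Suc (card {u \<in> A. E v u})" using assms by simp
qed

lemma sum_deg: "(\<Sum>k<n. c * deg k) = c * M"
  by (simp add: M_def sum_distrib_left)

lemma check_border_correct:
  assumes r: "regs_ok s" and ks: "rg s rKs = card (marked aF s)"
  shows "wpi check_border (\<lambda>s' _. rg s' rOk \<noteq> 0 \<longleftrightarrow> clique E (marked aF s)) s (20 * M + 29 * n + 4)"
proof -
  let ?S = "marked aF s" and ?s = "upd rOk 1 s"
  let ?test = "Set rCc 1 ;; count_adj aF ;; Sub rT rKs rCc ;; If rT (Set rOk 0) Skip"
  let ?body = "GetV rT aF rV ;; If rT ?test Skip"
  let ?I = "\<lambda>k s'. ar s' = ar s \<and> regs_ok s' \<and> rg s' rKs = card ?S \<and>
      (rg s' rOk \<noteq> 0 \<longleftrightarrow> (\<forall>v<k. v \<in> ?S \<longrightarrow> (\<forall>u\<in>?S. u \<noteq> v \<longrightarrow> E v u)))"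
  have rN: "rg ?s rN = n" using r by (simp add: regs_ok_def)
  have "wpi (for_loop rV rC rN ?body) (\<lambda>s' _. rg s' rOk \<noteq> 0 \<longleftrightarrow> clique E ?S) ?s (20 * M + 29 * n + 3)"
  proof (rule wp_for_sum[where b = 25 and g = "\<lambda>v. 20 * deg v" and I = ?I])
    show "?I 0 ?s" using r ks by (simp add: regs_ok_def)
    show "?I k s2" if "?I k s1" "ar s2 = ar s1" "\<And>r. r \<noteq> rV \<Longrightarrow> r \<noteq> rC \<Longrightarrow> rg s2 r = rg s1 r" for k s1 s2
      using that by (simp add: regs_ok_def)
    show "rg s' rOk \<noteq> 0 \<longleftrightarrow> clique E ?S" if "?I (rg ?s rN) s'" for s'
      using that rN by (auto simp: clique_def marked_def)
    show "(\<Sum>k<rg ?s rN. 20 * deg k) + (rg ?s rN * (25 + 4) + 3) \<le> 20 * M + 29 * n + 3"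
      using rN by (simp add: sum_deg)
    fix k s' assume k: "k < rg ?s rN" and I: "?I k s'" and v: "rg s' rV = k"
    have kn: "k < n" using k rN by simp
    have zero: "rg s' rZero = 0" using I by (simp add: regs_ok_def)
    show "wpi ?body (\<lambda>s' _. ?I (Suc k) s') s' (25 + 20 * deg k)"
    proof (cases "ar s aF k 0 = 0")
      case True
      then have "k \<notin> ?S" by (simp add: marked_def)
      then show ?thesis using True I v zero by (auto simp: wp_eqs regs_ok_def less_Suc_eq)
    next
      case False
      then have kS: "k \<in> ?S" using kn by (simp add: marked_def)
      let ?s1 = "upd rCc 1 (upd rT (ar s aF k 0) s')"
      have "wpi (count_adj aF ;; Sub rT rKs rCc ;; If rT (Set rOk 0) Skip) (\<lambda>s' _. ?I (Suc k) s') ?s1 (10 + 20 * deg k)"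
      proof (rule wp_seq[OF count_adj_correct[of ?s1 k aF]])
        fix s2 assume c: "rg s2 rCc = rg ?s1 rCc + card {u \<in> marked aF ?s1. E k u} \<and> ar s2 = ar ?s1"
          and fr: "frame (count_adj aF) ?s1 s2"
        have r2: "regs_ok s2" by (rule regs_ok_frame[OF _ fr]) (use I in \<open>auto simp: regs_ok_def\<close>)
        have "marked aF ?s1 = ?S" using I by (simp add: marked_def)
        then have cc: "rg s2 rCc = Suc (card {u \<in> ?S. E k u})" "ar s2 = ar s" using c I by auto
        have "rg s2 rKs = card ?S" "rg s2 rOk = rg s' rOk" using frame_rg[OF fr] I by auto
        moreover have "(card ?S - rg s2 rCc = 0) \<longleftrightarrow> (\<forall>u\<in>?S. u \<noteq> k \<longrightarrow> E k u)"
          using card_adjacent_all[of ?S k] kS cc by simp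
        ultimately show "wpi (Sub rT rKs rCc ;; If rT (Set rOk 0) Skip) (\<lambda>s' _. ?I (Suc k) s') s2 (10 + 20 * deg k - (20 * deg k + 6))"
          using r2 cc I kS by (auto simp: wp_eqs regs_ok_def less_Suc_eq)
      qed (use I v kn in \<open>auto simp: regs_ok_def\<close>)
      then show ?thesis using False I v zero by (simp add: wp_eqs)
    qed
  qed (use r in auto)
  then show ?thesis by (simp add: check_border_def wp_eqs add_ac)
qed

lemma mark_piece_correct:
  assumes r: "regs_ok s"
  shows "wpi mark_piece (\<lambda>s' _. marked aA s' = marked aR s - marked aDead s \<and> rg s' rA = card (marked aA s')) s (44 * n + 4)"
proof -
  let ?P = "\<lambda>v. ar s aDead v 0 = 0 \<and> ar s aR v 0 \<noteq> 0"
  have "wpi (for_loop rV rC rN (GetV rT aDead rV ;; If rT (Set rT2 0) (GetV rT2 aR rV) ;;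
     PutV aA rV rT2 ;; If rT2 (Inc rA rA) Skip))
     (\<lambda>s' _. marked aA s' = marked aR s - marked aDead s \<and> rg s' rA = card (marked aA s')) (upd rA 0 s) (44 * n + 3)"
  proof (rule wp_for_const[where b = 40 and I = "\<lambda>k s'. ar s' aDead = ar s aDead \<and> ar s' aR = ar s aR \<and> rg s' rZero = 0 \<and>
      (\<forall>v<k. ar s' aA v 0 \<noteq> 0 \<longleftrightarrow> ?P v) \<and> rg s' rA = card {v. v < k \<and> ?P v}"])
    fix s' :: st assume I: "ar s' aDead = ar s aDead \<and> ar s' aR = ar s aR \<and> rg s' rZero = 0 \<and>
      (\<forall>v<rg (upd rA 0 s) rN. ar s' aA v 0 \<noteq> 0 \<longleftrightarrow> ?P v) \<and> rg s' rA = card {v. v < rg (upd rA 0 s) rN \<and> ?P v}"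
    then have "marked aA s' = {v. v < n \<and> ?P v}" "rg s' rA = card {v. v < n \<and> ?P v}"
      using r by (auto simp: marked_def regs_ok_def)
    moreover have "{v. v < n \<and> ?P v} = marked aR s - marked aDead s" by (auto simp: marked_def)
    ultimately show "marked aA s' = marked aR s - marked aDead s \<and> rg s' rA = card (marked aA s')" by simp
  next
    fix k and s' :: st assume "ar s' aDead = ar s aDead \<and> ar s' aR = ar s aR \<and> rg s' rZero = 0 \<and>
      (\<forall>v<k. ar s' aA v 0 \<noteq> 0 \<longleftrightarrow> ?P v) \<and> rg s' rA = card {v. v < k \<and> ?P v}" "rg s' rV = k"
    then show "wpi (GetV rT aDead rV ;; If rT (Set rT2 0) (GetV rT2 aR rV) ;; PutV aA rV rT2 ;; If rT2 (Inc rA rA) Skip)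
      (\<lambda>s' _. ar s' aDead = ar s aDead \<and> ar s' aR = ar s aR \<and> rg s' rZero = 0 \<and>
      (\<forall>v<Suc k. ar s' aA v 0 \<noteq> 0 \<longleftrightarrow> ?P v) \<and> rg s' rA = card {v. v < Suc k \<and> ?P v}) s' 40"
      unfolding card_marked_less_Suc by (auto simp: wp_eqs less_Suc_eq ar_put_other)
  qed (use r in \<open>auto simp: regs_ok_def\<close>)
  then show ?thesis by (simp add: mark_piece_def wp_eqs add_ac)
qed

lemma mark_core_correct:
  assumes r: "regs_ok s" and a: "rg s rA = card (marked aA s)"
  shows "wpi mark_core (\<lambda>s' _. marked aH s' = marked aA s - universals E (marked aA s)) s (20 * M + 38 * n + 3)"
proof -
  let ?A = "marked aA s"
  let ?body = "GetV rT aA rV ;; If rT (Set rCc 1 ;; count_adj aA ;; Sub rT rA rCc) Skip ;; PutV aH rV rT"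
  let ?I = "\<lambda>k s'. ar s' aA = ar s aA \<and> regs_ok s' \<and> rg s' rA = card ?A \<and>
      (\<forall>v<k. ar s' aH v 0 \<noteq> 0 \<longleftrightarrow> v \<in> ?A \<and> \<not> (\<forall>u\<in>?A. u \<noteq> v \<longrightarrow> E v u))"
  have rN: "rg s rN = n" using r by (simp add: regs_ok_def)
  show ?thesis
    unfolding mark_core_def
  proof (rule wp_for_sum[where b = 34 and g = "\<lambda>v. 20 * deg v" and I = ?I])
    show "?I 0 s" using r a by simp
    show "?I k s2" if "?I k s1" "ar s2 = ar s1" "\<And>r. r \<noteq> rV \<Longrightarrow> r \<noteq> rC \<Longrightarrow> rg s2 r = rg s1 r" for k s1 s2
      using that by (simp add: regs_ok_def)
    show "marked aH s' = ?A - universals E ?A" if "?I (rg s rN) s'" for s'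
      using that rN by (auto simp: universals_def marked_def)
    show "(\<Sum>k<rg s rN. 20 * deg k) + (rg s rN * (34 + 4) + 3) \<le> 20 * M + 38 * n + 3"
      using rN by (simp add: sum_deg)
    fix k s' assume k: "k < rg s rN" and I: "?I k s'" and v: "rg s' rV = k"
    have kn: "k < n" using k rN by simp
    have zero: "rg s' rZero = 0" using I by (simp add: regs_ok_def)
    show "wpi ?body (\<lambda>s' _. ?I (Suc k) s') s' (34 + 20 * deg k)"
    proof (cases "ar s aA k 0 = 0")
      case True
      then have "k \<notin> ?A" by (simp add: marked_def)
      then show ?thesis using True I v zero by (auto simp: wp_eqs regs_ok_def less_Suc_eq ar_put_other)
    next
      case False
      then have kA: "k \<in> ?A" using kn by (simp add: marked_def)
      let ?s1 = "upd rCc 1 (upd rT (ar s aA k 0) s')"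
      have "wpi (count_adj aA ;; Sub rT rA rCc ;; PutV aH rV rT) (\<lambda>s' _. ?I (Suc k) s') ?s1 (19 + 20 * deg k)"
      proof (rule wp_seq[OF count_adj_correct[of ?s1 k aA]])
        fix s2 assume c: "rg s2 rCc = rg ?s1 rCc + card {u \<in> marked aA ?s1. E k u} \<and> ar s2 = ar ?s1"
          and fr: "frame (count_adj aA) ?s1 s2"
        have r2: "regs_ok s2" by (rule regs_ok_frame[OF _ fr]) (use I in \<open>auto simp: regs_ok_def\<close>)
        have "marked aA ?s1 = ?A" using I by (simp add: marked_def)
        then have cc: "rg s2 rCc = Suc (card {u \<in> ?A. E k u})" "ar s2 = ar s'" using c I by auto
        have "rg s2 rA = card ?A" "rg s2 rV = k" using frame_rg[OF fr] I v by auto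
        moreover have "(card ?A - rg s2 rCc = 0) \<longleftrightarrow> (\<forall>u\<in>?A. u \<noteq> k \<longrightarrow> E k u)"
          using card_adjacent_all[of ?A k] kA cc by simp
        ultimately show "wpi (Sub rT rA rCc ;; PutV aH rV rT) (\<lambda>s' _. ?I (Suc k) s') s2 (19 + 20 * deg k - (20 * deg k + 6))"
          using r2 cc I kA by (auto simp: wp_eqs regs_ok_def less_Suc_eq ar_put_other)
      qed (use I v kn in \<open>auto simp: regs_ok_def\<close>)
      then show ?thesis using False I v zero by (simp add: wp_eqs wp_Seq_fun)
    qed
  qed (use r in auto)
qed

subsection \<open>Series-parallel reduction\<close>

text \<open>The matrix is described for all indices, not only inside \<open>H\<close>, so that for
  empty \<open>H\<close> it is the zero matrix.\<close>

definition represents :: "nat set \<Rightarrow> (nat \<Rightarrow> nat \<Rightarrow> bool) \<Rightarrow> st \<Rightarrow> bool" where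
  "represents H F s \<longleftrightarrow> regs_ok s \<and> H = marked aH s \<and>
     (\<forall>x y. ar s aM x y \<noteq> 0 \<longleftrightarrow> x \<in> H \<and> y \<in> H \<and> F x y) \<and> (\<forall>v\<in>H. ar s aD v 0 = card {u \<in> H. F v u})"

lemma copy_row_correct:
  assumes "regs_ok s" "rg s rV = v" "v < n" "rg s rCc = 0"
  shows "wpi copy_row (\<lambda>s' _. rg s' rCc = card {u \<in> marked aH s. E v u} \<and>
     (\<forall>x y. ar s' aM x y = (if x = v \<and> y \<in> marked aH s \<and> E v y then 1 else ar s aM x y))) s (33 * deg v + 6)"
proof -
  let ?I = "\<lambda>k s'. ar s' aH = ar s aH \<and> rg s' rZero = 0 \<and> rg s' rV = v \<and>
    rg s' rCc = card {u \<in> set (take k (al ! v)). ar s aH u 0 \<noteq> 0} \<and>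
    (\<forall>x y. ar s' aM x y = (if x = v \<and> y \<in> set (take k (al ! v)) \<and> ar s aH y 0 \<noteq> 0 then 1 else ar s aM x y))"
  show ?thesis
    unfolding copy_row_def
  proof (rule wp_adj_const[where b = 28 and I = ?I])
    fix s' :: st assume *: "?I (length (al ! rg s rV)) s'"
    have "y \<in> set (al ! v) \<and> ar s aH y 0 \<noteq> 0 \<longleftrightarrow> y \<in> marked aH s \<and> E v y" for y
      using set_al[OF assms(3)] E_n by (auto simp: marked_def)
    then show "rg s' rCc = card {u \<in> marked aH s. E v u} \<and>
     (\<forall>x y. ar s' aM x y = (if x = v \<and> y \<in> marked aH s \<and> E v y then 1 else ar s aM x y))"
      using * assms(2) by simp
  next
    fix k and s' :: st assume k: "k < length (al ! rg s rV)" and I: "?I k s'" and u: "rg s' rU = al ! rg s rV ! k"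
    have t: "set (take (Suc k) (al ! v)) = insert (al ! v ! k) (set (take k (al ! v)))" "al ! v ! k \<notin> set (take k (al ! v))"
      using take_al[of v k] assms k by auto
    show "wpi (GetV rT2 aH rU ;; If rT2 (Inc rCc rCc ;; Set rT2 1 ;; Put aM rV rU rT2) Skip) (\<lambda>s' _. ?I (Suc k) s') s' 28"
      unfolding t(1) card_filter_insert[OF finite_set t(2)] using I u assms by (auto simp: wp_eqs ar_put_other)
  qed (use assms in \<open>simp_all add: regs_ok_def n[symmetric]\<close>)
qed

text \<open>The matrix has to be zero on entry. Clearing it for each atom would take about n^2 steps
  every time; a successful elimination leaves it zero instead.\<close>

lemma build_correct:
  assumes r: "regs_ok s" and zero: "\<And>x y. ar s aM x y = 0"
  shows "wpi build (\<lambda>s' _. represents (marked aH s) E s' \<and> rg s' rH = card (marked aH s)) s (33 * M + 38 * n + 4)"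
proof -
  let ?H = "marked aH s" and ?s = "upd rH 0 s"
  let ?body = "GetV rT aH rV ;; If rT (Inc rH rH ;; Set rCc 0 ;; copy_row ;; PutV aD rV rCc) Skip"
  let ?I = "\<lambda>k s'. ar s' aH = ar s aH \<and> regs_ok s' \<and> rg s' rH = card {v. v < k \<and> ar s aH v 0 \<noteq> 0} \<and>
      (\<forall>x y. ar s' aM x y \<noteq> 0 \<longleftrightarrow> x < k \<and> x \<in> ?H \<and> y \<in> ?H \<and> E x y) \<and>
      (\<forall>v<k. v \<in> ?H \<longrightarrow> ar s' aD v 0 = card {u \<in> ?H. E v u})"
  have rN: "rg ?s rN = n" using r by (simp add: regs_ok_def)
  have "wpi (for_loop rV rC rN ?body) (\<lambda>s' _. represents ?H E s' \<and> rg s' rH = card ?H) ?s (33 * M + 38 * n + 3)"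
  proof (rule wp_for_sum[where b = 34 and g = "\<lambda>v. 33 * deg v" and I = ?I])
    show "?I 0 ?s" using r zero by (simp add: regs_ok_def)
    show "?I k s2" if "?I k s1" "ar s2 = ar s1" "\<And>r. r \<noteq> rV \<Longrightarrow> r \<noteq> rC \<Longrightarrow> rg s2 r = rg s1 r" for k s1 s2
      using that by (simp add: regs_ok_def)
    show "represents ?H E s' \<and> rg s' rH = card ?H" if "?I (rg ?s rN) s'" for s'
    proof -
      have "marked aH s' = ?H" using that by (simp add: marked_def)
      moreover have "{v. v < n \<and> ar s aH v 0 \<noteq> 0} = ?H" by (simp add: marked_def)
      moreover have "x < n" if "x \<in> ?H" for x using that by (simp add: marked_def)
      ultimately show ?thesis using that unfolding rN represents_def by auto
    qed
    show "(\<Sum>k<rg ?s rN. 33 * deg k) + (rg ?s rN * (34 + 4) + 3) \<le> 33 * M + 38 * n + 3"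
      using rN by (simp add: sum_deg)
    fix k s' assume k: "k < rg ?s rN" and I: "?I k s'" and v: "rg s' rV = k"
    have kn: "k < n" using k rN by simp
    have zero: "rg s' rZero = 0" using I by (simp add: regs_ok_def)
    show "wpi ?body (\<lambda>s' _. ?I (Suc k) s') s' (34 + 33 * deg k)"
    proof (cases "ar s aH k 0 = 0")
      case True
      then have "k \<notin> ?H" by (simp add: marked_def)
      then show ?thesis using True I v zero unfolding card_marked_less_Suc by (auto simp: wp_eqs regs_ok_def less_Suc_eq)
    next
      case False
      then have kH: "k \<in> ?H" using kn by (simp add: marked_def)
      let ?s1 = "upd rCc 0 (upd rH (Suc (rg s' rH)) (upd rT (ar s aH k 0) s'))"
      have "wpi (copy_row ;; PutV aD rV rCc) (\<lambda>s' _. ?I (Suc k) s') ?s1 (18 + 33 * deg k)"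
      proof (rule wp_seq[OF copy_row_correct[of ?s1 k]])
        fix s2 assume c: "rg s2 rCc = card {u \<in> marked aH ?s1. E k u} \<and>
            (\<forall>x y. ar s2 aM x y = (if x = k \<and> y \<in> marked aH ?s1 \<and> E k y then 1 else ar ?s1 aM x y))"
          and fr: "frame copy_row ?s1 s2"
        have r2: "regs_ok s2" by (rule regs_ok_frame[OF _ fr]) (use I in \<open>auto simp: regs_ok_def\<close>)
        have m: "marked aH ?s1 = ?H" using I by (simp add: marked_def)
        have "rg s2 rH = Suc (rg s' rH)" "rg s2 rV = k" "ar s2 aH = ar s aH" "ar s2 aD = ar s' aD"
          using frame_rg[OF fr] frame_ar[OF fr] I v by auto
        then show "wpi (PutV aD rV rCc) (\<lambda>s' _. ?I (Suc k) s') s2 (18 + 33 * deg k - (33 * deg k + 6))"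
          using r2 c I kH False unfolding m card_marked_less_Suc by (auto simp: wp_eqs regs_ok_def less_Suc_eq ar_put_other)
      qed (use I v kn in \<open>auto simp: regs_ok_def\<close>)
      then show ?thesis using False I v zero by (simp add: wp_eqs)
    qed
  qed (use r in auto)
  then show ?thesis by (simp add: build_def wp_eqs add_ac)
qed

lemma find_low_correct:
  assumes R: "represents H F s"
  shows "wpi find_low (\<lambda>s' _. if \<exists>v\<in>H. card {u \<in> H. F v u} \<le> 2
     then \<exists>v\<in>H. card {u \<in> H. F v u} \<le> 2 \<and> rg s' rF = Suc v else rg s' rF = 0) s (35 * n + 4)"
proof -
  let ?low = "\<lambda>v. v \<in> H \<and> card {u \<in> H. F v u} \<le> 2"
  have H: "v \<in> H \<longleftrightarrow> v < n \<and> ar s aH v 0 \<noteq> 0" "v \<in> H \<Longrightarrow> card {u \<in> H. F v u} = ar s aD v 0" for v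
    using R by (auto simp: represents_def marked_def)
  have rN: "rg s rN = n" "rg s rZero = 0" using R by (auto simp: represents_def regs_ok_def)
  define J where "J k r \<longleftrightarrow> (if \<exists>v<k. ?low v then \<exists>v. ?low v \<and> r = Suc v else r = 0)" for k r :: nat
  have J_0: "J 0 0" by (simp add: J_def)
  have J_low: "J (Suc k) (Suc k)" if "?low k" for k using that by (auto simp: J_def)
  have J_high: "J (Suc k) r" if "J k r" "\<not> ?low k" for k r
  proof -
    have "(\<exists>v<Suc k. ?low v) \<longleftrightarrow> (\<exists>v<k. ?low v)" using that(2) by (auto simp: less_Suc_eq)
    then show ?thesis using that(1) by (simp only: J_def)
  qed
  have "wpi (for_loop rV rC rN (GetV rT aH rV ;;
     If rT (GetV rT aD rV ;; Set rT2 3 ;; Sub rT2 rT2 rT ;; If rT2 (Inc rF rV) Skip) Skip))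
     (\<lambda>s' _. if \<exists>v\<in>H. card {u \<in> H. F v u} \<le> 2
     then \<exists>v\<in>H. card {u \<in> H. F v u} \<le> 2 \<and> rg s' rF = Suc v else rg s' rF = 0) (upd rF 0 s) (35 * n + 3)"
  proof (rule wp_for_const[where b = 31 and I = "\<lambda>k s'. ar s' = ar s \<and> rg s' rZero = 0 \<and> J k (rg s' rF)"])
    fix s' :: st assume "ar s' = ar s \<and> rg s' rZero = 0 \<and> J (rg (upd rF 0 s) rN) (rg s' rF)"
    then have J: "J n (rg s' rF)" using rN by simp
    have "(\<exists>v<n. ?low v) \<longleftrightarrow> (\<exists>v\<in>H. card {u \<in> H. F v u} \<le> 2)" using H(1) by blast
    then show "if \<exists>v\<in>H. card {u \<in> H. F v u} \<le> 2
     then \<exists>v\<in>H. card {u \<in> H. F v u} \<le> 2 \<and> rg s' rF = Suc v else rg s' rF = 0"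
      using J unfolding J_def by (simp only: Bex_def conj_assoc)
  next
    fix k and s' :: st assume k: "k < rg (upd rF 0 s) rN" and I: "ar s' = ar s \<and> rg s' rZero = 0 \<and> J k (rg s' rF)"
      and v: "rg s' rV = k"
    have low: "?low k \<longleftrightarrow> ar s aH k 0 \<noteq> 0 \<and> ar s aD k 0 \<le> 2" using H[of k] k rN by auto
    show "wpi (GetV rT aH rV ;; If rT (GetV rT aD rV ;; Set rT2 3 ;; Sub rT2 rT2 rT ;; If rT2 (Inc rF rV) Skip) Skip)
      (\<lambda>s' _. ar s' = ar s \<and> rg s' rZero = 0 \<and> J (Suc k) (rg s' rF)) s' 31"
    proof (cases "?low k")
      case True
      then have "ar s aH k 0 \<noteq> 0" "\<not> 3 - ar s aD k 0 = 0" using low by auto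
      then show ?thesis using I v J_low[OF True] by (simp add: wp_eqs)
    next
      case False
      then consider "ar s aH k 0 = 0" | "ar s aH k 0 \<noteq> 0" "3 - ar s aD k 0 = 0" using low by force
      then show ?thesis using I v J_high[OF _ False] by cases (simp_all add: wp_eqs)
    qed
  qed (use rN J_0 in auto)
  then show ?thesis by (simp add: find_low_def wp_eqs add_ac)
qed

end

context machine_input
begin

lemma detach_correct:
  assumes R: "represents H F s" and F: "symp F" "\<And>v. \<not> F v v" and x: "rg s rX = x" "x \<in> H"
    and deg: "card {u \<in> H. F x u} \<le> 2"
  shows "wpi detach (\<lambda>s' _. represents (H - {x}) F s' \<and>
     (rg s' rNb = 0 \<and> (\<forall>a b. a \<in> H \<and> b \<in> H \<and> F x a \<and> F x b \<longrightarrow> a = b) \<or>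
      (\<exists>a b. rg s' rNa = Suc a \<and> rg s' rNb = Suc b \<and> a \<noteq> b \<and> {u \<in> H. F x u} = {a, b}))) s (69 * n + 17)"
proof -
  let ?N = "{u \<in> H. F x u}"
  let ?body = "Get rT aM rX rV ;;
     If rT (Put aM rX rV rZero ;; Put aM rV rX rZero ;; GetV rT aD rV ;; Dec rT rT ;; PutV aD rV rT ;;
       Mov rNb rNa ;; Inc rNa rV) Skip"
  let ?s = "upd rNb 0 (upd rNa 0 s)"
  have H: "H = marked aH s" and regs: "regs_ok s" and M: "\<And>a b. ar s aM a b \<noteq> 0 \<longleftrightarrow> a \<in> H \<and> b \<in> H \<and> F a b"
    and D: "\<And>v. v \<in> H \<Longrightarrow> ar s aD v 0 = card {u \<in> H. F v u}"
    using R by (auto simp: represents_def)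
  have finH: "finite H" by (simp add: H)
  have Hn: "v \<in> H \<Longrightarrow> v < n" for v by (simp add: H marked_def)
  have rN: "rg ?s rN = n" using regs by (simp add: regs_ok_def)
  define nb where "nb k s' \<longleftrightarrow> rg s' rNa = 0 \<and> rg s' rNb = 0 \<and> {u \<in> ?N. u < k} = {} \<or>
      (\<exists>a. rg s' rNa = Suc a \<and> rg s' rNb = 0 \<and> {u \<in> ?N. u < k} = {a}) \<or>
      (\<exists>a b. rg s' rNa = Suc a \<and> rg s' rNb = Suc b \<and> a \<noteq> b \<and> {u \<in> ?N. u < k} = {a, b})" for k and s' :: st
  define I where "I k s' \<longleftrightarrow> regs_ok s' \<and> rg s' rX = x \<and> ar s' aH = ar s aH \<and> nb k s' \<and>
      (\<forall>a b. ar s' aM a b \<noteq> 0 \<longleftrightarrow> ar s aM a b \<noteq> 0 \<and> \<not> (a = x \<and> b < k) \<and> \<not> (b = x \<and> a < k)) \<and>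
      (\<forall>v. ar s' aD v 0 = ar s aD v 0 - (if v \<in> ?N \<and> v < k then 1 else 0))" for k and s' :: st
  have nb_cong: "nb k s2" if "nb k s1" "rg s2 rNa = rg s1 rNa" "rg s2 rNb = rg s1 rNb" for k s1 s2
    using that by (simp add: nb_def)
  have less_Suc: "{u \<in> ?N. u < Suc k} = (if k \<in> ?N then insert k {u \<in> ?N. u < k} else {u \<in> ?N. u < k})" for k
    by (auto simp: less_Suc_eq)
  have nb_add: "nb (Suc k) s2" if "nb k s1" "k \<in> ?N" "rg s2 rNa = Suc k" "rg s2 rNb = rg s1 rNa" for k s1 s2
  proof -
    have ins: "{u \<in> ?N. u < Suc k} = insert k {u \<in> ?N. u < k}" using less_Suc[of k] that(2) by (simp only: if_True)
    show ?thesis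
      using that(1)[unfolded nb_def]
    proof (elim disjE exE conjE)
      assume 1: "rg s1 rNa = 0" "{u \<in> ?N. u < k} = {}"
      have "{u \<in> ?N. u < Suc k} = {k}" unfolding ins 1(2) by simp
      then have "rg s2 rNa = Suc k \<and> rg s2 rNb = 0 \<and> {u \<in> ?N. u < Suc k} = {k}" using 1(1) that(3,4) by simp
      then show ?thesis unfolding nb_def by blast
    next
      fix a assume 2: "rg s1 rNa = Suc a" "{u \<in> ?N. u < k} = {a}"
      then have "a \<in> {u \<in> ?N. u < k}" by simp
      then have "a \<noteq> k" by simp
      moreover have "{u \<in> ?N. u < Suc k} = {k, a}" unfolding ins 2(2) by simp
      ultimately have "rg s2 rNa = Suc k \<and> rg s2 rNb = Suc a \<and> k \<noteq> a \<and> {u \<in> ?N. u < Suc k} = {k, a}" using 2(1) that(3,4) by simp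
      then show ?thesis unfolding nb_def by blast
    next
      \<comment> \<open>With two neighbours already recorded, a third one is excluded by the degree
        bound.\<close>
      fix a b assume "a \<noteq> b" and 3: "{u \<in> ?N. u < k} = {a, b}"
      then have "a \<in> {u \<in> ?N. u < k}" "b \<in> {u \<in> ?N. u < k}" by simp_all
      then have ab: "a \<in> ?N" "a < k" "b \<in> ?N" "b < k" by auto
      have "{a, b, k} \<subseteq> ?N" using ab that(2) by (simp only: insert_subset empty_subsetI simp_thms)
      moreover have "finite ?N" using finH by simp
      ultimately have "card {a, b, k} \<le> card ?N" by (intro card_mono)
      moreover have "card {a, b, k} = 3" using ab \<open>a \<noteq> b\<close> by simp
      ultimately show ?thesis using deg by simp
    qed
  qed
  have loop: "wpi (for_loop rV rC rN ?body) (\<lambda>s' _. I n s') ?s (69 * n + 3)"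
  proof (rule wp_for_const[where b = 65 and I = I])
    show "I 0 ?s" using regs x by (simp add: I_def nb_def regs_ok_def)
    show "I k s2" if "I k s1" "ar s2 = ar s1" "\<And>r. r \<noteq> rV \<Longrightarrow> r \<noteq> rC \<Longrightarrow> rg s2 r = rg s1 r" for k s1 s2
      using that nb_cong[of k s1 s2] by (simp add: I_def regs_ok_def)
    show "I n s'" if "I (rg ?s rN) s'" for s' using that rN by simp
    fix k s' assume k: "k < rg ?s rN" and I: "I k s'" and v: "rg s' rV = k"
    have I': "regs_ok s'" "rg s' rX = x" "ar s' aH = ar s aH" "nb k s'"
      "\<And>a b. ar s' aM a b \<noteq> 0 \<longleftrightarrow> ar s aM a b \<noteq> 0 \<and> \<not> (a = x \<and> b < k) \<and> \<not> (b = x \<and> a < k)"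
      "\<And>v. ar s' aD v 0 = ar s aD v 0 - (if v \<in> ?N \<and> v < k then 1 else 0)"
      using I by (auto simp: I_def)
    have zero: "rg s' rZero = 0" using I' by (simp add: regs_ok_def)
    have test: "ar s' aM x k \<noteq> 0 \<longleftrightarrow> k \<in> ?N" using I'(5) M x(2) by auto
    have xN: "x \<notin> ?N" using F by simp
    show "wpi ?body (\<lambda>s' _. I (Suc k) s') s' 65"
    proof (cases "k \<in> ?N")
      case False
      have "ar s aM k x = 0" "ar s aM x k = 0" using False M F(1) x(2) by (auto dest: sympD)
      moreover have "nb (Suc k) s2" if "rg s2 rNa = rg s' rNa" "rg s2 rNb = rg s' rNb" for s2
        using nb_cong[OF I'(4) that] less_Suc[of k] False by (simp only: nb_def if_False)
      ultimately have "I (Suc k) (upd rT (ar s' aM x k) s')"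
        using I' False by (auto simp: I_def regs_ok_def less_Suc_eq)
      moreover have "ar s' aM x k = 0" using test False by blast
      ultimately show ?thesis using I'(1,2) v by (simp add: wp_eqs)
    next
      case True
      let ?s2 = "upd rNa (Suc k) (upd rNb (rg s' rNa) (put aD k 0 (ar s' aD k 0 - 1) (upd rT (ar s' aD k 0 - 1) (upd rT (ar s' aD k 0)
        (put aM k x 0 (put aM x k 0 (upd rT (ar s' aM x k) s')))))))"
      have "nb (Suc k) ?s2" by (rule nb_add[OF I'(4) True]) auto
      then have "I (Suc k) ?s2"
        using I' True xN by (auto simp: I_def regs_ok_def less_Suc_eq ar_put_other)
      moreover have "ar s' aM x k \<noteq> 0" using test True by blast
      ultimately show ?thesis using I'(1,2) v zero by (simp add: wp_eqs)
    qed
  qed (use regs in \<open>auto simp: regs_ok_def\<close>)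
  have final: "represents (H - {x}) F (put aH x 0 0 s') \<and>
     (rg s' rNb = 0 \<and> (\<forall>a b. a \<in> H \<and> b \<in> H \<and> F x a \<and> F x b \<longrightarrow> a = b) \<or>
      (\<exists>a b. rg s' rNa = Suc a \<and> rg s' rNb = Suc b \<and> a \<noteq> b \<and> ?N = {a, b}))" if I: "I n s'" for s'
  proof
    have N: "{u \<in> ?N. u < n} = ?N" using Hn by auto
    have "marked aH (put aH x 0 0 s') = H - {x}" using I by (auto simp: I_def H marked_def)
    moreover have "ar s' aM a b \<noteq> 0 \<longleftrightarrow> a \<in> H - {x} \<and> b \<in> H - {x} \<and> F a b" for a b
      using I M Hn unfolding I_def by auto
    moreover have "ar s' aD v 0 = card {u \<in> H - {x}. F v u}" if v: "v \<in> H - {x}" for v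
    proof -
      have "{u \<in> H - {x}. F v u} = {u \<in> H. F v u} - (if F x v then {x} else {})" using F(1) by (auto dest: sympD)
      moreover have "F x v \<Longrightarrow> x \<in> {u \<in> H. F v u}" using F(1) x by (auto dest: sympD)
      ultimately have "card {u \<in> H - {x}. F v u} = card {u \<in> H. F v u} - (if F x v then 1 else 0)"
        using finH by (auto simp: card_Diff_singleton)
      moreover have "ar s' aD v 0 = ar s aD v 0 - (if F x v then 1 else 0)" using I v Hn by (simp add: I_def)
      ultimately show ?thesis using D v by simp
    qed
    ultimately show "represents (H - {x}) F (put aH x 0 0 s')"
      using I by (auto simp: represents_def I_def regs_ok_def)
    have "nb n s'" using I by (simp add: I_def)
    then show "rg s' rNb = 0 \<and> (\<forall>a b. a \<in> H \<and> b \<in> H \<and> F x a \<and> F x b \<longrightarrow> a = b) \<or>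
      (\<exists>a b. rg s' rNa = Suc a \<and> rg s' rNb = Suc b \<and> a \<noteq> b \<and> ?N = {a, b})"
      unfolding nb_def N
    proof (elim disjE exE conjE)
      assume *: "rg s' rNb = 0" "?N = {}"
      then have "\<not> (a \<in> H \<and> F x a)" for a by (simp add: set_eq_iff)
      then show ?thesis using *(1) by metis
    next
      fix a assume *: "rg s' rNb = 0" "?N = {a}"
      then have "u = a" if "u \<in> H" "F x u" for u using that unfolding set_eq_iff by auto
      then have "\<forall>b c. b \<in> H \<and> c \<in> H \<and> F x b \<and> F x c \<longrightarrow> b = c" by metis
      then show ?thesis using *(1) by simp
    next
      fix a b assume "rg s' rNa = Suc a" "rg s' rNb = Suc b" "a \<noteq> b" "?N = {a, b}"
      then have "\<exists>a b. rg s' rNa = Suc a \<and> rg s' rNb = Suc b \<and> a \<noteq> b \<and> ?N = {a, b}" by (intro exI conjI)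
      then show ?thesis by (rule disjI2)
    qed
  qed
  have "wpi (for_loop rV rC rN ?body ;; PutV aH rX rZero) (\<lambda>s' _. represents (H - {x}) F s' \<and>
     (rg s' rNb = 0 \<and> (\<forall>a b. a \<in> H \<and> b \<in> H \<and> F x a \<and> F x b \<longrightarrow> a = b) \<or>
      (\<exists>a b. rg s' rNa = Suc a \<and> rg s' rNb = Suc b \<and> a \<noteq> b \<and> ?N = {a, b}))) ?s (69 * n + 15)"
  proof (rule wp_seq[OF loop])
    fix s' assume "I n s'"
    then show "wpi (PutV aH rX rZero) (\<lambda>s' _. represents (H - {x}) F s' \<and>
     (rg s' rNb = 0 \<and> (\<forall>a b. a \<in> H \<and> b \<in> H \<and> F x a \<and> F x b \<longrightarrow> a = b) \<or>
      (\<exists>a b. rg s' rNa = Suc a \<and> rg s' rNb = Suc b \<and> a \<noteq> b \<and> ?N = {a, b}))) s' (69 * n + 15 - (69 * n + 3))"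
      using final[of s'] by (simp add: wp_eqs I_def regs_ok_def)
  qed simp
  then show ?thesis by (simp add: detach_def wp_eqs add_ac)
qed

lemma represents_cong:
  "represents H F s \<Longrightarrow> (\<And>a b. a \<in> H \<Longrightarrow> b \<in> H \<Longrightarrow> F a b = F' a b) \<Longrightarrow> represents H F' s"
proof -
  assume R: "represents H F s" and eq: "\<And>a b. a \<in> H \<Longrightarrow> b \<in> H \<Longrightarrow> F a b = F' a b"
  have "{u \<in> H. F v u} = {u \<in> H. F' v u}" if "v \<in> H" for v using eq that by auto
  moreover have "x \<in> H \<and> y \<in> H \<and> F x y \<longleftrightarrow> x \<in> H \<and> y \<in> H \<and> F' x y" for x y using eq by auto
  ultimately show "represents H F' s" using R unfolding represents_def by simp
qed

lemma represents_upd: "represents H F s \<Longrightarrow> r \<notin> {rN, rN1, rZero} \<Longrightarrow> represents H F (upd r y s)"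
  by (simp add: represents_def regs_ok_def marked_def)

text \<open>\<open>H'\<close> is the vertex set before the removal of \<open>x\<close>, in which its
  neighbours were recorded, and \<open>H\<close> the one after it.\<close>

lemma join_correct:
  assumes R: "represents H F s" and F: "symp F" "\<And>v. \<not> F v v" and nb: "\<And>u. F x u \<Longrightarrow> u \<in> H \<or> u \<notin> H'" "H \<subseteq> H'"
    and N: "rg s rNb = 0 \<and> (\<forall>a b. a \<in> H' \<and> b \<in> H' \<and> F x a \<and> F x b \<longrightarrow> a = b) \<or>
      (\<exists>a b. rg s rNa = Suc a \<and> rg s rNb = Suc b \<and> a \<noteq> b \<and> {u \<in> H'. F x u} = {a, b})"
  shows "wpi join (\<lambda>s' _. represents H (\<lambda>a b. F a b \<or> a \<noteq> b \<and> F x a \<and> F x b) s') s 92"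
proof -
  let ?F = "\<lambda>a b. F a b \<or> a \<noteq> b \<and> F x a \<and> F x b"
  have regs: "rg s rZero = 0" using R by (simp add: represents_def regs_ok_def)
  show ?thesis
    using N
  proof (elim disjE conjE exE)
    assume *: "rg s rNb = 0" "\<forall>a b. a \<in> H' \<and> b \<in> H' \<and> F x a \<and> F x b \<longrightarrow> a = b"
    have "represents H ?F s"
      by (rule represents_cong[OF R]) (use * nb(2) in blast)
    then show ?thesis using *(1) by (simp add: join_def wp_eqs)
  next
    fix a b assume ab: "rg s rNa = Suc a" "rg s rNb = Suc b" "a \<noteq> b" "{u \<in> H'. F x u} = {a, b}"
    have "a \<in> {u \<in> H'. F x u}" "b \<in> {u \<in> H'. F x u}" using ab(4) by auto
    then have abH: "a \<in> H" "b \<in> H" "F x a" "F x b" using nb by auto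
    have Fab: "?F c d \<longleftrightarrow> F c d \<or> c = a \<and> d = b \<or> c = b \<and> d = a" if "c \<in> H" "d \<in> H" for c d
    proof -
      have "F x c \<longleftrightarrow> c = a \<or> c = b" "F x d \<longleftrightarrow> d = a \<or> d = b" using ab(4) that nb(2) by blast+
      then show ?thesis using ab(3) by auto
    qed
    let ?s1 = "upd rT (ar s aM a b) (upd rNa a (upd rNb b s))"
    have M: "ar s aM c d \<noteq> 0 \<longleftrightarrow> c \<in> H \<and> d \<in> H \<and> F c d" for c d using R by (auto simp: represents_def)
    show ?thesis
    proof (cases "F a b")
      case True
      have "represents H ?F s"
        by (rule represents_cong[OF R]) (use Fab True F(1) in \<open>auto dest: sympD\<close>)
      then have "represents H ?F ?s1" by (intro represents_upd) auto
      moreover have "ar s aM a b \<noteq> 0" using M True abH by blast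
      ultimately show ?thesis using ab by (simp add: join_def wp_eqs)
    next
      case False
      have m0: "ar s aM a b = 0" using M[of a b] False by auto
      have nFba: "\<not> F b a" using False F(1) by (auto dest: sympD)
      let ?s2 = "put aD b 0 (Suc (ar s aD b 0)) (upd rT (Suc (ar s aD b 0)) (upd rT (ar s aD b 0)
         (put aD a 0 (Suc (ar s aD a 0)) (upd rT (Suc (ar s aD a 0)) (upd rT (ar s aD a 0)
         (put aM b a 1 (put aM a b 1 (upd rT 1 (upd rT 0 (upd rNa a (upd rNb b s)))))))))))"
      have D: "card {u \<in> H. ?F v u} = (if v = a \<or> v = b then Suc (ar s aD v 0) else ar s aD v 0)" if v: "v \<in> H" for v
      proof -
        have Dv: "ar s aD v 0 = card {u \<in> H. F v u}" using R v by (simp add: represents_def)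
        have fin: "finite H" using R by (simp add: represents_def)
        consider "v = a" | "v = b" | "v \<noteq> a" "v \<noteq> b" by blast
        then show ?thesis
        proof cases
          case 1
          then have "{u \<in> H. ?F v u} = insert b {u \<in> H. F v u}" using Fab[OF v] abH ab(3) by blast
          then show ?thesis using 1 Dv fin False by simp
        next
          case 2
          then have "{u \<in> H. ?F v u} = insert a {u \<in> H. F v u}" using Fab[OF v] abH ab(3) by blast
          then show ?thesis using 2 Dv fin nFba by simp
        next
          case 3
          then have "{u \<in> H. ?F v u} = {u \<in> H. F v u}" using Fab[OF v] by blast
          then show ?thesis using 3 Dv by simp
        qed
      qed
      have aM2: "ar ?s2 aM c d = (if c = b \<and> d = a then 1 else if c = a \<and> d = b then 1 else ar s aM c d)" for c d
        by (simp only: ar_put_other[of aM aD, simplified] ar_upd ar_put refl simp_thms)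
      have "represents H ?F ?s2"
        unfolding represents_def
      proof (intro conjI allI ballI)
        show "regs_ok ?s2" using R by (simp add: represents_def regs_ok_def)
        show "H = marked aH ?s2" using R by (simp add: represents_def marked_def)
        show "ar ?s2 aM c d \<noteq> 0 \<longleftrightarrow> c \<in> H \<and> d \<in> H \<and> ?F c d" for c d
        proof (cases "c \<in> H \<and> d \<in> H")
          case True
          have Fcd: "?F c d \<longleftrightarrow> F c d \<or> c = a \<and> d = b \<or> c = b \<and> d = a" using Fab True by blast
          show ?thesis unfolding aM2 Fcd using M[of c d] True by auto
        next
          case False
          then have "\<not> (c = b \<and> d = a)" "\<not> (c = a \<and> d = b)" using abH by blast+
          then have "ar ?s2 aM c d = ar s aM c d" unfolding aM2 by (simp only: if_False)
          moreover have "\<not> (c \<in> H \<and> d \<in> H \<and> F c d)" "\<not> (c \<in> H \<and> d \<in> H \<and> ?F c d)" using False by blast+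
          moreover have "ar s aM c d = 0" using M[of c d] False by blast
          ultimately show ?thesis by (simp only: simp_thms)
        qed
        show "ar ?s2 aD v 0 = card {u \<in> H. ?F v u}" if "v \<in> H" for v
          unfolding D[OF that] using ab(3) by simp
      qed
      then show ?thesis using ab m0 regs by (simp add: join_def wp_eqs)
    qed
  qed
qed

text \<open>The invariant asks for some graph on the remaining vertices that has a K4 minor if and
  only if the original one has. A round eliminates a vertex of degree at most 2, or finds minimum
  degree 3 and hence a minor. After \<open>card H0\<close> rounds without failure nothing is left,
  so there is no minor and the matrix is zero.\<close>

lemma eliminate_correct:
  assumes R: "represents H0 E s" and h: "rg s rH = card H0" and res: "rg s rRes \<noteq> 0"
  shows "wpi eliminate (\<lambda>s' _. (rg s' rRes = 0 \<or> rg s' rRes = rg s rRes) \<and> (rg s' rRes \<noteq> 0 \<longleftrightarrow> \<not> k4_minor E H0) \<and>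
     (rg s' rRes \<noteq> 0 \<longrightarrow> (\<forall>x y. ar s' aM x y = 0))) s (card H0 * (104 * n + 122) + 3)"
proof -
  let ?step = "find_low ;; If rF (Dec rX rF ;; detach ;; join) (Set rRes 0)"
  define I where "I k s' \<longleftrightarrow> (rg s' rRes = 0 \<or> rg s' rRes = rg s rRes) \<and> (rg s' rRes = 0 \<longrightarrow> k4_minor E H0) \<and>
      (rg s' rRes \<noteq> 0 \<longrightarrow> (\<exists>H F. represents H F s' \<and> card H = card H0 - k \<and> symp F \<and> (\<forall>v. \<not> F v v) \<and>
         (k4_minor F H \<longleftrightarrow> k4_minor E H0)))" for k and s' :: st
  show ?thesis
    unfolding eliminate_def
  proof (rule wp_for_const[where b = "104 * n + 118" and I = I])
    have "symp E" using E_sym by (simp add: symp_def)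
    then show "I 0 s" unfolding I_def using R res E_irr by (intro conjI impI exI[of _ H0] exI[of _ E]) auto
    show "I k s2" if I1: "I k s1" and a: "ar s2 = ar s1" and r: "\<And>r. r \<noteq> rK \<Longrightarrow> r \<noteq> rCK \<Longrightarrow> rg s2 r = rg s1 r" for k s1 s2
    proof -
      have "represents H F s2 = represents H F s1" for H F
        using a r by (simp add: represents_def regs_ok_def marked_def)
      then show ?thesis using I1 r by (simp add: I_def)
    qed
    show "(rg s' rRes = 0 \<or> rg s' rRes = rg s rRes) \<and> (rg s' rRes \<noteq> 0 \<longleftrightarrow> \<not> k4_minor E H0) \<and>
     (rg s' rRes \<noteq> 0 \<longrightarrow> (\<forall>x y. ar s' aM x y = 0))" if IH: "I (rg s rH) s'" for s'
    proof (cases "rg s' rRes = 0")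
      case True
      then show ?thesis using that by (simp add: I_def)
    next
      case False
      then obtain H F where HF: "represents H F s'" "card H = 0" "k4_minor F H \<longleftrightarrow> k4_minor E H0"
        using IH h by (auto simp: I_def)
      have "finite H" using HF(1) by (simp add: represents_def)
      then have "H = {}" using HF(2) by simp
      then have "\<not> k4_minor E H0" using HF(3) by simp
      moreover have "ar s' aM x y = 0" for x y using HF(1) \<open>H = {}\<close> by (auto simp: represents_def)
      ultimately show ?thesis using False that by (simp add: I_def)
    qed
    fix k s' assume k: "k < rg s rH" and I: "I k s'"
    show "wpi (If rRes ?step Skip) (\<lambda>s' _. I (Suc k) s') s' (104 * n + 118)"
    proof (cases "rg s' rRes = 0")
      case True
      then have "I (Suc k) s'" using I by (simp add: I_def)
      then show ?thesis using True by (simp add: wp_eqs)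
    next
      case False
      then obtain H F where HF: "represents H F s'" "card H = card H0 - k" "symp F" "\<And>v. \<not> F v v"
        "k4_minor F H \<longleftrightarrow> k4_minor E H0"
        using I by (auto simp: I_def)
      have finH: "finite H" using HF(1) by (simp add: represents_def)
      have neH: "H \<noteq> {}" using HF(2) k h by auto
      have "wpi ?step (\<lambda>s' _. I (Suc k) s') s' (104 * n + 116)"
      proof (rule wp_seq[OF find_low_correct[OF HF(1)]])
        fix s1 assume low: "if \<exists>v\<in>H. card {u \<in> H. F v u} \<le> 2
          then \<exists>v\<in>H. card {u \<in> H. F v u} \<le> 2 \<and> rg s1 rF = Suc v else rg s1 rF = 0" and fr1: "frame find_low s' s1"
        have res1: "rg s1 rRes = rg s' rRes" using frame_rg[OF fr1] by simp
        have ar1: "ar s1 = ar s'" using frame_ar[OF fr1] by (simp add: fun_eq_iff)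
        have R1: "represents H F s1"
          using HF(1) regs_ok_frame[OF _ fr1] ar1 by (simp add: represents_def marked_def)
        show "wpi (If rF (Dec rX rF ;; detach ;; join) (Set rRes 0)) (\<lambda>s' _. I (Suc k) s') s1 (104 * n + 116 - (35 * n + 4))"
        proof (cases "\<exists>v\<in>H. card {u \<in> H. F v u} \<le> 2")
          case nolow: False
          have "3 \<le> card {u \<in> H. F v u}" if "v \<in> H" for v using nolow that by fastforce
          then have "k4_minor F H" by (intro k4_minor_min_degree[OF HF(3,4) finH neH])
          then have "I (Suc k) (upd rRes 0 s1)" using HF(5) by (simp add: I_def)
          moreover have "rg s1 rF = 0" using low nolow by (simp only: if_False)
          ultimately show ?thesis by (simp add: wp_eqs)
        next
          case True
          then obtain x where x: "x \<in> H" "card {u \<in> H. F x u} \<le> 2" "rg s1 rF = Suc x"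
            using low by (auto simp only: if_True)
          let ?F = "\<lambda>a b. F a b \<or> a \<noteq> b \<and> F x a \<and> F x b"
          let ?s2 = "upd rX x s1"
          have R2: "represents H F ?s2" by (rule represents_upd[OF R1]) simp
          have "wpi (detach ;; join) (\<lambda>s' _. I (Suc k) s') ?s2 (69 * n + 109)"
          proof (rule wp_seq[OF detach_correct[OF R2 HF(3,4) _ x(1,2)]])
            fix s3 assume d: "represents (H - {x}) F s3 \<and>
              (rg s3 rNb = 0 \<and> (\<forall>a b. a \<in> H \<and> b \<in> H \<and> F x a \<and> F x b \<longrightarrow> a = b) \<or>
              (\<exists>a b. rg s3 rNa = Suc a \<and> rg s3 rNb = Suc b \<and> a \<noteq> b \<and> {u \<in> H. F x u} = {a, b}))"
              and fr3: "frame detach ?s2 s3"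
            have "wpi join (\<lambda>s' _. represents (H - {x}) ?F s') s3 92"
            proof (rule join_correct[OF _ HF(3,4)])
              show "u \<in> H - {x} \<or> u \<notin> H" if "F x u" for u using that HF(4) by auto
            qed (use d in auto)
            then show "wpi join (\<lambda>s' _. I (Suc k) s') s3 (69 * n + 109 - (69 * n + 17))"
            proof (rule wp_weaken)
              fix s4 assume R4: "represents (H - {x}) ?F s4" and fr4: "frame join s3 s4"
              have "rg s4 rRes = rg s' rRes" using frame_rg[OF fr4] frame_rg[OF fr3] res1 by simp
              moreover have "card (H - {x}) = card H0 - Suc k" using x(1) finH HF(2) by simp
              moreover have "symp ?F" using HF(3) by (auto simp: symp_def)
              moreover have "k4_minor F H \<longleftrightarrow> k4_minor ?F (H - {x})"
                by (rule k4_minor_eliminate[OF HF(3) finH x(1) HF(4) x(2)])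
              ultimately show "I (Suc k) s4"
                unfolding I_def using R4 HF(4,5) False I
                by (intro conjI impI exI[of _ "H - {x}"] exI[of _ ?F]) (auto simp: I_def)
            qed simp
          qed auto
          then have "wpi (detach ;; join) (\<lambda>s' _. I (Suc k) s') ?s2 (104 * n + 116 - (35 * n + 4) - 3)"
            by (rule wp_weaken) auto
          then show ?thesis using x(3) by (simp add: wp_eqs)
        qed
      qed simp
      then show ?thesis using False by (simp add: wp_eqs add_ac)
    qed
  qed (use h in auto)
qed

lemma kill_correct:
  assumes r: "regs_ok s"
  shows "wpi kill (\<lambda>s' _. marked aDead s' = marked aDead s \<union> (marked aA s - marked aF s)) s (44 * n + 3)"
  unfolding kill_def
proof (rule wp_for_const[where b = 40 and I = "\<lambda>k s'. ar s' aA = ar s aA \<and> ar s' aF = ar s aF \<and> rg s' rZero = 0 \<and>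
    (\<forall>v. ar s' aDead v 0 \<noteq> 0 \<longleftrightarrow> ar s aDead v 0 \<noteq> 0 \<or> v < k \<and> ar s aA v 0 \<noteq> 0 \<and> ar s aF v 0 = 0)"])
  fix k and s' :: st assume "ar s' aA = ar s aA \<and> ar s' aF = ar s aF \<and> rg s' rZero = 0 \<and>
    (\<forall>v. ar s' aDead v 0 \<noteq> 0 \<longleftrightarrow> ar s aDead v 0 \<noteq> 0 \<or> v < k \<and> ar s aA v 0 \<noteq> 0 \<and> ar s aF v 0 = 0)" "rg s' rV = k"
  then show "wpi (GetV rT aA rV ;; If rT (GetV rT2 aF rV ;; If rT2 Skip (Set rT2 1 ;; PutV aDead rV rT2)) Skip)
    (\<lambda>s' _. ar s' aA = ar s aA \<and> ar s' aF = ar s aF \<and> rg s' rZero = 0 \<and>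
    (\<forall>v. ar s' aDead v 0 \<noteq> 0 \<longleftrightarrow> ar s aDead v 0 \<noteq> 0 \<or> v < Suc k \<and> ar s aA v 0 \<noteq> 0 \<and> ar s aF v 0 = 0)) s' 40"
    by (auto simp: wp_eqs less_Suc_eq ar_put_other)
qed (use r in \<open>auto simp: regs_ok_def marked_def\<close>)

end

section \<open>The algorithm\<close>

text \<open>Earlier vertices get key 1 and all others key 0; with \<open>rL = 1\<close> only key 0
  is expanded. So the search runs through the piece and reaches its border without continuing from
  there. The key test compares with \<open>i\<close> non-strictly because \<open>aPos\<close> is the
  position plus one.\<close>

definition prepare_peel :: com where
  "prepare_peel = GetV rZ aOrd rI ;;
     for_loop rV rC rN (GetV rT aDead rV ;; PutV aR rV rT ;; PutV aF rV rZero ;;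
       GetV rT aPos rV ;; Sub rT rT rI ;; If rT (Set rT2 0) (Set rT2 1) ;; PutV aKey rV rT2) ;;
     Set rT 1 ;; PutV aR rZ rT ;; Set rL 1"

definition process :: com where
  "process = mark_piece ;; mark_core ;; build ;; eliminate ;; kill"

definition peel :: com where
  "peel = prepare_peel ;; search ;; count_border ;; check_border ;; If rOk process Skip"

definition peel_phase :: com where
  "peel_phase = Set rRes 1 ;; Mov rI rN ;; While rI (Dec rI rI ;; If rRes peel Skip)"

definition algorithm :: com where
  "algorithm = Set rZero 0 ;; Inp rN rZero ;; Inc rN1 rN ;; order_phase ;; peel_phase"

lemma mods_process [simp]:
  "mods prepare_peel = {rZ, rV, rC, rT, rT2, rL}" "arrs prepare_peel = {aR, aF, aKey}"
  "mods process = {rA, rV, rC, rT, rT2, rCc, rP, rE, rCA, rU, rH, rK, rCK, rF, rX, rNa, rNb, rRes}"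
  "arrs process = {aA, aH, aM, aD, aDead}"
  by (auto simp: prepare_peel_def process_def)

lemma mods_peel_round [simp]:
  "mods peel = {rZ, rV, rC, rT, rT2, rL, rJ, rCJ, rCn, rX, rP, rE, rCA, rU, rKs, rOk, rCc, rA, rH, rK, rCK, rF, rNa, rNb, rRes}"
  "arrs peel = {aR, aF, aKey, aBk, aCnt, aA, aH, aM, aD, aDead}"
  by (auto simp: peel_def)

context machine_input
begin

lemma prepare_peel_correct:
  assumes r: "regs_ok s" and i: "rg s rI = i" and z: "ar s aOrd i 0 = z" "z < n"
  shows "wpi prepare_peel (\<lambda>s' _. rg s' rZ = z \<and> rg s' rL = 1 \<and> (\<forall>v<n. (ar s' aR v 0 \<noteq> 0 \<longleftrightarrow> ar s aDead v 0 \<noteq> 0 \<or> v = z) \<and>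
     ar s' aF v 0 = 0 \<and> ar s' aKey v 0 = (if ar s aPos v 0 \<le> i then 1 else 0))) s (68 * n + 38)"
proof -
  let ?body = "GetV rT aDead rV ;; PutV aR rV rT ;; PutV aF rV rZero ;;
       GetV rT aPos rV ;; Sub rT rT rI ;; If rT (Set rT2 0) (Set rT2 1) ;; PutV aKey rV rT2"
  let ?s = "upd rZ z s"
  let ?I = "\<lambda>k s'. ar s' aDead = ar s aDead \<and> ar s' aPos = ar s aPos \<and> rg s' rZero = 0 \<and> rg s' rI = i \<and> rg s' rZ = z \<and>
      (\<forall>v<k. ar s' aR v 0 = ar s aDead v 0 \<and> ar s' aF v 0 = 0 \<and> ar s' aKey v 0 = (if ar s aPos v 0 \<le> i then 1 else 0))"
  have loop: "wpi (for_loop rV rC rN ?body) (\<lambda>s' _. ?I n s') ?s (68 * n + 3)"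
  proof (rule wp_for_const[where b = 64 and I = ?I])
    fix k and s' :: st assume "?I k s'" "rg s' rV = k"
    then show "wpi ?body (\<lambda>s' _. ?I (Suc k) s') s' 64"
      by (auto simp: wp_eqs less_Suc_eq ar_put_other)
  qed (use r i in \<open>auto simp: regs_ok_def\<close>)
  have "wpi (for_loop rV rC rN ?body ;; Set rT 1 ;; PutV aR rZ rT ;; Set rL 1)
    (\<lambda>s' _. rg s' rZ = z \<and> rg s' rL = 1 \<and> (\<forall>v<n. (ar s' aR v 0 \<noteq> 0 \<longleftrightarrow> ar s aDead v 0 \<noteq> 0 \<or> v = z) \<and>
     ar s' aF v 0 = 0 \<and> ar s' aKey v 0 = (if ar s aPos v 0 \<le> i then 1 else 0))) ?s (68 * n + 26)"
  proof (rule wp_seq[OF loop])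
    fix s' :: st assume "?I n s'"
    then show "wpi (Set rT 1 ;; PutV aR rZ rT ;; Set rL 1)
      (\<lambda>s' _. rg s' rZ = z \<and> rg s' rL = 1 \<and> (\<forall>v<n. (ar s' aR v 0 \<noteq> 0 \<longleftrightarrow> ar s aDead v 0 \<noteq> 0 \<or> v = z) \<and>
       ar s' aF v 0 = 0 \<and> ar s' aKey v 0 = (if ar s aPos v 0 \<le> i then 1 else 0))) s' (68 * n + 26 - (68 * n + 3))"
      by (auto simp: wp_eqs)
  qed simp
  then show ?thesis using r i z by (simp add: prepare_peel_def wp_eqs regs_ok_def add_ac)
qed

lemma process_correct:
  assumes r: "regs_ok s" and res: "rg s rRes \<noteq> 0" and zero: "\<And>x y. ar s aM x y = 0"
    and A: "A = marked aR s - marked aDead s"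
  shows "wpi process (\<lambda>s' _. marked aDead s' = marked aDead s \<union> (A - marked aF s) \<and>
     (rg s' rRes = 0 \<or> rg s' rRes = rg s rRes) \<and> (rg s' rRes \<noteq> 0 \<longleftrightarrow> \<not> k4_minor E (A - universals E A)) \<and>
     (rg s' rRes \<noteq> 0 \<longrightarrow> (\<forall>x y. ar s' aM x y = 0))) s (164 * n + 53 * M + 17 + card A * (104 * n + 122))"
    (is "wpi process ?Q s ?T")
  unfolding process_def
proof (rule wp_seq[OF mark_piece_correct[OF r]])
  have finA: "finite A" by (simp add: A)
  fix s1 assume 1: "marked aA s1 = marked aR s - marked aDead s \<and> rg s1 rA = card (marked aA s1)" and f1: "frame mark_piece s s1"
  have r1: "regs_ok s1" using regs_ok_frame[OF r f1] by simp
  have a1: "ar s1 aDead = ar s aDead" "ar s1 aF = ar s aF" "ar s1 aM = ar s aM" "rg s1 rRes = rg s rRes"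
    using frame_ar[OF f1] frame_rg[OF f1] by auto
  have A1: "marked aA s1 = A" using 1 A by simp
  let ?T1 = "?T - (44 * n + 4)"
  show "wpi (mark_core ;; build ;; eliminate ;; kill) ?Q s1 ?T1"
  proof (rule wp_seq[OF mark_core_correct[OF r1]])
    show "rg s1 rA = card (marked aA s1)" using 1 by simp
    show "20 * M + 38 * n + 3 \<le> ?T1" by simp
    let ?C = "A - universals E A"
    fix s2 assume 2: "marked aH s2 = marked aA s1 - universals E (marked aA s1)" and f2: "frame mark_core s1 s2"
    have r2: "regs_ok s2" using regs_ok_frame[OF r1 f2] by simp
    have a2: "ar s2 aDead = ar s aDead" "ar s2 aF = ar s aF" "ar s2 aM = ar s aM" "rg s2 rRes = rg s rRes" "ar s2 aA = ar s1 aA"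
      using frame_ar[OF f2] frame_rg[OF f2] a1 by auto
    have C: "marked aH s2 = ?C" using 2 A1 by simp
    show "wpi (build ;; eliminate ;; kill) ?Q s2 (?T1 - (20 * M + 38 * n + 3))"
    proof (rule wp_seq[OF build_correct[OF r2]])
      show "ar s2 aM x y = 0" for x y using zero a2 by simp
      show "33 * M + 38 * n + 4 \<le> ?T1 - (20 * M + 38 * n + 3)" by simp
      fix s3 assume 3: "represents (marked aH s2) E s3 \<and> rg s3 rH = card (marked aH s2)" and f3: "frame build s2 s3"
      have r3: "regs_ok s3" using regs_ok_frame[OF r2 f3] by simp
      have a3: "ar s3 aDead = ar s aDead" "ar s3 aF = ar s aF" "rg s3 rRes = rg s rRes" "ar s3 aA = ar s1 aA"
        using frame_ar[OF f3] frame_rg[OF f3] a2 by auto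
      have R3: "represents ?C E s3" "rg s3 rH = card ?C" "rg s3 rRes \<noteq> 0" using 3 C a3 res by auto
      have cC: "card ?C \<le> card A" using finA by (intro card_mono) auto
      then have cC': "card ?C * (104 * n + 122) \<le> card A * (104 * n + 122)" by (rule mult_right_mono) simp
      have "wpi (eliminate ;; kill) ?Q s3 (card A * (104 * n + 122) + 3 + (44 * n + 3))"
      proof (rule wp_seq[OF eliminate_correct[OF R3]])
        show "card ?C * (104 * n + 122) + 3 \<le> card A * (104 * n + 122) + 3 + (44 * n + 3)" using cC' by linarith
        fix s4 assume 4: "(rg s4 rRes = 0 \<or> rg s4 rRes = rg s3 rRes) \<and> (rg s4 rRes \<noteq> 0 \<longleftrightarrow> \<not> k4_minor E ?C) \<and>
          (rg s4 rRes \<noteq> 0 \<longrightarrow> (\<forall>x y. ar s4 aM x y = 0))" and f4: "frame eliminate s3 s4"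
        have r4: "regs_ok s4" using regs_ok_frame[OF r3 f4] by simp
        have a4: "ar s4 aDead = ar s aDead" "ar s4 aF = ar s aF" "ar s4 aA = ar s1 aA"
          using frame_ar[OF f4] a3 by auto
        have m: "marked aDead s4 = marked aDead s" "marked aF s4 = marked aF s" "marked aA s4 = A"
          using a4 A1 by (auto simp: marked_def)
        have "wpi kill ?Q s4 (44 * n + 3)"
        proof (rule wp_weaken[OF kill_correct[OF r4]])
          fix s5 assume 5: "marked aDead s5 = marked aDead s4 \<union> (marked aA s4 - marked aF s4)" and f5: "frame kill s4 s5"
          have "ar s5 aM = ar s4 aM" "rg s5 rRes = rg s4 rRes" using frame_ar[OF f5] frame_rg[OF f5] by auto
          then show "marked aDead s5 = marked aDead s \<union> (A - marked aF s) \<and>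
             (rg s5 rRes = 0 \<or> rg s5 rRes = rg s rRes) \<and> (rg s5 rRes \<noteq> 0 \<longleftrightarrow> \<not> k4_minor E ?C) \<and>
             (rg s5 rRes \<noteq> 0 \<longrightarrow> (\<forall>x y. ar s5 aM x y = 0))"
            using 4 5 m a3 by simp
        qed simp
        then show "wpi kill ?Q s4 (card A * (104 * n + 122) + 3 + (44 * n + 3) - (card ?C * (104 * n + 122) + 3))"
          by (rule wp_weaken) (use cC' in linarith)+
      qed
      then show "wpi (eliminate ;; kill) ?Q s3 (?T1 - (20 * M + 38 * n + 3) - (33 * M + 38 * n + 4))"
        by (rule wp_weaken) auto
    qed
  qed
qed simp

end

locale peeling = machine_input al n E + mcs_order E "{..<n}" n ord pos w
  for al n E ord pos w +
  fixes G :: "nat ugraph"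
  assumes G: "simple_graph G" "verts G = {..<n}" "adj G = E"
begin

definition alive :: "st \<Rightarrow> nat set" where
  "alive s = {v. v < n \<and> ar s aDead v 0 = 0}"

definition stored :: "st \<Rightarrow> bool" where
  "stored s \<longleftrightarrow> regs_ok s \<and> (\<forall>i<n. ar s aOrd i 0 = ord i) \<and> (\<forall>v<n. ar s aPos v 0 = Suc (pos v))"

text \<open>While the answer is 1, membership of the remaining graph implies membership of the
  whole, which is the sufficiency half of the characterisation. An answer 0 is final.\<close>

definition peel_inv :: "nat \<Rightarrow> st \<Rightarrow> bool" where
  "peel_inv i s \<longleftrightarrow> stored s \<and>
     (rg s rRes = 1 \<and> peeled i (alive s) \<and> (in_class_G (induced_subgraph G (alive s)) \<longrightarrow> in_class_G G) \<and>
        (\<forall>x y. ar s aM x y = 0) \<or>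
      rg s rRes = 0 \<and> \<not> in_class_G G)"

text \<open>The price that \<open>eliminate\<close> pays for each vertex.\<close>

definition cost :: nat where "cost = 104 * n + 122"

text \<open>At threshold 1 only vertices from position \<open>i\<close> on are passed through.
  Earlier ones are entered but not left, and since only they have key 1, the flags single out the
  border.\<close>

lemma reach_piece:
  assumes L: "peeled (Suc i) L" and i: "i < n"
    and bl: "\<And>v. v < n \<Longrightarrow> bl v \<longleftrightarrow> v \<notin> L \<or> v = ord i" and key: "\<And>v. v < n \<Longrightarrow> key v = (if pos v < i then 1 else 0)"
  shows "reach E bl key (ord i) 1 = piece i L \<union> border i L"
    and "v < n \<Longrightarrow> v \<noteq> ord i \<and> v \<in> reach E bl key (ord i) 1 \<and> v \<in> reach E bl key (ord i) (key v) \<longleftrightarrow> v \<in> border i L"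
proof -
  let ?z = "ord i" and ?X = "reach E bl key (ord i)"
  note LV = L_V[OF L i] and ps = piece_sub[OF L i] and zp = ord_piece[OF L i]
  have Ln: "v < n" if "v \<in> L" for v using LV that by auto
  have sub: "v \<in> piece i L \<union> border i L" if "v \<in> ?X 1" for v
    using that
  proof (induction rule: reach.induct)
    case (reach_step v u)
    have n: "v < n" "u < n" using E_n reach_step by blast+
    have "\<not> pos v < i" using key[OF n(1)] reach_step by auto
    then have "v \<in> piece i L" using reach_step by (auto simp: border_def)
    moreover have "u \<in> L" using bl[OF n(2)] reach_step by auto
    ultimately show ?case using piece_nbr[OF L i] reach_step by blast
  qed (use zp in simp)
  have p_sub: "v \<in> ?X 1" if "v \<in> piece i L" for v
  proof -
    have "conn E {v \<in> L. i \<le> pos v} ?z v" using that by (simp add: piece_def)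
    then show ?thesis
    proof (induction rule: conn_induct)
      case refl
      show ?case by (rule reach_start)
    next
      case (step y u)
      have n: "y < n" "u < n" using Ln step by auto
      show ?case
      proof (cases "u = ?z")
        case True
        then show ?thesis by (simp add: reach_start)
      next
        case False
        then have "\<not> bl u" using bl[OF n(2)] step by auto
        moreover have "key y < 1" using key[OF n(1)] step by auto
        moreover have "y \<in> ?X 1" "E y u" using step by simp_all
        ultimately show ?thesis using reach.reach_step[of y E bl key ?z 1 u] by simp
      qed
    qed
  qed
  have b_sub: "v \<in> ?X 1" if "v \<in> border i L" for v
  proof -
    obtain k where k: "k \<in> piece i L" "E k v" "v \<in> L" "pos v < i" using \<open>v \<in> border i L\<close> by (auto simp: border_def)
    have n: "k < n" "v < n" using E_n k by blast+
    have "v \<noteq> ?z" using k pos_ord[OF i] by auto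
    then have "\<not> bl v" using bl[OF n(2)] k by auto
    moreover have "i \<le> pos k" using ps k by auto
    then have "key k < 1" using key[OF n(1)] by auto
    ultimately show ?thesis using reach_step[OF p_sub[OF k(1)]] k by blast
  qed
  show X1: "?X 1 = piece i L \<union> border i L" using sub p_sub b_sub by blast
  have X0: "v = ?z" if "v \<in> ?X 0" for v using that by (induction rule: reach.induct) auto
  show "v \<noteq> ?z \<and> v \<in> ?X 1 \<and> v \<in> ?X (key v) \<longleftrightarrow> v \<in> border i L" if v: "v < n"
  proof (cases "pos v < i")
    case True
    then have "v \<notin> piece i L" using ps by auto
    moreover have "v \<noteq> ?z" using True pos_ord[OF i] by auto
    ultimately show ?thesis using key[OF v] True unfolding X1[symmetric] using X1 by auto
  next
    case False
    then show ?thesis using key[OF v] X0 by (auto simp: border_def)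
  qed
qed

text \<open>Either the atom is a member, by putting back its universal vertices, and a clique sum
  glues it to the rest; or, being an atom, it refutes membership of the whole graph.\<close>

lemma piece_result:
  assumes L: "peeled (Suc i) L" and i: "i < n" and S: "clique E (border i L)"
    and imp: "in_class_G (induced_subgraph G L) \<Longrightarrow> in_class_G G"
  defines "A \<equiv> piece i L \<union> border i L"
  shows "\<not> k4_minor E (A - universals E A) \<Longrightarrow> in_class_G (induced_subgraph G (L - piece i L)) \<Longrightarrow> in_class_G G"
    and "k4_minor E (A - universals E A) \<Longrightarrow> \<not> in_class_G G"
proof -
  note LV = L_V[OF L i] and ps = piece_sub[OF L i]
  have AV: "A \<subseteq> verts G" using LV ps G(2) by (auto simp: A_def border_def)
  have LG: "L \<subseteq> verts G" using LV G(2) by simp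
  show "in_class_G G" if nk: "\<not> k4_minor E (A - universals E A)" and rest: "in_class_G (induced_subgraph G (L - piece i L))"
  proof -
    have "in_class_G (induced_subgraph G (A - universals (adj G) A))"
      by (rule in_class_not_k4_minor[OF G(1)]) (use AV nk G(3) in auto)
    then have "in_class_G (induced_subgraph G A)" by (rule in_class_universals[OF G(1) AV])
    moreover have "separation (adj G) L (L - piece i L) A"
      unfolding A_def G(3) by (rule separation_piece[OF L i S])
    ultimately have "in_class_G (induced_subgraph G L)"
      using in_class_separation[OF G(1) LG] rest by blast
    then show ?thesis by (rule imp)
  qed
  show "\<not> in_class_G G" if k: "k4_minor E (A - universals E A)"
  proof
    assume "in_class_G G"
    then have "good_atoms E (verts G)" using in_class_good_atoms G(3) by metis
    moreover have "atom E A" unfolding A_def by (rule atom_piece[OF L i S])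
    ultimately show False using k AV by (simp add: good_atoms_def)
  qed
qed

text \<open>The linear part adds up preparation, search, counting, clique test and the fixed cost of
  processing. Only the elimination depends on the size of the atom, and it takes place only when a
  piece is removed.\<close>

lemma peel_correct:
  assumes I: "peel_inv (Suc i) s" "rg s rRes \<noteq> 0" and i: "i < n" "rg s rI = i"
  defines "L \<equiv> alive s"
  shows "wpi peel (\<lambda>s' _. peel_inv i s' \<and> alive s' = (if clique E (border i L) then L - piece i L else L)) s
    (383 * n + 179 * M + 129 + (if clique E (border i L) then card (piece i L \<union> border i L) * cost else 0))"
    (is "wpi peel ?Q s (?c + ?d)")
proof -
  have st: "stored s" "regs_ok s" and res: "rg s rRes = 1" and L: "peeled (Suc i) L"
    and imp: "in_class_G (induced_subgraph G L) \<Longrightarrow> in_class_G G" and zero: "\<And>x y. ar s aM x y = 0"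
    using I by (auto simp: peel_inv_def L_def stored_def)
  have zi: "ar s aOrd i 0 = ord i" "ord i < n" using st(1) i ord_V[OF i(1)] by (auto simp: stored_def)
  define bl where "bl v \<longleftrightarrow> v \<notin> L \<or> v = ord i" for v
  define key where "key v = (if pos v < i then 1 else (0::nat))" for v
  interpret search_run al n E bl key "ord i"
    using zi i pos_ord by unfold_locales (auto simp: bl_def key_def)
  have X: "X 1 = piece i L \<union> border i L"
    "\<And>v. v < n \<Longrightarrow> v \<noteq> ord i \<and> v \<in> X 1 \<and> v \<in> X (key v) \<longleftrightarrow> v \<in> border i L"
    using reach_piece[OF L i(1), of bl key] by (simp_all add: bl_def key_def)
  note ps = piece_sub[OF L i(1)]
  have bL: "border i L \<subseteq> L" "border i L \<inter> piece i L = {}" using ps by (auto simp: border_def)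
  have Ldead: "L = {..<n} - marked aDead s" by (auto simp: L_def alive_def marked_def)
  show ?thesis
    unfolding peel_def
  proof (rule wp_seq[OF prepare_peel_correct[OF st(2) i(2) zi]])
    show "68 * n + 38 \<le> ?c + ?d" by simp
    fix s1 assume 1: "rg s1 rZ = ord i \<and> rg s1 rL = 1 \<and> (\<forall>v<n. (ar s1 aR v 0 \<noteq> 0 \<longleftrightarrow> ar s aDead v 0 \<noteq> 0 \<or> v = ord i) \<and>
       ar s1 aF v 0 = 0 \<and> ar s1 aKey v 0 = (if ar s aPos v 0 \<le> i then 1 else 0))" and f1: "frame prepare_peel s s1"
    have r1: "regs_ok s1" using regs_ok_frame[OF st(2) f1] by simp
    have key1: "ar s1 aKey v 0 = key v" if "v < n" for v
      using 1 that st(1) by (auto simp: key_def stored_def)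
    have bl1: "ar s1 aR v 0 \<noteq> 0 \<longleftrightarrow> bl v" if "v < n" for v
      using 1 that by (auto simp: bl_def L_def alive_def)
    show "wpi (search ;; count_border ;; check_border ;; If rOk process Skip) ?Q s1 (?c + ?d - (68 * n + 38))"
    proof (rule wp_seq[OF search_correct[of s1 1]])
      show "106 * M + 103 * n + 64 \<le> ?c + ?d - (68 * n + 38)" by simp
      fix s2 assume 2: "\<forall>v<n. (ar s2 aR v 0 \<noteq> 0 \<longleftrightarrow> bl v \<or> v \<in> X 1) \<and>
          ar s2 aF v 0 = (if v \<noteq> ord i \<and> v \<in> X 1 \<and> v \<in> X (key v) then 1 else 0)" and f2: "frame search s1 s2"
      have r2: "regs_ok s2" using regs_ok_frame[OF r1 f2] by simp
      have F2: "marked aF s2 = border i L" using 2 X(2) bL ps L_V[OF L i(1)] by (auto simp: marked_def)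
      show "wpi (count_border ;; check_border ;; If rOk process Skip) ?Q s2 (?c + ?d - (68 * n + 38) - (106 * M + 103 * n + 64))"
      proof (rule wp_seq[OF count_border_correct[OF r2]])
        show "19 * n + 4 \<le> ?c + ?d - (68 * n + 38) - (106 * M + 103 * n + 64)" by simp
        fix s3 assume 3: "rg s3 rKs = card (marked aF s2)" and f3: "frame count_border s2 s3"
        have r3: "regs_ok s3" using regs_ok_frame[OF r2 f3] by simp
        have F3: "marked aF s3 = border i L" using F2 frame_ar[OF f3] by (simp add: marked_def)
        have ks3: "rg s3 rKs = card (marked aF s3)" using 3 F2 F3 by simp
        show "wpi (check_border ;; If rOk process Skip) ?Q s3 (?c + ?d - (68 * n + 38) - (106 * M + 103 * n + 64) - (19 * n + 4))"
        proof (rule wp_seq[OF check_border_correct[OF r3 ks3]])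
          show "20 * M + 29 * n + 4 \<le> ?c + ?d - (68 * n + 38) - (106 * M + 103 * n + 64) - (19 * n + 4)" by simp
          fix s4 assume 4: "rg s4 rOk \<noteq> 0 \<longleftrightarrow> clique E (marked aF s3)" and f4: "frame check_border s3 s4"
          have r4: "regs_ok s4" using regs_ok_frame[OF r3 f4] by simp
          have a4: "ar s4 k = ar s k" if "k \<in> {aDead, aM, aOrd, aPos}" for k
            using frame_ar[OF f4, of k] frame_ar[OF f3, of k] frame_ar[OF f2, of k] frame_ar[OF f1, of k] that by auto
          have a4': "ar s4 k = ar s2 k" for k
            using frame_ar[OF f4, of k] frame_ar[OF f3, of k] by simp
          have res4: "rg s4 rRes = 1"
            using frame_rg[OF f4, of rRes] frame_rg[OF f3, of rRes] frame_rg[OF f2, of rRes] frame_rg[OF f1, of rRes] res by simp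
          have stored_cong: "stored s'" if "regs_ok s'" "ar s' aOrd = ar s aOrd" "ar s' aPos = ar s aPos" for s'
            using that st(1) by (simp add: stored_def)
          have F4: "marked aF s4 = border i L" using F2 a4'[of aF] by (simp add: marked_def)
          have D4: "marked aDead s4 = marked aDead s" using a4[of aDead] by (simp add: marked_def)
          have A4: "piece i L \<union> border i L = marked aR s4 - marked aDead s4"
          proof (intro equalityI subsetI)
            fix v assume v: "v \<in> piece i L \<union> border i L"
            then have "v \<in> X 1" "v \<in> L" using X(1) ps bL by auto
            then show "v \<in> marked aR s4 - marked aDead s4"
              using 2 D4 a4'[of aR] unfolding Ldead by (auto simp: marked_def)
          next
            fix v assume v: "v \<in> marked aR s4 - marked aDead s4"
            then have v: "v \<in> marked aR s4" "v \<notin> marked aDead s" using D4 by blast+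
            then have "v < n" "ar s2 aR v 0 \<noteq> 0" using a4'[of aR] by (simp_all add: marked_def)
            moreover have "v \<in> L" unfolding Ldead using v \<open>v < n\<close> by simp
            ultimately have "v = ord i \<or> v \<in> X 1" using 2 by (auto simp: bl_def)
            moreover have "ord i \<in> X 1" by (rule reach_start)
            ultimately have "v \<in> X 1" by (elim disjE) (simp only:)
            then show "v \<in> piece i L \<union> border i L" unfolding X(1) .
          qed
          let ?A = "piece i L \<union> border i L"
          show "wpi (If rOk process Skip) ?Q s4 (?c + ?d - (68 * n + 38) - (106 * M + 103 * n + 64) - (19 * n + 4) - (20 * M + 29 * n + 4))"
          proof (cases "clique E (border i L)")
            case False
            have "alive s4 = L" using a4[of aDead] by (simp add: alive_def L_def)
            moreover have "peel_inv i s4"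
              unfolding peel_inv_def
              using stored_cong[OF r4] a4 res4 peeled_keep[OF L i(1) False] imp zero calculation by auto
            moreover have "rg s4 rOk = 0" using 4 F3 False by simp
            ultimately show ?thesis using False by (simp add: wp_eqs)
          next
            case True
            have z4: "ar s4 aM x y = 0" for x y using a4[of aM] zero by simp
            have "rg s4 rRes \<noteq> 0" using res4 by simp
            have "wpi process ?Q s4 (164 * n + 53 * M + 17 + card ?A * (104 * n + 122))"
            proof (rule wp_weaken[OF process_correct[OF r4 \<open>rg s4 rRes \<noteq> 0\<close> z4 A4]])
              fix s5 assume 5: "marked aDead s5 = marked aDead s4 \<union> (?A - marked aF s4) \<and>
                 (rg s5 rRes = 0 \<or> rg s5 rRes = rg s4 rRes) \<and> (rg s5 rRes \<noteq> 0 \<longleftrightarrow> \<not> k4_minor E (?A - universals E ?A)) \<and>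
                 (rg s5 rRes \<noteq> 0 \<longrightarrow> (\<forall>x y. ar s5 aM x y = 0))" and f5: "frame process s4 s5"
              have r5: "regs_ok s5" using regs_ok_frame[OF r4 f5] by simp
              have st5: "stored s5"
                using frame_ar[OF f5, of aOrd] frame_ar[OF f5, of aPos] a4 by (intro stored_cong[OF r5]) auto
              have "alive s5 = {..<n} - marked aDead s5" by (auto simp: alive_def marked_def)
              also have "\<dots> = L - piece i L" using 5 D4 F4 bL unfolding Ldead by auto
              finally have L5: "alive s5 = L - piece i L" .
              have "peel_inv i s5"
              proof (cases "rg s5 rRes = 0")
                case res0: True
                then have "\<not> in_class_G G" using 5 piece_result(2)[OF L i(1) True imp] by simp
                then show ?thesis using st5 res0 by (simp add: peel_inv_def)
              next
                case res1: False
                then have "rg s5 rRes = 1" "\<not> k4_minor E (?A - universals E ?A)" "\<forall>x y. ar s5 aM x y = 0" using 5 res4 by auto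
                then show ?thesis
                  using st5 piece_result(1)[OF L i(1) True imp] peeled_remove[OF L i(1) True] L5 by (simp add: peel_inv_def)
              qed
              then show "peel_inv i s5 \<and> alive s5 = (if clique E (border i L) then L - piece i L else L)"
                using L5 True by simp
            qed simp
            then have "wpi process ?Q s4 (?c + ?d - (68 * n + 38) - (106 * M + 103 * n + 64) - (19 * n + 4) - (20 * M + 29 * n + 4) - 2)"
              by (rule wp_weaken) (use True in \<open>auto simp: cost_def\<close>)
            moreover have "rg s4 rOk \<noteq> 0" using 4 F3 True by simp
            ultimately show ?thesis by (simp only: wp_If_eq if_False) simp
          qed
        qed
      qed
    next
      show "rg s1 rN = n" "rg s1 rN1 = Suc n" "rg s1 rZero = 0" using r1 by (auto simp: regs_ok_def)
      show "rg s1 rZ = ord i" "rg s1 rL = 1" using 1 by auto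
      show "ar s1 aKey v 0 = key v" if "v < n" for v using key1[OF that] .
      show "ar s1 aR v 0 \<noteq> 0 \<longleftrightarrow> bl v" if "v < n" for v using bl1[OF that] .
      show "ar s1 aF v 0 = 0" if "v < n" for v using 1 that by auto
    qed simp
  qed
qed

text \<open>A remaining vertex keeps the price of \<open>Suc (deg v)\<close> vertices of an atom:
  one for itself in its piece, and one for each edge that may lead to a border vertex.\<close>

definition potential :: "nat set \<Rightarrow> nat" where
  "potential L = (\<Sum>v\<in>L. Suc (deg v)) * cost"

lemma card_piece_le:
  assumes L: "peeled (Suc i) L" and i: "i < n"
  shows "potential (L - piece i L) + card (piece i L \<union> border i L) * cost \<le> potential L"
proof -
  note LV = L_V[OF L i] and ps = piece_sub[OF L i]
  have finL: "finite L" using LV finite_subset by blast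
  have "piece i L \<subseteq> L" using ps by auto
  then have finp: "finite (piece i L)" "piece i L \<subseteq> L" using finite_subset[OF _ finL] by blast+
  have "border i L \<subseteq> (\<Union>v\<in>piece i L. {u. E v u})" by (auto simp: border_def)
  moreover have finN: "finite {u. E v u}" for v by (rule finite_subset[of _ "{..<n}"]) (use E_n in auto)
  ultimately have "card (border i L) \<le> card (\<Union>v\<in>piece i L. {u. E v u})"
    using finp by (intro card_mono) auto
  also have "\<dots> \<le> (\<Sum>v\<in>piece i L. card {u. E v u})" using finp by (intro card_UN_le)
  also have "\<dots> = (\<Sum>v\<in>piece i L. deg v)"
    using deg_card ps LV by (intro sum.cong) auto
  finally have b: "card (border i L) \<le> (\<Sum>v\<in>piece i L. deg v)" .
  have "card (piece i L \<union> border i L) \<le> card (piece i L) + card (border i L)" by (rule card_Un_le)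
  also have "\<dots> \<le> card (piece i L) + (\<Sum>v\<in>piece i L. deg v)" using b by simp
  also have "\<dots> = (\<Sum>v\<in>piece i L. Suc (deg v))" by (simp add: sum_Suc)
  finally have "(\<Sum>v\<in>L - piece i L. Suc (deg v)) + card (piece i L \<union> border i L) \<le> (\<Sum>v\<in>L. Suc (deg v))"
    using sum.subset_diff[OF finp(2) finL, of "\<lambda>v. Suc (deg v)"] by simp
  then have "((\<Sum>v\<in>L - piece i L. Suc (deg v)) + card (piece i L \<union> border i L)) * cost \<le> (\<Sum>v\<in>L. Suc (deg v)) * cost"
    by (rule mult_right_mono) simp
  then show ?thesis by (simp add: potential_def add_mult_distrib)
qed

lemma peel_phase_correct:
  assumes st: "stored s" and zero: "\<And>v. ar s aDead v 0 = 0" "\<And>x y. ar s aM x y = 0"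
  shows "wpi peel_phase (\<lambda>s' _. rg s' rRes = (if in_class_G G then 1 else 0)) s
    (n * (383 * n + 179 * M + 134) + (n + M) * cost + 3)"
proof -
  let ?c = "383 * n + 179 * M + 134"
  let ?Q = "\<lambda>s' (_ :: nat). rg s' rRes = (if in_class_G G then 1 else 0)"
  \<comment> \<open>\<open>?c\<close> pays for a round apart from the elimination, which the
    potential pays; the final 1 is the failing test.\<close>
  define I where "I s' T \<longleftrightarrow> (\<exists>i\<le>n. rg s' rI = i \<and> peel_inv i s' \<and> i * ?c + potential (alive s') + 1 \<le> T)" for s' T
  have "wpi (While rI (Dec rI rI ;; If rRes peel Skip)) ?Q s' T" if "I s' T" for s' T
    using that
  proof (rule wp_While)
    fix s' T assume "I s' T" "rg s' rI \<noteq> 0"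
    then obtain i where i: "i < n" "rg s' rI = Suc i" "peel_inv (Suc i) s'" "Suc i * ?c + potential (alive s') + 1 \<le> T"
      unfolding I_def by (metis Suc_le_lessD not0_implies_Suc)
    let ?s = "upd rI i s'"
    have al: "alive ?s = alive s'" by (simp add: alive_def)
    have cong: "peel_inv (Suc i) ?s" using i(3) al by (simp add: peel_inv_def stored_def regs_ok_def)
    have T: "?c + (i * ?c + potential (alive s') + 1) \<le> T" using i(4) by simp
    show "2 \<le> T \<and> wpi (Dec rI rI ;; If rRes peel Skip) I s' (T - 2)"
    proof (cases "rg s' rRes = 0")
      case True
      have "peel_inv i ?s" using cong True by (simp add: peel_inv_def)
      then have "I ?s (T - 4)" unfolding I_def using i al T by (intro exI[of _ i]) auto
      then show ?thesis using True i T by (simp add: wp_eqs) linarith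
    next
      case False
      have L: "peeled (Suc i) (alive ?s)" using cong False by (auto simp: peel_inv_def)
      let ?L = "alive ?s"
      define d where "d = (if clique E (border i ?L) then card (piece i ?L \<union> border i ?L) * cost else 0)"
      define L' where "L' = (if clique E (border i ?L) then ?L - piece i ?L else ?L)"
      have pot: "potential L' + d \<le> potential ?L"
      proof (cases "clique E (border i ?L)")
        case True
        then show ?thesis using card_piece_le[OF L i(1)] by (simp only: L'_def d_def if_True)
      next
        case False
        then show ?thesis by (simp only: L'_def d_def if_False)
      qed
      have res: "rg ?s rRes \<noteq> 0" "rg ?s rI = i" using False by auto
      have run: "wpi peel (\<lambda>s' _. peel_inv i s' \<and> alive s' = L') ?s (383 * n + 179 * M + 129 + d)"
        using peel_correct[OF cong res(1) i(1) res(2)] unfolding L'_def d_def .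
      have T': "383 * n + 179 * M + 129 + d + (i * ?c + potential L' + 6) \<le> T"
        using T pot[unfolded al] by linarith
      have "wpi peel I ?s (T - 5)"
      proof (rule wp_use[OF run])
        show "383 * n + 179 * M + 129 + d \<le> T - 5" using T' by linarith
        fix s2 t assume 2: "peel_inv i s2 \<and> alive s2 = L'" and f: "frame peel ?s s2"
        have rI2: "rg s2 rI = i" using frame_rg[OF f] by simp
        have "i * ?c + potential (alive s2) + 1 \<le> t + (T - 5 - (383 * n + 179 * M + 129 + d))"
          unfolding conjunct2[OF 2] using T' by linarith
        then show "I s2 (t + (T - 5 - (383 * n + 179 * M + 129 + d)))"
          unfolding I_def using 2 i rI2 by (intro exI[of _ i]) auto
      qed
      moreover have "5 \<le> T" using T by linarith
      ultimately show ?thesis using False i by (simp add: wp_eqs) linarith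
    qed
  next
    fix s' T assume "I s' T" "rg s' rI = 0"
    then have p: "peel_inv 0 s'" "1 \<le> T" by (auto simp: I_def)
    show "1 \<le> T \<and> ?Q s' (T - 1)"
    proof (cases "rg s' rRes = 0")
      case True
      then show ?thesis using p by (simp add: peel_inv_def)
    next
      case False
      then have "alive s' = {}" "in_class_G (induced_subgraph G (alive s')) \<longrightarrow> in_class_G G" "rg s' rRes = 1"
        using p peeled_end by (auto simp: peel_inv_def)
      moreover have "in_class_G (induced_subgraph G {})" by (rule in_class_not_k4_minor[OF G(1)]) auto
      ultimately show ?thesis using p by simp
    qed
  qed
  moreover have "I (upd rI n (upd rRes 1 s)) (n * ?c + (n + M) * cost + 1)"
  proof -
    let ?s = "upd rI n (upd rRes 1 s)"
    have al: "alive ?s = {..<n}" using zero by (auto simp: alive_def)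
    have "induced_subgraph G {..<n} = G"
    proof -
      have "{e \<in> edges G. e \<subseteq> {..<n}} = edges G" using G(1,2) by (auto simp: simple_graph_def)
      then show ?thesis using G(2) by (simp add: induced_subgraph_def)
    qed
    then have "peel_inv n ?s"
      using st zero peeled_start al by (simp add: peel_inv_def stored_def regs_ok_def)
    moreover have "potential {..<n} = (n + M) * cost" by (simp add: potential_def M_def sum_Suc)
    ultimately show ?thesis unfolding I_def al by (intro exI[of _ n]) simp
  qed
  ultimately have "wpi (While rI (Dec rI rI ;; If rRes peel Skip)) ?Q (upd rI n (upd rRes 1 s)) (n * ?c + (n + M) * cost + 1)"
    by blast
  then show ?thesis using st by (simp add: peel_phase_def wp_eqs stored_def regs_ok_def)
qed

end

section \<open>From the structured program to the machine: total time and word size\<close>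

section \<open>The machine program\<close>

definition blank :: st where
  "blank = \<lparr>rg = (\<lambda>_. 0), ar = (\<lambda>_ _ _. 0)\<rparr>"

text \<open>The last entry of the table of addresses is the length of the input, where the memory of the
  structured programs begins.\<close>

definition prologue :: program where
  "prologue = [SET 1 1, LOAD 3 0, ADD 3 3 1, LOAD 2 3]"

definition decider :: program where
  "decider = prologue @ compile 4 algorithm @ [HALT]"

lemma wfc_algorithm: "wfc algorithm"
  by (simp add: algorithm_def order_phase_def visit_def select_def prepare_visit_def bump_def search_def
    level_body_def expand_def discover_def peel_phase_def peel_def prepare_peel_def process_def
    count_adj_def count_border_def check_border_def mark_piece_def mark_core_def copy_row_def build_def
    find_low_def detach_def join_def eliminate_def kill_def user_def)

lemma leveled_decider: "\<forall>x\<in>set decider. leveled x"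
  using leveled_compile[OF wfc_algorithm, of 4] by (auto simp: decider_def prologue_def list_all_iff level_def)

lemma machine_input_adj:
  assumes G: "simple_graph G" and al: "adjacency_lists al G"
  shows "machine_input al (length al) (adj G)"
proof
  show "distinct (al ! v) \<and> set (al ! v) = {u. adj G v u}" if "v < length al" for v
    using al that by (simp add: adjacency_lists_def adj_def)
  show uv: "u < length al \<and> v < length al" if "adj G u v" for u v
  proof -
    have "{u, v} \<subseteq> verts G" using G that by (auto simp: simple_graph_def adj_def)
    then show ?thesis using al by (simp add: adjacency_lists_def)
  qed
  show "adj G v u" if "adj G u v" for u v using that by (simp add: adj_def insert_commute)
  show "\<not> adj G v v" for v using G by (auto simp: simple_graph_def adj_def)
qed simp

lemma finite_edges: "simple_graph G \<Longrightarrow> finite (edges G)"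
  by (rule finite_subset[of _ "Pow (verts G)"]) (auto simp: simple_graph_def)

text \<open>Each list entry stands for an edge at one of its two ends, so the sum over vertices is
  exchanged with the sum over edges.\<close>

lemma length_concat_adjacency_lists:
  assumes G: "simple_graph G" and al: "adjacency_lists al G"
  shows "length (concat al) \<le> 2 * card (edges G)" and "(\<Sum>v<length al. length (al ! v)) = length (concat al)"
proof -
  have V: "verts G = {..<length al}" using al by (simp add: adjacency_lists_def)
  show sum: "(\<Sum>v<length al. length (al ! v)) = length (concat al)"
    by (simp add: length_concat sum_list_sum_nth atLeast0LessThan)
  have "length (al ! v) \<le> (\<Sum>e\<in>{e \<in> edges G. v \<in> e}. 1)" if v: "v < length al" for v
  proof -
    have d: "length (al ! v) = card {u. {v, u} \<in> edges G}"
      using al v by (metis adjacency_lists_def distinct_card)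
    have "card {u. {v, u} \<in> edges G} \<le> card {e \<in> edges G. v \<in> e}"
    proof (rule card_inj_on_le)
      show "inj_on (\<lambda>u. {v, u}) {u. {v, u} \<in> edges G}" by (auto simp: inj_on_def doubleton_eq_iff)
    qed (use finite_edges[OF G] in auto)
    then show ?thesis using d by simp
  qed
  then have "length (concat al) \<le> (\<Sum>v<length al. \<Sum>e\<in>{e \<in> edges G. v \<in> e}. 1)"
    unfolding sum[symmetric] by (intro sum_mono) auto
  also have "\<dots> = (\<Sum>e\<in>edges G. \<Sum>v\<in>{v \<in> {..<length al}. v \<in> e}. 1)"
    by (rule sum.swap_restrict) (use finite_edges[OF G] in auto)
  also have "\<dots> = (\<Sum>e\<in>edges G. 2)"
  proof (rule sum.cong[OF refl])
    fix e assume e: "e \<in> edges G"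
    then have "{v \<in> {..<length al}. v \<in> e} = e" "card e = 2" using G V by (auto simp: simple_graph_def)
    then show "(\<Sum>v\<in>{v \<in> {..<length al}. v \<in> e}. 1) = (2 :: nat)" by simp
  qed
  finally show "length (concat al) \<le> 2 * card (edges G)" by simp
qed

context machine_input
begin

text \<open>The coefficients add up the order phase, the rounds of peeling and all eliminations: 733
  = 246 + 383 + 104, 389 = 106 + 179 + 104 and 373 = 117 + 134 + 122.\<close>

lemma algorithm_correct:
  assumes G: "simple_graph G" "verts G = {..<n}" "adj G = E"
  shows "wpi algorithm (\<lambda>s' _. rg s' rRes = (if in_class_G G then 1 else 0)) blank
    (733 * (n * n) + 389 * (n * M) + 373 * n + 122 * M + 9)"
    (is "wpi _ ?Q _ ?T")
proof -
  let ?s = "upd rN1 (Suc n) (upd rN n (upd rZero 0 blank))"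
  have r: "regs_ok ?s" by (simp add: regs_ok_def)
  have "wpi (order_phase ;; peel_phase) ?Q ?s (?T - 3)"
  proof (rule wp_seq[OF order_phase_correct[OF r]])
    fix s assume "\<exists>w. order_inv n w s" and f: "frame order_phase ?s s"
    then obtain w where w: "order_inv n w s" by blast
    have P: "peeling al n E (\<lambda>i. ar s aOrd i 0) (\<lambda>v. ar s aPos v 0 - 1) w G"
      by (intro peeling.intro machine_input_axioms order_inv_mcs(1)[OF w] peeling_axioms.intro G)
    have "peeling.stored n (\<lambda>i. ar s aOrd i 0) (\<lambda>v. ar s aPos v 0 - 1) s"
      unfolding peeling.stored_def[OF P] using w order_inv_mcs(2)[OF w] by (simp add: order_inv_def)
    moreover have "ar s aDead v 0 = 0" "ar s aM x y = 0" for v x y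
      using frame_ar[OF f, of aDead] frame_ar[OF f, of aM] by (simp_all add: blank_def order_phase_def)
    ultimately have "wpi peel_phase ?Q s (n * (383 * n + 179 * M + 134) + (n + M) * peeling.cost n + 3)"
      by (intro peeling.peel_phase_correct[OF P])
    then show "wpi peel_phase ?Q s (?T - 3 - (n * (106 * M + 246 * n + 117) + 3))"
      by (rule wp_weaken) (simp_all add: peeling.cost_def[OF P] algebra_simps)
  qed (simp_all add: blank_def algebra_simps)
  moreover have "input_words al ! 0 = n" "0 < length (input_words al)" by (simp_all add: input_words_def n)
  ultimately show ?thesis by (simp add: algorithm_def wp_eqs)
qed

end

lemma has_code_infix: "has_code (xs @ ys @ zs) (length xs) ys"
  by (simp add: has_code_def nth_append)

lemma length_prologue: "length prologue = 4"
  by (simp add: prologue_def)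

lemma decider_prologue:
  "sim (input_words al) blank (run decider 4 (initial_config al))" "pc (run decider 4 (initial_config al)) = 4"
proof -
  let ?w = "input_words al"
  have "has_code decider 0 prologue"
    using has_code_infix[of "[]" prologue] by (simp add: decider_def)
  then have "run decider (length prologue) (initial_config al) = fold exec_instr prologue (initial_config al)"
    by (intro run_straight) (auto simp: initial_config_def prologue_def)
  then have run: "run decider 4 (initial_config al) = fold exec_instr [SET 1 1, LOAD 3 0, ADD 3 3 1, LOAD 2 3] (initial_config al)"
    by (simp only: length_prologue) (simp only: prologue_def)
  have w: "?w ! 0 = length al" "?w ! Suc (length al) = length ?w" "0 < length ?w" "Suc (length al) < length ?w"
    using input_words_start[of "length al" al] by (simp_all add: length_input_words) (simp add: input_words_def)
  show "sim ?w blank (run decider 4 (initial_config al))"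
    unfolding run using w by (auto simp: sim_def blank_def initial_config_def set_reg_def user_def)
  show "pc (run decider 4 (initial_config al)) = 4"
    unfolding run by (simp add: initial_config_def set_reg_def)
qed

lemma input_words_le:
  assumes "x \<in> set (input_words al)" and al: "\<And>v u. v < length al \<Longrightarrow> u \<in> set (al ! v) \<Longrightarrow> u < length al"
  shows "x \<le> length (input_words al)"
proof -
  have start: "length (concat (take v al)) \<le> length (concat al)" for v
    by (metis append_take_drop_id concat_append length_append le_add1)
  have entry: "u < length al" if u: "u \<in> set (concat al)" for u
  proof -
    obtain xs where xs: "xs \<in> set al" "u \<in> set xs" using u by auto
    then obtain v where "v < length al" "u \<in> set (al ! v)" by (metis in_set_conv_nth)
    then show ?thesis by (rule al)
  qed
  have "x = length al \<or> (\<exists>v. x = length al + 2 + length (concat (take v al))) \<or> x \<in> set (concat al)"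
    using assms(1) by (auto simp: input_words_def simp del: upt_Suc set_concat)
  then show ?thesis
    unfolding length_input_words
  proof (elim disjE exE)
    show "x \<le> length al + 2 + length (concat al)" if "x = length al + 2 + length (concat (take v al))" for v
      using that start[of v] by simp
    show "x \<le> length al + 2 + length (concat al)" if "x \<in> set (concat al)"
      using entry[OF that] by simp
  qed simp
qed

lemma words_bounded_mono: "words_bounded W c \<Longrightarrow> W \<le> W' \<Longrightarrow> words_bounded W' c"
  unfolding words_bounded_def by (meson le_trans)

lemma decider_correct:
  assumes G: "simple_graph G" and L: "adjacency_lists al G" and m: "card (edges G) = m" "m > 0" and n: "card (verts G) = n"
  shows "decides_within decider al (in_class_G G) (1200 * (n ^ 2 + n * m)) ((n + m) ^ 576)"
proof -
  let ?w = "input_words al" and ?c = "initial_config al"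
  have V: "verts G = {..<length al}" using L by (simp add: adjacency_lists_def)
  then have len: "length al = n" using n by simp
  interpret machine_input al n "adj G"
    using machine_input_adj[OF G L] len by simp
  have M: "M \<le> 2 * m" "M = length (concat al)"
    using length_concat_adjacency_lists[OF G L] m(1) by (simp_all add: M_def len)
  \<comment> \<open>An edge forces two vertices; this lets the terms in \<open>n\<close>, in
    \<open>M\<close> and the constant be absorbed.\<close>
  obtain e where "e \<in> edges G" using m by fastforce
  then have "card e = 2" "e \<subseteq> verts G" using G by (auto simp: simple_graph_def)
  then have n2: "2 \<le> n" using n V card_mono[of "verts G" e] by simp
  define T where "T = 1200 * (n ^ 2 + n * m)"
  have nM: "n * M \<le> 2 * (n * m)" "M \<le> n * M" "n \<le> n * n" "1 \<le> n * n"
    using mult_left_mono[OF M(1), of n] n2 by auto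
  obtain s' t where big: "big ?w algorithm blank t s'" and t: "t \<le> 733 * (n * n) + 389 * (n * M) + 373 * n + 122 * M + 9"
    and res: "rg s' rRes = (if in_class_G G then 1 else 0)"
    using algorithm_correct[OF G] V len unfolding wp_def by auto
  \<comment> \<open>Read \<open>a\<close> as \<open>n * n\<close>, \<open>b\<close> as
    \<open>n * m\<close> and \<open>c\<close> as \<open>n * M\<close>: 733 + 373 + 9 + 4 = 1119 and
    2 (389 + 122) = 1022 are both at most 1200. The 4 is the prologue.\<close>
  have "4 + t \<le> 1200 * (a + b)"
    if "t \<le> 733 * a + 389 * c + 373 * n + 122 * M + 9" "c \<le> 2 * b" "M \<le> c" "n \<le> a" "1 \<le> a" for a b c
  proof -
    have "389 * c + 122 * M \<le> 511 * c" "511 * c \<le> 1022 * b" "373 * n \<le> 373 * a" using that(2-4) by simp_all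
    then show ?thesis using that(1,5) by simp
  qed
  from this[OF t nM] have t4: "4 + t \<le> T" by (simp only: T_def power2_eq_square)
  have "has_code decider 4 (compile 4 algorithm)"
    using has_code_infix[of prologue "compile 4 algorithm" "[HALT]"] by (simp only: decider_def length_prologue)
  then have fin: "sim ?w s' (run decider (4 + t) ?c)" "pc (run decider (4 + t) ?c) = 4 + clen algorithm"
    using compile_correct[OF big wfc_algorithm, of decider "run decider 4 ?c"] decider_prologue
    by (simp_all add: run_add)
  have halt: "halted decider (run decider (4 + t) ?c)"
    unfolding halted_def fin(2) by (simp add: decider_def nth_append length_prologue)
  have run_T: "run decider u ?c = run decider (4 + t) ?c" if "4 + t \<le> u" for u
    using run_halted[OF halt, of "u - (4 + t)"] that by simp
  have res0: "regs (run decider (4 + t) ?c) 0 = (if in_class_G G then 1 else 0)"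
    using fin(1) res by (simp add: sim_def user_def)
  define M0 where "M0 = 16 + length ?w"
  have "level_bounded M0 ?c"
  proof -
    have "?w ! a \<le> length ?w" if "a < length ?w" for a
      by (rule input_words_le[OF nth_mem[OF that]]) (use L E_n V len in \<open>auto simp: adjacency_lists_def adj_def\<close>)
    then show ?thesis by (auto simp: level_bounded_def initial_config_def M0_def intro: trans_le_add2)
  qed
  then have lb: "level_bounded (M0 + u) (run decider u ?c)" for u
    by (rule level_bounded_run[OF _ _ leveled_decider]) (simp add: M0_def)
  \<comment> \<open>Since 2187 = 3^7 and \<open>n + m\<close> is at least 3, the constant factor
    becomes seven more powers on top of the square.\<close>
  have "M0 + T \<le> (n + m) ^ 9"
  proof -
    let ?s = "n + m"
    have s: "3 \<le> ?s" using n2 m(2) by simp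
    have s2: "?s \<le> ?s * ?s" "9 \<le> ?s * ?s" using s mult_mono[OF s s] by auto
    have "M0 + 1200 * a \<le> 2187 * b" if "a \<le> b" "M0 \<le> 2 * s + 18" "s \<le> b" "9 \<le> b" for a b s
      using that by linarith
    moreover have "n * n + n * m \<le> ?s * ?s" by (simp add: algebra_simps)
    moreover have "M0 \<le> 2 * ?s + 18" using M len by (simp add: M0_def length_input_words)
    ultimately have "M0 + T \<le> 2187 * (?s * ?s)" using s2 by (simp only: T_def power2_eq_square)
    also have "\<dots> = 3 ^ 7 * ?s ^ 2" by (simp add: power2_eq_square)
    also have "\<dots> \<le> ?s ^ 7 * ?s ^ 2" by (intro mult_right_mono power_mono s) auto
    also have "\<dots> = ?s ^ 9" by (simp flip: power_add)
    finally show ?thesis .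
  qed
  \<comment> \<open>The exponent of the word bound is 9 * 64 = 576, with 64 coming from the highest
    level.\<close>
  then have W: "(M0 + T) ^ 64 \<le> (n + m) ^ 576"
    using power_mono[of "M0 + T" "(n + m) ^ 9" 64] by (simp flip: power_mult)
  have "words_bounded ((n + m) ^ 576) (run decider u ?c)" if "u \<le> T" for u
    using level_bounded_mono[OF lb, of u "M0 + T"] that
    by (intro words_bounded_mono[OF words_bounded_level W]) (simp_all add: M0_def)
  \<comment> \<open>A halted machine does not move, so no new words appear after time
    \<open>T\<close>.\<close>
  moreover have "run decider u ?c = run decider T ?c" if "\<not> u \<le> T" for u
    using run_T[of u] run_T[OF t4] t4 that by simp
  ultimately have "words_bounded ((n + m) ^ 576) (run decider u ?c)" for u
    by (metis order_refl)
  then show ?thesis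
    unfolding decides_within_def T_def[symmetric] using run_T[OF t4] halt res0 by simp
qed

theorem mainTheorem8:
  "\<exists>(P :: program) (C :: nat) (k :: nat).
     \<forall>(G :: nat ugraph) (n :: nat) (m :: nat) (adj :: nat list list).
       simple_graph G \<longrightarrow> card (verts G) = n \<longrightarrow> card (edges G) = m \<longrightarrow> m > 0 \<longrightarrow>
       adjacency_lists adj G \<longrightarrow>
       decides_within P adj (in_class_G G) (C * (n ^ 2 + n * m)) ((n + m) ^ k)"
  using decider_correct by blast

end
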